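(* Let $\mathfrak h$ be the complexified reflection representation of the Coxeter group $H_3$. The irreducible module $L_{1/2}(\widetilde{\mathbf 3}_-)$ in the category $\mathcal O_{1/2}$ of the rational Cherednik algebra $H_{1/2}(H_3,\mathfrak h)$, whose character is $\chi_{\widetilde{\mathbf 3}_-}t^{-1}+\chi_{\mathbf 4_+}+\chi_{\widetilde{\mathbf 3}_-}t$, has no nonzero $H_3$-invariants. Hence $c=1/2$ is an aspherical value for $(H_3,\mathfrak h)$.
   Context: The group. $W=H_3$ is the Coxeter group of order $120$ of all symmetries of the regular icosahedron; $\mathfrak h\cong\mathbb C^3$ is its complexified reflection representation. $H_3\cong\mathbb Z_2\times A_5$, where $\mathbb Z_2=\{\pm\mathrm{Id}\}$ and $A_5$ is the rotation group. Let $\mathbf 3$ be the restriction of $\mathfrak h$ to $A_5$, $\widetilde{\mathbf 3}$ its twist by conjugation by $(12)\in S_5$, and $\mathbf 4$ the $4$-dimensional irreducible representation of $A_5$. A subscript $+$ (resp. $-$) denotes the representation of $H_3$ extending the given representation of $A_5$ in which $-\mathrm{Id}$ acts by $1$ (resp. $-1$). $\chi_\tau$ is the character of $\tau$. The algebra. $S$ is the set of the $15$ reflections of $H_3$. For $s\in S$, $\alpha_s\in\mathfrak h^*$ and $\alpha_s^\vee\in\mathfrak h$ are eigenvectors of $s$ with eigenvalue $-1$, normalized by $(\alpha_s,\alpha_s^\vee)=2$. For $c\in\mathbb C$, $H_c(H_3,\mathfrak h)$ is the quotient of $\mathbb CW\ltimes T(\mathfrak h\oplus\mathfrak h^* )$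 by the relations $[x,x']=0$, $[y,y']=0$, $[y,x]=(y,x)-\sum_{s\in S}c\,(\alpha_s,y)(x,\alpha_s^\vee)s$ for $x,x'\in\mathfrak h^*$, $y,y'\in\mathfrak h$. Category $\mathcal O_c$: the $H_c(H_3,\mathfrak h)$-modules finitely generated over $\mathrm S\mathfrak h^*$ and locally nilpotent under $\mathfrak h\subset\mathrm S\mathfrak h$. For an irreducible representation $\tau$ of $H_3$, $M_c(\tau)=H_c(H_3,\mathfrak h)\otimes_{\mathbb CW\ltimes\mathrm S\mathfrak h}\tau$, where $\mathfrak h$ acts on $\tau$ by $0$; $L_c(\tau)$ is its unique irreducible quotient. Characters. Let $x_i,y_i$ be dual bases of $\mathfrak h^*,\mathfrak h$ and $\mathbf h=\sum_i x_iy_i+\frac32-c\sum_{s\in S}s$. For $V\in\mathcal O_c$ with generalized $\mathbf h$-eigenspaces $V[j]$, the character of $V$ is $\mathrm{ch}_V(w,t)=\sum_j t^j\,\mathrm{Tr}_{V[j]}(w)$, $w\in H_3$. A value $c$ is called aspherical for $(W,\mathfrak h)$ if there exists a nonzero module $V$ in $\mathcal O_c$ with $V^W=0$. *)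

theory Defs
  imports
    "HOL-Analysis.Analysis"
    "HOL-Algebra.Algebra"
    "HOL-Library.Poly_Mapping"
begin

section \<open>The group \<open>H\<^sub>3\<close> and its reflection representation\<close>

type_synonym mat3 = "real^3^3"

definition golden :: real where
  "golden = (1 + sqrt 5) / 2"

definition icosahedron_vertices :: "(real^3) set" where
  "icosahedron_vertices =
     (\<Union>a\<in>{1, -1}. \<Union>b\<in>{golden, -golden}.
        {vector [0, a, b], vector [a, b, 0], vector [b, 0, a]})"

definition H3 :: "mat3 set" where
  "H3 = {A. orthogonal_matrix A \<and> (\<lambda>v. A *v v) ` icosahedron_vertices = icosahedron_vertices}"

definition rotation_group :: "mat3 monoid" where
  "rotation_group = \<lparr>carrier = {A \<in> H3. det A = 1}, monoid.mult = (**), monoid.one = mat 1\<rparr>"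

definition reflections :: "mat3 set" where
  "reflections = {s \<in> H3. dim {v. s *v v = v} = 2}"

text \<open>A vector of \<open>\<hh> = \<complex>\<^sup>3\<close> is given by its coordinates in the standard basis \<open>y\<^sub>i\<close>, a functional in
  \<open>\<hh>\<^sup>*\<close> by its coordinates in the dual basis \<open>x\<^sub>i\<close>.\<close>

type_synonym h_vec = "complex^3"
type_synonym h_dual = "complex^3"

definition pairing :: "h_dual \<Rightarrow> h_vec \<Rightarrow> complex" where
  "pairing x y = (\<Sum>i\<in>UNIV. x $ i * y $ i)"

definition refl_rep :: "mat3 \<Rightarrow> complex^3^3" where
  "refl_rep w = map_matrix complex_of_real w"

definition act_h :: "mat3 \<Rightarrow> h_vec \<Rightarrow> h_vec" where
  "act_h w y = refl_rep w *v y"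

text \<open>The contragredient action \<open>x \<mapsto> x \<circ> w\<^sup>-\<^sup>1\<close>, with functionals as row vectors.\<close>

definition act_dual :: "mat3 \<Rightarrow> h_dual \<Rightarrow> h_dual" where
  "act_dual w x = x v* refl_rep (matrix_inv w)"

text \<open>The pair \<open>(\<alpha>\<^sub>s, \<alpha>\<^sub>s\<^sup>\<or>)\<close> is determined up to \<open>(z \<alpha>\<^sub>s, z\<^sup>-\<^sup>1 \<alpha>\<^sub>s\<^sup>\<or>)\<close>, which does not affect the
  relations of the Cherednik algebra.\<close>

definition root_pair :: "mat3 \<Rightarrow> h_dual \<times> h_vec" where
  "root_pair s = (SOME (a, a'). act_dual s a = - a \<and> act_h s a' = - a' \<and> pairing a a' = 2)"

definition refl_root :: "mat3 \<Rightarrow> h_dual" where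
  "refl_root s = fst (root_pair s)"

definition refl_coroot :: "mat3 \<Rightarrow> h_vec" where
  "refl_coroot s = snd (root_pair s)"


section \<open>The smash product \<open>\<complex>W \<ltimes> T(\<hh> \<oplus> \<hh>\<^sup>*)\<close>\<close>

text \<open>The tensor algebra of \<open>\<hh> \<oplus> \<hh>\<^sup>*\<close> is the free algebra on the basis \<open>x\<^sub>i, y\<^sub>i\<close>, realised as the monoid
  algebra over \<open>\<complex>\<close> of the free monoid on six letters. The monoid is written additively because
  the product of \<^typ>\<open>'a \<Rightarrow>\<^sub>0 'b\<close> is convolution with respect to addition of keys.\<close>

datatype letter = X_letter 3 | Y_letter 3

datatype word = Word (letters: "letter list")

instantiation word :: monoid_add
begin

definition zero_word :: word where
  "0 = Word []"

definition plus_word :: "word \<Rightarrow> word \<Rightarrow> word" where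
  "u + v = Word (letters u @ letters v)"

instance
  by standard (simp_all add: zero_word_def plus_word_def)

end

type_synonym tensor_algebra = "word \<Rightarrow>\<^sub>0 complex"

definition const :: "complex \<Rightarrow> tensor_algebra" where
  "const z = Poly_Mapping.single 0 z"

definition emb_dual :: "h_dual \<Rightarrow> tensor_algebra" where
  "emb_dual x = (\<Sum>i\<in>UNIV. Poly_Mapping.single (Word [X_letter i]) (x $ i))"

definition emb_h :: "h_vec \<Rightarrow> tensor_algebra" where
  "emb_h y = (\<Sum>i\<in>UNIV. Poly_Mapping.single (Word [Y_letter i]) (y $ i))"

text \<open>The action of \<open>W\<close> on \<open>T(\<hh> \<oplus> \<hh>\<^sup>*)\<close> by algebra automorphisms.\<close>

fun act_letter :: "mat3 \<Rightarrow> letter \<Rightarrow> tensor_algebra" where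
  "act_letter w (X_letter i) = emb_dual (act_dual w (axis i 1))"
| "act_letter w (Y_letter i) = emb_h (act_h w (axis i 1))"

definition act_tensor :: "mat3 \<Rightarrow> tensor_algebra \<Rightarrow> tensor_algebra" where
  "act_tensor w p =
     (\<Sum>u\<in>Poly_Mapping.keys p.
        const (Poly_Mapping.lookup p u) * prod_list (map (act_letter w) (letters u)))"

text \<open>A function \<open>f\<close> stands for \<open>\<Sum>\<^sub>w f(w) w\<close>, and \<open>(p w) (q w') = p (w q) (w w')\<close>.\<close>

definition smash :: "(mat3 \<Rightarrow> tensor_algebra) ring" where
  "smash =
     \<lparr>carrier = {f. \<forall>w. w \<notin> H3 \<longrightarrow> f w = 0},
      monoid.mult = (\<lambda>f g u.
        if u \<in> H3 then \<Sum>w\<in>H3. f w * act_tensor w (g (matrix_inv w ** u)) else 0),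
      monoid.one = (\<lambda>u. if u = mat 1 then 1 else 0),
      ring.zero = (\<lambda>u. 0),
      ring.add = (\<lambda>f g u. f u + g u)\<rparr>"

definition of_tensor :: "tensor_algebra \<Rightarrow> mat3 \<Rightarrow> tensor_algebra" where
  "of_tensor p = (\<lambda>u. if u = mat 1 then p else 0)"

definition of_group :: "mat3 \<Rightarrow> mat3 \<Rightarrow> tensor_algebra" where
  "of_group w = (\<lambda>u. if u = w then 1 else 0)"

definition tensor_plus_refl ::
    "tensor_algebra \<Rightarrow> (mat3 \<Rightarrow> complex) \<Rightarrow> mat3 \<Rightarrow> tensor_algebra" where
  \<comment> \<open>the element \<open>p + \<Sum>\<^sub>s k(s) s\<close>, the sum over reflections\<close>
  "tensor_plus_refl p k =
     (\<lambda>u. of_tensor p u + (if u \<in> reflections then const (k u) else 0))"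


section \<open>The rational Cherednik algebra\<close>

definition commutator :: "tensor_algebra \<Rightarrow> tensor_algebra \<Rightarrow> tensor_algebra" where
  "commutator p q = p * q - q * p"

definition cherednik_relations :: "complex \<Rightarrow> (mat3 \<Rightarrow> tensor_algebra) set" where
  "cherednik_relations c =
     {of_tensor (commutator (emb_dual x) (emb_dual x')) | x x'. True} \<union>
     {of_tensor (commutator (emb_h y) (emb_h y')) | y y'. True} \<union>
     {tensor_plus_refl (commutator (emb_h y) (emb_dual x) - const (pairing x y))
        (\<lambda>s. c * pairing (refl_root s) y * pairing x (refl_coroot s)) | x y. True}"

type_synonym hc_elem = "(mat3 \<Rightarrow> tensor_algebra) set"

definition Hc :: "complex \<Rightarrow> hc_elem ring" where
  "Hc c = smash Quot (Idl\<^bsub>smash\<^esub> (cherednik_relations c))"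

definition hc_class :: "complex \<Rightarrow> (mat3 \<Rightarrow> tensor_algebra) \<Rightarrow> hc_elem" where
  "hc_class c f = (Idl\<^bsub>smash\<^esub> (cherednik_relations c)) +>\<^bsub>smash\<^esub> f"

definition hc_scalar :: "complex \<Rightarrow> complex \<Rightarrow> hc_elem" where
  "hc_scalar c z = hc_class c (of_tensor (const z))"

definition hc_dual :: "complex \<Rightarrow> h_dual \<Rightarrow> hc_elem" where
  "hc_dual c x = hc_class c (of_tensor (emb_dual x))"

definition hc_vec :: "complex \<Rightarrow> h_vec \<Rightarrow> hc_elem" where
  "hc_vec c y = hc_class c (of_tensor (emb_h y))"

definition hc_group :: "complex \<Rightarrow> mat3 \<Rightarrow> hc_elem" where
  "hc_group c w = hc_class c (of_group w)"

definition euler :: "complex \<Rightarrow> hc_elem" where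
  "euler c = hc_class c
     (tensor_plus_refl
        ((\<Sum>i\<in>UNIV. emb_dual (axis i 1) * emb_h (axis i 1)) + const (3/2))
        (\<lambda>s. - c))"


section \<open>Left modules over a noncommutative ring\<close>

text \<open>The library locale \<^locale>\<open>Module.module\<close> requires a commutative ring of scalars. The record type is
  reused here; its fields \<open>mult\<close> and \<open>one\<close> carry no meaning for a module.\<close>

locale left_module = R?: ring R + M?: abelian_group M
  for R :: "('a, 'r) ring_scheme" and M :: "('a, 'b, 'm) module_scheme" (structure) +
  assumes smult_closed: "\<lbrakk>a \<in> carrier R; v \<in> carrier M\<rbrakk> \<Longrightarrow> a \<odot>\<^bsub>M\<^esub> v \<in> carrier M"
    and smult_l_distr: "\<lbrakk>a \<in> carrier R; b \<in> carrier R; v \<in> carrier M\<rbrakk> \<Longrightarrow>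
      (a \<oplus>\<^bsub>R\<^esub> b) \<odot>\<^bsub>M\<^esub> v = a \<odot>\<^bsub>M\<^esub> v \<oplus>\<^bsub>M\<^esub> b \<odot>\<^bsub>M\<^esub> v"
    and smult_r_distr: "\<lbrakk>a \<in> carrier R; v \<in> carrier M; v' \<in> carrier M\<rbrakk> \<Longrightarrow>
      a \<odot>\<^bsub>M\<^esub> (v \<oplus>\<^bsub>M\<^esub> v') = a \<odot>\<^bsub>M\<^esub> v \<oplus>\<^bsub>M\<^esub> a \<odot>\<^bsub>M\<^esub> v'"
    and smult_assoc: "\<lbrakk>a \<in> carrier R; b \<in> carrier R; v \<in> carrier M\<rbrakk> \<Longrightarrow>
      (a \<otimes>\<^bsub>R\<^esub> b) \<odot>\<^bsub>M\<^esub> v = a \<odot>\<^bsub>M\<^esub> (b \<odot>\<^bsub>M\<^esub> v)"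
    and smult_one: "v \<in> carrier M \<Longrightarrow> \<one>\<^bsub>R\<^esub> \<odot>\<^bsub>M\<^esub> v = v"

definition irreducible_module :: "('a, 'r) ring_scheme \<Rightarrow> ('a, 'b, 'm) module_scheme \<Rightarrow> bool" where
  "irreducible_module R M \<longleftrightarrow>
     left_module R M \<and> carrier M \<noteq> {\<zero>\<^bsub>M\<^esub>} \<and>
     (\<forall>N. submodule N R M \<longrightarrow> N = {\<zero>\<^bsub>M\<^esub>} \<or> N = carrier M)"

definition quotient_module :: "('a, 'b, 'm) module_scheme \<Rightarrow> 'b set \<Rightarrow> ('a, 'b set) module" where
  "quotient_module M N =
     \<lparr>carrier = a_rcosets\<^bsub>M\<^esub> N, monoid.mult = undefined, monoid.one = undefined,
      ring.zero = N, ring.add = set_add M,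
      smult = (\<lambda>a C. \<Union>v\<in>C. N +>\<^bsub>M\<^esub> (a \<odot>\<^bsub>M\<^esub> v))\<rparr>"


section \<open>Category \<open>\<O>\<^sub>c\<close>\<close>

text \<open>The image of \<open>S\<hh>\<^sup>*\<close> in \<open>H\<^sub>c\<close> is the subalgebra generated by \<open>\<hh>\<^sup>*\<close>.\<close>

definition sym_dual :: "complex \<Rightarrow> hc_elem set" where
  "sym_dual c = generate_ring (Hc c) (range (hc_scalar c) \<union> range (hc_dual c))"

definition category_O :: "complex \<Rightarrow> (hc_elem, 'v) module \<Rightarrow> bool" where
  "category_O c V \<longleftrightarrow>
     left_module (Hc c) V \<and>
     (\<exists>F. finite F \<and> F \<subseteq> carrier V \<and>
        (\<forall>N. submodule N (Hc c \<lparr>carrier := sym_dual c\<rparr>) V \<and> F \<subseteq> N \<longrightarrow> N = carrier V)) \<and>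
     (\<forall>v\<in>carrier V. \<exists>n. \<forall>ys. length ys = n \<longrightarrow>
        foldr (\<lambda>y u. hc_vec c y \<odot>\<^bsub>V\<^esub> u) ys v = \<zero>\<^bsub>V\<^esub>)"

definition invariants :: "complex \<Rightarrow> (hc_elem, 'v) module \<Rightarrow> 'v set" where
  "invariants c V = {v \<in> carrier V. \<forall>w\<in>H3. hc_group c w \<odot>\<^bsub>V\<^esub> v = v}"

text \<open>A module in \<open>\<O>\<^sub>c\<close> is finitely generated over \<open>S\<hh>\<^sup>*\<close>, hence of at most countable dimension over \<open>\<complex>\<close>,
  hence isomorphic to one whose elements are finitely supported sequences of complex numbers.\<close>

definition aspherical :: "complex \<Rightarrow> bool" where
  "aspherical c \<longleftrightarrow>
     (\<exists>V :: (hc_elem, nat \<Rightarrow>\<^sub>0 complex) module.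
        category_O c V \<and> carrier V \<noteq> {\<zero>\<^bsub>V\<^esub>} \<and> invariants c V = {\<zero>\<^bsub>V\<^esub>})"


section \<open>Standard modules and their irreducible quotients\<close>

text \<open>The tensor product of \<open>H\<^sub>c\<close> and \<open>\<tau> = \<complex>\<^sup>n\<close> over \<open>\<complex>W \<ltimes> S\<hh>\<close> is the free abelian group on
  \<open>H\<^sub>c \<times> \<tau>\<close> modulo biadditivity and \<open>(a b, v) = (a, b v)\<close>. It is enough to impose the latter for \<open>b\<close> in
  a set of algebra generators of \<open>\<complex>W \<ltimes> S\<hh>\<close>: scalars, \<open>W\<close>, and \<open>\<hh>\<close>, which acts on \<open>\<tau>\<close> by \<open>0\<close>.\<close>

definition verma_relations ::
    "complex \<Rightarrow> (mat3 \<Rightarrow> complex^'n^'n) \<Rightarrow> (hc_elem \<times> (complex^'n) \<Rightarrow>\<^sub>0 int) set" where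
  "verma_relations c \<tau> =
     {frag_of (a \<oplus>\<^bsub>Hc c\<^esub> a', v) - frag_of (a, v) - frag_of (a', v) | a a' v.
        a \<in> carrier (Hc c) \<and> a' \<in> carrier (Hc c)} \<union>
     {frag_of (a, v + v') - frag_of (a, v) - frag_of (a, v') | a v v'. a \<in> carrier (Hc c)} \<union>
     {frag_of (a \<otimes>\<^bsub>Hc c\<^esub> hc_scalar c z, v) - frag_of (a, z *s v) | a z v. a \<in> carrier (Hc c)} \<union>
     {frag_of (a \<otimes>\<^bsub>Hc c\<^esub> hc_group c w, v) - frag_of (a, \<tau> w *v v) | a w v.
        a \<in> carrier (Hc c) \<and> w \<in> H3} \<union>
     {frag_of (a \<otimes>\<^bsub>Hc c\<^esub> hc_vec c y, v) - frag_of (a, 0) | a y v. a \<in> carrier (Hc c)}"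

definition verma ::
    "complex \<Rightarrow> (mat3 \<Rightarrow> complex^'n^'n) \<Rightarrow>
     (hc_elem, (hc_elem \<times> (complex^'n) \<Rightarrow>\<^sub>0 int) set) module" where
  "verma c \<tau> =
     (let F = free_Abelian_group (carrier (Hc c) \<times> UNIV);
          K = generate F (verma_relations c \<tau>)
      in \<lparr>carrier = carrier (F Mod K), monoid.mult = undefined, monoid.one = undefined,
          ring.zero = \<one>\<^bsub>F Mod K\<^esub>, ring.add = (\<otimes>\<^bsub>F Mod K\<^esub>),
          smult = (\<lambda>a C. \<Union>p\<in>C.
            K #>\<^bsub>F\<^esub> frag_extend (\<lambda>(b, v). frag_of (a \<otimes>\<^bsub>Hc c\<^esub> b, v)) p)\<rparr>)"

definition simple_L ::
    "complex \<Rightarrow> (mat3 \<Rightarrow> complex^'n^'n) \<Rightarrow>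
     (hc_elem, (hc_elem \<times> (complex^'n) \<Rightarrow>\<^sub>0 int) set set) module" where
  "simple_L c \<tau> = quotient_module (verma c \<tau>)
     (THE N. submodule N (Hc c) (verma c \<tau>) \<and>
             irreducible_module (Hc c) (quotient_module (verma c \<tau>) N))"


section \<open>Characters\<close>

definition gen_eigenspace :: "complex \<Rightarrow> (hc_elem, 'v) module \<Rightarrow> complex \<Rightarrow> 'v set" where
  "gen_eigenspace c V j =
     {v \<in> carrier V. \<exists>n.
        ((\<lambda>u. (euler c \<odot>\<^bsub>V\<^esub> u) \<ominus>\<^bsub>V\<^esub> (hc_scalar c j \<odot>\<^bsub>V\<^esub> u)) ^^ n) v = \<zero>\<^bsub>V\<^esub>}"

definition is_basis ::
    "complex \<Rightarrow> (hc_elem, 'v) module \<Rightarrow> 'v set \<Rightarrow> nat \<Rightarrow> (nat \<Rightarrow> 'v) \<Rightarrow> bool" where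
  "is_basis c V U n b \<longleftrightarrow>
     (\<forall>i<n. b i \<in> U) \<and>
     (\<forall>u\<in>U. \<exists>!a :: nat \<Rightarrow> complex.
        (\<forall>i\<ge>n. a i = 0) \<and> u = (\<Oplus>\<^bsub>V\<^esub>i\<in>{..<n}. hc_scalar c (a i) \<odot>\<^bsub>V\<^esub> b i))"

text \<open>The trace of a linear operator preserving a finite-dimensional complex subspace \<open>U\<close> of \<open>V\<close>.\<close>

definition operator_trace ::
    "complex \<Rightarrow> (hc_elem, 'v) module \<Rightarrow> 'v set \<Rightarrow> ('v \<Rightarrow> 'v) \<Rightarrow> complex" where
  "operator_trace c V U T =
     (THE t. \<exists>n b (a :: nat \<Rightarrow> nat \<Rightarrow> complex).
        is_basis c V U n b \<and>
        (\<forall>k<n. T (b k) = (\<Oplus>\<^bsub>V\<^esub>i\<in>{..<n}. hc_scalar c (a i k) \<odot>\<^bsub>V\<^esub> b i)) \<and>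
        t = (\<Sum>i<n. a i i))"

text \<open>For fixed \<open>w\<close> the character is a formal combination of the powers \<open>t\<^sup>j\<close>, \<open>j \<in> \<complex>\<close>, represented by
  its coefficient function; \<open>t_power j\<close> is the single power \<open>t\<^sup>j\<close>.\<close>

definition character :: "complex \<Rightarrow> (hc_elem, 'v) module \<Rightarrow> mat3 \<Rightarrow> complex \<Rightarrow> complex" where
  "character c V w j = operator_trace c V (gen_eigenspace c V j) (\<lambda>v. hc_group c w \<odot>\<^bsub>V\<^esub> v)"

definition t_power :: "complex \<Rightarrow> complex \<Rightarrow> complex" where
  "t_power j = (\<lambda>k. if k = j then 1 else 0)"


section \<open>Representations of \<open>A\<^sub>5\<close> and \<open>H\<^sub>3\<close>\<close>

definition irreducible_rep :: "('g, 'm) monoid_scheme \<Rightarrow> ('g \<Rightarrow> complex^'n^'n) \<Rightarrow> bool" where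
  "irreducible_rep G \<rho> \<longleftrightarrow>
     \<rho> \<one>\<^bsub>G\<^esub> = mat 1 \<and>
     (\<forall>g\<in>carrier G. \<forall>h\<in>carrier G. \<rho> (g \<otimes>\<^bsub>G\<^esub> h) = \<rho> g ** \<rho> h) \<and>
     (\<forall>U. vec.subspace U \<and> (\<forall>g\<in>carrier G. \<forall>u\<in>U. \<rho> g *v u \<in> U) \<longrightarrow> U = {0} \<or> U = UNIV)"

text \<open>The twist of the rotation representation by conjugation with \<open>(1 2)\<close>, relative to an
  isomorphism \<open>\<phi>\<close> from \<open>A\<^sub>5\<close> to the rotation group.\<close>

definition rep3_tilde :: "((nat \<Rightarrow> nat) \<Rightarrow> mat3) \<Rightarrow> mat3 \<Rightarrow> complex^3^3" where
  "rep3_tilde \<phi> g =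
     (let \<sigma> = Transposition.transpose 1 2
      in refl_rep (\<phi> (\<sigma> \<circ> inv_into (carrier (alt_group 5)) \<phi> g \<circ> \<sigma>)))"

text \<open>The extension to \<open>H\<^sub>3\<close> of a representation of the rotation group in which \<open>-Id\<close> acts by \<open>\<epsilon>\<close>.\<close>

definition extend_rep :: "complex \<Rightarrow> (mat3 \<Rightarrow> complex^'n^'n) \<Rightarrow> mat3 \<Rightarrow> complex^'n^'n" where
  "extend_rep \<epsilon> \<rho> w =
     (if w \<in> carrier rotation_group then \<rho> w else mat \<epsilon> ** \<rho> (- w))"

end

theory Submission
  imports Defs
begin

text \<open>The irreducible module is written down explicitly and then recognised as \<open>L\<^bsub>1/2\<^esub>\<close>.

  The field automorphism \<open>\<surd>5 \<mapsto> -\<surd>5\<close> carries the reflection representation \<open>\<hh>\<close> to a second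
  three-dimensional representation \<open>gal\<close>, and \<open>\<hh> \<otimes> gal\<close> is the sum of a four-dimensional
  representation \<open>drep\<close> and a five-dimensional one. On \<open>gal \<oplus> drep \<oplus> gal\<close>, in degrees \<open>-1, 0, 1\<close>, a
  functional \<open>x \<in> \<hh>\<^sup>*\<close> raises the degree by the equivariant maps \<open>Bm : \<hh>\<^sup>* \<otimes> gal \<rightarrow> drep\<close> and
  \<open>Nm : drep \<otimes> \<hh>\<^sup>* \<rightarrow> gal\<close>, and \<open>y \<in> \<hh>\<close> lowers it by multiples of the same two maps. The
  commutator relation for \<open>c = 1/2\<close> then says that \<open>\<Sum>\<^sub>s (x - s x, y) \<rho>(s)\<close> takes prescribed values for
  \<open>\<rho> = gal\<close> and \<open>\<rho> = drep\<close>. These are the second moments of the fifteen reflections, computed exactly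
  in \<open>\<int>[\<gamma>]\<close> with \<open>\<gamma>\<close> the golden ratio (\<open>relation_e\<close>, \<open>relation_d\<close>). The resulting module \<open>L10\<close> is
  irreducible, since every nonzero vector can be lowered to degree \<open>-1\<close>, where \<open>gal\<close> is irreducible
  and generates (\<open>L10_irreducible\<close>). It has no invariants, since \<open>-Id\<close> acts by \<open>-1\<close> on \<open>gal\<close> and no
  vector of \<open>drep\<close> is fixed by all reflections (\<open>L10_invariants\<close>). Asphericity follows, and so does
  the character.

  That \<open>L10\<close> is \<open>L\<^bsub>1/2\<^esub>(\<tau>)\<close> for every \<open>\<tau>\<close> equivalent to \<open>gal\<close> is an instance of the theory of lowest
  weights. The Euler element grades each module generated by a lowest weight space, submodules are
  graded, and so the sum of two proper submodules misses an irreducible lowest weight space. Hence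
  the maximal submodule of a standard module is unique, and any irreducible module with this lowest
  weight is the quotient by it (\<open>irreducible_quotient_unique\<close>, \<open>simple_L_iso\<close>).

  It remains to see that the representations of the statement, which depend on an arbitrary
  isomorphism \<open>\<phi>\<close> and an arbitrary model of the four-dimensional representation, are the concrete
  ones. Conjugation by \<open>(1 2)\<close> preserves the order of an even permutation and exchanges the two
  classes of 5-cycles, and Galois conjugation does the same to traces of rotations; so the twist and
  \<open>gal\<close> have equal characters (\<open>trace_twist\<close>) and averaging produces an equivalence
  (\<open>gal_equivalent\<close>). A four-dimensional irreducible representation occurs in the regular
  representation, hence in one of \<open>1\<close>, \<open>\<hh>\<close>, \<open>gal\<close>, \<open>\<hh> \<otimes> gal\<close>, \<open>drep\<close>. Dimensions exclude the first
  three, and an intertwiner that kills \<open>drep\<close> inside \<open>\<hh> \<otimes> gal\<close> also kills the five-dimensional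
  complement, because five vectors in a space of dimension four are dependent
  (\<open>four_dimensional_equivalent\<close>).\<close>

section \<open>The symmetry group\<close>

lemma H3_orthogonal: "w \<in> H3 \<Longrightarrow> orthogonal_matrix w"
  by (simp add: H3_def)

lemma orthogonal_inverse:
  fixes w :: "real^'n^'n"
  assumes "orthogonal_matrix w"
  shows "matrix_inv w = transpose w" "w ** matrix_inv w = mat 1" "matrix_inv w ** w = mat 1"
proof -
  have t: "w ** transpose w = mat 1" "transpose w ** w = mat 1"
    using assms by (auto simp: orthogonal_matrix_def)
  have "w ** matrix_inv w = mat 1 \<and> matrix_inv w ** w = mat 1"
    unfolding matrix_inv_def by (rule someI[of _ "transpose w"]) (use t in auto)
  then show i: "w ** matrix_inv w = mat 1" "matrix_inv w ** w = mat 1" by auto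
  then show "matrix_inv w = transpose w"
    by (metis matrix_mul_assoc matrix_mul_lid matrix_mul_rid t(2))
qed

lemma H3_inverse:
  assumes "w \<in> H3"
  shows "matrix_inv w = transpose w" "w ** matrix_inv w = mat 1" "matrix_inv w ** w = mat 1"
    "w ** transpose w = mat 1" "transpose w ** w = mat 1"
  using orthogonal_inverse[OF H3_orthogonal[OF assms]] by auto

lemma H3_one: "mat 1 \<in> H3"
  by (simp add: H3_def orthogonal_matrix_id)

lemma H3_mult:
  assumes "w \<in> H3" "w' \<in> H3"
  shows "w ** w' \<in> H3"
proof -
  have "(*v) (w ** w') ` icosahedron_vertices = (*v) w ` ((*v) w' ` icosahedron_vertices)"
    by (simp only: image_image matrix_vector_mul_assoc)
  also have "\<dots> = icosahedron_vertices"
    using assms by (simp add: H3_def)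
  finally show ?thesis
    using assms by (simp add: H3_def orthogonal_matrix_mul)
qed

lemma H3_inv:
  assumes "w \<in> H3"
  shows "matrix_inv w \<in> H3"
proof -
  have "(*v) (matrix_inv w) ` icosahedron_vertices = (*v) (matrix_inv w) ` ((*v) w ` icosahedron_vertices)"
    using assms by (simp add: H3_def)
  also have "\<dots> = icosahedron_vertices"
    by (simp only: image_image matrix_vector_mul_assoc H3_inverse(3)[OF assms]) simp
  finally show ?thesis
    using assms by (simp add: H3_inverse(1) H3_def)
qed

lemma H3_transpose: "w \<in> H3 \<Longrightarrow> transpose w \<in> H3"
  using H3_inv H3_inverse(1) by metis

lemma H3_cancel:
  assumes "w \<in> H3"
  shows "matrix_inv w ** (w ** u) = u" "w ** (matrix_inv w ** u) = u"
  using H3_inverse[OF assms] by (simp_all add: matrix_mul_assoc)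

lemma H3_inv_mult:
  assumes "w \<in> H3" "w' \<in> H3"
  shows "matrix_inv (w ** w') = matrix_inv w' ** matrix_inv w"
  using assms by (simp add: H3_inverse(1) H3_mult matrix_transpose_mul)

lemma golden_eqs: "golden * golden = golden + 1" "golden > 1" "golden \<noteq> 0"
proof -
  have "sqrt 5 > sqrt 1" by (rule real_sqrt_less_mono) simp
  then show "golden > 1" by (simp add: golden_def)
  then show "golden \<noteq> 0" by simp
  show "golden * golden = golden + 1" by (simp add: golden_def field_simps)
qed

lemma finite_vertices: "finite icosahedron_vertices"
  by (simp add: icosahedron_vertices_def)

text \<open>The vertices span \<open>\<real>\<^sup>3\<close>, so a symmetry is determined by the images of four of them.\<close>

lemma finite_H3: "finite H3"
proof -
  let ?a = "vector [0, 1, golden] :: real^3" and ?b = "vector [0, 1, -golden] :: real^3"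
  let ?c = "vector [1, golden, 0] :: real^3" and ?d = "vector [-1, golden, 0] :: real^3"
  let ?V = "icosahedron_vertices"
  let ?f = "\<lambda>w::mat3. (w *v ?a, w *v ?b, w *v ?c, w *v ?d)"
  have mem: "?a \<in> ?V" "?b \<in> ?V" "?c \<in> ?V" "?d \<in> ?V"
    by (auto simp: icosahedron_vertices_def)
  have "?f ` H3 \<subseteq> ?V \<times> ?V \<times> ?V \<times> ?V"
    using mem by (auto simp: H3_def)
  then have fin: "finite (?f ` H3)"
    by (rule finite_subset) (simp add: finite_vertices)
  have "inj_on ?f H3"
  proof (rule inj_onI)
    fix w w' assume "?f w = ?f w'"
    then have e: "w *v ?a = w' *v ?a" "w *v ?b = w' *v ?b" "w *v ?c = w' *v ?c" "w *v ?d = w' *v ?d"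
      by auto
    have "w $ i $ j = w' $ i $ j" for i j
    proof -
      have r: "w $ i $ 2 + golden * w $ i $ 3 = w' $ i $ 2 + golden * w' $ i $ 3"
        "w $ i $ 2 - golden * w $ i $ 3 = w' $ i $ 2 - golden * w' $ i $ 3"
        "w $ i $ 1 + golden * w $ i $ 2 = w' $ i $ 1 + golden * w' $ i $ 2"
        using arg_cong[OF e(1), of "\<lambda>v. v $ i"] arg_cong[OF e(2), of "\<lambda>v. v $ i"]
          arg_cong[OF e(3), of "\<lambda>v. v $ i"]
        by (simp_all add: matrix_vector_mult_def sum_3 algebra_simps)
      have "w $ i $ 2 = w' $ i $ 2" using r(1,2) by linarith
      moreover have "golden * w $ i $ 3 = golden * w' $ i $ 3" using r(1,2) by linarith
      moreover have "w $ i $ 3 = w' $ i $ 3" using calculation(2) golden_eqs by simp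
      ultimately show ?thesis using r(3) exhaust_3[of j] by auto
    qed
    then show "w = w'" by (simp add: vec_eq_iff)
  qed
  then show ?thesis using fin finite_imageD by blast
qed

lemma refl_rep_mult: "refl_rep (w ** w') = refl_rep w ** refl_rep w'"
  by (simp add: refl_rep_def vec_eq_iff matrix_matrix_mult_def)

lemma refl_rep_one [simp]: "refl_rep (mat 1) = mat 1"
  by (simp add: refl_rep_def vec_eq_iff mat_def)

lemma act_h_mult: "act_h (w ** w') y = act_h w (act_h w' y)"
  by (simp add: act_h_def refl_rep_mult matrix_vector_mul_assoc)

lemma act_dual_mult:
  assumes "w \<in> H3" "w' \<in> H3"
  shows "act_dual (w ** w') x = act_dual w (act_dual w' x)"
  by (simp add: act_dual_def H3_inv_mult[OF assms] refl_rep_mult vector_matrix_mul_assoc)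

lemma act_dual_eq_act_h: "w \<in> H3 \<Longrightarrow> act_dual w x = act_h w x"
  by (simp add: act_dual_def act_h_def H3_inverse(1) refl_rep_def vec_eq_iff
      matrix_vector_mult_def vector_matrix_mult_def transpose_def mult.commute)

lemma act_h_one [simp]: "act_h (mat 1) y = y"
  by (simp add: act_h_def)

lemma act_h_linear: "act_h w y = (\<Sum>i\<in>UNIV. y $ i *s act_h w (axis i 1))"
  by (simp add: act_h_def vec_eq_iff matrix_vector_mult_def axis_def if_distrib mult.commute
      cong: if_cong)

section \<open>The smash product is a ring\<close>

lemma tensor_induct [case_names zero single add]:
  fixes p :: tensor_algebra
  assumes "P 0" "\<And>u z. P (Poly_Mapping.single u z)" "\<And>p q. P p \<Longrightarrow> P q \<Longrightarrow> P (p + q)"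
  shows "P p"
proof (induction p rule: update_induct)
  case (update f a b)
  have "Poly_Mapping.update a b f = f + Poly_Mapping.single a b"
    using update(1)
    by (intro poly_mapping_eqI)
      (auto simp: lookup_update lookup_add lookup_single when_def in_keys_iff)
  then show ?case using assms update by simp
qed (rule assms)

text \<open>A family of linear operators indexed by the letters makes a complex vector space a module over
  the tensor algebra. Both the automorphisms \<open>act_tensor w\<close> and the modules over the
  Cherednik algebra arise in this way, so that multiplicativity has to be verified only once.\<close>

locale word_action = vector_space sc
  for sc :: "complex \<Rightarrow> 'v::ab_group_add \<Rightarrow> 'v" +
  fixes opr :: "letter \<Rightarrow> 'v \<Rightarrow> 'v"
  assumes opr_add: "opr l (u + v) = opr l u + opr l v"
    and opr_sc: "opr l (sc z v) = sc z (opr l v)"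
begin

definition wact :: "word \<Rightarrow> 'v \<Rightarrow> 'v" where
  "wact u v = foldr opr (letters u) v"

definition tact :: "tensor_algebra \<Rightarrow> 'v \<Rightarrow> 'v" where
  "tact p v = (\<Sum>u\<in>Poly_Mapping.keys p. sc (Poly_Mapping.lookup p u) (wact u v))"

lemma wact_zero_word [simp]: "wact 0 v = v"
  by (simp add: wact_def zero_word_def)

lemma wact_plus: "wact (u + u') v = wact u (wact u' v)"
  by (simp add: wact_def plus_word_def)

lemma wact_letter [simp]: "wact (Word [l]) v = opr l v"
  by (simp add: wact_def)

lemma foldr_opr_add: "foldr opr ls (v + v') = foldr opr ls v + foldr opr ls v'"
  by (induction ls) (simp_all add: opr_add)

lemma foldr_opr_sc: "foldr opr ls (sc z v) = sc z (foldr opr ls v)"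
  by (induction ls) (simp_all add: opr_sc)

lemma tact_superset:
  assumes "finite S" "Poly_Mapping.keys p \<subseteq> S"
  shows "tact p v = (\<Sum>u\<in>S. sc (Poly_Mapping.lookup p u) (wact u v))"
  unfolding tact_def using assms
  by (intro sum.mono_neutral_left) (auto simp: in_keys_iff)

lemma tact_add: "tact (p + q) v = tact p v + tact q v"
proof -
  let ?S = "Poly_Mapping.keys p \<union> Poly_Mapping.keys q"
  show ?thesis
    by (subst (1 2 3) tact_superset[of ?S])
      (use keys_add[of p q] in \<open>auto simp: lookup_add scale_left_distrib sum.distrib\<close>)
qed

lemma tact_0 [simp]: "tact 0 v = 0"
  by (simp add: tact_def)

lemma tact_minus: "tact (- p) v = - tact p v"
  using tact_add[of p "- p" v] by (simp add: eq_neg_iff_add_eq_0 add.commute)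

lemma tact_diff: "tact (p - q) v = tact p v - tact q v"
  using tact_add[of p "- q" v] by (simp add: tact_minus)

lemma tact_sum: "tact (sum f I) v = (\<Sum>i\<in>I. tact (f i) v)"
  by (induction I rule: infinite_finite_induct) (simp_all add: tact_add)

lemma tact_single [simp]: "tact (Poly_Mapping.single u z) v = sc z (wact u v)"
  by (cases "z = 0") (simp_all add: tact_def)

lemma tact_const [simp]: "tact (const z) v = sc z v"
  by (simp add: const_def)

lemma tact_1 [simp]: "tact 1 v = v"
  using tact_const[of 1 v] by (simp add: const_def)

lemma tact_add_right: "tact p (v + v') = tact p v + tact p v'"
  by (simp add: tact_def wact_def foldr_opr_add scale_right_distrib sum.distrib)

lemma tact_zero_right [simp]: "tact p 0 = 0"
  using tact_add_right[of p 0 0] by simp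

lemma tact_sum_right: "tact p (sum f I) = (\<Sum>i\<in>I. tact p (f i))"
  by (induction I rule: infinite_finite_induct) (simp_all add: tact_add_right)

lemma tact_mult: "tact (p * q) v = tact p (tact q v)"
proof (induction p rule: tensor_induct)
  case (single u z)
  show ?case
  proof (induction q rule: tensor_induct)
    case (single u' z')
    have "sc (z * z') (wact u (wact u' v)) = sc z (wact u (sc z' (wact u' v)))"
      by (simp add: wact_def foldr_opr_sc)
    then show ?case by (simp add: mult_single wact_plus)
  next
    case (add p q)
    then show ?case by (simp add: distrib_left tact_add tact_add_right)
  qed simp
qed (simp_all add: distrib_right tact_add)

end

lemma const_0 [simp]: "const 0 = 0" by (simp add: const_def)
lemma const_1 [simp]: "const 1 = 1" by (simp add: const_def)
lemma const_add: "const (a + b) = const a + const b" by (simp add: const_def single_add)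
lemma const_mult: "const (a * b) = const a * const b" by (simp add: const_def mult_single)
lemma const_uminus: "const (- a) = - const a" by (simp add: const_def single_uminus)

lemma const_commutes: "const z * p = p * const z"
  by (induction p rule: tensor_induct)
    (simp_all add: const_def mult_single distrib_left distrib_right mult.commute)

lemma single_word: "Poly_Mapping.single (Word ls) z =
    const z * prod_list (map (\<lambda>l. Poly_Mapping.single (Word [l]) 1) ls)"
proof -
  have "prod_list (map (\<lambda>l. Poly_Mapping.single (Word [l]) (1::complex)) ls)
      = Poly_Mapping.single (Word ls) 1"
    by (induction ls)
      (simp_all add: zero_word_def[symmetric] mult_single plus_word_def)
  then show ?thesis by (simp add: const_def mult_single)
qed

interpretation substitution: word_action "\<lambda>z q. const z * q" "\<lambda>l q. act_letter w l * q" for w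
proof unfold_locales
  show "act_letter w l * (const z * q) = const z * (act_letter w l * q)" for l z q
    by (metis const_commutes mult.assoc)
qed (simp_all add: distrib_left distrib_right const_add const_mult mult.assoc)

lemma substitution_tact: "substitution.tact w p q = act_tensor w p * q"
proof -
  have "foldr (\<lambda>l. (*) (act_letter w l)) ls q = prod_list (map (act_letter w) ls) * q" for ls
    by (induction ls) (simp_all add: mult.assoc)
  then show ?thesis
    by (simp add: substitution.tact_def substitution.wact_def act_tensor_def sum_distrib_right
        mult.assoc)
qed

lemma act_tensor_eq_tact: "act_tensor w p = substitution.tact w p 1"
  by (simp add: substitution_tact)

lemma act_tensor_0 [simp]: "act_tensor w 0 = 0"
  by (simp add: act_tensor_eq_tact)

lemma act_tensor_1 [simp]: "act_tensor w 1 = 1"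
  by (simp add: act_tensor_eq_tact)

lemma act_tensor_const [simp]: "act_tensor w (const z) = const z"
  by (simp add: act_tensor_eq_tact)

lemma act_tensor_add: "act_tensor w (p + q) = act_tensor w p + act_tensor w q"
  by (simp add: act_tensor_eq_tact substitution.tact_add)

lemma act_tensor_sum: "act_tensor w (sum f I) = (\<Sum>i\<in>I. act_tensor w (f i))"
  by (simp add: act_tensor_eq_tact substitution.tact_sum)

lemma act_tensor_mult: "act_tensor w (p * q) = act_tensor w p * act_tensor w q"
  using substitution.tact_mult[of w p q 1] by (simp add: substitution_tact)

lemma act_tensor_letter: "act_tensor w (Poly_Mapping.single (Word [l]) z) = const z * act_letter w l"
  by (simp add: act_tensor_eq_tact)

lemma emb_dual_add: "emb_dual (x + y) = emb_dual x + emb_dual y"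
  by (simp add: emb_dual_def single_add sum.distrib)

lemma emb_dual_scale: "emb_dual (z *s x) = const z * emb_dual x"
  by (simp add: emb_dual_def const_def sum_distrib_left mult_single)

lemma emb_h_add: "emb_h (x + y) = emb_h x + emb_h y"
  by (simp add: emb_h_def single_add sum.distrib)

lemma emb_h_scale: "emb_h (z *s x) = const z * emb_h x"
  by (simp add: emb_h_def const_def sum_distrib_left mult_single)

lemma emb_dual_0 [simp]: "emb_dual 0 = 0" by (simp add: emb_dual_def)
lemma emb_h_0 [simp]: "emb_h 0 = 0" by (simp add: emb_h_def)

lemma emb_dual_sum: "emb_dual (sum f I) = (\<Sum>i\<in>I. emb_dual (f i))"
  by (induction I rule: infinite_finite_induct) (simp_all add: emb_dual_add)

lemma emb_h_sum: "emb_h (sum f I) = (\<Sum>i\<in>I. emb_h (f i))"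
  by (induction I rule: infinite_finite_induct) (simp_all add: emb_h_add)

lemma emb_dual_axis: "emb_dual (axis i 1) = Poly_Mapping.single (Word [X_letter i]) 1"
proof -
  have "emb_dual (axis i 1) = (\<Sum>j\<in>UNIV. if j = i then Poly_Mapping.single (Word [X_letter i]) 1 else 0)"
    unfolding emb_dual_def by (rule sum.cong) (auto simp: axis_def)
  then show ?thesis by simp
qed

lemma emb_h_axis: "emb_h (axis i 1) = Poly_Mapping.single (Word [Y_letter i]) 1"
proof -
  have "emb_h (axis i 1) = (\<Sum>j\<in>UNIV. if j = i then Poly_Mapping.single (Word [Y_letter i]) 1 else 0)"
    unfolding emb_h_def by (rule sum.cong) (auto simp: axis_def)
  then show ?thesis by simp
qed

lemma act_tensor_emb_dual:
  assumes "w \<in> H3"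
  shows "act_tensor w (emb_dual x) = emb_dual (act_dual w x)"
proof -
  have "act_tensor w (emb_dual x) = (\<Sum>i\<in>UNIV. const (x $ i) * emb_dual (act_dual w (axis i 1)))"
    by (simp add: emb_dual_def[of x] act_tensor_sum act_tensor_letter)
  also have "\<dots> = emb_dual (\<Sum>i\<in>UNIV. x $ i *s act_h w (axis i 1))"
    by (simp add: emb_dual_sum emb_dual_scale act_dual_eq_act_h assms)
  also have "\<dots> = emb_dual (act_dual w x)"
    using act_h_linear[of w x] by (simp add: act_dual_eq_act_h assms)
  finally show ?thesis .
qed

lemma act_tensor_emb_h: "act_tensor w (emb_h y) = emb_h (act_h w y)"
proof -
  have "act_tensor w (emb_h y) = (\<Sum>i\<in>UNIV. const (y $ i) * emb_h (act_h w (axis i 1)))"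
    by (simp add: emb_h_def[of y] act_tensor_sum act_tensor_letter)
  also have "\<dots> = emb_h (act_h w y)"
    using act_h_linear[of w y] by (simp add: emb_h_sum emb_h_scale)
  finally show ?thesis .
qed

lemma act_tensor_comp:
  assumes "w \<in> H3" "w' \<in> H3"
  shows "act_tensor w (act_tensor w' p) = act_tensor (w ** w') p"
proof (induction p rule: tensor_induct)
  case (single u z)
  have l: "act_tensor w (act_letter w' l) = act_letter (w ** w') l" for l
    by (cases l)
      (simp_all add: act_tensor_emb_dual act_tensor_emb_h act_dual_mult act_h_mult assms)
  have "act_tensor w (act_tensor w' (prod_list (map (\<lambda>l. Poly_Mapping.single (Word [l]) 1) ls)))
      = act_tensor (w ** w') (prod_list (map (\<lambda>l. Poly_Mapping.single (Word [l]) 1) ls))" for ls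
    by (induction ls) (simp_all add: act_tensor_mult act_tensor_letter l)
  then show ?case
    using single_word[of "letters u" z] by (simp add: act_tensor_mult)
qed (simp_all add: act_tensor_add)

lemma act_tensor_id: "act_tensor (mat 1) p = p"
proof (induction p rule: tensor_induct)
  case (single u z)
  have l: "act_letter (mat 1) l = Poly_Mapping.single (Word [l]) 1" for l
    using H3_one by (cases l) (simp_all add: act_dual_eq_act_h emb_dual_axis emb_h_axis)
  have "act_tensor (mat 1) (prod_list (map (\<lambda>l. Poly_Mapping.single (Word [l]) 1) ls))
      = prod_list (map (\<lambda>l. Poly_Mapping.single (Word [l]) 1) ls)" for ls
    by (induction ls) (simp_all add: act_tensor_mult act_tensor_letter l)
  then show ?case
    using single_word[of "letters u" z] by (simp add: act_tensor_mult)
qed (simp_all add: act_tensor_add)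

lemma smash_simps:
  "carrier smash = {f. \<forall>w. w \<notin> H3 \<longrightarrow> f w = 0}"
  "f \<otimes>\<^bsub>smash\<^esub> g = (\<lambda>u. if u \<in> H3 then \<Sum>w\<in>H3. f w * act_tensor w (g (matrix_inv w ** u)) else 0)"
  "\<one>\<^bsub>smash\<^esub> = (\<lambda>u. if u = mat 1 then 1 else 0)"
  "\<zero>\<^bsub>smash\<^esub> = (\<lambda>u. 0)"
  "f \<oplus>\<^bsub>smash\<^esub> g = (\<lambda>u. f u + g u)"
  by (simp_all add: smash_def)

lemma sum_H3_translate:
  assumes "v \<in> H3"
  shows "(\<Sum>w\<in>H3. f (matrix_inv v ** w)) = sum f H3"
  by (rule sum.reindex_bij_witness[where i = "\<lambda>w. v ** w" and j = "\<lambda>w. matrix_inv v ** w"])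
    (use assms in \<open>auto simp: H3_mult H3_inv H3_cancel\<close>)

text \<open>Associativity is the change of summation variable \<open>w \<mapsto> v\<^sup>-\<^sup>1 w\<close> together with the fact that \<open>H3\<close> acts
  on the tensor algebra by ring automorphisms.\<close>

lemma ring_smash: "ring smash"
proof (rule ringI)
  show "abelian_group smash"
  proof (rule abelian_groupI)
    fix f assume "f \<in> carrier smash"
    then show "\<exists>g\<in>carrier smash. g \<oplus>\<^bsub>smash\<^esub> f = \<zero>\<^bsub>smash\<^esub>"
      by (intro bexI[of _ "\<lambda>u. - f u"]) (auto simp: smash_simps)
  qed (auto simp: smash_simps add.assoc add.commute)
  show "monoid smash"
  proof (rule monoidI)
    fix f g h assume fgh: "f \<in> carrier smash" "g \<in> carrier smash" "h \<in> carrier smash"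
    show "(f \<otimes>\<^bsub>smash\<^esub> g) \<otimes>\<^bsub>smash\<^esub> h = f \<otimes>\<^bsub>smash\<^esub> (g \<otimes>\<^bsub>smash\<^esub> h)"
    proof
      fix u
      show "((f \<otimes>\<^bsub>smash\<^esub> g) \<otimes>\<^bsub>smash\<^esub> h) u = (f \<otimes>\<^bsub>smash\<^esub> (g \<otimes>\<^bsub>smash\<^esub> h)) u"
      proof (cases "u \<in> H3")
        case True
        let ?F = "\<lambda>v w. f v * act_tensor v (g w) * act_tensor (v ** w) (h (matrix_inv (v ** w) ** u))"
        have "((f \<otimes>\<^bsub>smash\<^esub> g) \<otimes>\<^bsub>smash\<^esub> h) u
            = (\<Sum>w\<in>H3. \<Sum>v\<in>H3. f v * act_tensor v (g (matrix_inv v ** w)) * act_tensor w (h (matrix_inv w ** u)))"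
          using True by (simp add: smash_simps sum_distrib_right)
        also have "\<dots> = (\<Sum>v\<in>H3. \<Sum>w\<in>H3. ?F v (matrix_inv v ** w))"
          by (subst sum.swap) (auto intro!: sum.cong simp: H3_cancel)
        also have "\<dots> = (\<Sum>v\<in>H3. \<Sum>w\<in>H3. ?F v w)"
        proof (rule sum.cong)
          fix v assume "v \<in> H3"
          then show "(\<Sum>w\<in>H3. ?F v (matrix_inv v ** w)) = (\<Sum>w\<in>H3. ?F v w)"
            by (rule sum_H3_translate[of v "?F v"])
        qed simp
        also have "\<dots> = (f \<otimes>\<^bsub>smash\<^esub> (g \<otimes>\<^bsub>smash\<^esub> h)) u"
          using True
          by (auto simp: smash_simps H3_mult H3_inv act_tensor_sum act_tensor_mult act_tensor_comp
              sum_distrib_left mult.assoc H3_inv_mult matrix_mul_assoc intro!: sum.cong)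
        finally show ?thesis .
      qed (simp add: smash_simps)
    qed
  next
    fix f assume f: "f \<in> carrier smash"
    have "(\<one>\<^bsub>smash\<^esub> \<otimes>\<^bsub>smash\<^esub> f) u = f u" for u
    proof (cases "u \<in> H3")
      case True
      have "(\<Sum>w\<in>H3. (if w = mat 1 then 1 else 0) * act_tensor w (f (matrix_inv w ** u)))
        = (\<Sum>w\<in>H3. if w = mat 1 then f u else 0)"
        by (rule sum.cong) (use H3_inverse[OF H3_one] in \<open>auto simp: act_tensor_id transpose_mat\<close>)
      then show ?thesis using True by (simp add: smash_simps finite_H3 H3_one)
    qed (use f in \<open>auto simp: smash_simps\<close>)
    then show "\<one>\<^bsub>smash\<^esub> \<otimes>\<^bsub>smash\<^esub> f = f" by auto
    have "(f \<otimes>\<^bsub>smash\<^esub> \<one>\<^bsub>smash\<^esub>) u = f u" for u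
    proof (cases "u \<in> H3")
      case True
      have "(\<Sum>w\<in>H3. f w * act_tensor w (if matrix_inv w ** u = mat 1 then 1 else 0))
        = (\<Sum>w\<in>H3. if w = u then f u else 0)"
      proof (rule sum.cong)
        fix w assume w: "w \<in> H3"
        have "matrix_inv w ** u = mat 1 \<longleftrightarrow> w = u"
          using H3_cancel(2)[OF w, of u] H3_inverse(3)[OF w] by auto
        then show "f w * act_tensor w (if matrix_inv w ** u = mat 1 then 1 else 0)
            = (if w = u then f u else 0)" by simp
      qed simp
      then show ?thesis using True by (simp add: smash_simps finite_H3)
    qed (use f in \<open>auto simp: smash_simps\<close>)
    then show "f \<otimes>\<^bsub>smash\<^esub> \<one>\<^bsub>smash\<^esub> = f" by auto
  qed (auto simp: smash_simps H3_one)
qed (auto simp: smash_simps distrib_left distrib_right act_tensor_add sum.distrib)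

section \<open>Reflections and roots\<close>

definition refl_matrix :: "real^3 \<Rightarrow> mat3" where
  "refl_matrix n = (\<chi> i j. (if i = j then 1 else 0) - 2 * n $ i * n $ j)"

lemma refl_matrix_apply: "refl_matrix n *v v = v - (2 * (n \<bullet> v)) *\<^sub>R n"
proof -
  have "(refl_matrix n *v v) $ i = v $ i - 2 * (n \<bullet> v) * n $ i" for i
    using exhaust_3[of i]
    by (auto simp: refl_matrix_def matrix_vector_mult_def sum_3 inner_vec_def algebra_simps)
  then show ?thesis by (simp add: vec_eq_iff)
qed

lemma inner_orthogonal: "orthogonal_matrix w \<Longrightarrow> (w *v u) \<bullet> (w *v v) = u \<bullet> v" for w :: mat3
  using orthogonal_transformation_def orthogonal_transformation_matrix
  by (metis matrix_of_matrix_vector_mul matrix_vector_mul_linear)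

text \<open>An orthogonal map that fixes a plane pointwise maps the normal of the plane to a multiple of
  itself, and hence to its negative.\<close>

lemma reflection_normal_form:
  assumes "s \<in> reflections"
  obtains n where "n \<bullet> n = 1" "s = refl_matrix n"
proof -
  let ?S = "{v. s *v v = v}"
  have orth: "orthogonal_matrix s" and d: "dim ?S = 2"
    using assms by (auto simp: reflections_def H3_def)
  have sub: "subspace ?S"
    by (auto simp: subspace_def matrix_vector_right_distrib matrix_vector_mult_scaleR)
  have "dim ?S < DIM(real^3)" using d by simp
  then obtain m where m: "m \<noteq> 0" "\<And>y. y \<in> span ?S \<Longrightarrow> orthogonal m y"
    using orthogonal_to_subspace_exists by blast
  define n where "n = m /\<^sub>R norm m"
  have nn: "n \<bullet> n = 1" using m(1) by (simp add: n_def dot_square_norm power2_eq_square)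
  have "?S \<subseteq> {v. n \<bullet> v = 0}"
  proof
    fix v assume "v \<in> ?S"
    then have "orthogonal m v" by (rule m(2)[OF span_base])
    then show "v \<in> {v. n \<bullet> v = 0}" by (simp add: n_def orthogonal_def)
  qed
  moreover have "dim {v. n \<bullet> v = 0} = 2"
    using nn by (subst dim_hyperplane) auto
  ultimately have S: "?S = {v. n \<bullet> v = 0}"
    using subspace_dim_equal[OF sub subspace_hyperplane] d by simp
  define u where "u = s *v n"
  have "(u \<bullet> v) = 0" if "n \<bullet> v = 0" for v
  proof -
    have "s *v v = v" using that S by blast
    then show ?thesis using inner_orthogonal[OF orth, of n v] that by (simp add: u_def)
  qed
  moreover have n_perp: "n \<bullet> (u - (u \<bullet> n) *\<^sub>R n) = 0"
    by (simp add: inner_diff_right nn inner_commute)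
  ultimately have "u \<bullet> (u - (u \<bullet> n) *\<^sub>R n) = 0" by blast
  moreover note n_perp
  ultimately have "(u - (u \<bullet> n) *\<^sub>R n) \<bullet> (u - (u \<bullet> n) *\<^sub>R n) = 0"
    by (simp add: inner_diff_left)
  then have u: "u = (u \<bullet> n) *\<^sub>R n" by simp
  have "u \<bullet> u = 1" using inner_orthogonal[OF orth, of n n] nn by (simp add: u_def)
  then have "(u \<bullet> n) * (u \<bullet> n) = 1"
    using u nn by (metis inner_scaleR_left inner_scaleR_right mult.right_neutral)
  then have "u \<bullet> n = 1 \<or> u \<bullet> n = -1" by (simp add: square_eq_1_iff)
  moreover have "u \<bullet> n \<noteq> 1"
  proof
    assume "u \<bullet> n = 1"
    then have "n \<in> ?S" using u by (simp add: u_def)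
    then show False using S nn by auto
  qed
  ultimately have un: "s *v n = - n" using u by (simp add: u_def)
  have "s *v v = refl_matrix n *v v" for v
  proof -
    have "n \<bullet> (v - (n \<bullet> v) *\<^sub>R n) = 0" by (simp add: inner_diff_right nn)
    then have "s *v (v - (n \<bullet> v) *\<^sub>R n) = v - (n \<bullet> v) *\<^sub>R n" using S by blast
    moreover have "s *v v = s *v (v - (n \<bullet> v) *\<^sub>R n) + (n \<bullet> v) *\<^sub>R (s *v n)"
      by (simp only: matrix_vector_mult_diff_distrib matrix_vector_mult_scaleR) simp
    ultimately have "s *v v = v - (n \<bullet> v) *\<^sub>R n - (n \<bullet> v) *\<^sub>R n" by (simp add: un)
    also have "\<dots> = v - (2 * (n \<bullet> v)) *\<^sub>R n"
      by (simp only: mult_2 scaleR_add_left diff_diff_eq)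
    finally show ?thesis by (simp only: refl_matrix_apply)
  qed
  then show thesis using that nn matrix_eq by blast
qed

lemma refl_matrix_reflection:
  assumes "n \<bullet> n = 1" "refl_matrix n \<in> H3"
  shows "refl_matrix n \<in> reflections"
proof -
  have "n \<noteq> 0" using assms by auto
  then have "{v. refl_matrix n *v v = v} = {v. n \<bullet> v = 0}"
    by (simp add: refl_matrix_apply)
  moreover have "dim {v. n \<bullet> v = 0} = 2"
    using \<open>n \<noteq> 0\<close> by (subst dim_hyperplane) auto
  ultimately show ?thesis using assms by (simp add: reflections_def)
qed

lemma reflections_H3: "reflections \<subseteq> H3"
  by (auto simp: reflections_def)

lemma finite_reflections: "finite reflections"
  using reflections_H3 finite_H3 finite_subset by blast

lemma one_not_reflection: "mat 1 \<notin> reflections"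
  using dim_UNIV[where 'a = "real^3"] by (auto simp: reflections_def)

lemma conj_refl_matrix:
  assumes "orthogonal_matrix w"
  shows "w ** refl_matrix n ** transpose w = refl_matrix (w *v n)"
proof -
  have "(w ** refl_matrix n ** transpose w) *v v = refl_matrix (w *v n) *v v" for v
  proof -
    have "w *v (refl_matrix n *v (transpose w *v v)) = w *v (transpose w *v v) - (2 * (n \<bullet> (transpose w *v v))) *\<^sub>R (w *v n)"
      by (simp only: refl_matrix_apply matrix_vector_mult_diff_distrib matrix_vector_mult_scaleR)
    also have "w *v (transpose w *v v) = v"
      using assms by (simp only: matrix_vector_mul_assoc) (simp add: orthogonal_matrix_def)
    also have "n \<bullet> (transpose w *v v) = (w *v n) \<bullet> v"
      by (metis dot_lmul_matrix inner_commute transpose_matrix_vector)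
    finally show ?thesis by (simp only: matrix_vector_mul_assoc[symmetric] refl_matrix_apply)
  qed
  then show ?thesis using matrix_eq by blast
qed

lemma conj_reflection:
  assumes "w \<in> H3" "s \<in> reflections"
  shows "w ** s ** transpose w \<in> reflections"
proof -
  obtain n where n: "n \<bullet> n = 1" "s = refl_matrix n" using reflection_normal_form[OF assms(2)] .
  have o: "orthogonal_matrix w" using assms H3_orthogonal by auto
  have e: "w ** s ** transpose w = refl_matrix (w *v n)" using conj_refl_matrix[OF o] n by simp
  have "(w *v n) \<bullet> (w *v n) = 1" using inner_orthogonal[OF o] n by simp
  moreover have "w ** s ** transpose w \<in> H3"
    using assms reflections_H3 by (intro H3_mult H3_transpose) auto
  ultimately show ?thesis using e refl_matrix_reflection by metis
qed

text \<open>Conjugation permutes the reflections; this gives the equivariance of every sum over them.\<close>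

lemma sum_reflections_conj:
  assumes "w \<in> H3"
  shows "(\<Sum>s\<in>reflections. f (w ** s ** transpose w)) = sum f reflections"
proof (rule sum.reindex_bij_witness[where i = "\<lambda>s. transpose w ** s ** w" and j = "\<lambda>s. w ** s ** transpose w"])
  have i: "transpose w ** w = mat 1" "w ** transpose w = mat 1" using H3_inverse[OF assms] by auto
  have cl: "transpose w ** (w ** u) = u" "w ** (transpose w ** u) = u" for u
    by (simp_all add: matrix_mul_assoc i)
  show "transpose w ** (w ** s ** transpose w) ** w = s" for s
    by (simp add: matrix_mul_assoc[symmetric] cl i)
  show "w ** (transpose w ** s ** w) ** transpose w = s" for s
    by (simp add: matrix_mul_assoc[symmetric] cl i)
  show "s \<in> reflections \<Longrightarrow> w ** s ** transpose w \<in> reflections" for s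
    using conj_reflection assms by auto
  show "s \<in> reflections \<Longrightarrow> transpose w ** s ** w \<in> reflections" for s
    using conj_reflection[OF H3_transpose[OF assms], of s] by simp
qed simp

lemma pairing_scale: "pairing (z *s x) y = z * pairing x y" "pairing x (z *s y) = z * pairing x y"
  by (simp_all add: pairing_def sum_distrib_left mult_ac)

text \<open>The choice of \<open>(\<alpha>\<^sub>s, \<alpha>\<^sub>s\<^sup>\<or>)\<close> is immaterial, because the rank one operator \<open>x \<mapsto> (x, \<alpha>\<^sub>s\<^sup>\<or>) \<alpha>\<^sub>s\<close> is
  \<open>1 - s\<close>.\<close>

lemma root_coroot:
  assumes "s \<in> reflections"
  shows "pairing x (refl_coroot s) *s refl_root s = x - act_h s x"
proof -
  obtain n where n: "n \<bullet> n = 1" "s = refl_matrix n" using reflection_normal_form[OF assms] .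
  define m :: "complex^3" where "m = (\<chi> i. of_real (n $ i))"
  have mm: "pairing m m = 1"
    using n(1) by (simp add: pairing_def m_def inner_vec_def flip: of_real_mult of_real_sum)
  have s: "act_h s a = a - (2 * pairing m a) *s m" for a
    by (simp add: vec_eq_iff act_h_def refl_rep_def n(2) refl_matrix_def matrix_vector_mult_def
        forall_3 sum_3 pairing_def m_def algebra_simps)
  have d: "act_dual s a = act_h s a" for a
    using assms reflections_H3 act_dual_eq_act_h by auto
  let ?P = "\<lambda>(a, a'). act_dual s a = - a \<and> act_h s a' = - a' \<and> pairing a a' = 2"
  have "?P (m, 2 *s m)"
    by (simp add: d s mm pairing_scale) (simp add: vec_eq_iff)
  then have "?P (root_pair s)" unfolding root_pair_def by (rule someI)
  then have r: "act_h s (refl_root s) = - refl_root s" "act_h s (refl_coroot s) = - refl_coroot s"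
    "pairing (refl_root s) (refl_coroot s) = 2"
    by (auto simp: refl_root_def refl_coroot_def case_prod_beta d)
  have eig: "a = pairing m a *s m" if "act_h s a = - a" for a
  proof -
    have "2 *s a = 2 *s (pairing m a *s m)"
    proof -
      have "a $ i - 2 * pairing m a * m $ i = - (a $ i)" for i
        using that unfolding s by (simp add: vec_eq_iff)
      then have "a $ i + a $ i = 2 * pairing m a * m $ i" for i
        by (metis add.commute add_uminus_conv_diff diff_add_cancel diff_eq_eq)
      then show ?thesis by (simp add: vec_eq_iff)
    qed
    then show ?thesis by (simp add: vec_eq_iff)
  qed
  define p q where "p = pairing m (refl_root s)" and "q = pairing m (refl_coroot s)"
  have pq: "refl_root s = p *s m" "refl_coroot s = q *s m"
    using eig r by (auto simp: p_def q_def)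
  have "p * q = 2" using r(3) by (simp add: pq pairing_scale mm mult.commute)
  moreover have "pairing x m = pairing m x" by (simp add: pairing_def mult.commute)
  then have "pairing x (refl_coroot s) *s refl_root s = (p * q * pairing m x) *s m"
    by (simp add: pq pairing_scale mult_ac)
  ultimately show ?thesis by (simp add: s)
qed

lemma root_coroot_pairing:
  assumes "s \<in> reflections"
  shows "pairing (refl_root s) y * pairing x (refl_coroot s) = pairing (x - act_h s x) y"
  unfolding root_coroot[OF assms, symmetric] pairing_scale by (rule mult.commute)

section \<open>The Cherednik algebra\<close>

definition smash_single :: "tensor_algebra \<Rightarrow> mat3 \<Rightarrow> mat3 \<Rightarrow> tensor_algebra" where
  "smash_single p w = (\<lambda>u. if u = w then p else 0)"

lemma of_tensor_single: "of_tensor p = smash_single p (mat 1)"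
  by (auto simp: of_tensor_def smash_single_def)

lemma of_group_single: "of_group w = smash_single 1 w"
  by (auto simp: of_group_def smash_single_def)

lemma smash_single_closed: "w \<in> H3 \<Longrightarrow> smash_single p w \<in> carrier smash"
  by (auto simp: smash_single_def smash_simps)

lemma of_tensor_closed [simp]: "of_tensor p \<in> carrier smash"
  by (simp add: of_tensor_single smash_single_closed H3_one)

lemma of_group_closed [simp]: "w \<in> H3 \<Longrightarrow> of_group w \<in> carrier smash"
  by (simp add: of_group_single smash_single_closed)

lemma smash_mult_single:
  assumes "w \<in> H3"
  shows "smash_single p w \<otimes>\<^bsub>smash\<^esub> g =
    (\<lambda>u. if u \<in> H3 then p * act_tensor w (g (matrix_inv w ** u)) else 0)"
proof -
  have "(\<Sum>v\<in>H3. smash_single p w v * act_tensor v (g (matrix_inv v ** u)))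
      = (\<Sum>v\<in>H3. if v = w then p * act_tensor w (g (matrix_inv w ** u)) else 0)" for u
    by (rule sum.cong) (auto simp: smash_single_def)
  then show ?thesis using assms by (auto simp: smash_simps finite_H3)
qed

lemma smash_single_mult:
  assumes "w \<in> H3" "w' \<in> H3"
  shows "smash_single p w \<otimes>\<^bsub>smash\<^esub> smash_single q w' = smash_single (p * act_tensor w q) (w ** w')"
proof
  fix u
  have "matrix_inv w ** u = w' \<longleftrightarrow> u = w ** w'"
    using H3_cancel[OF assms(1)] by metis
  then show "(smash_single p w \<otimes>\<^bsub>smash\<^esub> smash_single q w') u = smash_single (p * act_tensor w q) (w ** w') u"
    using H3_mult[OF assms] by (simp add: smash_mult_single assms) (simp add: smash_single_def)
qed

lemma of_tensor_mult: "of_tensor p \<otimes>\<^bsub>smash\<^esub> of_tensor q = of_tensor (p * q)"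
  by (simp add: of_tensor_single smash_single_mult H3_one act_tensor_id)

lemma of_tensor_add: "of_tensor p \<oplus>\<^bsub>smash\<^esub> of_tensor q = of_tensor (p + q)"
  by (auto simp: of_tensor_def smash_simps)

lemma of_group_of_tensor:
  "w \<in> H3 \<Longrightarrow> of_group w \<otimes>\<^bsub>smash\<^esub> of_tensor p = of_tensor (act_tensor w p) \<otimes>\<^bsub>smash\<^esub> of_group w"
  by (simp add: of_group_single of_tensor_single smash_single_mult H3_one act_tensor_id)

lemma of_tensor_mult_apply: "g \<in> carrier smash \<Longrightarrow> (of_tensor p \<otimes>\<^bsub>smash\<^esub> g) u = p * g u"
  using H3_inverse[OF H3_one] by (simp add: of_tensor_single smash_mult_single H3_one act_tensor_id) (auto simp: smash_simps)

lemma mult_of_tensor_apply: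
  assumes "f \<in> carrier smash"
  shows "(f \<otimes>\<^bsub>smash\<^esub> of_tensor q) u = f u * act_tensor u q"
proof (cases "u \<in> H3")
  case True
  have "f w * act_tensor w (of_tensor q (matrix_inv w ** u)) = (if w = u then f u * act_tensor u q else 0)"
    if "w \<in> H3" for w
  proof -
    have "matrix_inv w ** u = mat 1 \<longleftrightarrow> w = u"
      using H3_cancel(2)[OF that, of u] H3_inverse(3)[OF that] by auto
    then show ?thesis by (simp add: of_tensor_def)
  qed
  then show ?thesis using True by (simp add: smash_simps finite_H3)
qed (use assms in \<open>auto simp: smash_simps\<close>)

text \<open>Elements of the smash product are reached from products \<open>p w\<close> of a tensor and a group element, so the
  action on a module is controlled by the action of tensors and of the group.\<close>

lemma smash_induct [consumes 1, case_names zero single add]: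
  assumes f: "f \<in> carrier smash"
    and "P (\<lambda>u. 0)" "\<And>ls z w. w \<in> H3 \<Longrightarrow> P (smash_single (Poly_Mapping.single (Word ls) z) w)"
    and add: "\<And>f g. f \<in> carrier smash \<Longrightarrow> g \<in> carrier smash \<Longrightarrow> P f \<Longrightarrow> P g \<Longrightarrow> P (\<lambda>u. f u + g u)"
  shows "P f"
proof -
  have s: "P (smash_single p w)" if "w \<in> H3" for p w
  proof (induction p rule: tensor_induct)
    case zero
    then show ?case using assms(2) by (simp add: smash_single_def)
  next
    case (single u z)
    then show ?case using assms(3)[OF that, of "letters u"] by simp
  next
    case (add p q)
    have "smash_single (p + q) w = (\<lambda>u. smash_single p w u + smash_single q w u)"
      by (auto simp: smash_single_def)
    then show ?case
      using assms(4)[OF smash_single_closed[OF that] smash_single_closed[OF that] add.IH] by simp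
  qed
  have "finite A \<Longrightarrow> A \<subseteq> H3 \<Longrightarrow> P (\<lambda>u. if u \<in> A then f u else 0)" for A
  proof (induction A rule: finite_induct)
    case (insert w A)
    have "(\<lambda>u. if u \<in> insert w A then f u else 0)
        = (\<lambda>u. smash_single (f w) w u + (if u \<in> A then f u else 0))"
      using insert.hyps by (auto simp: smash_single_def)
    moreover have "(\<lambda>u. if u \<in> A then f u else 0) \<in> carrier smash"
      using insert.prems by (auto simp: smash_simps)
    ultimately show ?case
      using insert s add[OF smash_single_closed] by simp
  qed (use assms(2) in simp)
  then have "P (\<lambda>u. if u \<in> H3 then f u else 0)" using finite_H3 by simp
  moreover have "(\<lambda>u. if u \<in> H3 then f u else 0) = f" using f by (auto simp: smash_simps)
  ultimately show ?thesis by simp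
qed

lemma tensor_plus_refl_closed [simp]: "tensor_plus_refl p k \<in> carrier smash"
  using reflections_H3 H3_one by (auto simp: tensor_plus_refl_def smash_simps of_tensor_def)

lemma relations_closed: "cherednik_relations c \<subseteq> carrier smash"
  by (auto simp: cherednik_relations_def)

abbreviation relation_ideal :: "complex \<Rightarrow> (mat3 \<Rightarrow> tensor_algebra) set" where
  "relation_ideal c \<equiv> Idl\<^bsub>smash\<^esub> (cherednik_relations c)"

lemma relation_ideal: "ideal (relation_ideal c) smash"
  by (rule ring.genideal_ideal[OF ring_smash relations_closed])

lemma relations_in_ideal: "cherednik_relations c \<subseteq> relation_ideal c"
  by (rule ring.genideal_self[OF ring_smash relations_closed])

lemma ring_Hc: "ring (Hc c)"
  unfolding Hc_def by (rule ideal.quotient_is_ring[OF relation_ideal])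

lemma hc_class_hom: "hc_class c \<in> ring_hom smash (Hc c)"
proof -
  have "hc_class c = (\<lambda>f. relation_ideal c +>\<^bsub>smash\<^esub> f)"
    by (auto simp: hc_class_def)
  then show ?thesis using ideal.rcos_ring_hom[OF relation_ideal] by (simp add: Hc_def)
qed

lemma carrier_Hc: "carrier (Hc c) = hc_class c ` carrier smash"
  by (auto simp: Hc_def FactRing_def A_RCOSETS_def' hc_class_def)

lemma hc_class_closed [simp]: "f \<in> carrier smash \<Longrightarrow> hc_class c f \<in> carrier (Hc c)"
  by (simp add: carrier_Hc)

lemma hc_class_mult:
  "f \<in> carrier smash \<Longrightarrow> g \<in> carrier smash \<Longrightarrow>
    hc_class c f \<otimes>\<^bsub>Hc c\<^esub> hc_class c g = hc_class c (f \<otimes>\<^bsub>smash\<^esub> g)"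
  using hc_class_hom by (auto simp: ring_hom_def)

lemma hc_class_add:
  "f \<in> carrier smash \<Longrightarrow> g \<in> carrier smash \<Longrightarrow>
    hc_class c f \<oplus>\<^bsub>Hc c\<^esub> hc_class c g = hc_class c (\<lambda>u. f u + g u)"
  using ring_hom_add[OF hc_class_hom] by (simp add: smash_simps)

lemma hc_class_one: "hc_class c (of_tensor 1) = \<one>\<^bsub>Hc c\<^esub>"
proof -
  have "of_tensor 1 = \<one>\<^bsub>smash\<^esub>" by (auto simp: of_tensor_def smash_simps)
  then show ?thesis using hc_class_hom by (auto simp: ring_hom_def)
qed

lemma hc_class_zero: "hc_class c (\<lambda>u. 0) = \<zero>\<^bsub>Hc c\<^esub>"
  using ring_hom_zero[OF hc_class_hom ring_smash ring_Hc] by (simp add: smash_simps)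

lemma hc_gen_closed [simp]:
  "hc_scalar c z \<in> carrier (Hc c)" "hc_dual c x \<in> carrier (Hc c)" "hc_vec c y \<in> carrier (Hc c)"
  "w \<in> H3 \<Longrightarrow> hc_group c w \<in> carrier (Hc c)" "euler c \<in> carrier (Hc c)"
  by (simp_all add: hc_scalar_def hc_dual_def hc_vec_def hc_group_def euler_def)

lemma hc_class_eqI:
  assumes "f \<in> carrier smash" "g \<in> carrier smash" "(\<lambda>u. f u - g u) \<in> relation_ideal c"
  shows "hc_class c f = hc_class c g"
proof -
  interpret ideal "relation_ideal c" smash by (rule relation_ideal)
  have "f \<in> relation_ideal c +>\<^bsub>smash\<^esub> g"
    unfolding a_r_coset_def' using assms(3) by (auto simp: smash_simps intro!: bexI[of _ "\<lambda>u. f u - g u"])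
  then show ?thesis
    unfolding hc_class_def using a_repr_independence[OF _ assms(2) a_subgroup] by simp
qed

text \<open>Expressing the coefficient of \<open>s\<close> as \<open>c (x - s x, y)\<close> removes the chosen roots from the relation.\<close>

lemma hc_y_x:
  "hc_vec c y \<otimes>\<^bsub>Hc c\<^esub> hc_dual c x = (hc_dual c x \<otimes>\<^bsub>Hc c\<^esub> hc_vec c y) \<oplus>\<^bsub>Hc c\<^esub>
     hc_class c (tensor_plus_refl (const (pairing x y)) (\<lambda>s. - (c * pairing (x - act_h s x) y)))"
proof -
  let ?r = "tensor_plus_refl (commutator (emb_h y) (emb_dual x) - const (pairing x y))
        (\<lambda>s. c * pairing (refl_root s) y * pairing x (refl_coroot s))"
  let ?k = "tensor_plus_refl (const (pairing x y)) (\<lambda>s. - (c * pairing (x - act_h s x) y))"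
  have "?r \<in> cherednik_relations c" by (auto simp: cherednik_relations_def)
  then have r: "?r \<in> relation_ideal c" using relations_in_ideal by auto
  have "(\<lambda>u. of_tensor (emb_h y * emb_dual x) u - (of_tensor (emb_dual x * emb_h y) u + ?k u)) = ?r"
    by (auto simp: tensor_plus_refl_def of_tensor_def commutator_def root_coroot_pairing[symmetric]
        one_not_reflection const_uminus fun_eq_iff mult.assoc)
  then have "hc_class c (of_tensor (emb_h y * emb_dual x))
      = hc_class c (\<lambda>u. of_tensor (emb_dual x * emb_h y) u + ?k u)"
    using r ring.ring_simprules(1)[OF ring_smash of_tensor_closed tensor_plus_refl_closed]
    by (intro hc_class_eqI) (simp_all add: smash_simps(5))
  then show ?thesis
    by (simp add: hc_vec_def hc_dual_def hc_class_mult of_tensor_mult hc_class_add)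
qed

lemma ideal_sum:
  assumes "\<And>i. i \<in> I \<Longrightarrow> f i \<in> relation_ideal c"
  shows "(\<lambda>u. \<Sum>i\<in>I. f i u) \<in> relation_ideal c"
proof -
  interpret ideal "relation_ideal c" smash by (rule relation_ideal)
  show ?thesis using assms
  proof (induction I rule: infinite_finite_induct)
    case (insert i I)
    then show ?case
      using additive_subgroup.a_closed[OF is_additive_subgroup, of "f i" "\<lambda>u. \<Sum>i\<in>I. f i u"]
      by (simp add: smash_simps(5))
  qed (use additive_subgroup.zero_closed[OF is_additive_subgroup] in \<open>simp_all add: smash_simps(4)\<close>)
qed

lemma emb_dual_components: "emb_dual v = (\<Sum>i\<in>UNIV. const (v $ i) * emb_dual (axis i 1))"
  by (subst emb_dual_def) (simp add: emb_dual_axis const_def mult_single)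

lemma pairing_axis: "pairing v (axis i 1) = v $ i"
  by (simp add: pairing_def axis_def if_distrib cong: if_cong)

text \<open>The Euler element measures the degree in \<open>\<hh>\<^sup>*\<close>: modulo the relations, \<open>[h, x] - x\<close> is a
  combination of the relations for \<open>[y\<^sub>i, x]\<close> and \<open>[x\<^sub>i, x]\<close>, the group parts cancelling
  because \<open>s x - x = - (x, \<alpha>\<^sub>s\<^sup>\<or>) \<alpha>\<^sub>s\<close>.\<close>

lemma hc_euler_x:
  "euler c \<otimes>\<^bsub>Hc c\<^esub> hc_dual c x = (hc_dual c x \<otimes>\<^bsub>Hc c\<^esub> euler c) \<oplus>\<^bsub>Hc c\<^esub> hc_dual c x"
proof -
  interpret ideal "relation_ideal c" smash by (rule relation_ideal)
  let ?X = "emb_dual x" and ?x = "\<lambda>i. emb_dual (axis i 1)" and ?y = "\<lambda>i. emb_h (axis i 1)"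
  define e where "e = tensor_plus_refl ((\<Sum>i\<in>UNIV. ?x i * ?y i) + const (3/2)) (\<lambda>s. - c)"
  define r where "r i = tensor_plus_refl (commutator (?y i) ?X - const (pairing x (axis i 1)))
        (\<lambda>s. c * pairing (refl_root s) (axis i 1) * pairing x (refl_coroot s))" for i
  define q where "q i = of_tensor (commutator (?x i) ?X)" for i
  have e_closed: "e \<in> carrier smash" by (simp add: e_def)
  have "r i \<in> cherednik_relations c" for i
    unfolding r_def cherednik_relations_def by blast
  then have "r i \<in> relation_ideal c" for i
    using relations_in_ideal by auto
  then have xr: "of_tensor (?x i) \<otimes>\<^bsub>smash\<^esub> r i \<in> relation_ideal c" for i
    using I_l_closed by simp
  have "q i \<in> cherednik_relations c" for i
    unfolding q_def cherednik_relations_def by blast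
  then have "q i \<in> relation_ideal c" for i
    using relations_in_ideal by auto
  then have qy: "q i \<otimes>\<^bsub>smash\<^esub> of_tensor (?y i) \<in> relation_ideal c" for i
    using I_r_closed by simp
  let ?L = "e \<otimes>\<^bsub>smash\<^esub> of_tensor ?X" and ?R = "\<lambda>u. (of_tensor ?X \<otimes>\<^bsub>smash\<^esub> e) u + of_tensor ?X u"
  have "?L u - ?R u = (\<Sum>i\<in>UNIV. (of_tensor (?x i) \<otimes>\<^bsub>smash\<^esub> r i) u)
      + (\<Sum>i\<in>UNIV. (q i \<otimes>\<^bsub>smash\<^esub> of_tensor (?y i)) u)" for u
  proof -
    have r_closed: "r i \<in> carrier smash" "q i \<in> carrier smash" for i by (simp_all add: r_def q_def)
    have val: "?L u = e u * act_tensor u ?X" "(of_tensor ?X \<otimes>\<^bsub>smash\<^esub> e) u = ?X * e u"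
      "(of_tensor (?x i) \<otimes>\<^bsub>smash\<^esub> r i) u = ?x i * r i u"
      "(q i \<otimes>\<^bsub>smash\<^esub> of_tensor (?y i)) u = q i u * act_tensor u (?y i)" for i
      using mult_of_tensor_apply[OF e_closed] of_tensor_mult_apply[OF e_closed]
        of_tensor_mult_apply[OF r_closed(1)] mult_of_tensor_apply[OF r_closed(2)] by auto
    consider "u = mat 1" | "u \<in> reflections" "u \<noteq> mat 1" | "u \<notin> reflections" "u \<noteq> mat 1" by blast
    then show ?thesis
    proof cases
      case 1
      have sx: "(\<Sum>i\<in>UNIV. ?x i * const (pairing x (axis i 1))) = ?X"
        unfolding emb_dual_components[of x] pairing_axis
        by (rule sum.cong) (rule refl, rule const_commutes[symmetric])
      have cx: "const (3/2) * ?X = ?X * const (3/2)" by (rule const_commutes)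
      have "?L u - ?R u = (\<Sum>i\<in>UNIV. ?x i * ?y i) * ?X - ?X * (\<Sum>i\<in>UNIV. ?x i * ?y i) - ?X"
        by (simp only: val) (simp add: 1 e_def tensor_plus_refl_def one_not_reflection of_tensor_def act_tensor_id
            distrib_left distrib_right cx)
      also have "\<dots> = (\<Sum>i\<in>UNIV. ?x i * (?y i * ?X - ?X * ?y i)) + (\<Sum>i\<in>UNIV. (?x i * ?X - ?X * ?x i) * ?y i)
          - (\<Sum>i\<in>UNIV. ?x i * const (pairing x (axis i 1)))"
      proof -
        have "?x i * (?y i * ?X - ?X * ?y i) + (?x i * ?X - ?X * ?x i) * ?y i
            = ?x i * ?y i * ?X - ?X * (?x i * ?y i)" for i
          by (simp add: algebra_simps)
        then have "(\<Sum>i\<in>UNIV. ?x i * (?y i * ?X - ?X * ?y i)) + (\<Sum>i\<in>UNIV. (?x i * ?X - ?X * ?x i) * ?y i)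
            = (\<Sum>i\<in>UNIV. ?x i * ?y i) * ?X - ?X * (\<Sum>i\<in>UNIV. ?x i * ?y i)"
          by (simp only: sum.distrib[symmetric] sum_subtractf sum_distrib_left sum_distrib_right)
        then show ?thesis by (simp only: sx)
      qed
      finally show ?thesis
        by (simp only: val) (simp add: 1 r_def q_def tensor_plus_refl_def one_not_reflection of_tensor_def
            act_tensor_id commutator_def right_diff_distrib sum_subtractf)
    next
      case 2
      have u: "u \<in> H3" using 2 reflections_H3 by auto
      have "(\<Sum>i\<in>UNIV. ?x i * const (c * pairing (refl_root u) (axis i 1) * pairing x (refl_coroot u)))
          = const c * emb_dual (pairing x (refl_coroot u) *s refl_root u)"
      proof -
        have "?x i * const (c * pairing (refl_root u) (axis i 1) * pairing x (refl_coroot u))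
            = const c * (const ((pairing x (refl_coroot u) *s refl_root u) $ i) * ?x i)" for i
        proof -
          have "const (c * pairing (refl_root u) (axis i 1) * pairing x (refl_coroot u))
              = const c * const ((pairing x (refl_coroot u) *s refl_root u) $ i)"
            by (simp add: pairing_axis mult_ac flip: const_mult)
          then show ?thesis
            using const_commutes[of "c * pairing (refl_root u) (axis i 1) * pairing x (refl_coroot u)" "?x i"]
            by (simp only: mult.assoc)
        qed
        then show ?thesis
          unfolding emb_dual_components[of "_ *s _"] by (simp only: sum_distrib_left)
      qed
      also have "\<dots> = const c * (?X - emb_dual (act_h u x))"
        using emb_dual_add[of "x - act_h u x" "act_h u x"]
        by (simp add: root_coroot 2)
      finally have sc: "(\<Sum>i\<in>UNIV. ?x i * const (c * pairing (refl_root u) (axis i 1) * pairing x (refl_coroot u)))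
          = const c * (?X - emb_dual (act_h u x))" .
      have cx: "?X * const c = const c * ?X" by (rule const_commutes[symmetric])
      show ?thesis
        by (simp only: val) (simp add: sc cx 2 e_def r_def q_def tensor_plus_refl_def of_tensor_def act_tensor_emb_dual u
            act_dual_eq_act_h const_uminus right_diff_distrib)
    next
      case 3
      then show ?thesis
        by (simp only: val) (simp add: e_def r_def q_def tensor_plus_refl_def of_tensor_def)
    qed
  qed
  then have "(\<lambda>u. ?L u - ?R u) = (\<lambda>u. \<Sum>i\<in>UNIV. (of_tensor (?x i) \<otimes>\<^bsub>smash\<^esub> r i) u)
      \<oplus>\<^bsub>smash\<^esub> (\<lambda>u. \<Sum>i\<in>UNIV. (q i \<otimes>\<^bsub>smash\<^esub> of_tensor (?y i)) u)"
    by (simp add: smash_simps(5))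
  then have "(\<lambda>u. ?L u - ?R u) \<in> relation_ideal c"
    by (simp only:) (intro additive_subgroup.a_closed[OF is_additive_subgroup] ideal_sum xr qy)
  moreover have "?L \<in> carrier smash" using e_closed by simp
  moreover have "?R \<in> carrier smash"
    using ring.ring_simprules(1)[OF ring_smash _ of_tensor_closed, of "of_tensor ?X \<otimes>\<^bsub>smash\<^esub> e" ?X] e_closed
    by (simp add: smash_simps(5))
  ultimately have "hc_class c ?L = hc_class c ?R" by (intro hc_class_eqI)
  then show ?thesis
    using e_closed by (simp add: euler_def hc_dual_def hc_class_mult hc_class_add e_def)
qed

section \<open>Left modules\<close>

context left_module
begin

lemma smult_r_null:
  assumes "a \<in> carrier R" shows "a \<odot> \<zero> = \<zero>"
proof -
  have "a \<odot> \<zero> \<oplus> a \<odot> \<zero> = a \<odot> \<zero>"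
    using smult_r_distr[OF assms, of \<zero> \<zero>] by simp
  then show ?thesis using smult_closed[OF assms M.zero_closed] by (metis M.add.r_cancel_one)
qed

lemma smult_l_null:
  assumes "v \<in> carrier M" shows "\<zero>\<^bsub>R\<^esub> \<odot> v = \<zero>"
proof -
  have "\<zero>\<^bsub>R\<^esub> \<odot> v \<oplus> \<zero>\<^bsub>R\<^esub> \<odot> v = \<zero>\<^bsub>R\<^esub> \<odot> v"
    using smult_l_distr[of "\<zero>\<^bsub>R\<^esub>" "\<zero>\<^bsub>R\<^esub>" v] assms by simp
  then show ?thesis using smult_closed[OF R.zero_closed assms] by (metis M.add.r_cancel_one)
qed

lemma smult_neg_one:
  assumes "v \<in> carrier M" shows "(\<ominus>\<^bsub>R\<^esub> \<one>\<^bsub>R\<^esub>) \<odot> v = \<ominus> v"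
proof -
  have "(\<ominus>\<^bsub>R\<^esub> \<one>\<^bsub>R\<^esub>) \<odot> v \<oplus> v = \<zero>"
    using smult_l_distr[of "\<ominus>\<^bsub>R\<^esub> \<one>\<^bsub>R\<^esub>" "\<one>\<^bsub>R\<^esub>" v] assms by (simp add: smult_one R.l_neg smult_l_null)
  then show ?thesis
    using M.minus_equality assms smult_closed by (metis R.a_inv_closed R.one_closed)
qed

lemma submodule_intro:
  assumes "H \<subseteq> carrier M" "\<zero> \<in> H" "\<And>u v. u \<in> H \<Longrightarrow> v \<in> H \<Longrightarrow> u \<oplus> v \<in> H"
    and cl: "\<And>a v. a \<in> carrier R \<Longrightarrow> v \<in> H \<Longrightarrow> a \<odot> v \<in> H"
  shows "submodule H R M"
proof (intro submodule.intro subgroup.intro submodule_axioms.intro)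
  fix v assume v: "v \<in> H"
  then have "\<ominus> v \<in> H" using cl[of "\<ominus>\<^bsub>R\<^esub> \<one>\<^bsub>R\<^esub>" v] smult_neg_one assms(1) by auto
  then show "inv\<^bsub>add_monoid M\<^esub> v \<in> H" by (simp add: a_inv_def)
qed (use assms in auto)

lemma submoduleD:
  assumes "submodule H R M"
  shows "H \<subseteq> carrier M" "\<zero> \<in> H" "\<And>u v. u \<in> H \<Longrightarrow> v \<in> H \<Longrightarrow> u \<oplus> v \<in> H"
    "\<And>a v. a \<in> carrier R \<Longrightarrow> v \<in> H \<Longrightarrow> a \<odot> v \<in> H" "\<And>u. u \<in> H \<Longrightarrow> \<ominus> u \<in> H"
proof -
  interpret submodule H R M by fact
  show "H \<subseteq> carrier M" "\<zero> \<in> H" "\<And>u v. u \<in> H \<Longrightarrow> v \<in> H \<Longrightarrow> u \<oplus> v \<in> H"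
    "\<And>a v. a \<in> carrier R \<Longrightarrow> v \<in> H \<Longrightarrow> a \<odot> v \<in> H"
    using subset one_closed m_closed smult_closed by auto
  show "\<And>u. u \<in> H \<Longrightarrow> \<ominus> u \<in> H" using m_inv_closed by (simp add: a_inv_def)
qed

lemma zero_submodule: "submodule {\<zero>} R M"
  by (rule submodule_intro) (auto simp: smult_r_null)

lemma submodule_sum:
  assumes "submodule N R M" "submodule N' R M"
  shows "submodule {n \<oplus> n' | n n'. n \<in> N \<and> n' \<in> N'} R M"
proof (rule submodule_intro)
  note D = submoduleD[OF assms(1)] and D' = submoduleD[OF assms(2)]
  show "{n \<oplus> n' | n n'. n \<in> N \<and> n' \<in> N'} \<subseteq> carrier M" using D(1) D'(1) by auto
  have "\<zero> = \<zero> \<oplus> \<zero>" by simp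
  then show "\<zero> \<in> {n \<oplus> n' | n n'. n \<in> N \<and> n' \<in> N'}" using D(2) D'(2) by blast
next
  note D = submoduleD[OF assms(1)] and D' = submoduleD[OF assms(2)]
  fix u v assume "u \<in> {n \<oplus> n' | n n'. n \<in> N \<and> n' \<in> N'}" "v \<in> {n \<oplus> n' | n n'. n \<in> N \<and> n' \<in> N'}"
  then obtain a b a' b' where ab: "u = a \<oplus> b" "v = a' \<oplus> b'" "a \<in> N" "b \<in> N'" "a' \<in> N" "b' \<in> N'" by auto
  then have "u \<oplus> v = (a \<oplus> a') \<oplus> (b \<oplus> b')"
    using D(1) D'(1) by (simp add: subset_iff M.add.m_ac)
  then show "u \<oplus> v \<in> {n \<oplus> n' | n n'. n \<in> N \<and> n' \<in> N'}" using ab D(3) D'(3) by blast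
next
  note D = submoduleD[OF assms(1)] and D' = submoduleD[OF assms(2)]
  fix a v assume a: "a \<in> carrier R" and "v \<in> {n \<oplus> n' | n n'. n \<in> N \<and> n' \<in> N'}"
  then obtain n n' where n: "v = n \<oplus> n'" "n \<in> N" "n' \<in> N'" by auto
  then have "a \<odot> v = a \<odot> n \<oplus> a \<odot> n'" using a D(1) D'(1) by (simp add: subset_iff smult_r_distr)
  then show "a \<odot> v \<in> {n \<oplus> n' | n n'. n \<in> N \<and> n' \<in> N'}" using n a D(4) D'(4) by blast
qed

lemma submodule_abelian_subgroup:
  assumes "submodule N R M" shows "abelian_subgroup N M"
  using submodule.axioms(1)[OF assms] M.abelian_group_axioms
  by (intro abelian_subgroupI3 additive_subgroup.intro)

lemma quotient_carrier: "carrier (quotient_module M N) = {N +> v | v. v \<in> carrier M}"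
  by (auto simp: quotient_module_def A_RCOSETS_def')

lemma quotient_zero: "\<zero>\<^bsub>quotient_module M N\<^esub> = N"
  by (simp add: quotient_module_def)

lemma quotient_add:
  assumes "submodule N R M" "u \<in> carrier M" "v \<in> carrier M"
  shows "(N +> u) \<oplus>\<^bsub>quotient_module M N\<^esub> (N +> v) = N +> (u \<oplus> v)"
  using abelian_subgroup.a_rcos_sum[OF submodule_abelian_subgroup[OF assms(1)] assms(2,3)]
  by (simp add: quotient_module_def)

lemma quotient_coset_eq:
  assumes "submodule N R M" "u \<in> carrier M" "v \<in> carrier M"
  shows "N +> u = N +> v \<longleftrightarrow> u \<oplus> (\<ominus> v) \<in> N"
proof -
  interpret N: abelian_subgroup N M by (rule submodule_abelian_subgroup[OF assms(1)])
  have "N +> u = N +> v \<longleftrightarrow> u \<in> N +> v"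
    using N.a_rcos_self[OF assms(2)] M.a_repr_independence[OF _ assms(3) N.a_subgroup] by metis
  also have "\<dots> \<longleftrightarrow> u \<oplus> (\<ominus> v) \<in> N"
  proof
    assume "u \<in> N +> v"
    then have "\<exists>n\<in>N. u = n \<oplus> v" unfolding a_r_coset_def' by blast
    then obtain n where n: "n \<in> N" "u = n \<oplus> v" by blast
    then have "n \<in> carrier M" using submoduleD(1)[OF assms(1)] by auto
    then show "u \<oplus> (\<ominus> v) \<in> N" using n assms by (simp add: M.a_assoc M.r_neg)
  next
    assume "u \<oplus> (\<ominus> v) \<in> N"
    moreover have "u = (u \<oplus> (\<ominus> v)) \<oplus> v" using assms by (simp add: M.a_assoc M.l_neg)
    ultimately show "u \<in> N +> v" by (auto simp: a_r_coset_def')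
  qed
  finally show ?thesis .
qed

lemma quotient_smult:
  assumes N: "submodule N R M" and a: "a \<in> carrier R" and v: "v \<in> carrier M"
  shows "a \<odot>\<^bsub>quotient_module M N\<^esub> (N +> v) = N +> (a \<odot> v)"
proof -
  interpret N: abelian_subgroup N M by (rule submodule_abelian_subgroup[OF N])
  have "N +> (a \<odot> u) = N +> (a \<odot> v)" if u: "u \<in> N +> v" for u
  proof -
    obtain n where n: "n \<in> N" "u = n \<oplus> v" using u by (auto simp: a_r_coset_def')
    have nM: "n \<in> carrier M" using n submoduleD(1)[OF N] by auto
    have "a \<odot> u = a \<odot> n \<oplus> a \<odot> v" using n nM a v by (simp add: smult_r_distr)
    then have "a \<odot> u \<oplus> (\<ominus> (a \<odot> v)) = a \<odot> n"
      using a v nM by (simp add: M.a_assoc M.r_neg smult_closed)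
    then show ?thesis
      using n nM a v submoduleD(4)[OF N] by (subst quotient_coset_eq[OF N]) (auto simp: smult_closed)
  qed
  moreover have "N +> v \<noteq> {}" using N.a_rcos_self[OF v] by auto
  ultimately show ?thesis by (simp add: quotient_module_def)
qed

lemma quotient_coset_zero:
  assumes N: "submodule N R M" and v: "v \<in> carrier M"
  shows "N +> v = N \<longleftrightarrow> v \<in> N"
proof -
  interpret N: abelian_subgroup N M by (rule submodule_abelian_subgroup[OF N])
  have "N +> \<zero> = N" using N.a_subset M.a_coset_add_zero by auto
  moreover have "v \<oplus> (\<ominus> \<zero>) = v" using M.minus_equality[of \<zero> \<zero>] v by simp
  ultimately show ?thesis using quotient_coset_eq[OF N v M.zero_closed] by simp
qed

text \<open>The image of a larger submodule in the irreducible quotient is zero or everything.\<close>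

lemma irreducible_quotient_maximal:
  assumes N: "submodule N R M" and irr: "irreducible_module R (quotient_module M N)"
    and N': "submodule N' R M" and sub: "N \<subseteq> N'"
  shows "N' = N \<or> N' = carrier M"
proof -
  let ?Q = "quotient_module M N" and ?H = "(\<lambda>v. N +> v) ` N'"
  note D = submoduleD[OF N] and D' = submoduleD[OF N']
  interpret Q: left_module R ?Q using irr by (simp add: irreducible_module_def)
  have "submodule ?H R ?Q"
  proof (rule Q.submodule_intro)
    show "?H \<subseteq> carrier ?Q" using D'(1) by (auto simp: quotient_carrier)
    show "\<zero>\<^bsub>?Q\<^esub> \<in> ?H"
      using quotient_coset_zero[OF N M.zero_closed] D(2) D'(2) by (auto simp: quotient_zero)
    show "u \<oplus>\<^bsub>?Q\<^esub> v \<in> ?H" if "u \<in> ?H" "v \<in> ?H" for u v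
      using that D'(1,3) by (auto simp: quotient_add[OF N] subset_iff)
    show "a \<odot>\<^bsub>?Q\<^esub> v \<in> ?H" if "a \<in> carrier R" "v \<in> ?H" for a v
      using that D'(1,4) by (auto simp: quotient_smult[OF N] subset_iff)
  qed
  then consider "?H = {N}" | "?H = carrier ?Q"
    using irr by (auto simp: irreducible_module_def quotient_zero)
  then show ?thesis
  proof cases
    case 1
    have "v \<in> N" if "v \<in> N'" for v
    proof -
      have "N +> v = N" using that 1 by blast
      then show ?thesis using quotient_coset_zero[OF N, of v] that D'(1) by auto
    qed
    then show ?thesis using sub by blast
  next
    case 2
    have "v \<in> N'" if v: "v \<in> carrier M" for v
    proof -
      have "N +> v \<in> ?H" using v unfolding 2 quotient_carrier by blast
      then obtain v' where v': "v' \<in> N'" "N +> v = N +> v'" by blast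
      then have v'M: "v' \<in> carrier M" using D'(1) by auto
      then have "v \<oplus> (\<ominus> v') \<in> N'" using quotient_coset_eq[OF N v v'M] v' sub by auto
      then have "(v \<oplus> (\<ominus> v')) \<oplus> v' \<in> N'" using v' D'(3) by blast
      then show ?thesis using v v'M by (simp add: M.a_assoc M.l_neg)
    qed
    then show ?thesis using D'(1) by blast
  qed
qed

lemma quotient_proper:
  assumes N: "submodule N R M" and irr: "irreducible_module R (quotient_module M N)"
  shows "N \<noteq> carrier M"
proof
  assume eq: "N = carrier M"
  have "carrier (quotient_module M N) = {N}"
  proof -
    have "N +> v = N" if "v \<in> carrier M" for v
      using quotient_coset_zero[OF N that] that eq by simp
    then show ?thesis unfolding quotient_carrier using M.zero_closed by blast
  qed
  then show False using irr by (simp add: irreducible_module_def quotient_zero)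
qed

end

definition lmod_hom :: "('a, 'r) ring_scheme \<Rightarrow> ('a, 'b, 'm) module_scheme \<Rightarrow> ('a, 'c, 'n) module_scheme
    \<Rightarrow> ('b \<Rightarrow> 'c) \<Rightarrow> bool" where
  "lmod_hom R M V f \<longleftrightarrow> (\<forall>u\<in>carrier M. f u \<in> carrier V) \<and>
     (\<forall>u\<in>carrier M. \<forall>v\<in>carrier M. f (u \<oplus>\<^bsub>M\<^esub> v) = f u \<oplus>\<^bsub>V\<^esub> f v) \<and>
     (\<forall>a\<in>carrier R. \<forall>u\<in>carrier M. f (a \<odot>\<^bsub>M\<^esub> u) = a \<odot>\<^bsub>V\<^esub> f u)"

locale lmod_iso = M: left_module R M + V: left_module R V
  for R :: "('a, 'r) ring_scheme" and M :: "('a, 'b, 'm) module_scheme"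
    and V :: "('a, 'c, 'n) module_scheme" +
  fixes f :: "'b \<Rightarrow> 'c"
  assumes hom: "lmod_hom R M V f" and bij: "bij_betw f (carrier M) (carrier V)"
begin

lemma f_closed [simp]: "u \<in> carrier M \<Longrightarrow> f u \<in> carrier V"
  using hom by (simp add: lmod_hom_def)

lemma f_add: "u \<in> carrier M \<Longrightarrow> v \<in> carrier M \<Longrightarrow> f (u \<oplus>\<^bsub>M\<^esub> v) = f u \<oplus>\<^bsub>V\<^esub> f v"
  using hom by (simp add: lmod_hom_def)

lemma f_smult: "a \<in> carrier R \<Longrightarrow> u \<in> carrier M \<Longrightarrow> f (a \<odot>\<^bsub>M\<^esub> u) = a \<odot>\<^bsub>V\<^esub> f u"
  using hom by (simp add: lmod_hom_def)

lemma f_zero [simp]: "f \<zero>\<^bsub>M\<^esub> = \<zero>\<^bsub>V\<^esub>"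
  using f_smult[of "\<zero>\<^bsub>R\<^esub>" "\<zero>\<^bsub>M\<^esub>"] by (simp add: M.smult_l_null V.smult_l_null)

lemma f_minus: "u \<in> carrier M \<Longrightarrow> f (\<ominus>\<^bsub>M\<^esub> u) = \<ominus>\<^bsub>V\<^esub> f u"
  using f_smult[of "\<ominus>\<^bsub>R\<^esub> \<one>\<^bsub>R\<^esub>" u] by (simp add: M.smult_neg_one V.smult_neg_one)

lemma f_inj: "u \<in> carrier M \<Longrightarrow> v \<in> carrier M \<Longrightarrow> f u = f v \<longleftrightarrow> u = v"
  using bij by (auto simp: bij_betw_def inj_on_def)

lemma f_zero_iff: "u \<in> carrier M \<Longrightarrow> f u = \<zero>\<^bsub>V\<^esub> \<longleftrightarrow> u = \<zero>\<^bsub>M\<^esub>"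
  using f_inj[of u "\<zero>\<^bsub>M\<^esub>"] by simp

lemma f_surj: "v \<in> carrier V \<Longrightarrow> \<exists>u\<in>carrier M. v = f u"
  using bij by (auto simp: bij_betw_def)

lemma f_finsum:
  assumes "finite I" "\<And>i. i \<in> I \<Longrightarrow> g i \<in> carrier M"
  shows "f (\<Oplus>\<^bsub>M\<^esub>i\<in>I. g i) = (\<Oplus>\<^bsub>V\<^esub>i\<in>I. f (g i))"
  using assms
proof (induction I rule: finite_induct)
  case (insert i I)
  then have "g \<in> I \<rightarrow> carrier M" "(\<lambda>i. f (g i)) \<in> I \<rightarrow> carrier V" by auto
  then show ?case using insert by (simp add: f_add)
qed simp

lemma image_submodule:
  assumes R': "R' \<subseteq> carrier R" and N: "submodule N (R\<lparr>carrier := R'\<rparr>) V"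
  shows "submodule {u \<in> carrier M. f u \<in> N} (R\<lparr>carrier := R'\<rparr>) M"
proof -
  interpret N: submodule N "R\<lparr>carrier := R'\<rparr>" V by fact
  show ?thesis
  proof (intro submodule.intro subgroup.intro submodule_axioms.intro)
    show "inv\<^bsub>add_monoid M\<^esub> u \<in> {u \<in> carrier M. f u \<in> N}" if "u \<in> {u \<in> carrier M. f u \<in> N}" for u
      using that N.m_inv_closed[of "f u"] f_minus[of u] by (simp add: a_inv_def[symmetric])
  qed (use R' N.one_closed N.m_closed N.smult_closed in \<open>auto simp: f_add f_smult M.smult_closed\<close>)
qed

lemma inverse: "lmod_iso R V M (inv_into (carrier M) f)"
proof -
  let ?g = "inv_into (carrier M) f"
  have g: "?g (f u) = u" if "u \<in> carrier M" for u
    using that bij by (simp add: bij_betw_def)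
  have b: "bij_betw ?g (carrier V) (carrier M)" using bij by (rule bij_betw_inv_into)
  have "lmod_hom R V M ?g"
    unfolding lmod_hom_def
  proof (intro conjI ballI)
    fix v v' assume "v \<in> carrier V" "v' \<in> carrier V"
    then obtain u u' where u: "u \<in> carrier M" "v = f u" "u' \<in> carrier M" "v' = f u'" using f_surj by metis
    then show "?g (v \<oplus>\<^bsub>V\<^esub> v') = ?g v \<oplus>\<^bsub>M\<^esub> ?g v'"
      using g[of "u \<oplus>\<^bsub>M\<^esub> u'"] by (simp add: f_add g)
  next
    fix a v assume a: "a \<in> carrier R" and "v \<in> carrier V"
    then obtain u where u: "u \<in> carrier M" "v = f u" using f_surj by metis
    then show "?g (a \<odot>\<^bsub>V\<^esub> v) = a \<odot>\<^bsub>M\<^esub> ?g v"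
      using g[of "a \<odot>\<^bsub>M\<^esub> u"] a by (simp add: f_smult g M.smult_closed)
  next
    fix v assume "v \<in> carrier V"
    then show "?g v \<in> carrier M" using b by (auto simp: bij_betw_def)
  qed
  then show ?thesis
    using b by (intro lmod_iso.intro lmod_iso_axioms.intro M.left_module_axioms V.left_module_axioms)
qed

end

lemma irreducible_transport:
  assumes "lmod_iso R M V f" "irreducible_module R V"
  shows "irreducible_module R M"
proof -
  interpret lmod_iso R M V f by fact
  interpret inv: lmod_iso R V M "inv_into (carrier M) f" by (rule inverse)
  have ne: "carrier V \<noteq> {\<zero>\<^bsub>V\<^esub>}" and simple: "\<And>N. submodule N R V \<Longrightarrow> N = {\<zero>\<^bsub>V\<^esub>} \<or> N = carrier V"
    using assms(2) by (auto simp: irreducible_module_def)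
  have "carrier M \<noteq> {\<zero>\<^bsub>M\<^esub>}"
  proof
    assume eq: "carrier M = {\<zero>\<^bsub>M\<^esub>}"
    have "v = \<zero>\<^bsub>V\<^esub>" if v: "v \<in> carrier V" for v
    proof -
      obtain u where "u \<in> carrier M" "v = f u" using f_surj[OF v] by auto
      then show ?thesis using eq by simp
    qed
    then show False using ne V.M.zero_closed by blast
  qed
  moreover have "N = {\<zero>\<^bsub>M\<^esub>} \<or> N = carrier M" if N: "submodule N R M" for N
  proof -
    let ?g = "inv_into (carrier M) f"
    have gf: "?g (f u) = u" if "u \<in> carrier M" for u
      using that bij by (simp add: bij_betw_def)
    have "submodule {v \<in> carrier V. ?g v \<in> N} R V"
      using inv.image_submodule[of "carrier R" N] N by simp
    then consider "{v \<in> carrier V. ?g v \<in> N} = {\<zero>\<^bsub>V\<^esub>}" | "{v \<in> carrier V. ?g v \<in> N} = carrier V"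
      using simple by blast
    then show ?thesis
    proof cases
      case 1
      have "u = \<zero>\<^bsub>M\<^esub>" if "u \<in> N" for u
      proof -
        have u: "u \<in> carrier M" using that M.submoduleD(1)[OF N] by auto
        then have "f u \<in> {v \<in> carrier V. ?g v \<in> N}" using that gf by simp
        then show ?thesis using 1 f_zero_iff[OF u] by simp
      qed
      then show ?thesis using M.submoduleD(2)[OF N] by blast
    next
      case 2
      have "u \<in> N" if "u \<in> carrier M" for u
        using 2 gf[OF that] f_closed[OF that] by force
      then show ?thesis using M.submoduleD(1)[OF N] by blast
    qed
  qed
  ultimately show ?thesis using M.left_module_axioms by (simp add: irreducible_module_def)
qed

text \<open>The structure of \<open>V\<close> is pulled back along the bijection \<open>f\<close>; only closure has to be assumed, the
  axioms follow by injectivity.\<close>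

lemma left_module_transport:
  fixes M :: "('a, 'b, 'm) module_scheme" and V :: "('a, 'c, 'n) module_scheme"
  assumes V: "left_module R V" and hom: "lmod_hom R M V f" and bij: "bij_betw f (carrier M) (carrier V)"
    and cl: "\<zero>\<^bsub>M\<^esub> \<in> carrier M" "f \<zero>\<^bsub>M\<^esub> = \<zero>\<^bsub>V\<^esub>"
      "\<And>u v. u \<in> carrier M \<Longrightarrow> v \<in> carrier M \<Longrightarrow> u \<oplus>\<^bsub>M\<^esub> v \<in> carrier M"
      "\<And>a v. a \<in> carrier R \<Longrightarrow> v \<in> carrier M \<Longrightarrow> a \<odot>\<^bsub>M\<^esub> v \<in> carrier M"
  shows "left_module R M"
proof -
  interpret V: left_module R V by fact
  have f: "\<And>u. u \<in> carrier M \<Longrightarrow> f u \<in> carrier V"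
    "\<And>u v. u \<in> carrier M \<Longrightarrow> v \<in> carrier M \<Longrightarrow> f (u \<oplus>\<^bsub>M\<^esub> v) = f u \<oplus>\<^bsub>V\<^esub> f v"
    "\<And>a u. a \<in> carrier R \<Longrightarrow> u \<in> carrier M \<Longrightarrow> f (a \<odot>\<^bsub>M\<^esub> u) = a \<odot>\<^bsub>V\<^esub> f u"
    using hom by (auto simp: lmod_hom_def)
  have eqI: "u = v" if "u \<in> carrier M" "v \<in> carrier M" "f u = f v" for u v
    using bij that by (auto simp: bij_betw_def inj_on_def)
  have "abelian_group M"
  proof (rule abelian_groupI)
    fix u assume u: "u \<in> carrier M"
    then have "\<ominus>\<^bsub>V\<^esub> f u \<in> f ` carrier M" using bij f(1) by (simp add: bij_betw_def)
    then obtain u' where u': "u' \<in> carrier M" "f u' = \<ominus>\<^bsub>V\<^esub> f u" by auto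
    then have "u' \<oplus>\<^bsub>M\<^esub> u = \<zero>\<^bsub>M\<^esub>" using u by (intro eqI) (auto simp: cl f V.M.l_neg)
    then show "\<exists>y\<in>carrier M. y \<oplus>\<^bsub>M\<^esub> u = \<zero>\<^bsub>M\<^esub>" using u' by blast
  qed (auto intro!: eqI simp: cl f V.M.a_ac)
  then show ?thesis
    by (intro left_module.intro left_module_axioms.intro)
      (auto intro!: eqI V.R.ring_axioms simp: cl f V.smult_l_distr V.smult_r_distr V.smult_assoc V.smult_one)
qed

lemma (in left_module) first_isomorphism:
  assumes V: "left_module R V" and hom: "lmod_hom R M V f" and surj: "f ` carrier M = carrier V"
  defines "K \<equiv> {u \<in> carrier M. f u = \<zero>\<^bsub>V\<^esub>}"
  shows "submodule K R M" "\<exists>g. lmod_iso R (quotient_module M K) V g \<and> (\<forall>u\<in>carrier M. g (K +> u) = f u)"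
proof -
  interpret V: left_module R V by fact
  have f: "\<And>u. u \<in> carrier M \<Longrightarrow> f u \<in> carrier V"
    "\<And>u v. u \<in> carrier M \<Longrightarrow> v \<in> carrier M \<Longrightarrow> f (u \<oplus> v) = f u \<oplus>\<^bsub>V\<^esub> f v"
    "\<And>a u. a \<in> carrier R \<Longrightarrow> u \<in> carrier M \<Longrightarrow> f (a \<odot> u) = a \<odot>\<^bsub>V\<^esub> f u"
    using hom by (auto simp: lmod_hom_def)
  have f0: "f \<zero> = \<zero>\<^bsub>V\<^esub>"
    using f(3)[of "\<zero>\<^bsub>R\<^esub>" \<zero>] by (simp add: smult_l_null V.smult_l_null f)
  show K: "submodule K R M"
    by (rule submodule_intro) (auto simp: K_def f f0 smult_closed V.smult_r_null)
  have fm: "f (\<ominus> v) = \<ominus>\<^bsub>V\<^esub> f v" if "v \<in> carrier M" for v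
    using f(3)[of "\<ominus>\<^bsub>R\<^esub> \<one>\<^bsub>R\<^esub>" v] that f(1) by (simp add: smult_neg_one V.smult_neg_one)
  have eq: "K +> u = K +> v \<longleftrightarrow> f u = f v" if "u \<in> carrier M" "v \<in> carrier M" for u v
  proof -
    have "K +> u = K +> v \<longleftrightarrow> f u \<oplus>\<^bsub>V\<^esub> (\<ominus>\<^bsub>V\<^esub> f v) = \<zero>\<^bsub>V\<^esub>"
      using that by (simp add: quotient_coset_eq[OF K]) (simp add: K_def f fm)
    also have "\<dots> \<longleftrightarrow> f u = f v"
      using f(1) that V.M.minus_equality V.M.minus_minus V.M.r_neg by (metis V.M.a_inv_closed)
    finally show ?thesis .
  qed
  define g where "g C = f (SOME u. u \<in> carrier M \<and> C = K +> u)" for C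
  have g: "g (K +> u) = f u" if "u \<in> carrier M" for u
  proof -
    have "\<exists>v. v \<in> carrier M \<and> K +> u = K +> v" using that by blast
    from someI_ex[OF this] show ?thesis unfolding g_def using eq that by metis
  qed
  let ?Q = "quotient_module M K"
  have car: "carrier ?Q = (\<lambda>u. K +> u) ` carrier M" by (auto simp: quotient_carrier)
  have K0: "K +> \<zero> = K" using quotient_coset_zero[OF K M.zero_closed] submoduleD(2)[OF K] by simp
  have h: "lmod_hom R ?Q V g"
    by (auto simp: lmod_hom_def car quotient_add[OF K] quotient_smult[OF K] g f smult_closed)
  have b: "bij_betw g (carrier ?Q) (carrier V)"
    unfolding bij_betw_def
  proof
    show "inj_on g (carrier ?Q)" by (auto simp: inj_on_def car g eq)
    show "g ` carrier ?Q = carrier V"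
      using surj by (simp add: car image_image g cong: image_cong)
  qed
  have "left_module R ?Q"
  proof (rule left_module_transport[OF V h b])
    show "\<zero>\<^bsub>?Q\<^esub> \<in> carrier ?Q" using K0 by (force simp: quotient_zero car)
    show "g \<zero>\<^bsub>?Q\<^esub> = \<zero>\<^bsub>V\<^esub>" using g[of \<zero>] by (simp add: K0 f0 quotient_zero)
  qed (auto simp: car quotient_add[OF K] quotient_smult[OF K] smult_closed)
  then show "\<exists>g. lmod_iso R ?Q V g \<and> (\<forall>u\<in>carrier M. g (K +> u) = f u)"
    using V h b g by (intro exI[of _ g]) (simp add: lmod_iso.intro lmod_iso_axioms.intro)
qed

section \<open>Modules over the Cherednik algebra\<close>

locale hc_module = left_module "Hc c" M for c :: complex and M :: "(hc_elem, 'b, 'm) module_scheme" (structure)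
begin

lemma class_mult:
  assumes "f \<in> carrier smash" "g \<in> carrier smash" "v \<in> carrier M"
  shows "hc_class c f \<odot> (hc_class c g \<odot> v) = hc_class c (f \<otimes>\<^bsub>smash\<^esub> g) \<odot> v"
  using assms by (simp add: smult_assoc[symmetric] hc_class_mult)

lemma class_add:
  assumes "f \<in> carrier smash" "g \<in> carrier smash" "v \<in> carrier M"
  shows "hc_class c (\<lambda>u. f u + g u) \<odot> v = hc_class c f \<odot> v \<oplus> hc_class c g \<odot> v"
  using assms by (simp add: smult_l_distr[symmetric] hc_class_add)

lemma tensor_add:
  assumes "v \<in> carrier M"
  shows "hc_class c (of_tensor (p + q)) \<odot> v = hc_class c (of_tensor p) \<odot> v \<oplus> hc_class c (of_tensor q) \<odot> v"
  using class_add[OF of_tensor_closed of_tensor_closed assms, of p q] of_tensor_add[of p q]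
  by (simp add: smash_simps(5))

lemma tensor_mult:
  assumes "v \<in> carrier M"
  shows "hc_class c (of_tensor (p * q)) \<odot> v = hc_class c (of_tensor p) \<odot> (hc_class c (of_tensor q) \<odot> v)"
  using assms by (simp add: class_mult of_tensor_mult)

lemma gen_smult_closed [simp]:
  assumes "v \<in> carrier M"
  shows "hc_scalar c z \<odot> v \<in> carrier M" "hc_dual c x \<odot> v \<in> carrier M" "hc_vec c y \<odot> v \<in> carrier M"
    "w \<in> H3 \<Longrightarrow> hc_group c w \<odot> v \<in> carrier M" "euler c \<odot> v \<in> carrier M"
    "f \<in> carrier smash \<Longrightarrow> hc_class c f \<odot> v \<in> carrier M"
  using assms by (simp_all add: smult_closed)

lemma scalar_one: "v \<in> carrier M \<Longrightarrow> hc_scalar c 1 \<odot> v = v"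
  by (simp add: hc_scalar_def hc_class_one smult_one)

lemma scalar_zero: "v \<in> carrier M \<Longrightarrow> hc_scalar c 0 \<odot> v = \<zero>"
proof -
  have "of_tensor 0 = (\<lambda>u. 0)" by (auto simp: of_tensor_def)
  then show "v \<in> carrier M \<Longrightarrow> hc_scalar c 0 \<odot> v = \<zero>"
    by (simp add: hc_scalar_def hc_class_zero smult_l_null)
qed

lemma scalar_add: "v \<in> carrier M \<Longrightarrow> hc_scalar c (z + z') \<odot> v = hc_scalar c z \<odot> v \<oplus> hc_scalar c z' \<odot> v"
  by (simp add: hc_scalar_def const_add tensor_add)

lemma dual_scalar: "v \<in> carrier M \<Longrightarrow> hc_dual c x \<odot> (hc_scalar c z \<odot> v) = hc_scalar c z \<odot> (hc_dual c x \<odot> v)"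
  by (simp add: hc_scalar_def hc_dual_def const_commutes flip: tensor_mult)

lemma group_dual:
  "v \<in> carrier M \<Longrightarrow> w \<in> H3 \<Longrightarrow> hc_group c w \<odot> (hc_dual c x \<odot> v) = hc_dual c (act_dual w x) \<odot> (hc_group c w \<odot> v)"
  by (simp add: hc_group_def hc_dual_def class_mult of_group_of_tensor act_tensor_emb_dual)

lemma vec_dual:
  assumes "v \<in> carrier M"
  shows "hc_vec c y \<odot> (hc_dual c x \<odot> v) = hc_dual c x \<odot> (hc_vec c y \<odot> v) \<oplus>
     hc_class c (tensor_plus_refl (const (pairing x y)) (\<lambda>s. - (c * pairing (x - act_h s x) y))) \<odot> v"
proof -
  have "hc_vec c y \<odot> (hc_dual c x \<odot> v) = (hc_vec c y \<otimes>\<^bsub>Hc c\<^esub> hc_dual c x) \<odot> v"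
    using assms by (simp add: smult_assoc)
  then show ?thesis
    using assms by (simp add: hc_y_x smult_l_distr smult_assoc R.m_closed)
qed

lemma euler_dual:
  assumes "v \<in> carrier M"
  shows "euler c \<odot> (hc_dual c x \<odot> v) = hc_dual c x \<odot> (euler c \<odot> v) \<oplus> hc_dual c x \<odot> v"
proof -
  have "euler c \<odot> (hc_dual c x \<odot> v) = (euler c \<otimes>\<^bsub>Hc c\<^esub> hc_dual c x) \<odot> v"
    using assms by (simp add: smult_assoc)
  then show ?thesis
    using assms by (simp add: hc_euler_x smult_l_distr smult_assoc R.m_closed)
qed

text \<open>Scalars, \<open>\<hh>\<^sup>*\<close>, \<open>\<hh>\<close> and the group generate the algebra, so stability under them suffices.\<close>

lemma submodule_criterion:
  assumes sub: "H \<subseteq> carrier M" and zero: "\<zero> \<in> H" and add: "\<And>u v. u \<in> H \<Longrightarrow> v \<in> H \<Longrightarrow> u \<oplus> v \<in> H"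
    and scalar: "\<And>z v. v \<in> H \<Longrightarrow> hc_scalar c z \<odot> v \<in> H"
    and dual: "\<And>x v. v \<in> H \<Longrightarrow> hc_dual c x \<odot> v \<in> H"
    and vec: "\<And>y v. v \<in> H \<Longrightarrow> hc_vec c y \<odot> v \<in> H"
    and group: "\<And>w v. w \<in> H3 \<Longrightarrow> v \<in> H \<Longrightarrow> hc_group c w \<odot> v \<in> H"
  shows "submodule H (Hc c) M"
proof (rule submodule_intro[OF sub zero add])
  fix a v assume "a \<in> carrier (Hc c)" and v: "v \<in> H"
  then obtain f where f: "f \<in> carrier smash" "a = hc_class c f" by (auto simp: carrier_Hc)
  have "hc_class c f \<odot> v \<in> H" using f(1)
  proof (induction f rule: smash_induct)
    case zero
    then show ?case using assms(2) v sub by (auto simp: hc_class_zero smult_l_null)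
  next
    case (single ls z w)
    have words: "hc_class c (of_tensor (Poly_Mapping.single (Word ls) z)) \<odot> u \<in> H" if "u \<in> H" for u
    proof (induction ls)
      case Nil
      have "of_tensor (Poly_Mapping.single (Word []) z) = of_tensor (const z)"
        by (simp add: const_def zero_word_def)
      then show ?case using scalar[OF that, of z] by (simp add: hc_scalar_def)
    next
      case (Cons l ls)
      have "Poly_Mapping.single (Word (l # ls)) z
          = Poly_Mapping.single (Word [l]) 1 * Poly_Mapping.single (Word ls) z"
        by (simp add: mult_single plus_word_def)
      then have "hc_class c (of_tensor (Poly_Mapping.single (Word (l # ls)) z)) \<odot> u
          = hc_class c (of_tensor (Poly_Mapping.single (Word [l]) 1)) \<odot>
            (hc_class c (of_tensor (Poly_Mapping.single (Word ls) z)) \<odot> u)"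
        using that sub by (auto simp: tensor_mult)
      moreover have "hc_class c (of_tensor (Poly_Mapping.single (Word [l]) 1)) \<odot> u' \<in> H" if "u' \<in> H" for u'
        using dual[OF that] vec[OF that]
        by (cases l) (simp_all add: hc_dual_def hc_vec_def flip: emb_dual_axis emb_h_axis)
      ultimately show ?case using Cons by simp
    qed
    have "smash_single (Poly_Mapping.single (Word ls) z) w
        = of_tensor (Poly_Mapping.single (Word ls) z) \<otimes>\<^bsub>smash\<^esub> of_group w"
      using single by (simp add: of_tensor_single of_group_single smash_single_mult H3_one)
    then show ?case
      using class_mult[of "of_tensor (Poly_Mapping.single (Word ls) z)" "of_group w" v] v sub single
        words[OF group[OF single v]]
      by (auto simp: hc_group_def)
  next
    case (add f g)
    then show ?case using assms(3) v sub by (auto simp: class_add)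
  qed
  then show "a \<odot> v \<in> H" using f by simp
qed

lemma group_algebra_insert:
  assumes "finite A" "u \<notin> A" "insert u A \<subseteq> H3" "v \<in> carrier M"
  shows "hc_class c (\<lambda>w. if w \<in> insert u A then const (k w) else 0) \<odot> v
     = hc_scalar c (k u) \<odot> (hc_group c u \<odot> v) \<oplus> hc_class c (\<lambda>w. if w \<in> A then const (k w) else 0) \<odot> v"
proof -
  have "(\<lambda>w. if w \<in> insert u A then const (k w) else 0)
      = (\<lambda>w. smash_single (const (k u)) u w + (if w \<in> A then const (k w) else 0))"
    using assms(2) by (auto simp: smash_single_def)
  moreover have ss: "smash_single (const (k u)) u = of_tensor (const (k u)) \<otimes>\<^bsub>smash\<^esub> of_group u"
    using assms by (simp add: of_tensor_single of_group_single smash_single_mult H3_one)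
  moreover have "(\<lambda>w. if w \<in> A then const (k w) else 0) \<in> carrier smash"
    using assms by (auto simp: smash_simps)
  moreover have "smash_single (const (k u)) u \<in> carrier smash"
    using assms by (simp add: smash_single_closed)
  ultimately have "hc_class c (\<lambda>w. if w \<in> insert u A then const (k w) else 0) \<odot> v
      = hc_class c (smash_single (const (k u)) u) \<odot> v \<oplus> hc_class c (\<lambda>w. if w \<in> A then const (k w) else 0) \<odot> v"
    using assms by (simp only: class_add)
  moreover have "hc_class c (smash_single (const (k u)) u) \<odot> v = hc_scalar c (k u) \<odot> (hc_group c u \<odot> v)"
    using assms unfolding ss hc_scalar_def hc_group_def by (intro class_mult[symmetric]) auto
  ultimately show ?thesis by simp
qed

lemma tensor_plus_refl_const:
  "tensor_plus_refl (const z) k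
    = (\<lambda>u. if u \<in> insert (mat 1) reflections then const (if u = mat 1 then z else k u) else 0)"
  using one_not_reflection by (auto simp: tensor_plus_refl_def of_tensor_def)

text \<open>Commuting a vector past a functional produces an element of the group algebra, which preserves every
  graded component.\<close>

lemma group_algebra_closed:
  assumes "\<zero> \<in> H" "H \<subseteq> carrier M" "\<And>u v. u \<in> H \<Longrightarrow> v \<in> H \<Longrightarrow> u \<oplus> v \<in> H"
    "\<And>z v. v \<in> H \<Longrightarrow> hc_scalar c z \<odot> v \<in> H" "\<And>w v. w \<in> H3 \<Longrightarrow> v \<in> H \<Longrightarrow> hc_group c w \<odot> v \<in> H"
    and v: "v \<in> H"
  shows "hc_class c (tensor_plus_refl (const z) k) \<odot> v \<in> H"
proof -
  have "hc_class c (\<lambda>w. if w \<in> A then const (k' w) else 0) \<odot> v \<in> H" if "finite A" "A \<subseteq> H3" for A k'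
    using that
  proof (induction A rule: finite_induct)
    case empty
    then show ?case using assms(1,2) v by (auto simp: hc_class_zero smult_l_null)
  next
    case (insert w A)
    then show ?case using assms by (subst group_algebra_insert) auto
  qed
  from this[of "insert (mat 1) reflections" "\<lambda>u. if u = mat 1 then z else k u"] show ?thesis
    using finite_reflections reflections_H3 H3_one unfolding tensor_plus_refl_const by simp
qed

end

lemma (in left_module) smult_r_minus:
  assumes a: "a \<in> carrier R" and v: "v \<in> carrier M"
  shows "a \<odot> (\<ominus> v) = \<ominus> (a \<odot> v)"
proof -
  have "a \<odot> (\<ominus> v) \<oplus> a \<odot> v = \<zero>"
    using smult_r_distr[OF a M.a_inv_closed[OF v] v] v by (simp add: M.l_neg smult_r_null a)
  then show ?thesis
    using M.minus_equality[OF _ smult_closed[OF a v] smult_closed[OF a M.a_inv_closed[OF v]]] by simp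
qed

section \<open>Lowest weight modules\<close>

text \<open>The locale covers both the standard modules and their nonzero quotients. The number \<open>e0\<close> is the
  eigenvalue of the Euler element on the lowest weight space \<open>\<tau>\<close>. For an irreducible \<open>\<tau>\<close> it exists by
  Schur's lemma; giving it as a parameter avoids this lemma, since it is \<open>-1\<close> in the case at hand.\<close>

locale lowest_weight_module = hc_module c M
  for c and M :: "(hc_elem, 'b, 'm) module_scheme" (structure) +
  fixes \<tau> :: "mat3 \<Rightarrow> complex^'n^'n" and \<iota> :: "complex^'n \<Rightarrow> 'b" and e0 :: complex
  assumes \<iota>_closed [simp]: "\<iota> v \<in> carrier M"
    and \<iota>_add: "\<iota> (v + v') = \<iota> v \<oplus> \<iota> v'"
    and \<iota>_scalar: "hc_scalar c z \<odot> \<iota> v = \<iota> (z *s v)"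
    and \<iota>_group: "w \<in> H3 \<Longrightarrow> hc_group c w \<odot> \<iota> v = \<iota> (\<tau> w *v v)"
    and \<iota>_vec: "hc_vec c y \<odot> \<iota> v = \<zero>"
    and generated: "submodule N (Hc c) M \<Longrightarrow> range \<iota> \<subseteq> N \<Longrightarrow> N = carrier M"
    and lowest: "(3/2) *s v - c *s (\<Sum>s\<in>reflections. \<tau> s *v v) = e0 *s v"
    and \<tau>_one: "\<tau> (mat 1) = mat 1"
    and \<tau>_irreducible: "v0 \<in> U \<Longrightarrow> v0 \<noteq> 0 \<Longrightarrow> (\<And>u v. u \<in> U \<Longrightarrow> v \<in> U \<Longrightarrow> u + v \<in> U) \<Longrightarrow>
      (\<And>z v. v \<in> U \<Longrightarrow> z *s v \<in> U) \<Longrightarrow> (\<And>w v. w \<in> H3 \<Longrightarrow> v \<in> U \<Longrightarrow> \<tau> w *v v \<in> U) \<Longrightarrow> U = UNIV"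
begin

lemma \<iota>_zero: "\<iota> 0 = \<zero>"
  using \<iota>_scalar[of 0 0] scalar_zero[OF \<iota>_closed] by simp

lemma group_algebra_\<iota>:
  assumes "finite A" "A \<subseteq> H3"
  shows "hc_class c (\<lambda>u. if u \<in> A then const (k u) else 0) \<odot> \<iota> v = \<iota> (\<Sum>u\<in>A. k u *s (\<tau> u *v v))"
  using assms
proof (induction A rule: finite_induct)
  case empty
  then show ?case by (simp add: hc_class_zero smult_l_null \<iota>_zero)
next
  case (insert w A)
  then show ?case by (subst group_algebra_insert) (simp_all add: \<iota>_group \<iota>_scalar \<iota>_add)
qed

lemma vanish_products:
  assumes "finite I"
  shows "hc_class c (of_tensor (\<Sum>i\<in>I. emb_dual (a i) * emb_h (b i))) \<odot> \<iota> v = \<zero>"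
  using assms
proof (induction I rule: finite_induct)
  case empty
  then show ?case using scalar_zero[OF \<iota>_closed] by (simp add: hc_scalar_def)
next
  case (insert i I)
  have "hc_class c (of_tensor (emb_dual (a i) * emb_h (b i))) \<odot> \<iota> v = \<zero>"
    using \<iota>_vec[of "b i" v] by (simp add: tensor_mult hc_vec_def smult_r_null)
  then show ?case using insert by (simp add: tensor_add)
qed

lemma euler_\<iota>: "euler c \<odot> \<iota> v = \<iota> (e0 *s v)"
proof -
  let ?p = "\<Sum>i\<in>UNIV. emb_dual (axis i 1) * emb_h (axis i 1)"
  have "tensor_plus_refl (?p + const (3/2)) (\<lambda>s. - c)
      = (\<lambda>u. of_tensor ?p u + tensor_plus_refl (const (3/2)) (\<lambda>s. - c) u)"
    by (auto simp: tensor_plus_refl_def of_tensor_def)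
  then have "euler c \<odot> \<iota> v = hc_class c (of_tensor ?p) \<odot> \<iota> v
      \<oplus> hc_class c (tensor_plus_refl (const (3/2)) (\<lambda>s. - c)) \<odot> \<iota> v"
    unfolding euler_def by (simp only: class_add of_tensor_closed tensor_plus_refl_closed \<iota>_closed)
  also have "hc_class c (of_tensor ?p) \<odot> \<iota> v = \<zero>" by (rule vanish_products) simp
  also have "hc_class c (tensor_plus_refl (const (3/2)) (\<lambda>s. - c)) \<odot> \<iota> v
      = \<iota> (\<Sum>u\<in>insert (mat 1) reflections. (if u = mat 1 then 3/2 else - c) *s (\<tau> u *v v))"
    unfolding tensor_plus_refl_const
    by (rule group_algebra_\<iota>) (use finite_reflections reflections_H3 H3_one in auto)
  also have "(\<Sum>u\<in>insert (mat 1) reflections. (if u = mat 1 then 3/2 else - c) *s (\<tau> u *v v))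
      = (3/2) *s v + (\<Sum>u\<in>reflections. (- c) *s (\<tau> u *v v))"
    using one_not_reflection
    by (subst sum.insert) (auto simp: finite_reflections \<tau>_one intro!: sum.cong)
  also have "\<dots> = e0 *s v"
    unfolding lowest[symmetric] by (simp add: vec.scale_sum_right sum_negf)
  finally show ?thesis by simp
qed

text \<open>The graded components are presented by generators, so that the action of the group, of \<open>\<hh>\<close> and of
  the Euler element on them is found by rule induction.\<close>

inductive deg :: "nat \<Rightarrow> 'b \<Rightarrow> bool" where
  base: "deg 0 (\<iota> v)"
| zero: "deg k \<zero>"
| step: "deg k u \<Longrightarrow> deg (Suc k) (hc_dual c x \<odot> u)"
| add: "deg k u \<Longrightarrow> deg k u' \<Longrightarrow> deg k (u \<oplus> u')"

lemma deg_closed: "deg k u \<Longrightarrow> u \<in> carrier M"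
  by (induction rule: deg.induct) auto

lemma deg_0: "deg k u \<Longrightarrow> k = 0 \<Longrightarrow> \<exists>v. u = \<iota> v"
proof (induction rule: deg.induct)
  case (zero k) then show ?case using \<iota>_zero by metis
next
  case (add k u u') then show ?case using \<iota>_add by metis
qed auto

lemma deg_scalar: "deg k u \<Longrightarrow> deg k (hc_scalar c z \<odot> u)"
proof (induction rule: deg.induct)
  case (base v) then show ?case by (simp add: \<iota>_scalar deg.base)
next
  case (zero k) then show ?case by (simp add: smult_r_null deg.zero)
next
  case (step k u x)
  then show ?case using deg.step[of k "hc_scalar c z \<odot> u" x] by (simp add: dual_scalar deg_closed)
next
  case (add k u u') then show ?case by (simp add: smult_r_distr deg_closed deg.add)
qed

lemma deg_group: "deg k u \<Longrightarrow> w \<in> H3 \<Longrightarrow> deg k (hc_group c w \<odot> u)"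
proof (induction rule: deg.induct)
  case (base v) then show ?case by (simp add: \<iota>_group deg.base)
next
  case (zero k) then show ?case by (simp add: smult_r_null deg.zero)
next
  case (step k u x) then show ?case by (simp add: group_dual deg_closed deg.step)
next
  case (add k u u') then show ?case by (simp add: smult_r_distr deg_closed deg.add)
qed

text \<open>Moving \<open>y\<close> to the right past a functional costs an element of the group algebra, which preserves
  degrees; at the lowest weight space \<open>y\<close> acts by zero.\<close>

lemma deg_vec: "deg k u \<Longrightarrow> if k = 0 then hc_vec c y \<odot> u = \<zero> else deg (k - 1) (hc_vec c y \<odot> u)"
proof (induction rule: deg.induct)
  case (base v) then show ?case by (simp add: \<iota>_vec)
next
  case (zero k) then show ?case by (simp add: smult_r_null deg.zero)
next
  case (step k u x)
  let ?g = "hc_class c (tensor_plus_refl (const (pairing x y)) (\<lambda>s. - (c * pairing (x - act_h s x) y)))"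
  have "deg k (?g \<odot> u)"
    using group_algebra_closed[of "Collect (deg k)" u] step.hyps
    by (auto intro: deg.zero deg.add deg_scalar deg_group deg_closed)
  moreover have "deg k (hc_dual c x \<odot> (hc_vec c y \<odot> u))"
    using step.IH by (cases k) (auto simp: smult_r_null intro: deg.zero deg.step)
  ultimately show ?case using step.hyps by (simp add: vec_dual deg_closed deg.add)
next
  case (add k u u') then show ?case by (auto simp: smult_r_distr deg_closed deg.add)
qed

lemma euler_deg: "deg k u \<Longrightarrow> euler c \<odot> u = hc_scalar c (e0 + of_nat k) \<odot> u"
proof (induction rule: deg.induct)
  case (base v) then show ?case by (simp add: euler_\<iota> \<iota>_scalar)
next
  case (zero k) then show ?case by (simp add: smult_r_null)
next
  case (step k u x)
  have u: "u \<in> carrier M" using deg_closed step.hyps by auto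
  have "euler c \<odot> (hc_dual c x \<odot> u)
      = hc_scalar c (e0 + of_nat k) \<odot> (hc_dual c x \<odot> u) \<oplus> hc_scalar c 1 \<odot> (hc_dual c x \<odot> u)"
    using step.IH u by (simp add: euler_dual dual_scalar scalar_one)
  also have "\<dots> = hc_scalar c (e0 + of_nat k + 1) \<odot> (hc_dual c x \<odot> u)"
    using u by (simp add: scalar_add)
  finally show ?case by (simp add: add_ac)
next
  case (add k u u') then show ?case by (simp add: smult_r_distr deg_closed)
qed

text \<open>The degree \<open>0\<close> component is carried along as the index \<open>v\<close>, because the sum of the components is
  not known to be direct at this point.\<close>

inductive fil :: "nat \<Rightarrow> complex^'n \<Rightarrow> 'b \<Rightarrow> bool" where
  fil_0: "fil 0 v (\<iota> v)"
| fil_Suc: "fil n v m \<Longrightarrow> deg (Suc n) u \<Longrightarrow> fil (Suc n) v (m \<oplus> u)"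

lemma fil_closed: "fil n v m \<Longrightarrow> m \<in> carrier M"
  by (induction rule: fil.induct) (auto simp: deg_closed)

lemma fil_raise: "fil n v m \<Longrightarrow> n \<le> n' \<Longrightarrow> fil n' v m"
proof (induction n' arbitrary: n)
  case (Suc n')
  then consider "n = Suc n'" | "fil n' v m" by (meson le_Suc_eq)
  then show ?case
  proof cases
    case 2
    then show ?thesis using fil_Suc[OF _ deg.zero] fil_closed by fastforce
  qed (use Suc in auto)
qed auto

lemma fil_add: "fil n v m \<Longrightarrow> fil n v' m' \<Longrightarrow> fil n (v + v') (m \<oplus> m')"
proof (induction arbitrary: v' m' rule: fil.induct)
  case (fil_0 v)
  then show ?case by (auto elim!: fil.cases simp: \<iota>_add[symmetric] intro: fil.intros)
next
  case (fil_Suc n v m u)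
  from fil_Suc.prems obtain m1 u1 where m': "m' = m1 \<oplus> u1" "fil n v' m1" "deg (Suc n) u1"
    by (cases rule: fil.cases) auto
  have "(m \<oplus> u) \<oplus> (m1 \<oplus> u1) = (m \<oplus> m1) \<oplus> (u \<oplus> u1)"
    using fil_Suc.hyps m' by (simp add: M.add.m_ac fil_closed deg_closed)
  then show ?case
    using fil.fil_Suc[OF fil_Suc.IH[OF m'(2)] deg.add[OF fil_Suc.hyps(2) m'(3)]] m' by simp
qed

lemma fil_scalar: "fil n v m \<Longrightarrow> fil n (z *s v) (hc_scalar c z \<odot> m)"
  by (induction rule: fil.induct)
    (auto simp: \<iota>_scalar smult_r_distr fil_closed deg_closed intro: fil.intros deg_scalar)

lemma fil_group: "fil n v m \<Longrightarrow> w \<in> H3 \<Longrightarrow> fil n (\<tau> w *v v) (hc_group c w \<odot> m)"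
  by (induction rule: fil.induct)
    (auto simp: \<iota>_group smult_r_distr fil_closed deg_closed intro: fil.intros deg_group)

lemma fil_dual: "fil n v m \<Longrightarrow> fil (Suc n) 0 (hc_dual c x \<odot> m)"
proof (induction rule: fil.induct)
  case (fil_0 v)
  have "fil (Suc 0) 0 (\<iota> 0 \<oplus> hc_dual c x \<odot> \<iota> v)"
    by (intro fil.intros deg.intros)
  then show ?case by (simp add: \<iota>_zero)
next
  case (fil_Suc n v m u)
  then show ?case by (auto simp: smult_r_distr fil_closed deg_closed intro: fil.intros deg.intros)
qed

lemma deg_fil: "deg k u \<Longrightarrow> \<exists>n v. fil n v u"
proof (cases k)
  case 0
  assume "deg k u"
  then show ?thesis using deg_0 0 fil_0 by metis
next
  case (Suc k')
  assume d: "deg k u"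
  have "fil k' 0 \<zero>" using fil_raise[OF fil_0[of 0], of k'] by (simp add: \<iota>_zero)
  then show ?thesis using fil_Suc[of k' 0 \<zero> u] d Suc deg_closed[OF d] by auto
qed

lemma fil_exists_add:
  assumes "\<exists>n v. fil n v m" "\<exists>n v. fil n v m'"
  shows "\<exists>n v. fil n v (m \<oplus> m')"
proof -
  obtain n v n' v' where "fil n v m" "fil n' v' m'" using assms by auto
  then have "fil (max n n') v m" "fil (max n n') v' m'" by (auto intro: fil_raise)
  then show ?thesis using fil_add by blast
qed

lemma fil_vec: "fil n v m \<Longrightarrow> \<exists>n v. fil n v (hc_vec c y \<odot> m)"
proof (induction rule: fil.induct)
  case (fil_0 v)
  then show ?case using fil.fil_0[of 0] by (auto simp: \<iota>_vec \<iota>_zero)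
next
  case (fil_Suc n v m u)
  have "\<exists>n v. fil n v (hc_vec c y \<odot> u)"
    using deg_vec[OF fil_Suc.hyps(2), of y] deg_fil by auto
  then show ?case using fil_Suc fil_exists_add by (simp add: smult_r_distr fil_closed deg_closed)
qed

lemma fil_total:
  assumes "m \<in> carrier M" shows "\<exists>n v. fil n v m"
proof -
  let ?H = "{m. \<exists>n v. fil n v m}"
  have "submodule ?H (Hc c) M"
  proof (rule submodule_criterion)
    show "?H \<subseteq> carrier M" by (auto simp: fil_closed)
    show "\<zero> \<in> ?H" using fil_0[of 0] by (auto simp: \<iota>_zero)
  qed (use fil_exists_add fil_scalar fil_dual fil_group fil_vec in blast)+
  moreover have "range \<iota> \<subseteq> ?H" using fil_0 by blast
  ultimately have "?H = carrier M" by (rule generated)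
  then show ?thesis using assms by blast
qed

lemma fil_euler_shift:
  "fil n v m \<Longrightarrow> fil n ((e0 + b) *s v) (euler c \<odot> m \<oplus> hc_scalar c b \<odot> m)"
proof (induction rule: fil.induct)
  case (fil_0 v)
  have "euler c \<odot> \<iota> v \<oplus> hc_scalar c b \<odot> \<iota> v = \<iota> ((e0 + b) *s v)"
    by (simp add: euler_\<iota> \<iota>_scalar \<iota>_add[symmetric] vec.scale_left_distrib)
  then show ?case by (simp add: fil.fil_0)
next
  case (fil_Suc n v m u)
  have cl: "m \<in> carrier M" "u \<in> carrier M" using fil_Suc by (auto simp: fil_closed deg_closed)
  have "euler c \<odot> (m \<oplus> u) \<oplus> hc_scalar c b \<odot> (m \<oplus> u)
      = (euler c \<odot> m \<oplus> hc_scalar c b \<odot> m) \<oplus> (euler c \<odot> u \<oplus> hc_scalar c b \<odot> u)"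
    using cl by (simp add: smult_r_distr M.add.m_ac)
  also have "euler c \<odot> u \<oplus> hc_scalar c b \<odot> u = hc_scalar c (e0 + of_nat (Suc n) + b) \<odot> u"
    using cl euler_deg[OF fil_Suc.hyps(2)] by (simp add: scalar_add)
  finally show ?case using fil_Suc by (auto intro: fil.intros deg_scalar)
qed

text \<open>Submodules are graded: the degree \<open>0\<close> component of an element is obtained from it by
  applying a polynomial in the Euler element that kills the components of positive degree.\<close>

lemma lowest_component_mem:
  assumes "submodule N (Hc c) M"
  shows "fil n v m \<Longrightarrow> m \<in> N \<Longrightarrow> \<iota> v \<in> N"
proof (induction n arbitrary: v m)
  case 0
  then show ?case by (auto elim: fil.cases)
next
  case (Suc n)
  from Suc.prems(1) obtain m1 u where m: "m = m1 \<oplus> u" "fil n v m1" "deg (Suc n) u"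
    by (cases rule: fil.cases) auto
  let ?b = "- (e0 + of_nat (Suc n))"
  have cl: "m1 \<in> carrier M" "u \<in> carrier M" using m by (auto simp: fil_closed deg_closed)
  have "euler c \<odot> u \<oplus> hc_scalar c ?b \<odot> u = hc_scalar c (e0 + of_nat (Suc n) + ?b) \<odot> u"
    unfolding scalar_add[OF cl(2), of "e0 + of_nat (Suc n)" ?b] euler_deg[OF m(3)] ..
  then have "euler c \<odot> u \<oplus> hc_scalar c ?b \<odot> u = \<zero>" using cl by (simp add: scalar_zero)
  moreover have "euler c \<odot> m \<oplus> hc_scalar c ?b \<odot> m
      = (euler c \<odot> m1 \<oplus> hc_scalar c ?b \<odot> m1) \<oplus> (euler c \<odot> u \<oplus> hc_scalar c ?b \<odot> u)"
    unfolding m(1) using cl by (simp only: smult_r_distr hc_gen_closed) (simp only: M.add.m_ac gen_smult_closed cl M.add.m_closed)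
  ultimately have "euler c \<odot> m \<oplus> hc_scalar c ?b \<odot> m = euler c \<odot> m1 \<oplus> hc_scalar c ?b \<odot> m1"
    using cl by simp
  moreover have "euler c \<odot> m \<oplus> hc_scalar c ?b \<odot> m \<in> N"
    by (intro submoduleD(3,4)[OF assms] hc_gen_closed Suc.prems(2))
  ultimately have "\<iota> ((e0 + ?b) *s v) \<in> N" 
    using Suc.IH[OF fil_euler_shift[OF m(2), of ?b]] by (simp only:)
  then have "hc_scalar c (inverse (e0 + ?b)) \<odot> \<iota> ((e0 + ?b) *s v) \<in> N"
    using submoduleD(4)[OF assms] by simp
  \<comment> \<open>The factor is \<open>- (n + 1)\<close>, so it can be divided out.\<close>
  moreover have "e0 + ?b \<noteq> 0" using of_nat_neq_0[of n] by (simp del: of_nat_Suc)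
  ultimately show ?case by (simp only: \<iota>_scalar vec.scale_scale) (simp only: left_inverse vec.scale_one not_False_eq_True)
qed

text \<open>A nonzero degree \<open>0\<close> component would put the irreducible lowest weight space, and with it the whole
  module, into the submodule.\<close>

lemma proper_submodule:
  assumes N: "submodule N (Hc c) M" "N \<noteq> carrier M" and m: "m \<in> N"
  shows "\<exists>n. fil n 0 m"
proof -
  obtain n v where f: "fil n v m" using fil_total m submoduleD(1)[OF N(1)] by blast
  have "v = 0"
  proof (rule ccontr)
    assume "v \<noteq> 0"
    have "{v. \<iota> v \<in> N} = UNIV"
    proof (rule \<tau>_irreducible)
      show "v \<in> {v. \<iota> v \<in> N}" using lowest_component_mem[OF N(1) f m] by simp
    qed (use \<open>v \<noteq> 0\<close> submoduleD[OF N(1)] in \<open>auto simp: \<iota>_add simp flip: \<iota>_scalar \<iota>_group\<close>)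
    then have "range \<iota> \<subseteq> N" by auto
    then show False using generated[OF N(1)] N(2) by simp
  qed
  then show ?thesis using f by blast
qed

text \<open>The sum of two proper submodules has no component in degree \<open>0\<close>, so it is proper; two maximal
  submodules therefore coincide with their sum.\<close>

theorem irreducible_quotient_unique:
  assumes N: "submodule N (Hc c) M" "irreducible_module (Hc c) (quotient_module M N)"
    and N': "submodule N' (Hc c) M" "irreducible_module (Hc c) (quotient_module M N')"
    and nonzero: "\<iota> v0 \<noteq> \<zero>"
  shows "N = N'"
proof -
  let ?S = "{n \<oplus> n' | n n'. n \<in> N \<and> n' \<in> N'}"
  have proper: "N \<noteq> carrier M" "N' \<noteq> carrier M" using quotient_proper N N' by auto
  have S: "submodule ?S (Hc c) M" by (rule submodule_sum[OF N(1) N'(1)])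
  have "\<exists>n. fil n 0 m" if "m \<in> ?S" for m
  proof -
    from that obtain a b where m: "m = a \<oplus> b" "a \<in> N" "b \<in> N'" by blast
    obtain n n' where "fil n 0 a" "fil n' 0 b" using m proper_submodule N N' proper by metis
    then have "fil (max n n') 0 a" "fil (max n n') 0 b" by (auto intro: fil_raise)
    then have "fil (max n n') (0 + 0) m" unfolding m(1) by (rule fil_add)
    then show ?thesis by auto
  qed
  moreover have "\<not> fil n 0 (\<iota> v0)" for n
  proof
    assume "fil n 0 (\<iota> v0)"
    moreover have "fil n (- v0) (\<iota> (- v0))" using fil_raise[OF fil_0] by simp
    ultimately have "fil n (0 + - v0) (\<iota> v0 \<oplus> \<iota> (- v0))" by (rule fil_add)
    moreover have "\<iota> v0 \<oplus> \<iota> (- v0) = \<zero>" by (simp flip: \<iota>_add add: \<iota>_zero)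
    ultimately have "\<iota> (- v0) = \<zero>" using lowest_component_mem[OF zero_submodule] by auto
    then show False using \<open>\<iota> v0 \<oplus> \<iota> (- v0) = \<zero>\<close> nonzero by simp
  qed
  ultimately have "\<iota> v0 \<notin> ?S" by blast
  then have Sp: "?S \<noteq> carrier M" using \<iota>_closed by blast
  have "n = n \<oplus> \<zero>" "n' = \<zero> \<oplus> n'" if "n \<in> N" "n' \<in> N'" for n n'
    using that submoduleD(1)[OF N(1)] submoduleD(1)[OF N'(1)] by (auto simp: subset_iff)
  then have "N \<subseteq> ?S" "N' \<subseteq> ?S" using submoduleD(2)[OF N(1)] submoduleD(2)[OF N'(1)] by blast+
  then show ?thesis
    using irreducible_quotient_maximal[OF N S] irreducible_quotient_maximal[OF N' S] Sp by simp
qed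

end

section \<open>The standard module\<close>

context
  fixes c :: complex and \<tau> :: "mat3 \<Rightarrow> complex^'n^'n"
begin

abbreviation "verma_free \<equiv> free_Abelian_group (carrier (Hc c) \<times> (UNIV :: (complex^'n) set))"
abbreviation "verma_kernel \<equiv> generate verma_free (verma_relations c \<tau>)"

definition verma_class :: "(hc_elem \<times> (complex^'n) \<Rightarrow>\<^sub>0 int) \<Rightarrow> (hc_elem \<times> (complex^'n) \<Rightarrow>\<^sub>0 int) set" where
  "verma_class p = verma_kernel #>\<^bsub>verma_free\<^esub> p"

definition verma_act :: "hc_elem \<Rightarrow> (hc_elem \<times> (complex^'n) \<Rightarrow>\<^sub>0 int) \<Rightarrow> (hc_elem \<times> (complex^'n) \<Rightarrow>\<^sub>0 int)" where
  "verma_act a = frag_extend (\<lambda>(b, v). frag_of (a \<otimes>\<^bsub>Hc c\<^esub> b, v))"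

interpretation Hc: ring "Hc c" by (rule ring_Hc)

interpretation F: comm_group verma_free by (rule abelian_free_Abelian_group)

lemma verma_relations_closed: "verma_relations c \<tau> \<subseteq> carrier verma_free"
proof -
  have gen: "frag_of (a, v) \<in> carrier verma_free" if "a \<in> carrier (Hc c)" for a and v :: "complex^'n"
    using that by simp
  have diff: "p - q \<in> carrier verma_free" if "p \<in> carrier verma_free" "q \<in> carrier verma_free" for p q
    using that keys_diff[of p q] by auto
  show ?thesis
    unfolding verma_relations_def
    by (auto simp del: carrier_free_Abelian_group_iff intro!: diff gen)
qed

lemma verma_kernel_subgroup: "subgroup verma_kernel verma_free"
  using verma_relations_closed by (rule F.generate_is_subgroup)

lemma verma_kernel_normal: "verma_kernel \<lhd> verma_free"
  using F.subgroup_imp_normal[OF verma_kernel_subgroup] .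

lemma verma_kernel_closed:
  "0 \<in> verma_kernel" "p \<in> verma_kernel \<Longrightarrow> q \<in> verma_kernel \<Longrightarrow> p + q \<in> verma_kernel"
  "p \<in> verma_kernel \<Longrightarrow> q \<in> verma_kernel \<Longrightarrow> p - q \<in> verma_kernel"
  "p \<in> verma_kernel \<Longrightarrow> p \<in> carrier verma_free" "p \<in> verma_relations c \<tau> \<Longrightarrow> p \<in> verma_kernel"
proof -
  note s = verma_kernel_subgroup
  show "0 \<in> verma_kernel" using subgroup.one_closed[OF s] by simp
  show add: "p \<in> verma_kernel \<Longrightarrow> q \<in> verma_kernel \<Longrightarrow> p + q \<in> verma_kernel" for p q
    using subgroup.m_closed[OF s, of p q] by simp
  show cl: "p \<in> verma_kernel \<Longrightarrow> p \<in> carrier verma_free" for p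
    using subgroup.subset[OF s] by blast
  have "- q \<in> verma_kernel" if "q \<in> verma_kernel" for q
    using subgroup.m_inv_closed[OF s that] cl[OF that] by simp
  then show "p \<in> verma_kernel \<Longrightarrow> q \<in> verma_kernel \<Longrightarrow> p - q \<in> verma_kernel"
    using add[of p "- q"] by simp
  show "p \<in> verma_relations c \<tau> \<Longrightarrow> p \<in> verma_kernel" by (rule generate.incl)
qed

lemma verma_class_eq:
  assumes "p \<in> carrier verma_free" "q \<in> carrier verma_free"
  shows "verma_class p = verma_class q \<longleftrightarrow> p - q \<in> verma_kernel"
proof -
  have "verma_class p = verma_class q \<longleftrightarrow> p \<in> verma_class q"
    unfolding verma_class_def
    using F.repr_independence[OF _ assms(2) verma_kernel_subgroup] F.rcos_self[OF assms(1) verma_kernel_subgroup]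
    by metis
  also have "\<dots> \<longleftrightarrow> p - q \<in> verma_kernel"
    by (force simp: verma_class_def r_coset_def)
  finally show ?thesis .
qed

lemma verma_class_member: "p \<in> verma_class q \<longleftrightarrow> p - q \<in> verma_kernel"
  by (force simp: verma_class_def r_coset_def)

lemma verma_simps:
  "carrier (verma c \<tau>) = verma_class ` carrier verma_free"
  "\<zero>\<^bsub>verma c \<tau>\<^esub> = verma_class 0"
  "a \<odot>\<^bsub>verma c \<tau>\<^esub> C = (\<Union>p\<in>C. verma_class (verma_act a p))"
proof -
  show "carrier (verma c \<tau>) = verma_class ` carrier verma_free"
    by (simp add: verma_def Let_def carrier_FactGroup verma_class_def[abs_def])
  have "verma_class 0 = verma_kernel"
    using F.coset_join2[OF _ verma_kernel_subgroup, of 0] verma_kernel_closed(1) by (simp add: verma_class_def)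
  then show "\<zero>\<^bsub>verma c \<tau>\<^esub> = verma_class 0" by (simp add: verma_def Let_def)
qed (simp_all add: verma_def Let_def verma_class_def verma_act_def)

lemma verma_add:
  assumes "p \<in> carrier verma_free" "q \<in> carrier verma_free"
  shows "verma_class p \<oplus>\<^bsub>verma c \<tau>\<^esub> verma_class q = verma_class (p + q)"
proof -
  have "verma_class p \<oplus>\<^bsub>verma c \<tau>\<^esub> verma_class q = verma_class p <#>\<^bsub>verma_free\<^esub> verma_class q"
    by (simp add: verma_def Let_def)
  then show ?thesis
    using normal.rcos_sum[OF verma_kernel_normal assms] by (simp add: verma_class_def)
qed

lemma verma_act_closed:
  assumes "a \<in> carrier (Hc c)" "p \<in> carrier verma_free"
  shows "verma_act a p \<in> carrier verma_free"
  using keys_frag_extend[of "\<lambda>(b, v). frag_of (a \<otimes>\<^bsub>Hc c\<^esub> b, v)" p] assms Hc.m_closed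
  by (fastforce simp: verma_act_def)

lemma verma_act_add: "verma_act a (p + q) = verma_act a p + verma_act a q"
  and verma_act_diff: "verma_act a (p - q) = verma_act a p - verma_act a q"
  and verma_act_of: "verma_act a (frag_of (b, v)) = frag_of (a \<otimes>\<^bsub>Hc c\<^esub> b, v)"
  by (simp_all add: verma_act_def frag_extend_add frag_extend_diff)

text \<open>Each relation is stable under left multiplication of its first factor.\<close>

lemma verma_act_kernel:
  assumes a: "a \<in> carrier (Hc c)" and p: "p \<in> verma_kernel"
  shows "verma_act a p \<in> verma_kernel"
  using p
proof (induction rule: generate.induct)
  case one
  then show ?case using verma_kernel_closed(1) by (simp add: verma_act_def)
next
  have rel: "verma_act a h \<in> verma_relations c \<tau>" if "h \<in> verma_relations c \<tau>" for h
    using that a unfolding verma_relations_def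
    by (elim UnE CollectE exE conjE)
      (simp add: verma_act_diff verma_act_of Hc.r_distr Hc.m_assoc[symmetric], blast)+
  {
    case (incl h)
    then show ?case using rel verma_kernel_closed(5) by blast
  next
    case (inv h)
    then have "h \<in> carrier verma_free" using verma_relations_closed by blast
    then have "inv\<^bsub>verma_free\<^esub> h = 0 - h" by simp
    moreover have "verma_act a 0 = 0" by (simp add: verma_act_def)
    ultimately show ?case
      using verma_kernel_closed(1,3,5) rel[OF inv] by (simp add: verma_act_diff del: diff_0)
  }
next
  case (eng h1 h2)
  then show ?case using verma_kernel_closed(2) by (simp add: verma_act_add)
qed

lemma verma_smult:
  assumes "a \<in> carrier (Hc c)" "p \<in> carrier verma_free"
  shows "a \<odot>\<^bsub>verma c \<tau>\<^esub> verma_class p = verma_class (verma_act a p)"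
proof -
  have "verma_class (verma_act a q) = verma_class (verma_act a p)" if "q \<in> verma_class p" for q
  proof -
    have k: "q - p \<in> verma_kernel" using that by (simp add: verma_class_member)
    then have "(q - p) + p \<in> carrier verma_free"
      using F.m_closed[OF verma_kernel_closed(4)[OF k] assms(2)] by simp
    then have q: "q \<in> carrier verma_free" by simp
    have "verma_act a (q - p) \<in> verma_kernel" using verma_act_kernel[OF assms(1) k] .
    then show ?thesis
      using assms q by (subst verma_class_eq) (simp_all add: verma_act_closed verma_act_diff del: carrier_free_Abelian_group_iff)
  qed
  moreover have "p \<in> verma_class p" using verma_kernel_closed(1) by (simp add: verma_class_member)
  ultimately show ?thesis unfolding verma_simps(3) by blast
qed

lemma free_induct [consumes 1, case_names zero of diff]:
  assumes "p \<in> carrier verma_free" "P 0" "\<And>a v. a \<in> carrier (Hc c) \<Longrightarrow> P (frag_of (a, v))"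
    and d: "\<And>p q. p \<in> carrier verma_free \<Longrightarrow> q \<in> carrier verma_free \<Longrightarrow> P p \<Longrightarrow> P q \<Longrightarrow> P (p - q)"
  shows "P p"
proof -
  have "p \<in> carrier verma_free \<and> P p"
  proof (rule frag_induction[of p "carrier (Hc c) \<times> UNIV" "\<lambda>p. p \<in> carrier verma_free \<and> P p"])
    show "Poly_Mapping.keys p \<subseteq> carrier (Hc c) \<times> UNIV" using assms(1) by simp
    fix a b :: "hc_elem \<times> (complex^'n) \<Rightarrow>\<^sub>0 int"
    assume ab: "a \<in> carrier verma_free \<and> P a" "b \<in> carrier verma_free \<and> P b"
    then have "a - b \<in> carrier verma_free" using keys_diff[of a b] by auto
    then show "a - b \<in> carrier verma_free \<and> P (a - b)" using ab d by blast
  qed (use assms(2,3) in auto)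
  then show ?thesis by simp
qed

lemma left_module_verma: "left_module (Hc c) (verma c \<tau>)"
proof (intro left_module.intro left_module_axioms.intro ring_Hc)
  have add_cl: "p + q \<in> carrier verma_free" if "p \<in> carrier verma_free" "q \<in> carrier verma_free" for p q
    using F.m_closed[OF that] by simp
  have zero_cl: "0 \<in> carrier verma_free" by simp
  show "abelian_group (verma c \<tau>)"
  proof (rule abelian_groupI)
    fix u assume "u \<in> carrier (verma c \<tau>)"
    then obtain p where p: "p \<in> carrier verma_free" "u = verma_class p" unfolding verma_simps(1) by blast
    then have m: "- p \<in> carrier verma_free" by simp
    then have "verma_class (- p) \<oplus>\<^bsub>verma c \<tau>\<^esub> u = \<zero>\<^bsub>verma c \<tau>\<^esub>"
      using verma_add[OF m p(1)] p by (simp add: verma_simps(2))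
    then show "\<exists>y\<in>carrier (verma c \<tau>). y \<oplus>\<^bsub>verma c \<tau>\<^esub> u = \<zero>\<^bsub>verma c \<tau>\<^esub>"
      using m unfolding verma_simps(1) by blast
  qed (unfold verma_simps(1,2), use zero_cl add_cl in \<open>auto simp: verma_add add_ac
      simp del: carrier_free_Abelian_group_iff\<close>)
next
  fix a u v assume a: "a \<in> carrier (Hc c)" and "u \<in> carrier (verma c \<tau>)" "v \<in> carrier (verma c \<tau>)"
  then obtain p q where pq: "p \<in> carrier verma_free" "u = verma_class p" "q \<in> carrier verma_free" "v = verma_class q"
    unfolding verma_simps(1) by blast
  have "p + q \<in> carrier verma_free" using F.m_closed[OF pq(1,3)] by simp
  then show "a \<odot>\<^bsub>verma c \<tau>\<^esub> (u \<oplus>\<^bsub>verma c \<tau>\<^esub> v) = a \<odot>\<^bsub>verma c \<tau>\<^esub> u \<oplus>\<^bsub>verma c \<tau>\<^esub> a \<odot>\<^bsub>verma c \<tau>\<^esub> v"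
    using a pq by (simp add: verma_add verma_smult verma_act_closed verma_act_add del: carrier_free_Abelian_group_iff)
next
  fix a u assume a: "a \<in> carrier (Hc c)" and "u \<in> carrier (verma c \<tau>)"
  then obtain p where p: "p \<in> carrier verma_free" "u = verma_class p"
    unfolding verma_simps(1) by blast
  show "a \<odot>\<^bsub>verma c \<tau>\<^esub> u \<in> carrier (verma c \<tau>)"
    using a p verma_act_closed unfolding verma_simps(1) p(2) by (subst verma_smult) blast+
next
  fix a b u assume ab: "a \<in> carrier (Hc c)" "b \<in> carrier (Hc c)" and "u \<in> carrier (verma c \<tau>)"
  then obtain p where p: "p \<in> carrier verma_free" "u = verma_class p"
    unfolding verma_simps(1) by blast
  have "verma_act (a \<otimes>\<^bsub>Hc c\<^esub> b) p = verma_act a (verma_act b p)"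
    using p(1)
  proof (induction rule: free_induct)
    case zero then show ?case by (simp add: verma_act_def)
  qed (use ab in \<open>simp_all add: verma_act_of verma_act_diff Hc.m_assoc\<close>)
  then show "(a \<otimes>\<^bsub>Hc c\<^esub> b) \<odot>\<^bsub>verma c \<tau>\<^esub> u = a \<odot>\<^bsub>verma c \<tau>\<^esub> (b \<odot>\<^bsub>verma c \<tau>\<^esub> u)"
    using ab p by (simp add: verma_smult verma_act_closed Hc.m_closed del: carrier_free_Abelian_group_iff)
  have "verma_act (a \<oplus>\<^bsub>Hc c\<^esub> b) p - (verma_act a p + verma_act b p) \<in> verma_kernel"
    using p(1)
  proof (induction rule: free_induct)
    case zero then show ?case using verma_kernel_closed(1) by (simp add: verma_act_def)
  next
    case (of d v)
    have "frag_of ((a \<otimes>\<^bsub>Hc c\<^esub> d) \<oplus>\<^bsub>Hc c\<^esub> (b \<otimes>\<^bsub>Hc c\<^esub> d), v) - frag_of (a \<otimes>\<^bsub>Hc c\<^esub> d, v) - frag_of (b \<otimes>\<^bsub>Hc c\<^esub> d, v)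
        \<in> verma_relations c \<tau>"
      using ab of unfolding verma_relations_def by blast
    then show ?case using ab of verma_kernel_closed(5) by (simp add: verma_act_of Hc.l_distr diff_diff_add)
  next
    case (diff p q)
    from verma_kernel_closed(3)[OF diff(3,4)] show ?case
      by (simp add: verma_act_diff algebra_simps)
  qed
  moreover have "verma_act a p + verma_act b p \<in> carrier verma_free"
    using F.m_closed[OF verma_act_closed[OF ab(1) p(1)] verma_act_closed[OF ab(2) p(1)]] by simp
  ultimately have "verma_class (verma_act (a \<oplus>\<^bsub>Hc c\<^esub> b) p) = verma_class (verma_act a p + verma_act b p)"
    using verma_class_eq verma_act_closed ab p Hc.a_closed by blast
  then show "(a \<oplus>\<^bsub>Hc c\<^esub> b) \<odot>\<^bsub>verma c \<tau>\<^esub> u = a \<odot>\<^bsub>verma c \<tau>\<^esub> u \<oplus>\<^bsub>verma c \<tau>\<^esub> b \<odot>\<^bsub>verma c \<tau>\<^esub> u"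
    using ab p by (simp add: verma_smult verma_act_closed verma_add Hc.a_closed del: carrier_free_Abelian_group_iff)
next
  fix u assume "u \<in> carrier (verma c \<tau>)"
  then obtain p where p: "p \<in> carrier verma_free" "u = verma_class p"
    unfolding verma_simps(1) by blast
  have "verma_act \<one>\<^bsub>Hc c\<^esub> p = p"
    using p(1)
  proof (induction rule: free_induct)
    case zero then show ?case by (simp add: verma_act_def)
  qed (simp_all add: verma_act_of verma_act_diff)
  then show "\<one>\<^bsub>Hc c\<^esub> \<odot>\<^bsub>verma c \<tau>\<^esub> u = u" using p by (simp add: verma_smult del: carrier_free_Abelian_group_iff)
qed

definition verma_vec :: "complex^'n \<Rightarrow> (hc_elem \<times> (complex^'n) \<Rightarrow>\<^sub>0 int) set" where
  "verma_vec v = verma_class (frag_of (\<one>\<^bsub>Hc c\<^esub>, v))"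

lemma frag_of_closed: "a \<in> carrier (Hc c) \<Longrightarrow> frag_of (a, v) \<in> carrier verma_free"
  by simp

lemma verma_vec_closed: "verma_vec v \<in> carrier (verma c \<tau>)"
  unfolding verma_vec_def verma_simps(1) using frag_of_closed by blast

lemma smult_verma_vec: "a \<in> carrier (Hc c) \<Longrightarrow> a \<odot>\<^bsub>verma c \<tau>\<^esub> verma_vec v = verma_class (frag_of (a, v))"
  by (simp add: verma_vec_def verma_smult verma_act_of del: carrier_free_Abelian_group_iff add: frag_of_closed)

lemma verma_relation_eq:
  assumes "frag_of (a, v) - frag_of (a', v') \<in> verma_relations c \<tau>" "a \<in> carrier (Hc c)" "a' \<in> carrier (Hc c)"
  shows "verma_class (frag_of (a, v)) = verma_class (frag_of (a', v'))"
  using assms verma_class_eq[OF frag_of_closed frag_of_closed] verma_kernel_closed(5) by blast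

lemma verma_vec_add: "verma_vec (v + v') = verma_vec v \<oplus>\<^bsub>verma c \<tau>\<^esub> verma_vec v'"
proof -
  let ?p = "\<lambda>v. frag_of (\<one>\<^bsub>Hc c\<^esub>, v) :: (hc_elem \<times> (complex^'n) \<Rightarrow>\<^sub>0 int)"
  have "?p (v + v') - ?p v - ?p v' \<in> verma_relations c \<tau>"
    unfolding verma_relations_def using Hc.one_closed by blast
  then have "?p (v + v') - (?p v + ?p v') \<in> verma_kernel"
    using verma_kernel_closed(5) by (simp add: diff_diff_add)
  moreover have "?p v + ?p v' \<in> carrier verma_free"
    using F.m_closed[OF frag_of_closed frag_of_closed] by simp
  ultimately have "verma_class (?p (v + v')) = verma_class (?p v + ?p v')"
    using verma_class_eq frag_of_closed Hc.one_closed by blast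
  then show ?thesis
    unfolding verma_vec_def by (subst verma_add) (simp_all add: frag_of_closed del: carrier_free_Abelian_group_iff)
qed

lemma verma_vec_scalar: "hc_scalar c z \<odot>\<^bsub>verma c \<tau>\<^esub> verma_vec v = verma_vec (z *s v)"
proof -
  have "frag_of (\<one>\<^bsub>Hc c\<^esub> \<otimes>\<^bsub>Hc c\<^esub> hc_scalar c z, v) - frag_of (\<one>\<^bsub>Hc c\<^esub>, z *s v) \<in> verma_relations c \<tau>"
    unfolding verma_relations_def using Hc.one_closed by blast
  then show ?thesis
    using verma_relation_eq[of "hc_scalar c z"] smult_verma_vec[of "hc_scalar c z"] by (simp add: verma_vec_def)
qed

lemma verma_vec_group: "w \<in> H3 \<Longrightarrow> hc_group c w \<odot>\<^bsub>verma c \<tau>\<^esub> verma_vec v = verma_vec (\<tau> w *v v)"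
proof -
  assume w: "w \<in> H3"
  have "frag_of (\<one>\<^bsub>Hc c\<^esub> \<otimes>\<^bsub>Hc c\<^esub> hc_group c w, v) - frag_of (\<one>\<^bsub>Hc c\<^esub>, \<tau> w *v v) \<in> verma_relations c \<tau>"
    unfolding verma_relations_def using Hc.one_closed w by blast
  then show ?thesis
    using verma_relation_eq[of "hc_group c w"] smult_verma_vec[of "hc_group c w"] w by (simp add: verma_vec_def)
qed

lemma verma_vec_vec: "hc_vec c y \<odot>\<^bsub>verma c \<tau>\<^esub> verma_vec v = \<zero>\<^bsub>verma c \<tau>\<^esub>"
proof -
  interpret V: hc_module c "verma c \<tau>" using left_module_verma by (simp add: hc_module_def)
  have "frag_of (\<one>\<^bsub>Hc c\<^esub> \<otimes>\<^bsub>Hc c\<^esub> hc_vec c y, v) - frag_of (\<one>\<^bsub>Hc c\<^esub>, 0) \<in> verma_relations c \<tau>"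
    unfolding verma_relations_def using Hc.one_closed by blast
  then have "hc_vec c y \<odot>\<^bsub>verma c \<tau>\<^esub> verma_vec v = verma_vec 0"
    using verma_relation_eq[of "hc_vec c y"] smult_verma_vec[of "hc_vec c y"] by (simp add: verma_vec_def)
  also have "verma_vec 0 = \<zero>\<^bsub>verma c \<tau>\<^esub>"
    using verma_vec_scalar[of 0 0] V.scalar_zero[OF verma_vec_closed] by simp
  finally show ?thesis .
qed

lemma verma_generated:
  assumes N: "submodule N (Hc c) (verma c \<tau>)" and sub: "range verma_vec \<subseteq> N"
  shows "N = carrier (verma c \<tau>)"
proof -
  interpret V: left_module "Hc c" "verma c \<tau>" by (rule left_module_verma)
  note D = V.submoduleD[OF N]
  have "verma_class p \<in> N" if "p \<in> carrier verma_free" for p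
    using that
  proof (induction rule: free_induct)
    case zero then show ?case using D(2) by (simp add: verma_simps(2))
  next
    case (of a v)
    then show ?case using D(4)[of a "verma_vec v"] sub smult_verma_vec by auto
  next
    case (diff p q)
    have "verma_class (p - q) = verma_class p \<oplus>\<^bsub>verma c \<tau>\<^esub> (\<ominus>\<^bsub>verma c \<tau>\<^esub> verma_class q)"
    proof -
      have pq: "p - q \<in> carrier verma_free" using diff keys_diff[of p q] by auto
      have cl: "verma_class (p - q) \<in> carrier (verma c \<tau>)" "verma_class q \<in> carrier (verma c \<tau>)"
        unfolding verma_simps(1) using pq diff by blast+
      have "verma_class p = verma_class (p - q) \<oplus>\<^bsub>verma c \<tau>\<^esub> verma_class q"
        using verma_add[OF pq diff(2)] by simp
      then show ?thesis using cl by (simp add: V.M.a_assoc V.M.r_neg)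
    qed
    then show ?case using diff D(3,5) by simp
  qed
  then show ?thesis using D(1) unfolding verma_simps(1) by blast
qed

text \<open>The universal property of the standard module: the free abelian group maps to \<open>V\<close> by
  \<open>(a, v) \<mapsto> a (j v)\<close>, and the assumptions on \<open>j\<close> are the vanishing of this map on the relations.\<close>

lemma verma_universal:
  assumes V: "left_module (Hc c) V"
    and j: "\<And>v. j v \<in> carrier V" "\<And>v v'. j (v + v') = j v \<oplus>\<^bsub>V\<^esub> j v'"
      "\<And>z v. hc_scalar c z \<odot>\<^bsub>V\<^esub> j v = j (z *s v)"
      "\<And>w v. w \<in> H3 \<Longrightarrow> hc_group c w \<odot>\<^bsub>V\<^esub> j v = j (\<tau> w *v v)"
      "\<And>y v. hc_vec c y \<odot>\<^bsub>V\<^esub> j v = \<zero>\<^bsub>V\<^esub>"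
  shows "\<exists>\<psi>. lmod_hom (Hc c) (verma c \<tau>) V \<psi> \<and> (\<forall>v. \<psi> (verma_vec v) = j v)"
proof -
  interpret V: hc_module c V using V by (simp add: hc_module_def)
  have j0: "j 0 = \<zero>\<^bsub>V\<^esub>" using j(3)[of 0 0] V.scalar_zero[OF j(1)] by simp
  have "(\<lambda>(a, v). a \<odot>\<^bsub>V\<^esub> j v) ` (carrier (Hc c) \<times> UNIV) \<subseteq> carrier (add_monoid V)"
    using V.smult_closed j(1) by auto
  then obtain h where h: "h \<in> hom verma_free (add_monoid V)"
    and h_of': "\<And>x. x \<in> carrier (Hc c) \<times> UNIV \<Longrightarrow> h (frag_of x) = (case x of (a, v) \<Rightarrow> a \<odot>\<^bsub>V\<^esub> j v)"
    by (rule comm_group.free_Abelian_group_universal[OF V.M.a_comm_group]) (rule that)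
  have h_of: "h (frag_of (a, v)) = a \<odot>\<^bsub>V\<^esub> j v" if "a \<in> carrier (Hc c)" for a v
    using h_of'[of "(a, v)"] that by simp
  have h_cl: "h p \<in> carrier V" if "p \<in> carrier verma_free" for p
    using h that by (auto simp: hom_def simp del: carrier_free_Abelian_group_iff)
  have h_add: "h (p + q) = h p \<oplus>\<^bsub>V\<^esub> h q" if "p \<in> carrier verma_free" "q \<in> carrier verma_free" for p q
    using hom_mult[OF h that] by simp
  have h_diff: "h (p - q) = h p \<oplus>\<^bsub>V\<^esub> (\<ominus>\<^bsub>V\<^esub> h q)" if "p \<in> carrier verma_free" "q \<in> carrier verma_free" for p q
  proof -
    have pq: "p - q \<in> carrier verma_free" using that keys_diff[of p q] by auto
    have "h p = h (p - q) \<oplus>\<^bsub>V\<^esub> h q" using h_add[OF pq that(2)] by simp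
    then show ?thesis using h_cl pq that by (simp add: V.M.a_assoc V.M.r_neg del: carrier_free_Abelian_group_iff)
  qed
  have dcl: "p - q \<in> carrier verma_free" if "p \<in> carrier verma_free" "q \<in> carrier verma_free" for p q
    using that keys_diff[of p q] by auto
  have h_rel: "h r = \<zero>\<^bsub>V\<^esub>" if "r \<in> verma_relations c \<tau>" for r
    using that unfolding verma_relations_def
  proof (elim UnE CollectE exE conjE)
    fix a a' v assume r: "r = frag_of (a \<oplus>\<^bsub>Hc c\<^esub> a', v) - frag_of (a, v) - frag_of (a', v)"
      and a: "a \<in> carrier (Hc c)" "a' \<in> carrier (Hc c)"
    show ?thesis unfolding r using a j(1)
      by (simp add: h_diff h_of dcl frag_of_closed Hc.a_closed V.smult_l_distr V.smult_closed V.M.a_assoc V.M.minus_add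
          V.M.r_neg V.M.add.m_lcomm del: carrier_free_Abelian_group_iff)
  next
    fix a v v' assume r: "r = frag_of (a, v + v') - frag_of (a, v) - frag_of (a, v')"
      and a: "a \<in> carrier (Hc c)"
    show ?thesis unfolding r using a j(1)
      by (simp add: h_diff h_of dcl frag_of_closed j(2) V.smult_r_distr V.smult_closed V.M.a_assoc V.M.minus_add
          V.M.r_neg V.M.add.m_lcomm del: carrier_free_Abelian_group_iff)
  next
    fix a z v assume r: "r = frag_of (a \<otimes>\<^bsub>Hc c\<^esub> hc_scalar c z, v) - frag_of (a, z *s v)"
      and a: "a \<in> carrier (Hc c)"
    show ?thesis unfolding r using a j(1)
      by (simp add: h_diff h_of frag_of_closed Hc.m_closed V.smult_assoc j(3) V.M.r_neg V.smult_closed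
          del: carrier_free_Abelian_group_iff)
  next
    fix a w v assume r: "r = frag_of (a \<otimes>\<^bsub>Hc c\<^esub> hc_group c w, v) - frag_of (a, \<tau> w *v v)"
      and a: "a \<in> carrier (Hc c)" "w \<in> H3"
    show ?thesis unfolding r using a j(1)
      by (simp add: h_diff h_of frag_of_closed Hc.m_closed V.smult_assoc j(4) V.M.r_neg V.smult_closed
          del: carrier_free_Abelian_group_iff)
  next
    fix a y v assume r: "r = frag_of (a \<otimes>\<^bsub>Hc c\<^esub> hc_vec c y, v) - frag_of (a, 0)"
      and a: "a \<in> carrier (Hc c)"
    show ?thesis unfolding r using a j(1)
      by (simp add: h_diff h_of frag_of_closed Hc.m_closed V.smult_assoc j(5) j0 V.smult_r_null V.M.r_neg
          del: carrier_free_Abelian_group_iff)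
  qed
  have h0: "h 0 = \<zero>\<^bsub>V\<^esub>" using hom_one[OF h F.is_group V.M.add.is_group] by simp
  have h_ker: "h r = \<zero>\<^bsub>V\<^esub>" if "r \<in> verma_kernel" for r
    using that
  proof (induction rule: generate.induct)
    case one then show ?case using h0 by simp
  next
    case (incl r) then show ?case by (rule h_rel)
  next
    case (inv r)
    then have r: "r \<in> carrier verma_free" using verma_relations_closed by blast
    then have "h (0 - r) = \<zero>\<^bsub>V\<^esub>"
      using h_diff[OF _ r, of 0] h_rel[OF inv] V.M.r_neg[of "\<zero>\<^bsub>V\<^esub>"] by (simp add: h0)
    then show ?case using r by simp
  next
    case (eng r r')
    then have "r \<in> carrier verma_free" "r' \<in> carrier verma_free" using verma_kernel_closed(4) by auto
    then show ?case using h_add eng by simp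
  qed
  have h_eq: "h p = h q" if "p \<in> carrier verma_free" "q \<in> carrier verma_free" "verma_class p = verma_class q" for p q
  proof -
    have k: "p - q \<in> verma_kernel" using that verma_class_eq by blast
    have "h ((p - q) + q) = h (p - q) \<oplus>\<^bsub>V\<^esub> h q" by (rule h_add[OF verma_kernel_closed(4)[OF k] that(2)])
    then show ?thesis using h_ker[OF k] h_cl[OF that(2)] by simp
  qed
  define \<psi> where "\<psi> C = h (SOME p. p \<in> carrier verma_free \<and> C = verma_class p)" for C
  have \<psi>: "\<psi> (verma_class p) = h p" if "p \<in> carrier verma_free" for p
  proof -
    have "\<exists>q. q \<in> carrier verma_free \<and> verma_class p = verma_class q" using that by blast
    from someI_ex[OF this] show ?thesis
      unfolding \<psi>_def by (elim conjE) (rule h_eq[OF _ that], simp_all only:)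
  qed
  have h_act: "h (verma_act a p) = a \<odot>\<^bsub>V\<^esub> h p" if "a \<in> carrier (Hc c)" "p \<in> carrier verma_free" for a p
    using that(2)
  proof (induction rule: free_induct)
    case zero then show ?case using that(1) by (simp add: verma_act_def h0 V.smult_r_null)
  next
    case (of b v) then show ?case
      using that(1) j(1) by (simp add: verma_act_of h_of Hc.m_closed V.smult_assoc)
  next
    case (diff p q)
    show ?case
      using that(1) diff h_cl by (simp add: verma_act_diff h_diff verma_act_closed V.smult_r_distr V.smult_r_minus del: carrier_free_Abelian_group_iff)
  qed
  have "lmod_hom (Hc c) (verma c \<tau>) V \<psi>"
    unfolding lmod_hom_def
  proof (intro conjI ballI)
    fix u v assume "u \<in> carrier (verma c \<tau>)" "v \<in> carrier (verma c \<tau>)"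
    then obtain p q where pq: "p \<in> carrier verma_free" "u = verma_class p" "q \<in> carrier verma_free" "v = verma_class q"
      unfolding verma_simps(1) by blast
    have "p + q \<in> carrier verma_free" using F.m_closed[OF pq(1,3)] by simp
    then show "\<psi> (u \<oplus>\<^bsub>verma c \<tau>\<^esub> v) = \<psi> u \<oplus>\<^bsub>V\<^esub> \<psi> v"
      using pq by (simp add: verma_add \<psi> h_add del: carrier_free_Abelian_group_iff)
  next
    fix a u assume a: "a \<in> carrier (Hc c)" and "u \<in> carrier (verma c \<tau>)"
    then obtain p where "p \<in> carrier verma_free" "u = verma_class p"
      unfolding verma_simps(1) by blast
    then show "\<psi> (a \<odot>\<^bsub>verma c \<tau>\<^esub> u) = a \<odot>\<^bsub>V\<^esub> \<psi> u"
      using a by (simp add: verma_smult \<psi> verma_act_closed h_act del: carrier_free_Abelian_group_iff)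
  next
    fix u assume "u \<in> carrier (verma c \<tau>)"
    then show "\<psi> u \<in> carrier V" unfolding verma_simps(1) using \<psi> h_cl by auto
  qed
  moreover have "\<psi> (verma_vec v) = j v" for v
    using j(1) V.smult_one by (simp add: verma_vec_def \<psi> frag_of_closed h_of del: carrier_free_Abelian_group_iff)
  ultimately show ?thesis by blast
qed

end

text \<open>The kernel of the map from the standard module onto \<open>V\<close> is a submodule with irreducible quotient,
  so it is the one that the description in \<open>simple_L\<close> selects.\<close>

theorem simple_L_iso:
  fixes \<tau> :: "mat3 \<Rightarrow> complex^'n^'n" and V :: "(hc_elem, 'b, 'm) module_scheme"
  assumes V: "lowest_weight_module c V \<tau> \<iota> e0" and irr: "irreducible_module (Hc c) V"
    and nonzero: "\<iota> v0 \<noteq> \<zero>\<^bsub>V\<^esub>"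
  shows "\<exists>g. lmod_iso (Hc c) (simple_L c \<tau>) V g"
proof -
  let ?M = "verma c \<tau>"
  interpret V: lowest_weight_module c V \<tau> \<iota> e0 by fact
  interpret M: lowest_weight_module c ?M \<tau> "verma_vec c \<tau>" e0
  proof (intro lowest_weight_module.intro lowest_weight_module_axioms.intro)
    show "hc_module c ?M" using left_module_verma by (simp add: hc_module_def)
    show "N = carrier ?M" if "submodule N (Hc c) ?M" "range (verma_vec c \<tau>) \<subseteq> N" for N
      using that by (rule verma_generated)
    show "U = UNIV" if "v0 \<in> U" "v0 \<noteq> 0" "\<And>u v. u \<in> U \<Longrightarrow> v \<in> U \<Longrightarrow> u + v \<in> U"
      "\<And>z v. v \<in> U \<Longrightarrow> z *s v \<in> U" "\<And>w v. w \<in> H3 \<Longrightarrow> v \<in> U \<Longrightarrow> \<tau> w *v v \<in> U" for U v0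
      using that by (rule V.\<tau>_irreducible)
  qed (simp_all add: verma_vec_closed verma_vec_add verma_vec_scalar verma_vec_group verma_vec_vec
      V.lowest V.\<tau>_one)
  obtain \<psi> where \<psi>: "lmod_hom (Hc c) ?M V \<psi>" "\<And>v. \<psi> (verma_vec c \<tau> v) = \<iota> v"
    using verma_universal[OF V.left_module_axioms, of \<iota> \<tau>] V.\<iota>_closed V.\<iota>_add V.\<iota>_scalar V.\<iota>_group V.\<iota>_vec
    by metis
  let ?K = "{u \<in> carrier ?M. \<psi> u = \<zero>\<^bsub>V\<^esub>}"
  have \<psi>s: "\<And>u. u \<in> carrier ?M \<Longrightarrow> \<psi> u \<in> carrier V"
    "\<And>u v. u \<in> carrier ?M \<Longrightarrow> v \<in> carrier ?M \<Longrightarrow> \<psi> (u \<oplus>\<^bsub>?M\<^esub> v) = \<psi> u \<oplus>\<^bsub>V\<^esub> \<psi> v"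
    "\<And>a u. a \<in> carrier (Hc c) \<Longrightarrow> u \<in> carrier ?M \<Longrightarrow> \<psi> (a \<odot>\<^bsub>?M\<^esub> u) = a \<odot>\<^bsub>V\<^esub> \<psi> u"
    using \<psi>(1) by (auto simp: lmod_hom_def)
  have "submodule (\<psi> ` carrier ?M) (Hc c) V"
  proof (rule V.submodule_intro)
    show "\<zero>\<^bsub>V\<^esub> \<in> \<psi> ` carrier ?M"
      using \<psi>s(3)[of "\<zero>\<^bsub>Hc c\<^esub>" "verma_vec c \<tau> 0"] \<psi>s(1)
      by (metis M.\<iota>_closed M.smult_closed V.R.zero_closed V.smult_l_null image_eqI)
    show "u \<oplus>\<^bsub>V\<^esub> v \<in> \<psi> ` carrier ?M" if "u \<in> \<psi> ` carrier ?M" "v \<in> \<psi> ` carrier ?M" for u v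
      using that by (auto simp flip: \<psi>s(2))
    show "a \<odot>\<^bsub>V\<^esub> v \<in> \<psi> ` carrier ?M" if "a \<in> carrier (Hc c)" "v \<in> \<psi> ` carrier ?M" for a v
      using that by (auto simp: M.smult_closed simp flip: \<psi>s(3))
  qed (use \<psi>s(1) in auto)
  moreover have "range \<iota> \<subseteq> \<psi> ` carrier ?M" using \<psi>(2) M.\<iota>_closed by (metis image_subsetI imageI)
  ultimately have surj: "\<psi> ` carrier ?M = carrier V" by (rule V.generated)
  note iso = M.first_isomorphism[OF V.left_module_axioms \<psi>(1) surj]
  obtain g where g: "lmod_iso (Hc c) (quotient_module ?M ?K) V g" using iso(2) by blast
  have irrK: "irreducible_module (Hc c) (quotient_module ?M ?K)"
    by (rule irreducible_transport[OF g irr])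
  have "\<psi> \<zero>\<^bsub>?M\<^esub> = \<zero>\<^bsub>V\<^esub>"
    using M.submoduleD(2)[OF iso(1)] by simp
  then have nz: "verma_vec c \<tau> v0 \<noteq> \<zero>\<^bsub>?M\<^esub>" using \<psi>(2) nonzero by metis
  have "(THE N. submodule N (Hc c) ?M \<and> irreducible_module (Hc c) (quotient_module ?M N)) = ?K"
    by (rule the_equality) (use iso(1) irrK M.irreducible_quotient_unique nz in blast)+
  then show ?thesis using g by (auto simp: simple_L_def)
qed

section \<open>Galois conjugation\<close>

text \<open>The field \<open>\<rat>(\<surd>5)\<close> and its nontrivial automorphism \<open>star\<close>, as functions on the reals; outside the
  field \<open>star\<close> has no meaning.\<close>

definition quad5 :: "real set" where
  "quad5 = {of_rat a + of_rat b * sqrt 5 | a b. True}"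

definition star :: "real \<Rightarrow> real" where
  "star x = (THE y. \<exists>a b. x = of_rat a + of_rat b * sqrt 5 \<and> y = of_rat a - of_rat b * sqrt 5)"

lemma sqrt5_irrational: "of_rat r \<noteq> sqrt 5"
proof
  assume "of_rat r = sqrt 5"
  then have "of_rat (r * r) = (of_rat 5 :: real)" by (simp add: of_rat_mult)
  then have r: "r * r = 5" by (simp only: of_rat_eq_iff)
  obtain p q where pq: "quotient_of r = (p, q)" by (cases "quotient_of r")
  then have q: "q > 0" and cop: "coprime p q" and rq: "r = of_int p / of_int q"
    by (simp_all add: quotient_of_denom_pos quotient_of_coprime quotient_of_div)
  then have "of_int p = r * of_int q" by simp
  then have "of_int (p * p) = (r * r) * (of_int q * of_int q)" by simp
  then have "of_int (p * p) = (of_int (5 * q * q) :: rat)" by (simp add: r)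
  then have e: "p * p = 5 * q * q" by (simp only: of_int_eq_iff)
  then have "5 dvd p * p" by (simp add: mult.assoc)
  then have p5: "5 dvd p" using prime_dvd_mult_iff[of "5::int" p p] by auto
  then obtain k where "p = 5 * k" by auto
  then have "q * q = 5 * (k * k)" using e by simp
  then have "5 dvd q * q" by simp
  then have "5 dvd q" using prime_dvd_mult_iff[of "5::int" q q] by auto
  then have "is_unit (5::int)" using p5 cop coprime_common_divisor by blast
  then show False by simp
qed

lemma star_rat: "star (of_rat a + of_rat b * sqrt 5) = of_rat a - of_rat b * sqrt 5"
proof -
  have "a = a' \<and> b = b'" if e: "of_rat a + of_rat b * sqrt 5 = of_rat a' + of_rat b' * sqrt 5" for a' b'
  proof -
    have b: "b = b'"
    proof (rule ccontr)
      assume "b \<noteq> b'"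
      then have "sqrt 5 = of_rat ((a - a') / (b' - b))"
        using e by (simp add: of_rat_divide of_rat_diff field_simps)
      then show False using sqrt5_irrational by metis
    qed
    then show ?thesis using e by simp
  qed
  then show ?thesis unfolding star_def by (intro the_equality) auto
qed

lemma quad5E:
  assumes "x \<in> quad5"
  obtains a b where "x = of_rat a + of_rat b * sqrt 5" "star x = of_rat a - of_rat b * sqrt 5"
  using assms star_rat by (auto simp: quad5_def)

lemma quad5I: "x = of_rat a + of_rat b * sqrt 5 \<Longrightarrow> x \<in> quad5"
  by (auto simp: quad5_def)

lemma star_eqI: "x = of_rat a + of_rat b * sqrt 5 \<Longrightarrow> y = of_rat a - of_rat b * sqrt 5 \<Longrightarrow> star x = y"
  using star_rat by simp

lemma star_add:
  assumes "x \<in> quad5" "y \<in> quad5"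
  shows "x + y \<in> quad5" "star (x + y) = star x + star y"
proof -
  obtain a b where x: "x = of_rat a + of_rat b * sqrt 5" "star x = of_rat a - of_rat b * sqrt 5"
    using assms(1) by (rule quad5E)
  obtain a' b' where y: "y = of_rat a' + of_rat b' * sqrt 5" "star y = of_rat a' - of_rat b' * sqrt 5"
    using assms(2) by (rule quad5E)
  have e: "x + y = of_rat (a + a') + of_rat (b + b') * sqrt 5"
    using x y by (simp add: of_rat_add algebra_simps)
  show "x + y \<in> quad5" using e by (rule quad5I)
  show "star (x + y) = star x + star y"
    by (rule star_eqI[OF e]) (use x y in \<open>simp add: of_rat_add algebra_simps\<close>)
qed

lemma star_mult:
  assumes "x \<in> quad5" "y \<in> quad5"
  shows "x * y \<in> quad5" "star (x * y) = star x * star y"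
proof -
  obtain a b where x: "x = of_rat a + of_rat b * sqrt 5" "star x = of_rat a - of_rat b * sqrt 5"
    using assms(1) by (rule quad5E)
  obtain a' b' where y: "y = of_rat a' + of_rat b' * sqrt 5" "star y = of_rat a' - of_rat b' * sqrt 5"
    using assms(2) by (rule quad5E)
  have e: "x * y = of_rat (a * a' + 5 * b * b') + of_rat (a * b' + b * a') * sqrt 5"
    using x y by (simp add: of_rat_add of_rat_mult algebra_simps)
  show "x * y \<in> quad5" using e by (rule quad5I)
  show "star (x * y) = star x * star y"
    unfolding x(2) y(2) by (rule star_eqI[OF e]) (simp add: of_rat_add of_rat_mult algebra_simps)
qed

lemma star_of_rat: "of_rat a \<in> quad5" "star (of_rat a) = of_rat a"
  using quad5I[of "of_rat a" a 0] star_rat[of a 0] by auto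

lemma star_num: "0 \<in> quad5" "star 0 = 0" "1 \<in> quad5" "star 1 = 1" "1/2 \<in> quad5" "star (1/2) = 1/2"
  using star_of_rat[of 0] star_of_rat[of 1] star_of_rat[of "1/2"] by (simp_all add: of_rat_divide)

lemma star_minus:
  assumes "x \<in> quad5"
  shows "- x \<in> quad5" "star (- x) = - star x"
  using star_mult[OF star_of_rat(1)[of "-1"] assms] star_of_rat(2)[of "-1"] by (auto simp: of_rat_minus)

lemma star_diff:
  assumes "x \<in> quad5" "y \<in> quad5"
  shows "x - y \<in> quad5" "star (x - y) = star x - star y"
  using star_add[OF assms(1) star_minus(1)[OF assms(2)]] star_minus[OF assms(2)] by auto

lemma star_golden: "golden \<in> quad5" "star golden = 1 - golden"
proof -
  have e: "golden = of_rat (1/2) + of_rat (1/2) * sqrt 5"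
    by (simp add: golden_def of_rat_divide)
  show "golden \<in> quad5" using e by (rule quad5I)
  show "star golden = 1 - golden"
    by (rule star_eqI[OF e]) (simp add: golden_def of_rat_divide field_simps)
qed

lemma star_sum:
  assumes "\<And>i. i \<in> I \<Longrightarrow> f i \<in> quad5"
  shows "sum f I \<in> quad5 \<and> star (sum f I) = (\<Sum>i\<in>I. star (f i))"
  using assms by (induction I rule: infinite_finite_induct) (auto simp: star_num star_add)

lemmas star_rules = star_num star_golden star_minus star_add star_diff star_mult

section \<open>The rotations of the icosahedron\<close>

text \<open>The columns of a rotation are determined by the images \<open>p\<close> and \<open>q\<close> of the two vertices
  \<open>(0, 1, \<gamma>)\<close> and \<open>(0, -1, \<gamma>)\<close>, whose difference and sum are \<open>2 e\<^sub>2\<close> and \<open>2 \<gamma> e\<^sub>3\<close>. The parameter \<open>h\<close> is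
  \<open>\<gamma>\<^sup>-\<^sup>1 = \<gamma> - 1\<close>.\<close>

definition frame :: "real \<Rightarrow> real^3 \<Rightarrow> real^3 \<Rightarrow> mat3" where
  "frame h p q = (let u = (1/2) *\<^sub>R (p - q); v = (1/2 * h) *\<^sub>R (p + q); n = cross3 u v
    in \<chi> i j. if j = 1 then n $ i else if j = 2 then u $ i else v $ i)"

lemma frame_apply:
  "frame h p q $ 1 $ 1 = (1/2*(p$2-q$2))*(1/2*h*(p$3+q$3)) - (1/2*(p$3-q$3))*(1/2*h*(p$2+q$2))"
  "frame h p q $ 2 $ 1 = (1/2*(p$3-q$3))*(1/2*h*(p$1+q$1)) - (1/2*(p$1-q$1))*(1/2*h*(p$3+q$3))"
  "frame h p q $ 3 $ 1 = (1/2*(p$1-q$1))*(1/2*h*(p$2+q$2)) - (1/2*(p$2-q$2))*(1/2*h*(p$1+q$1))"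
  "frame h p q $ i $ 2 = 1/2*(p$i-q$i)" "frame h p q $ i $ 3 = 1/2*h*(p$i+q$i)"
  by (simp_all add: frame_def Let_def cross3_def)

text \<open>Pairs of adjacent vertices thus parametrise the sixty rotations.\<close>

lemma rotation_frame:
  assumes w: "w \<in> H3" "det w = 1"
  shows "\<exists>p\<in>icosahedron_vertices. \<exists>q\<in>icosahedron_vertices. p \<bullet> q = golden \<and> w = frame (golden - 1) p q"
proof -
  let ?v1 = "vector [0, 1, golden] :: real^3" and ?v2 = "vector [0, -1, golden] :: real^3"
  define p q where "p = w *v ?v1" and "q = w *v ?v2"
  have o: "orthogonal_matrix w" using w H3_orthogonal by auto
  have "?v1 \<in> icosahedron_vertices" "?v2 \<in> icosahedron_vertices"
    by (auto simp: icosahedron_vertices_def)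
  then have mem: "p \<in> icosahedron_vertices" "q \<in> icosahedron_vertices"
    using w by (auto simp: p_def q_def H3_def)
  have "p \<bullet> q = ?v1 \<bullet> ?v2" using inner_orthogonal[OF o] by (simp add: p_def q_def)
  also have "\<dots> = golden" by (simp add: inner_vec_def sum_3 golden_eqs)
  finally have pq: "p \<bullet> q = golden" .
  have gi: "golden * (golden - 1) = 1" by (simp add: algebra_simps golden_eqs)
  have u: "w *v axis 2 1 = (1/2) *\<^sub>R (p - q)"
  proof -
    have "axis 2 1 = (1/2) *\<^sub>R (?v1 - ?v2)" by (simp add: vec_eq_iff forall_3 axis_def)
    then show ?thesis
      by (simp only: p_def q_def matrix_vector_mult_scaleR matrix_vector_mult_diff_distrib)
  qed
  have v: "w *v axis 3 1 = (1/2 * (golden - 1)) *\<^sub>R (p + q)"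
  proof -
    have "axis 3 1 = (1/2 * (golden - 1)) *\<^sub>R (?v1 + ?v2)"
      using gi by (simp add: vec_eq_iff forall_3 axis_def mult.commute)
    then show ?thesis
      by (simp only: p_def q_def matrix_vector_mult_scaleR matrix_vector_right_distrib)
  qed
  have "cross3 (axis 2 1) (axis 3 1) = (axis 1 1 :: real^3)"
    by (simp add: cross3_def vec_eq_iff forall_3 axis_def)
  then have n: "w *v axis 1 1 = cross3 (w *v axis 2 1) (w *v axis 3 1)"
    using cross_orthogonal_matrix[OF o, of "axis 2 1" "axis 3 1"] w by simp
  have col: "w $ i $ j = (w *v axis j 1) $ i" for i j
    by (simp add: matrix_vector_mult_def axis_def if_distrib cong: if_cong)
  have "w $ i $ j = frame (golden - 1) p q $ i $ j" for i j
    unfolding col using exhaust_3[of j] by (auto simp: frame_def Let_def n u v)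
  then have "w = frame (golden - 1) p q" by (simp add: vec_eq_iff)
  then show ?thesis using mem pq by blast
qed

lemma H3_det: "w \<in> H3 \<Longrightarrow> det w = 1 \<or> det w = -1"
  using H3_orthogonal det_orthogonal_matrix by blast

lemma H3_minus: "w \<in> H3 \<Longrightarrow> - w \<in> H3"
proof -
  assume w: "w \<in> H3"
  have n: "- v \<in> icosahedron_vertices" if "v \<in> icosahedron_vertices" for v
  proof -
    have neg: "- vector [a, b, c] = (vector [- a, - b, - c] :: real^3)" for a b c
      by (simp add: vec_eq_iff forall_3)
    show ?thesis using that unfolding icosahedron_vertices_def by (auto simp: neg)
  qed
  then have nn: "uminus ` icosahedron_vertices = icosahedron_vertices"
    by (metis (no_types, opaque_lifting) image_eqI image_subsetI subsetI subset_antisym verit_minus_simplify(4))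
  have "(*v) (- w) ` icosahedron_vertices = uminus ` ((*v) w ` icosahedron_vertices)"
  proof -
    have "(- w) *v v = - (w *v v)" for v
      by (simp add: vec_eq_iff matrix_vector_mult_def sum_negf)
    then show ?thesis by (simp add: image_image)
  qed
  moreover have "orthogonal_matrix (- w)"
  proof -
    have "transpose (- w) ** (- w) = transpose w ** w" "(- w) ** transpose (- w) = w ** transpose w"
      by (simp_all add: vec_eq_iff matrix_matrix_mult_def transpose_def)
    then show ?thesis using w by (simp add: H3_def orthogonal_matrix_def)
  qed
  ultimately show ?thesis using w nn by (simp add: H3_def)
qed

lemma det_minus3: "det (- w) = - det (w::mat3)"
  by (simp add: det_3)

lemma vertex_quad5:
  assumes "p \<in> icosahedron_vertices" shows "p $ i \<in> quad5"
  using assms exhaust_3[of i] unfolding icosahedron_vertices_def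
  by (auto simp: star_rules)

lemma frame_quad5:
  assumes "\<And>i. p $ i \<in> quad5" "\<And>i. q $ i \<in> quad5"
  shows "frame (golden - 1) p q $ i $ j \<in> quad5"
  using exhaust_3[of i] exhaust_3[of j]
  by (elim disjE; simp only: frame_apply) (simp_all only: frame_apply star_rules assms)

text \<open>All symmetries are defined over \<open>\<rat>(\<surd>5)\<close>, so the Galois conjugation acts on their matrices.\<close>

lemma H3_quad5:
  assumes "w \<in> H3" shows "w $ i $ j \<in> quad5"
proof -
  have rot: "w $ i $ j \<in> quad5" if "w \<in> H3" "det w = 1" for w
    using rotation_frame[OF that] frame_quad5 vertex_quad5 by metis
  from H3_det[OF assms] show ?thesis
  proof
    assume "det w = -1"
    then have "(- w) $ i $ j \<in> quad5" using rot[OF H3_minus[OF assms]] det_minus3 by simp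
    then show ?thesis using star_minus(1)[of "- (w $ i $ j)"] by simp
  qed (use rot assms in auto)
qed

definition conj_mat :: "mat3 \<Rightarrow> mat3" where
  "conj_mat = map_matrix star"

lemma conj_mat_mult: "w \<in> H3 \<Longrightarrow> w' \<in> H3 \<Longrightarrow> conj_mat (w ** w') = conj_mat w ** conj_mat w'"
  using star_sum[of UNIV "\<lambda>k. w $ i $ k * w' $ k $ j" for i j]
  by (simp add: conj_mat_def vec_eq_iff matrix_matrix_mult_def star_mult H3_quad5)

lemma conj_mat_one: "conj_mat (mat 1) = mat 1"
  by (simp add: conj_mat_def vec_eq_iff mat_def star_num)

lemma conj_mat_minus: "w \<in> H3 \<Longrightarrow> conj_mat (- w) = - conj_mat w"
  by (simp add: conj_mat_def vec_eq_iff star_minus H3_quad5)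

section \<open>Exact arithmetic in \<open>\<int>[\<gamma>]\<close>\<close>

text \<open>The pair \<open>(a, b)\<close> stands for \<open>a + b \<gamma>\<close> with \<open>\<gamma>\<^sup>2 = \<gamma> + 1\<close>. The finitely many
  numerical facts about the icosahedron are evaluated in this ring.\<close>

type_synonym zg = "int \<times> int"

definition zval :: "zg \<Rightarrow> real" where
  "zval z = of_int (fst z) + of_int (snd z) * golden"

fun zadd :: "zg \<Rightarrow> zg \<Rightarrow> zg" where "zadd (a, b) (c, d) = (a + c, b + d)"
fun zsub :: "zg \<Rightarrow> zg \<Rightarrow> zg" where "zsub (a, b) (c, d) = (a - c, b - d)"
fun zmul :: "zg \<Rightarrow> zg \<Rightarrow> zg" where "zmul (a, b) (c, d) = (a * c + b * d, a * d + b * c + b * d)"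
fun zconj :: "zg \<Rightarrow> zg" where "zconj (a, b) = (a + b, - b)"

lemma zval_add: "zval (zadd x y) = zval x + zval y"
  by (cases x; cases y) (simp add: zval_def algebra_simps)

lemma zval_sub: "zval (zsub x y) = zval x - zval y"
  by (cases x; cases y) (simp add: zval_def algebra_simps)

lemma zval_mul: "zval (zmul x y) = zval x * zval y"
proof -
  obtain a b c d where xy: "x = (a, b)" "y = (c, d)" by (cases x; cases y)
  have "zval x * zval y = of_int (a * c) + of_int (a * d + b * c) * golden + of_int (b * d) * (golden * golden)"
    by (simp add: xy zval_def algebra_simps)
  also have "\<dots> = zval (zmul x y)" by (simp add: xy zval_def golden_eqs algebra_simps)
  finally show ?thesis ..
qed

lemma zval_quad5: "zval z \<in> quad5" and zval_conj: "star (zval z) = zval (zconj z)"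
proof -
  obtain a b where z: "z = (a, b)" by (cases z)
  have i: "of_int n \<in> quad5" "star (of_int n) = of_int n" for n
    using star_of_rat[of "of_int n"] by simp_all
  show "zval z \<in> quad5" by (simp add: z zval_def star_rules i)
  show "star (zval z) = zval (zconj z)" by (simp add: z zval_def star_rules i algebra_simps)
qed

lemma zval_inject: "zval x = zval y \<longleftrightarrow> x = y"
proof -
  obtain a b c d where xy: "x = (a, b)" "y = (c, d)" by (cases x; cases y)
  have "a = c \<and> b = d" if e: "zval x = zval y"
  proof -
    have "(of_int (b - d) :: real) * golden = of_int (c - a)"
      using e by (simp add: xy zval_def algebra_simps)
    moreover have "golden * 2 = 1 + sqrt 5" by (simp add: golden_def)
    ultimately have "of_int (b - d) * (1 + sqrt 5) = of_int (c - a) * 2" by (metis mult.assoc)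
    then have "of_int (b - d) * sqrt 5 = of_int (2 * (c - a) - (b - d))"
      by (simp add: algebra_simps)
    moreover have False if "sqrt 5 = of_int m / of_int n" for m n
      using sqrt5_irrational[of "of_int m / of_int n"] that by (simp add: of_rat_divide)
    ultimately have "b = d" by (metis eq_divide_eq mult.commute of_int_eq_0_iff right_minus_eq)
    then show ?thesis using e by (simp add: xy zval_def)
  qed
  then show ?thesis using xy by auto
qed

definition ix3 :: "3 \<Rightarrow> nat" where "ix3 i = (if i = 1 then 0 else if i = 2 then 1 else 2)"

lemma ix3_simps [simp]: "ix3 1 = 0" "ix3 2 = 1" "ix3 3 = 2" by (simp_all add: ix3_def)

definition zvec :: "zg list \<Rightarrow> real^3" where "zvec v = (\<chi> i. zval (v ! ix3 i))"

text \<open>The denominator \<open>4\<close> clears the halves in the frame of two vertices and in a reflection.\<close>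

definition zmat :: "zg list list \<Rightarrow> mat3" where "zmat m = (\<chi> i j. zval (m ! ix3 i ! ix3 j) / 4)"

definition vertex_table :: "zg list list" where
  "vertex_table = [[(0,0),(1,0),(0,1)], [(0,0),(1,0),(0,-1)], [(0,0),(-1,0),(0,1)], [(0,0),(-1,0),(0,-1)],
    [(1,0),(0,1),(0,0)], [(1,0),(0,-1),(0,0)], [(-1,0),(0,1),(0,0)], [(-1,0),(0,-1),(0,0)],
    [(0,1),(0,0),(1,0)], [(0,1),(0,0),(-1,0)], [(0,-1),(0,0),(1,0)], [(0,-1),(0,0),(-1,0)]]"

fun zdot :: "zg list \<Rightarrow> zg list \<Rightarrow> zg" where
  "zdot [a, b, c] [d, e, f] = zadd (zmul a d) (zadd (zmul b e) (zmul c f))"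
| "zdot _ _ = (0, 0)"

fun zframe :: "zg list \<Rightarrow> zg list \<Rightarrow> zg list list" where
  "zframe [p1, p2, p3] [q1, q2, q3] =
    (let u1 = zsub p1 q1; u2 = zsub p2 q2; u3 = zsub p3 q3; h = (-1, 1);
         v1 = zmul h (zadd p1 q1); v2 = zmul h (zadd p2 q2); v3 = zmul h (zadd p3 q3)
     in [[zsub (zmul u2 v3) (zmul u3 v2), zmul (2, 0) u1, zmul (2, 0) v1],
         [zsub (zmul u3 v1) (zmul u1 v3), zmul (2, 0) u2, zmul (2, 0) v2],
         [zsub (zmul u1 v2) (zmul u2 v1), zmul (2, 0) u3, zmul (2, 0) v3]])"
| "zframe _ _ = []"

definition rotation_table :: "zg list list list" where
  "rotation_table = concat (map (\<lambda>p. map (zframe p) (filter (\<lambda>q. zdot p q = (0, 1)) vertex_table)) vertex_table)"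

text \<open>Twice the unit normals of the mirrors.\<close>

definition root_table :: "zg list list" where
  "root_table = [[(2,0),(0,0),(0,0)], [(0,0),(2,0),(0,0)], [(0,0),(0,0),(2,0)],
    [(1,0),(-1,1),(0,1)], [(1,0),(-1,1),(0,-1)], [(1,0),(1,-1),(0,1)], [(1,0),(1,-1),(0,-1)],
    [(0,1),(1,0),(-1,1)], [(0,-1),(1,0),(-1,1)], [(0,1),(1,0),(1,-1)], [(0,-1),(1,0),(1,-1)],
    [(-1,1),(0,1),(1,0)], [(-1,1),(0,-1),(1,0)], [(1,-1),(0,1),(1,0)], [(1,-1),(0,-1),(1,0)]]"

fun zrefl :: "zg list \<Rightarrow> zg list list" where
  "zrefl [a, b, c] =
    [[zsub (4, 0) (zmul (2, 0) (zmul a a)), zmul (-2, 0) (zmul a b), zmul (-2, 0) (zmul a c)],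
     [zmul (-2, 0) (zmul b a), zsub (4, 0) (zmul (2, 0) (zmul b b)), zmul (-2, 0) (zmul b c)],
     [zmul (-2, 0) (zmul c a), zmul (-2, 0) (zmul c b), zsub (4, 0) (zmul (2, 0) (zmul c c))]]"
| "zrefl _ = []"

fun ztrace :: "zg list list \<Rightarrow> zg" where
  "ztrace [[a, b, c], [d, e, f], [g, h, i]] = zadd a (zadd e i)"
| "ztrace _ = (0, 0)"

definition zneg :: "zg list list \<Rightarrow> zg list list" where
  "zneg = map (map (zmul (-1, 0)))"

definition zstar :: "zg list list \<Rightarrow> zg list list" where
  "zstar = map (map zconj)"

text \<open>The trace of the four-dimensional representation on the pair of a symmetry and its Galois conjugate.
  It is needed in this form for evaluation in \<open>\<int>[\<gamma>]\<close>; \<open>trace_dmat\<close> gives the agreement.\<close>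

definition dtrace :: "mat3 \<Rightarrow> mat3 \<Rightarrow> real" where
  "dtrace w u = w$1$1*u$1$1 + w$1$2*u$1$2 + w$1$3*u$1$3
     + ((w$2$2*u$3$3 + w$3$3*u$1$1 + w$1$1*u$2$2) + (golden - 1) * (golden - 1) * (w$2$3*u$3$2 + w$3$1*u$1$3 + w$1$2*u$2$1))"

fun zdtrace :: "zg list list \<Rightarrow> zg list list \<Rightarrow> zg" where
  "zdtrace [[a, b, c], [d, e, f], [g, h, i]] [[a', b', c'], [d', e', f'], [g', h', i']]
    = zadd (zadd (zmul a a') (zadd (zmul b b') (zmul c c')))
       (zadd (zadd (zmul e i') (zadd (zmul i a') (zmul a e')))
         (zmul (2, -1) (zadd (zmul f h') (zadd (zmul g c') (zmul b d')))))"
| "zdtrace _ _ = (0, 0)"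

text \<open>The character table of the alternating group of degree five, restricted to the characters of degrees
  three, three and four. The scaling is by \<open>4\<close>, \<open>4\<close> and \<open>16\<close>.\<close>

lemma rotation_table_traces:
  "list_all (\<lambda>m. (ztrace m, ztrace (zstar m), zdtrace m (zstar m)) \<in>
     {((12,0), (12,0), (64,0)), ((-4,0), (-4,0), (0,0)), ((0,0), (0,0), (16,0)),
      ((0,4), (4,-4), (-16,0)), ((4,-4), (0,4), (-16,0))}) rotation_table"
  by code_simp

lemma rotation_table_half_turns:
  "list_all (\<lambda>m. ztrace m = (-4, 0) \<longrightarrow> zneg m \<in> set (map zrefl root_table)) rotation_table"
  by code_simp

lemma distinct_refl_table: "distinct (map zrefl root_table)"
  by code_simp

definition zsum :: "zg list \<Rightarrow> zg" where "zsum xs = foldr zadd xs (0, 0)"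

definition zdelta :: "zg list list \<Rightarrow> nat \<Rightarrow> nat \<Rightarrow> zg" where
  "zdelta m i j = zsub (if i = j then (4, 0) else (0, 0)) (m!i!j)"

text \<open>The counterpart in \<open>\<int>[\<gamma>]\<close> of the matrix \<open>dmat\<close> of the four-dimensional representation, up to the
  factor \<open>16\<close>.\<close>

fun zrow :: "zg list \<Rightarrow> zg list \<Rightarrow> zg list" where
  "zrow [a, b, c] [a', b', c'] =
    [zadd (zmul a a') (zadd (zmul b b') (zmul c c')),
     zadd (zmul (0, 1) (zmul b c')) (zmul (-1, 1) (zmul c b')),
     zadd (zmul (0, 1) (zmul c a')) (zmul (-1, 1) (zmul a c')),
     zadd (zmul (0, 1) (zmul a b')) (zmul (-1, 1) (zmul b a'))]"
| "zrow _ _ = []"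

fun zdmat :: "zg list list \<Rightarrow> zg list list \<Rightarrow> zg list list" where
  "zdmat [m1, m2, m3] [u1, u2, u3] = [zrow m1 u1, map (zmul (-1, 1)) (zrow m2 u3),
      map (zmul (-1, 1)) (zrow m3 u1), map (zmul (-1, 1)) (zrow m1 u2)]"
| "zdmat _ _ = []"

definition refl_table :: "zg list list list" where "refl_table = map zrefl root_table"

text \<open>The matrices \<open>\<Sum>\<^sub>s (1 - s)\<^sub>i\<^sub>j \<rho>(s)\<close> for \<open>i \<le> j\<close>; they are all that the commutator of \<open>y\<close> and \<open>x\<close> sees
  of the reflections.\<close>

definition moment_table :: "nat list \<Rightarrow> (zg list list \<times> zg list list) list \<Rightarrow> zg list list list" where
  "moment_table ks t = map (\<lambda>(i, j). map (\<lambda>k. map (\<lambda>l. zsum (map (\<lambda>(m, u). zmul (zdelta m i j) (u!k!l)) t))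
      ks) ks) [(0,0), (1,1), (2,2), (0,1), (0,2), (1,2)]"

definition sum_table :: "zg list list list \<Rightarrow> zg list list" where
  "sum_table t = map (\<lambda>k. map (\<lambda>l. zsum (map (\<lambda>u. u!k!l) t)) [0,1,2]) [0,1,2]"

lemma sum_table_eval: "sum_table (map zstar refl_table)
    = [[(20,0), (0,0), (0,0)], [(0,0), (20,0), (0,0)], [(0,0), (0,0), (20,0)]]"
  by code_simp

lemma moment_table_3: "moment_table [0,1,2] (map (\<lambda>m. (m, zstar m)) refl_table)
   = [[[(48,0), (0,0), (0,0)], [(0,0), (48,16), (0,0)], [(0,0), (0,0), (64,-16)]],
     [[(64,-16), (0,0), (0,0)], [(0,0), (48,0), (0,0)], [(0,0), (0,0), (48,16)]],
     [[(48,16), (0,0), (0,0)], [(0,0), (64,-16), (0,0)], [(0,0), (0,0), (48,0)]],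
     [[(0,0), (16,0), (0,0)], [(16,0), (0,0), (0,0)], [(0,0), (0,0), (0,0)]],
     [[(0,0), (0,0), (16,0)], [(0,0), (0,0), (0,0)], [(16,0), (0,0), (0,0)]],
     [[(0,0), (0,0), (0,0)], [(0,0), (0,0), (16,0)], [(0,0), (16,0), (0,0)]]]"
  by code_simp

lemma moment_table_4: "moment_table [0,1,2,3] (map (\<lambda>m. (m, zdmat m (zstar m))) refl_table)
   = [[[(0,0), (0,0), (0,0), (0,0)], [(0,0), (128,0), (0,0), (0,0)], [(0,0), (0,0), (-128,128), (0,0)], [(0,0), (0,0), (0,0), (0,-128)]],
     [[(0,0), (0,0), (0,0), (0,0)], [(0,0), (0,-128), (0,0), (0,0)], [(0,0), (0,0), (128,0), (0,0)], [(0,0), (0,0), (0,0), (-128,128)]],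
     [[(0,0), (0,0), (0,0), (0,0)], [(0,0), (-128,128), (0,0), (0,0)], [(0,0), (0,0), (0,-128), (0,0)], [(0,0), (0,0), (0,0), (128,0)]],
     [[(0,0), (0,0), (0,0), (64,-128)], [(0,0), (0,0), (-64,0), (0,0)], [(0,0), (-64,0), (0,0), (0,0)], [(64,-128), (0,0), (0,0), (0,0)]],
     [[(0,0), (0,0), (64,-128), (0,0)], [(0,0), (0,0), (0,0), (-64,0)], [(64,-128), (0,0), (0,0), (0,0)], [(0,0), (-64,0), (0,0), (0,0)]],
     [[(0,0), (64,-128), (0,0), (0,0)], [(64,-128), (0,0), (0,0), (0,0)], [(0,0), (0,0), (0,0), (-64,0)], [(0,0), (0,0), (-64,0), (0,0)]]]"
  by code_simp

definition vertices_preserved :: "zg list list \<Rightarrow> bool" where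
  "vertices_preserved m = list_all (\<lambda>v. map (\<lambda>r. zdot r v) m \<in> set (map (map (zmul (4, 0))) vertex_table)) vertex_table"

lemma refl_table_vertices: "list_all vertices_preserved refl_table"
  by code_simp

lemma root_table_norm: "list_all (\<lambda>r. zdot r r = (4, 0) \<and> length r = 3) root_table"
  by code_simp

definition square3 :: "zg list list \<Rightarrow> bool" where
  "square3 m \<longleftrightarrow> length m = 3 \<and> (\<forall>r\<in>set m. length r = 3)"

lemma square3E:
  assumes "square3 m"
  obtains a b c d e f g h i where "m = [[a, b, c], [d, e, f], [g, h, i]]"
  using assms unfolding square3_def by (auto simp: length_Suc_conv numeral_3_eq_3)

lemma zval_simps: "zval (a, b) = of_int a + of_int b * golden"
  by (simp add: zval_def)

lemma zmat_entries:
  "zmat [[a, b, c], [d, e, f], [g, h, i]] $ 1 $ 1 = zval a / 4"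
  "zmat [[a, b, c], [d, e, f], [g, h, i]] $ 1 $ 2 = zval b / 4"
  "zmat [[a, b, c], [d, e, f], [g, h, i]] $ 1 $ 3 = zval c / 4"
  "zmat [[a, b, c], [d, e, f], [g, h, i]] $ 2 $ 1 = zval d / 4"
  "zmat [[a, b, c], [d, e, f], [g, h, i]] $ 2 $ 2 = zval e / 4"
  "zmat [[a, b, c], [d, e, f], [g, h, i]] $ 2 $ 3 = zval f / 4"
  "zmat [[a, b, c], [d, e, f], [g, h, i]] $ 3 $ 1 = zval g / 4"
  "zmat [[a, b, c], [d, e, f], [g, h, i]] $ 3 $ 2 = zval h / 4"
  "zmat [[a, b, c], [d, e, f], [g, h, i]] $ 3 $ 3 = zval i / 4"
  by (simp_all add: zmat_def)

lemma zvec_entries: "zvec [a, b, c] $ 1 = zval a" "zvec [a, b, c] $ 2 = zval b" "zvec [a, b, c] $ 3 = zval c"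
  by (simp_all add: zvec_def)

lemma conj_zmat: "square3 m \<Longrightarrow> conj_mat (zmat m) = zmat (zstar m)"
proof -
  assume "square3 m"
  then obtain a b c d e f g h i where m: "m = [[a, b, c], [d, e, f], [g, h, i]]" by (rule square3E)
  have q: "star (zval z / 4) = zval (zconj z) / 4" for z
    using star_mult(2)[OF zval_quad5[of z] star_of_rat(1)[of "1/4"]] star_of_rat(2)[of "1/4"]
    by (simp add: zval_conj of_rat_divide)
  show ?thesis
    by (simp add: m vec_eq_iff forall_3 zstar_def zmat_entries q conj_mat_def)
qed

lemma zstar_square3: "square3 m \<Longrightarrow> square3 (zstar m)"
  by (auto simp: square3_def zstar_def)

lemma zmat_inj: "square3 m \<Longrightarrow> square3 m' \<Longrightarrow> zmat m = zmat m' \<Longrightarrow> m = m'"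
  by (elim square3E) (simp add: vec_eq_iff forall_3 zmat_entries zval_inject)

lemma vertices_zvec: "icosahedron_vertices = zvec ` set vertex_table"
proof -
  have e: "zvec [a, b, c] = vector [zval a, zval b, zval c]" for a b c
    by (simp add: vec_eq_iff forall_3 zvec_entries)
  show ?thesis
    unfolding vertex_table_def icosahedron_vertices_def
    by (simp add: e zval_simps insert_commute)
qed

lemma vertex_length: "v \<in> set vertex_table \<Longrightarrow> \<exists>a b c. v = [a, b, c]"
  by (auto simp: vertex_table_def)

lemma zmat_frame: "zmat (zframe [a, b, c] [d, e, f]) = frame (golden - 1) (zvec [a, b, c]) (zvec [d, e, f])"
  by (simp add: vec_eq_iff forall_3 Let_def zmat_entries frame_apply zvec_entries zval_sub zval_mul zval_add zval_simps
      field_simps)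

lemma zdot_inner: "zval (zdot [a, b, c] [d, e, f]) = zvec [a, b, c] \<bullet> zvec [d, e, f]"
  by (simp add: zval_add zval_mul inner_vec_def sum_3 zvec_entries)

lemma rotation_in_table:
  assumes w: "w \<in> H3" "det w = 1"
  obtains m where "m \<in> set rotation_table" "square3 m" "w = zmat m"
proof -
  obtain p q where pq: "p \<in> icosahedron_vertices" "q \<in> icosahedron_vertices" "p \<bullet> q = golden"
    "w = frame (golden - 1) p q" using rotation_frame[OF w] by blast
  then obtain P Q where PQ: "P \<in> set vertex_table" "p = zvec P" "Q \<in> set vertex_table" "q = zvec Q"
    by (auto simp: vertices_zvec)
  obtain a b c d e f where abc: "P = [a, b, c]" "Q = [d, e, f]" using PQ vertex_length by metis
  have "zval (zdot P Q) = zval (0, 1)" using pq(3) PQ abc zdot_inner by (simp add: zval_simps)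
  then have "zdot P Q = (0, 1)" by (simp only: zval_inject)
  then have "zframe P Q \<in> set rotation_table" using PQ by (auto simp: rotation_table_def)
  moreover have "square3 (zframe P Q)" by (simp add: abc square3_def Let_def)
  moreover have "w = zmat (zframe P Q)" using pq PQ abc zmat_frame by simp
  ultimately show thesis using that by blast
qed

lemma trace_zmat: "square3 m \<Longrightarrow> trace (zmat m) = zval (ztrace m) / 4"
  by (elim square3E) (simp add: trace_def sum_3 zmat_entries zval_add add_divide_distrib)

lemma dtrace_zmat: "square3 m \<Longrightarrow> square3 u \<Longrightarrow> dtrace (zmat m) (zmat u) = zval (zdtrace m u) / 16"
proof (elim square3E)
  fix a b c d e f g h i a' b' c' d' e' f' g' h' i'
  assume m: "m = [[a, b, c], [d, e, f], [g, h, i]]" and u: "u = [[a', b', c'], [d', e', f'], [g', h', i']]"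
  have gg: "(golden - 1) * (golden - 1) = 2 - golden" by (simp add: algebra_simps golden_eqs)
  show ?thesis
    by (simp add: m u dtrace_def zmat_entries zval_add zval_mul gg) (simp add: zval_simps field_simps)
qed

text \<open>The values on rotations of the characters of the rotation representation, of its Galois
  conjugate and of the four dimensional representation constructed below.\<close>

lemma rotation_traces:
  assumes w: "w \<in> H3" "det w = 1"
  shows "(trace w, trace (conj_mat w), dtrace w (conj_mat w)) \<in>
    {(3, 3, 4), (-1, -1, 0), (0, 0, 1), (golden, 1 - golden, -1), (1 - golden, golden, -1)}"
proof -
  obtain m where m: "m \<in> set rotation_table" "square3 m" "w = zmat m"
    using rotation_in_table[OF w] by blast
  have "(ztrace m, ztrace (zstar m), zdtrace m (zstar m)) \<in>
     {((12,0), (12,0), (64,0)), ((-4,0), (-4,0), (0,0)), ((0,0), (0,0), (16,0)),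
      ((0,4), (4,-4), (-16,0)), ((4,-4), (0,4), (-16,0))}"
    using rotation_table_traces m(1) by (simp only: list_all_iff)
  moreover have "trace w = zval (ztrace m) / 4" "trace (conj_mat w) = zval (ztrace (zstar m)) / 4"
    "dtrace w (conj_mat w) = zval (zdtrace m (zstar m)) / 16"
    by (simp_all only: m(3) conj_zmat[OF m(2)] trace_zmat[OF m(2)] trace_zmat[OF zstar_square3[OF m(2)]]
        dtrace_zmat[OF m(2) zstar_square3[OF m(2)]])
  ultimately show ?thesis
    by (elim insertE emptyE) (simp_all only: prod.inject, simp_all add: zval_simps diff_divide_distrib)
qed

lemma root_table_list: "r \<in> set root_table \<Longrightarrow> \<exists>a b c. r = [a, b, c]"
  using root_table_norm by (auto simp: list_all_iff length_Suc_conv numeral_3_eq_3)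

lemma refl_table_square3: "m \<in> set refl_table \<Longrightarrow> square3 m"
  using root_table_list by (fastforce simp: refl_table_def square3_def)

lemma zmat_zrefl: "zmat (zrefl [a, b, c]) = refl_matrix ((1/2) *\<^sub>R zvec [a, b, c])"
  by (simp add: vec_eq_iff forall_3 zmat_entries refl_matrix_def zvec_entries zval_sub zval_mul zval_simps)

lemma refl_matrix_orthogonal:
  assumes "n \<bullet> n = 1" shows "orthogonal_matrix (refl_matrix n)" "refl_matrix n ** refl_matrix n = mat 1"
proof -
  have "refl_matrix n *v (refl_matrix n *v v) = v" for v
    by (simp add: refl_matrix_apply inner_diff_right assms)
  then have "(refl_matrix n ** refl_matrix n) *v v = mat 1 *v v" for v
    by (simp add: matrix_vector_mul_assoc[symmetric])
  then show s: "refl_matrix n ** refl_matrix n = mat 1" using matrix_eq by blast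
  have "transpose (refl_matrix n) = refl_matrix n"
    by (auto simp: refl_matrix_def transpose_def vec_eq_iff)
  then show "orthogonal_matrix (refl_matrix n)" using s by (simp add: orthogonal_matrix_def)
qed

text \<open>A reflection is the negative of a rotation with trace \<open>-1\<close>, so the list of rotations yields all
  reflections; conversely the listed mirrors preserve the vertices.\<close>

lemma reflections_table: "reflections = zmat ` set refl_table"
proof
  show "zmat ` set refl_table \<subseteq> reflections"
  proof
    fix s assume "s \<in> zmat ` set refl_table"
    then obtain r where r: "r \<in> set root_table" "s = zmat (zrefl r)" by (auto simp: refl_table_def)
    obtain a b c where abc: "r = [a, b, c]" using root_table_list[OF r(1)] by blast
    define n where "n = (1/2) *\<^sub>R zvec r"
    have s: "s = refl_matrix n" using r abc zmat_zrefl n_def by simp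
    have "zdot r r = (4, 0)" using root_table_norm r(1) by (simp add: list_all_iff)
    then have "zvec r \<bullet> zvec r = 4" using zdot_inner[of a b c a b c] by (simp add: abc zval_simps)
    then have nn: "n \<bullet> n = 1" by (simp add: n_def)
    have sq: "square3 (zrefl r)" using r refl_table_square3 by (simp add: refl_table_def)
    have "s *v v \<in> icosahedron_vertices" if v: "v \<in> icosahedron_vertices" for v
    proof -
      obtain V where V: "V \<in> set vertex_table" "v = zvec V" using v by (auto simp: vertices_zvec)
      obtain d e f where def: "V = [d, e, f]" using vertex_length[OF V(1)] by blast
      have "vertices_preserved (zrefl r)"
        using refl_table_vertices r(1) by (simp add: list_all_iff refl_table_def)
      then obtain U where U: "U \<in> set vertex_table" "map (\<lambda>x. zdot x V) (zrefl r) = map (zmul (4, 0)) U"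
        using V(1) by (auto simp: vertices_preserved_def list_all_iff)
      obtain x y z where xyz: "U = [x, y, z]" using vertex_length[OF U(1)] by blast
      obtain m1 m2 m3 m4 m5 m6 m7 m8 m9 where M: "zrefl r = [[m1, m2, m3], [m4, m5, m6], [m7, m8, m9]]"
        using sq by (rule square3E)
      have zz: "zdot [m1, m2, m3] V = zmul (4, 0) x" "zdot [m4, m5, m6] V = zmul (4, 0) y"
        "zdot [m7, m8, m9] V = zmul (4, 0) z" using U(2) by (simp_all add: M xyz del: zdot.simps zmul.simps)
      have four: "zval (4, 0) = 4" by (simp add: zval_simps)
      have "zmat (zrefl r) *v v = zvec U"
        using arg_cong[OF zz(1), of zval] arg_cong[OF zz(2), of zval] arg_cong[OF zz(3), of zval]
        unfolding def zdot_inner zval_mul four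
        by (simp add: M V(2) def xyz vec_eq_iff forall_3 matrix_vector_mult_def sum_3 zmat_entries zvec_entries
            inner_vec_def add_divide_distrib[symmetric])
      then show ?thesis using U(1) r(2) by (auto simp: vertices_zvec)
    qed
    then have sub: "(*v) s ` icosahedron_vertices \<subseteq> icosahedron_vertices" by blast
    have "inj ((*v) s)"
    proof (rule injI)
      fix u v assume "s *v u = s *v v"
      then have "s *v (s *v u) = s *v (s *v v)" by simp
      then show "u = v"
        using refl_matrix_orthogonal(2)[OF nn] by (simp add: matrix_vector_mul_assoc s)
    qed
    then have "(*v) s ` icosahedron_vertices = icosahedron_vertices"
      using sub finite_vertices by (simp add: endo_inj_surj inj_on_subset)
    then have "s \<in> H3" using refl_matrix_orthogonal(1)[OF nn] by (simp add: H3_def s)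
    then show "s \<in> reflections" using refl_matrix_reflection[OF nn] s by simp
  qed
  show "reflections \<subseteq> zmat ` set refl_table"
  proof
    fix s assume s: "s \<in> reflections"
    obtain n where n: "n \<bullet> n = 1" "s = refl_matrix n" using reflection_normal_form[OF s] .
    have sH: "s \<in> H3" using s reflections_H3 by auto
    have n3: "n$1 * n$1 + n$2 * n$2 + n$3 * n$3 = 1" using n(1) by (simp add: inner_vec_def sum_3)
    have tr: "trace s = 1" using n3 by (simp add: n(2) trace_def sum_3 refl_matrix_def)
    have "det s = 1 - 2 * (n$1 * n$1 + n$2 * n$2 + n$3 * n$3)"
      by (simp add: n(2) det_3 refl_matrix_def algebra_simps)
    then have "det (- s) = 1" using n3 by (simp add: det_minus3)
    then obtain m where m: "m \<in> set rotation_table" "square3 m" "- s = zmat m"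
      using rotation_in_table[OF H3_minus[OF sH]] by blast
    have "trace (- s) = -1" using tr by (simp add: trace_def sum_negf)
    then have "zval (ztrace m) = zval (-4, 0)" using m by (simp add: trace_zmat zval_simps)
    then have "ztrace m = (-4, 0)" by (simp only: zval_inject)
    then have "zneg m \<in> set refl_table"
      using rotation_table_half_turns m(1) by (simp add: list_all_iff refl_table_def)
    moreover have "zmat (zneg m) = - zmat m"
      using m(2) by (elim square3E) (simp add: zneg_def vec_eq_iff forall_3 zmat_entries zval_mul zval_simps)
    ultimately show "s \<in> zmat ` set refl_table" using m(3) by (metis image_eqI minus_minus)
  qed
qed

lemma sum_reflections: "(\<Sum>s\<in>reflections. F s) = sum_list (map (\<lambda>m. F (zmat m)) refl_table)"
proof -
  have "inj_on zmat (set refl_table)"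
    using zmat_inj refl_table_square3 by (auto simp: inj_on_def)
  then have "(\<Sum>s\<in>reflections. F s) = (\<Sum>m\<in>set refl_table. F (zmat m))"
    unfolding reflections_table by (simp add: sum.reindex)
  also have "\<dots> = sum_list (map (\<lambda>m. F (zmat m)) refl_table)"
    using sum_list_distinct_conv_sum_set[OF distinct_refl_table, of "\<lambda>m. F (zmat m)"]
    unfolding refl_table_def by (rule sym)
  finally show ?thesis .
qed

lemma zval_zsum: "zval (zsum xs) = sum_list (map zval xs)"
proof (induction xs)
  case Nil then show ?case by (simp add: zsum_def zval_simps)
next
  case (Cons x xs) then show ?case by (simp add: zsum_def zval_add)
qed

lemma sum_list_divide: "sum_list (map (\<lambda>m. f m / k) xs) = sum_list (map f xs) / (k::real)"
  by (induction xs) (simp_all add: add_divide_distrib)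

text \<open>The sum of the reflections is the scalar \<open>5\<close> on the conjugate representation, which places its lowest
  weight at \<open>3/2 - 5/2 = -1\<close>.\<close>

lemma sum_conj_reflections: "(\<Sum>s\<in>reflections. conj_mat s $ k $ l) = (if k = l then 5 else 0)"
proof -
  have "(\<Sum>s\<in>reflections. conj_mat s $ k $ l) = sum_list (map (\<lambda>m. zval (zstar m ! ix3 k ! ix3 l) / 4) refl_table)"
    unfolding sum_reflections
    by (intro arg_cong[where f = sum_list] map_cong refl) (simp add: conj_zmat refl_table_square3, simp add: zmat_def)
  also have "\<dots> = zval (zsum (map (\<lambda>m. zstar m ! ix3 k ! ix3 l) refl_table)) / 4"
    by (simp add: sum_list_divide zval_zsum o_def)
  also have "zsum (map (\<lambda>m. zstar m ! ix3 k ! ix3 l) refl_table) = sum_table (map zstar refl_table) ! ix3 k ! ix3 l"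
    using exhaust_3[of k] exhaust_3[of l] by (elim disjE) (simp_all add: sum_table_def o_def)
  also have "zval \<dots> / 4 = (if k = l then 5 else 0)"
    using exhaust_3[of k] exhaust_3[of l]
    unfolding sum_table_eval by (elim disjE) (simp_all add: zval_simps)
  finally show ?thesis .
qed

definition pair_index :: "3 \<Rightarrow> 3 \<Rightarrow> nat" where
  "pair_index i j = (if i = j then ix3 i else ix3 i + ix3 j + 2)"

lemma moment:
  assumes u: "\<And>m. m \<in> set refl_table \<Longrightarrow> c (zmat m) = zval (u m ! k ! l) / q"
    and kl: "k < length ks" "l < length ks" "ks = [0..<length ks]"
  shows "(\<Sum>s\<in>reflections. ((if i = j then 1 else 0) - s $ i $ j) * c s)
    = zval (moment_table ks (map (\<lambda>m. (m, u m)) refl_table) ! pair_index i j ! k ! l) / (4 * q)"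
proof -
  have sym: "s $ i $ j = s $ j $ i" if s: "s \<in> reflections" for s i j
  proof -
    obtain n where "s = refl_matrix n" using reflection_normal_form[OF s] .
    then show ?thesis by (simp add: refl_matrix_def)
  qed
  have main: "(\<Sum>s\<in>reflections. ((if i = j then 1 else 0) - s $ i $ j) * c s)
      = zval (zsum (map (\<lambda>m. zmul (zdelta m (ix3 i) (ix3 j)) (u m ! k ! l)) refl_table)) / (4 * q)" for i j
  proof -
    have e: "((if i = j then 1 else 0) - zmat m $ i $ j) = zval (zdelta m (ix3 i) (ix3 j)) / 4" for m
      using exhaust_3[of i] exhaust_3[of j]
      by (elim disjE) (simp_all add: zdelta_def zmat_def zval_sub diff_divide_distrib, simp_all add: zval_simps)
    have "(\<Sum>s\<in>reflections. ((if i = j then 1 else 0) - s $ i $ j) * c s)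
       = sum_list (map (\<lambda>m. zval (zmul (zdelta m (ix3 i) (ix3 j)) (u m ! k ! l)) / (4 * q)) refl_table)"
      unfolding sum_reflections
      by (intro arg_cong[where f = sum_list] map_cong refl) (simp add: e u zval_mul)
    then show ?thesis by (simp add: sum_list_divide zval_zsum o_def)
  qed
  have nk: "ks ! k = k" "ks ! l = l" using kl by (metis add_0 nth_upt)+
  have swap: "(\<Sum>s\<in>reflections. ((if i = j then 1 else 0) - s $ i $ j) * c s)
      = (\<Sum>s\<in>reflections. ((if j = i then 1 else 0) - s $ j $ i) * c s)"
    using sym by (intro sum.cong) auto
  show ?thesis
    using exhaust_3[of i] exhaust_3[of j] kl(1,2) swap main[of i j] main[of j i]
    by (elim disjE) (simp_all add: moment_table_def pair_index_def nk o_def)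
qed

text \<open>The four-dimensional representation acts on the image of \<open>Emat\<close> below by \<open>M \<mapsto> w M conj(w)\<^sup>T\<close>. Each row
  of \<open>dmat\<close> gives one coordinate of the result, read off from a single entry of the matrix.\<close>

definition drow :: "real^3 \<Rightarrow> real^3 \<Rightarrow> real^4" where
  "drow a b = vector [a$1*b$1 + a$2*b$2 + a$3*b$3, golden*(a$2*b$3) + (golden-1)*(a$3*b$2),
     golden*(a$3*b$1) + (golden-1)*(a$1*b$3), golden*(a$1*b$2) + (golden-1)*(a$2*b$1)]"

definition dmat :: "mat3 \<Rightarrow> real^4^4" where
  "dmat w = (let u = conj_mat w in vector [drow (w$1) (u$1), (golden-1) *\<^sub>R drow (w$2) (u$3),
     (golden-1) *\<^sub>R drow (w$3) (u$1), (golden-1) *\<^sub>R drow (w$1) (u$2)])"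

lemma vector_4_nth:
  "(vector [a, b, c, d] :: ('a::zero)^4) $ 1 = a" "(vector [a, b, c, d] :: ('a::zero)^4) $ 2 = b"
  "(vector [a, b, c, d] :: ('a::zero)^4) $ 3 = c" "(vector [a, b, c, d] :: ('a::zero)^4) $ 4 = d"
  unfolding vector_def by auto

lemma golden_inverse: "golden * (golden - 1) = 1" "(golden - 1) * golden = 1"
  by (simp_all add: algebra_simps golden_eqs)

lemma trace_dmat: "trace (dmat w) = dtrace w (conj_mat w)"
proof -
  have k: "(golden - 1) * (golden * x + (golden - 1) * y) = x + (golden - 1) * (golden - 1) * y" for x y
    using golden_inverse(2) by (simp add: distrib_left mult.assoc[symmetric])
  show ?thesis
    by (simp add: trace_def sum_4 dmat_def Let_def vector_4_nth drow_def k dtrace_def) (simp add: algebra_simps)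
qed

definition ix4 :: "4 \<Rightarrow> nat" where
  "ix4 k = (if k = 1 then 0 else if k = 2 then 1 else if k = 3 then 2 else 3)"

lemma ix4_simps [simp]: "ix4 1 = 0" "ix4 2 = 1" "ix4 3 = 2" "ix4 4 = 3" by (simp_all add: ix4_def)

lemma dmat_zmat:
  assumes "square3 m" shows "dmat (zmat m) $ k $ l = zval (zdmat m (zstar m) ! ix4 k ! ix4 l) / 16"
proof -
  obtain a b c d e f g h i where m: "m = [[a, b, c], [d, e, f], [g, h, i]]" using assms by (rule square3E)
  have z: "zval (0, 1) = golden" "zval (-1, 1) = golden - 1" by (simp_all add: zval_simps)
  have c: "conj_mat (zmat m) = zmat [[zconj a, zconj b, zconj c], [zconj d, zconj e, zconj f], [zconj g, zconj h, zconj i]]"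
    using conj_zmat[OF assms] by (simp add: m zstar_def)
  show ?thesis
    using exhaust_4[of k] exhaust_4[of l]
    by (elim disjE; simp add: dmat_def c Let_def)
      (simp_all add: m zstar_def vector_4_nth drow_def zmat_entries zval_add zval_mul z field_simps)
qed

lemma moment_3:
  "(\<Sum>s\<in>reflections. ((if i = j then 1 else 0) - s $ i $ j) * conj_mat s $ k $ l)
    = zval (moment_table [0,1,2] (map (\<lambda>m. (m, zstar m)) refl_table) ! pair_index i j ! ix3 k ! ix3 l) / 16"
proof -
  have "ix3 k < 3" "ix3 l < 3" by (auto simp: ix3_def)
  then show ?thesis
    by (subst moment[where c = "\<lambda>s. conj_mat s $ k $ l" and u = zstar and q = 4 and k = "ix3 k" and l = "ix3 l" and ks = "[0,1,2]"])
      (simp_all add: conj_zmat refl_table_square3 upt_rec, simp_all add: zmat_def)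
qed

lemma moment_4:
  "(\<Sum>s\<in>reflections. ((if i = j then 1 else 0) - s $ i $ j) * dmat s $ k $ l)
    = zval (moment_table [0,1,2,3] (map (\<lambda>m. (m, zdmat m (zstar m))) refl_table) ! pair_index i j ! ix4 k ! ix4 l) / 64"
proof -
  have "ix4 k < 4" "ix4 l < 4" by (auto simp: ix4_def)
  then show ?thesis
    by (subst moment[where c = "\<lambda>s. dmat s $ k $ l" and u = "\<lambda>m. zdmat m (zstar m)" and q = 16 and k = "ix4 k" and l = "ix4 l" and ks = "[0,1,2,3]"])
      (simp_all add: dmat_zmat refl_table_square3 upt_rec)
qed

section \<open>Modules over the Cherednik algebra from operators\<close>

lemma smash_inv:
  assumes "f \<in> carrier smash" shows "inv\<^bsub>add_monoid smash\<^esub> f = (\<lambda>u. - f u)"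
proof -
  interpret smash: ring smash by (rule ring_smash)
  have "\<ominus>\<^bsub>smash\<^esub> f = (\<lambda>u. - f u)"
    using assms by (intro smash.minus_equality) (auto simp: smash_simps)
  then show ?thesis by (simp add: a_inv_def)
qed

lemma hc_class_eqD:
  assumes "f \<in> carrier smash" "g \<in> carrier smash" "hc_class c f = hc_class c g"
  shows "\<exists>i\<in>relation_ideal c. f = (\<lambda>u. i u + g u)"
proof -
  interpret ideal "relation_ideal c" smash by (rule relation_ideal)
  have "f \<in> relation_ideal c +>\<^bsub>smash\<^esub> f" by (rule a_rcos_self[OF assms(1)])
  then have "f \<in> relation_ideal c +>\<^bsub>smash\<^esub> g"
    using assms(3) by (simp add: hc_class_def)
  then show ?thesis unfolding a_r_coset_def' by (auto simp: smash_simps(5))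
qed

lemma act_tensor_single:
  "act_tensor w (Poly_Mapping.single u z) = const z * prod_list (map (act_letter w) (letters u))"
  by (cases "z = 0") (simp_all add: act_tensor_def)

text \<open>Functionals are identified with vectors by the standard basis, which is legitimate because \<open>H3\<close> acts
  by orthogonal matrices. The operators then need to satisfy only the defining relations in order to
  give a module over the quotient algebra.\<close>

locale cherednik_action = vector_space sc
  for sc :: "complex \<Rightarrow> 'v::ab_group_add \<Rightarrow> 'v" +
  fixes c :: complex and Xop :: "complex^3 \<Rightarrow> 'v \<Rightarrow> 'v" and Yop :: "complex^3 \<Rightarrow> 'v \<Rightarrow> 'v" and R :: "mat3 \<Rightarrow> 'v \<Rightarrow> 'v"
  assumes X_linear: "Xop (x + x') v = Xop x v + Xop x' v" "Xop (z *s x) v = sc z (Xop x v)"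
      "Xop x (v + v') = Xop x v + Xop x v'" "Xop x (sc z v) = sc z (Xop x v)"
    and Y_linear: "Yop (y + y') v = Yop y v + Yop y' v" "Yop (z *s y) v = sc z (Yop y v)"
      "Yop y (v + v') = Yop y v + Yop y v'" "Yop y (sc z v) = sc z (Yop y v)"
    and R_linear: "R w (v + v') = R w v + R w v'" "R w (sc z v) = sc z (R w v)"
    and R_one: "R (mat 1) v = v"
    and R_mult: "w \<in> H3 \<Longrightarrow> w' \<in> H3 \<Longrightarrow> R (w ** w') v = R w (R w' v)"
    and R_X: "w \<in> H3 \<Longrightarrow> R w (Xop x v) = Xop (act_h w x) (R w v)"
    and R_Y: "w \<in> H3 \<Longrightarrow> R w (Yop y v) = Yop (act_h w y) (R w v)"
    and XX: "Xop x (Xop x' v) = Xop x' (Xop x v)"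
    and YY: "Yop y (Yop y' v) = Yop y' (Yop y v)"
    and YX: "Yop y (Xop x v) - Xop x (Yop y v) =
      sc (pairing x y) v - (\<Sum>s\<in>reflections. sc (c * pairing (x - act_h s x) y) (R s v))"
begin

fun letter_op :: "letter \<Rightarrow> 'v \<Rightarrow> 'v" where
  "letter_op (X_letter i) v = Xop (axis i 1) v"
| "letter_op (Y_letter i) v = Yop (axis i 1) v"

sublocale word_action sc letter_op
proof unfold_locales
  fix l z u v
  show "letter_op l (u + v) = letter_op l u + letter_op l v"
    by (cases l) (simp_all add: X_linear Y_linear)
  show "letter_op l (sc z v) = sc z (letter_op l v)"
    by (cases l) (simp_all add: X_linear Y_linear)
qed

lemma X_sum: "Xop (sum g I) v = (\<Sum>i\<in>I. Xop (g i) v)"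
proof -
  have "Xop 0 v = 0" using X_linear(2)[of 0 0 v] by simp
  then show ?thesis by (induction I rule: infinite_finite_induct) (simp_all add: X_linear)
qed

lemma Y_sum: "Yop (sum g I) v = (\<Sum>i\<in>I. Yop (g i) v)"
proof -
  have "Yop 0 v = 0" using Y_linear(2)[of 0 0 v] by simp
  then show ?thesis by (induction I rule: infinite_finite_induct) (simp_all add: Y_linear)
qed

lemma R_0: "R w 0 = 0" using R_linear(2)[of w 0 0] by simp

lemma R_sum: "R w (sum g I) = (\<Sum>i\<in>I. R w (g i))"
  by (induction I rule: infinite_finite_induct) (simp_all add: R_linear R_0)

lemma basis_sum: "(x :: complex^3) = (\<Sum>i\<in>UNIV. x $ i *s axis i 1)"
  by (simp add: vec_eq_iff axis_def if_distrib cong: if_cong)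

lemma tact_emb_dual [simp]: "tact (emb_dual x) v = Xop x v"
proof -
  have "tact (emb_dual x) v = (\<Sum>i\<in>UNIV. Xop (x $ i *s axis i 1) v)"
    by (simp add: emb_dual_def tact_sum X_linear)
  also have "\<dots> = Xop x v" by (simp add: X_sum[symmetric] basis_sum[symmetric])
  finally show ?thesis .
qed

lemma tact_emb_h [simp]: "tact (emb_h y) v = Yop y v"
proof -
  have "tact (emb_h y) v = (\<Sum>i\<in>UNIV. Yop (y $ i *s axis i 1) v)"
    by (simp add: emb_h_def tact_sum Y_linear)
  also have "\<dots> = Yop y v" by (simp add: Y_sum[symmetric] basis_sum[symmetric])
  finally show ?thesis .
qed

lemma R_tact:
  assumes "w \<in> H3"
  shows "R w (tact p v) = tact (act_tensor w p) (R w v)"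
proof (induction p rule: tensor_induct)
  case zero then show ?case by (simp add: R_0)
next
  case (single u z)
  have l: "R w (letter_op l v) = tact (act_letter w l) (R w v)" for l v
    by (cases l) (simp_all add: R_X R_Y assms act_dual_eq_act_h)
  have "R w (foldr letter_op ls v) = tact (prod_list (map (act_letter w) ls)) (R w v)" for ls
    by (induction ls) (simp_all add: l tact_mult)
  then show ?case
    by (simp add: R_linear wact_def act_tensor_single tact_mult)
next
  case (add p q) then show ?case by (simp add: tact_add act_tensor_add R_linear)
qed

definition sact :: "(mat3 \<Rightarrow> tensor_algebra) \<Rightarrow> 'v \<Rightarrow> 'v" where
  "sact f v = (\<Sum>w\<in>H3. tact (f w) (R w v))"

lemma sact_add: "sact (\<lambda>u. f u + g u) v = sact f v + sact g v"
  by (simp add: sact_def tact_add sum.distrib)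

lemma sact_add_right: "sact f (u + v) = sact f u + sact f v"
  by (simp add: sact_def tact_add_right R_linear sum.distrib)

lemma sact_mult:
  assumes "f \<in> carrier smash" "g \<in> carrier smash"
  shows "sact (f \<otimes>\<^bsub>smash\<^esub> g) v = sact f (sact g v)"
proof -
  have "sact (f \<otimes>\<^bsub>smash\<^esub> g) v
      = (\<Sum>u\<in>H3. \<Sum>w\<in>H3. tact (f w) (tact (act_tensor w (g (matrix_inv w ** u))) (R u v)))"
    by (simp add: sact_def smash_simps tact_sum tact_mult)
  also have "\<dots> = (\<Sum>w\<in>H3. \<Sum>u\<in>H3. tact (f w) (R w (tact (g (matrix_inv w ** u)) (R (matrix_inv w ** u) v))))"
  proof (subst sum.swap, intro sum.cong refl)
    fix w u assume wu: "w \<in> H3" "u \<in> H3"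
    have "R u v = R w (R (matrix_inv w ** u) v)"
      using R_mult[OF wu(1) H3_mult[OF H3_inv[OF wu(1)] wu(2)]] by (simp only: H3_cancel(2)[OF wu(1)])
    then show "tact (f w) (tact (act_tensor w (g (matrix_inv w ** u))) (R u v))
        = tact (f w) (R w (tact (g (matrix_inv w ** u)) (R (matrix_inv w ** u) v)))"
      by (simp add: R_tact wu)
  qed
  also have "\<dots> = (\<Sum>w\<in>H3. \<Sum>u\<in>H3. tact (f w) (R w (tact (g u) (R u v))))"
  proof (rule sum.cong)
    fix w assume "w \<in> H3"
    then show "(\<Sum>u\<in>H3. tact (f w) (R w (tact (g (matrix_inv w ** u)) (R (matrix_inv w ** u) v))))
        = (\<Sum>u\<in>H3. tact (f w) (R w (tact (g u) (R u v))))"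
      by (rule sum_H3_translate[of w "\<lambda>u. tact (f w) (R w (tact (g u) (R u v)))"])
  qed simp
  also have "\<dots> = sact f (sact g v)" by (simp add: sact_def tact_sum_right R_sum)
  finally show ?thesis .
qed

lemma sact_of_tensor: "sact (of_tensor p) v = tact p v"
proof -
  have "sact (of_tensor p) v = (\<Sum>w\<in>H3. if w = mat 1 then tact p v else 0)"
    unfolding sact_def by (rule sum.cong) (auto simp: of_tensor_def R_one)
  then show ?thesis by (simp add: finite_H3 H3_one)
qed

lemma sact_of_group: "w \<in> H3 \<Longrightarrow> sact (of_group w) v = R w v"
proof -
  assume w: "w \<in> H3"
  have "sact (of_group w) v = (\<Sum>u\<in>H3. if u = w then R w v else 0)"
    unfolding sact_def by (rule sum.cong) (auto simp: of_group_def)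
  then show ?thesis by (simp add: finite_H3 w)
qed

lemma sact_plus_refl: "sact (tensor_plus_refl p k) v = tact p v + (\<Sum>s\<in>reflections. sc (k s) (R s v))"
proof -
  have "sact (tensor_plus_refl p k) v
      = sact (of_tensor p) v + sact (\<lambda>u. if u \<in> reflections then const (k u) else 0) v"
    unfolding tensor_plus_refl_def by (rule sact_add)
  also have "sact (\<lambda>u. if u \<in> reflections then const (k u) else 0) v
      = (\<Sum>w\<in>H3. if w \<in> reflections then sc (k w) (R w v) else 0)"
    unfolding sact_def by (rule sum.cong) auto
  also have "\<dots> = (\<Sum>s\<in>reflections. sc (k s) (R s v))"
    using reflections_H3 finite_H3 by (simp add: sum.inter_restrict[symmetric] Int_absorb1)
  finally show ?thesis by (simp add: sact_of_tensor)
qed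

lemma sact_minus: "sact (\<lambda>u. - f u) v = - sact f v"
  by (simp add: sact_def tact_minus sum_negf)

text \<open>The elements acting by zero form an ideal, so it is enough that the relations themselves act by zero.\<close>

lemma annihilator_ideal: "ideal {f \<in> carrier smash. \<forall>v. sact f v = 0} smash"
proof (rule idealI[OF ring_smash])
  let ?Z = "{f \<in> carrier smash. \<forall>v. sact f v = 0}"
  have sact_right_0: "sact f 0 = 0" for f using sact_add_right[of f 0 0] by simp
  show "subgroup ?Z (add_monoid smash)"
  proof (intro subgroup.intro)
    fix f assume f: "f \<in> ?Z"
    then have "f \<in> carrier smash" by simp
    then show "inv\<^bsub>add_monoid smash\<^esub> f \<in> ?Z"
      using f by (simp only: smash_inv) (auto simp: sact_minus smash_simps(1))
  next
    show "f \<otimes>\<^bsub>add_monoid smash\<^esub> g \<in> ?Z" if "f \<in> ?Z" "g \<in> ?Z" for f g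
      using that by (auto simp: smash_simps(1,5) sact_add)
  qed (auto simp: smash_simps(1,4) sact_def)
  show "g \<otimes>\<^bsub>smash\<^esub> f \<in> ?Z" "f \<otimes>\<^bsub>smash\<^esub> g \<in> ?Z" if "f \<in> ?Z" "g \<in> carrier smash" for f g
    using that ring.ring_simprules(5)[OF ring_smash] by (auto simp: sact_mult sact_right_0)
qed

lemma relations_annihilate: "f \<in> cherednik_relations c \<Longrightarrow> sact f v = 0"
proof -
  assume f: "f \<in> cherednik_relations c"
  have k: "c * pairing (refl_root s) y * pairing x (refl_coroot s) = c * pairing (x - act_h s x) y"
    if "s \<in> reflections" for s x y
    using root_coroot_pairing[OF that, of y x] by (simp add: mult.assoc)
  show ?thesis using f unfolding cherednik_relations_def
  proof (elim UnE CollectE exE conjE)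
    fix x x' assume "f = of_tensor (commutator (emb_dual x) (emb_dual x'))"
    then show ?thesis by (simp add: sact_of_tensor commutator_def tact_diff tact_mult XX)
  next
    fix y y' assume "f = of_tensor (commutator (emb_h y) (emb_h y'))"
    then show ?thesis by (simp add: sact_of_tensor commutator_def tact_diff tact_mult YY)
  next
    fix x y assume "f = tensor_plus_refl (commutator (emb_h y) (emb_dual x) - const (pairing x y))
        (\<lambda>s. c * pairing (refl_root s) y * pairing x (refl_coroot s))"
    then show ?thesis
      by (simp add: sact_plus_refl commutator_def tact_diff tact_mult YX k cong: sum.cong)
  qed
qed

lemma ideal_annihilates: "f \<in> relation_ideal c \<Longrightarrow> sact f v = 0"
proof -
  have "cherednik_relations c \<subseteq> {f \<in> carrier smash. \<forall>v. sact f v = 0}"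
    using relations_closed relations_annihilate by blast
  then have "relation_ideal c \<subseteq> {f \<in> carrier smash. \<forall>v. sact f v = 0}"
    using ring.genideal_minimal[OF ring_smash annihilator_ideal] by simp
  then show "f \<in> relation_ideal c \<Longrightarrow> sact f v = 0" by blast
qed

text \<open>The choice of a representative of a coset is immaterial because the relation ideal acts by zero.\<close>

definition hc_action :: "(hc_elem, 'v) module" where
  "hc_action = \<lparr>carrier = UNIV, monoid.mult = undefined, monoid.one = undefined, ring.zero = 0,
     ring.add = (+), smult = (\<lambda>C v. sact (SOME f. f \<in> carrier smash \<and> hc_class c f = C) v)\<rparr>"

lemma hc_action_simps [simp]: "carrier hc_action = UNIV" "\<zero>\<^bsub>hc_action\<^esub> = 0" "u \<oplus>\<^bsub>hc_action\<^esub> v = u + v"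
  by (simp_all add: hc_action_def)

lemma class_smult:
  assumes f: "f \<in> carrier smash" shows "hc_class c f \<odot>\<^bsub>hc_action\<^esub> v = sact f v"
proof -
  define g where "g = (SOME g. g \<in> carrier smash \<and> hc_class c g = hc_class c f)"
  have g: "g \<in> carrier smash \<and> hc_class c g = hc_class c f"
    unfolding g_def by (rule someI[of _ f]) (simp add: f)
  then obtain i where "i \<in> relation_ideal c" "g = (\<lambda>u. i u + f u)" using hc_class_eqD[of g f] f by blast
  then have "sact g v = sact f v" by (simp add: sact_add ideal_annihilates)
  then show ?thesis by (simp add: hc_action_def g_def)
qed

lemma left_module_action: "left_module (Hc c) hc_action"
proof (intro left_module.intro left_module_axioms.intro ring_Hc)
  show "abelian_group hc_action"
  proof (rule abelian_groupI)
    show "\<exists>v\<in>carrier hc_action. v \<oplus>\<^bsub>hc_action\<^esub> u = \<zero>\<^bsub>hc_action\<^esub>" for u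
      by (rule bexI[of _ "- u"]) simp_all
  qed (simp_all add: add_ac)
next
  fix a b u v assume "a \<in> carrier (Hc c)" "b \<in> carrier (Hc c)"
  then obtain f g where fg: "f \<in> carrier smash" "a = hc_class c f" "g \<in> carrier smash" "b = hc_class c g"
    by (auto simp: carrier_Hc)
  have cl: "(\<lambda>u. f u + g u) \<in> carrier smash" using fg by (simp add: smash_simps)
  show "(a \<oplus>\<^bsub>Hc c\<^esub> b) \<odot>\<^bsub>hc_action\<^esub> v = a \<odot>\<^bsub>hc_action\<^esub> v \<oplus>\<^bsub>hc_action\<^esub> b \<odot>\<^bsub>hc_action\<^esub> v"
    using fg cl by (simp add: hc_class_add class_smult sact_add)
  have "f \<otimes>\<^bsub>smash\<^esub> g \<in> carrier smash" using fg ring.ring_simprules(5)[OF ring_smash] by blast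
  then show "(a \<otimes>\<^bsub>Hc c\<^esub> b) \<odot>\<^bsub>hc_action\<^esub> v = a \<odot>\<^bsub>hc_action\<^esub> (b \<odot>\<^bsub>hc_action\<^esub> v)"
    using fg by (simp add: hc_class_mult class_smult sact_mult)
next
  fix a u v assume "a \<in> carrier (Hc c)"
  then obtain f where f: "f \<in> carrier smash" "a = hc_class c f" by (auto simp: carrier_Hc)
  then show "a \<odot>\<^bsub>hc_action\<^esub> (u \<oplus>\<^bsub>hc_action\<^esub> v) = a \<odot>\<^bsub>hc_action\<^esub> u \<oplus>\<^bsub>hc_action\<^esub> a \<odot>\<^bsub>hc_action\<^esub> v"
    by (simp add: class_smult sact_add_right)
next
  fix v show "\<one>\<^bsub>Hc c\<^esub> \<odot>\<^bsub>hc_action\<^esub> v = v"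
    by (simp add: hc_class_one[symmetric] class_smult sact_of_tensor)
qed simp_all

lemma action_generators [simp]:
  "hc_scalar c z \<odot>\<^bsub>hc_action\<^esub> v = sc z v" "hc_dual c x \<odot>\<^bsub>hc_action\<^esub> v = Xop x v"
  "hc_vec c y \<odot>\<^bsub>hc_action\<^esub> v = Yop y v"
  by (simp_all add: hc_scalar_def hc_dual_def hc_vec_def class_smult sact_of_tensor)

lemma action_group [simp]: "w \<in> H3 \<Longrightarrow> hc_group c w \<odot>\<^bsub>hc_action\<^esub> v = R w v"
  by (simp add: hc_group_def class_smult sact_of_group)

end

section \<open>The ten dimensional module\<close>

abbreviation G :: complex where "G \<equiv> complex_of_real golden"

lemma G_eqs: "G * G = G + 1" "G * (G * x) = G * x + x"
proof -
  show g: "G * G = G + 1" using arg_cong[OF golden_eqs(1), of complex_of_real] by simp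
  show "G * (G * x) = G * x + x" using g by (metis distrib_right mult.assoc mult_1)
qed

text \<open>In \<open>\<hh> \<otimes> gal\<close>, viewed as \<open>3 \<times> 3\<close> matrices, \<open>Emat\<close> parametrises the four-dimensional constituent by its
  coordinates and \<open>co\<close> recovers the coordinates. The map \<open>Bm\<close> is the projection of a rank one matrix
  to this constituent, up to a scalar, and \<open>Nm\<close> contracts a matrix of the constituent with a vector
  of \<open>\<hh>\<close>.\<close>

definition gal :: "mat3 \<Rightarrow> complex^3^3" where "gal w = refl_rep (conj_mat w)"

definition drep :: "mat3 \<Rightarrow> complex^4^4" where "drep w = map_matrix complex_of_real (dmat w)"

definition Emat :: "complex^4 \<Rightarrow> complex^3^3" where
  "Emat d = vector [vector [d$1, G * d$4, (G-1) * d$3], vector [(G-1) * d$4, d$1, G * d$2],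
     vector [G * d$3, (G-1) * d$2, d$1]]"

definition co :: "complex^3^3 \<Rightarrow> complex^4" where
  "co M = vector [M$1$1, (G-1) * M$2$3, (G-1) * M$3$1, (G-1) * M$1$2]"

definition Bm :: "complex^3 \<Rightarrow> complex^3 \<Rightarrow> complex^4" where
  "Bm x e = vector [x$1*e$1 + x$2*e$2 + x$3*e$3, G*(x$2*e$3) + (G-1)*(x$3*e$2),
     G*(x$3*e$1) + (G-1)*(x$1*e$3), G*(x$1*e$2) + (G-1)*(x$2*e$1)]"

definition Nm :: "complex^4 \<Rightarrow> complex^3 \<Rightarrow> complex^3" where
  "Nm d x = transpose (Emat d) *v x"

lemma forall_4: "(\<forall>i::4. P i) \<longleftrightarrow> P 1 \<and> P 2 \<and> P 3 \<and> P 4"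
  by (metis exhaust_4)

lemma Emat_entries:
  "Emat d $ 1 $ 1 = d$1" "Emat d $ 1 $ 2 = G * d$4" "Emat d $ 1 $ 3 = (G-1) * d$3"
  "Emat d $ 2 $ 1 = (G-1) * d$4" "Emat d $ 2 $ 2 = d$1" "Emat d $ 2 $ 3 = G * d$2"
  "Emat d $ 3 $ 1 = G * d$3" "Emat d $ 3 $ 2 = (G-1) * d$2" "Emat d $ 3 $ 3 = d$1"
  by (simp_all add: Emat_def)

lemma Nm_entries:
  "Nm d x $ 1 = d$1*x$1 + (G-1)*d$4*x$2 + G*d$3*x$3"
  "Nm d x $ 2 = G*d$4*x$1 + d$1*x$2 + (G-1)*d$2*x$3"
  "Nm d x $ 3 = (G-1)*d$3*x$1 + G*d$2*x$2 + d$1*x$3"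
  by (simp_all add: Nm_def matrix_vector_mult_def transpose_def sum_3 Emat_entries)

lemma Bm_entries:
  "Bm x e $ 1 = x$1*e$1 + x$2*e$2 + x$3*e$3" "Bm x e $ 2 = G*(x$2*e$3) + (G-1)*(x$3*e$2)"
  "Bm x e $ 3 = G*(x$3*e$1) + (G-1)*(x$1*e$3)" "Bm x e $ 4 = G*(x$1*e$2) + (G-1)*(x$2*e$1)"
  by (simp_all add: Bm_def vector_4_nth)

lemma co_Emat: "co (Emat d) = d"
proof -
  have "(G - 1) * (G * z) = z" for z
    using G_eqs by (simp add: algebra_simps)
  then show ?thesis by (simp add: co_def vec_eq_iff forall_4 vector_4_nth Emat_entries)
qed

text \<open>This symmetry is what makes the operators of \<open>\<hh>\<^sup>*\<close>, and those of \<open>\<hh>\<close>, commute.\<close>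

lemma Nm_Bm_sym: "Nm (Bm x e) y = Nm (Bm y e) x"
  by (simp add: vec_eq_iff forall_3 Nm_entries Bm_entries) (simp add: algebra_simps G_eqs)

lemma moment_pairing:
  "(\<Sum>s\<in>reflections. pairing (x - act_h s x) y * complex_of_real (q s)) =
   (\<Sum>i\<in>UNIV. \<Sum>j\<in>UNIV. y $ i * x $ j *
      complex_of_real (\<Sum>s\<in>reflections. ((if i = j then 1 else 0) - s $ i $ j) * q s))"
proof -
  have p: "pairing (x - act_h s x) y = (\<Sum>i\<in>UNIV. \<Sum>j\<in>UNIV. y $ i * x $ j * complex_of_real ((if i = j then 1 else 0) - s $ i $ j))" for s
    by (simp add: pairing_def act_h_def refl_rep_def matrix_vector_mult_def sum_3 algebra_simps)
  have "(\<Sum>s\<in>reflections. pairing (x - act_h s x) y * complex_of_real (q s))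
    = (\<Sum>s\<in>reflections. \<Sum>i\<in>UNIV. \<Sum>j\<in>UNIV. y $ i * x $ j * complex_of_real (((if i = j then 1 else 0) - s $ i $ j) * q s))"
    by (simp add: p sum_distrib_right mult.assoc)
  also have "\<dots> = (\<Sum>i\<in>UNIV. \<Sum>j\<in>UNIV. \<Sum>s\<in>reflections. y $ i * x $ j * complex_of_real (((if i = j then 1 else 0) - s $ i $ j) * q s))"
    by (subst sum.swap, rule sum.cong, simp, subst sum.swap, simp)
  finally show ?thesis by (simp add: sum_distrib_left of_real_sum)
qed

text \<open>The commutator relation in degrees \<open>-1\<close> and \<open>1\<close>, where only one of the two products of \<open>x\<close> and \<open>y\<close> is
  nonzero. The right-hand side is evaluated by the moments of the reflections.\<close>

lemma relation_e:
  "(-1/2) *s Nm (Bm x e) y = pairing x y *s e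
     - (\<Sum>s\<in>reflections. (1/2 * pairing (x - act_h s x) y) *s (gal s *v e))"
proof -
  let ?T = "\<lambda>k l. \<Sum>s\<in>reflections. pairing (x - act_h s x) y * complex_of_real (conj_mat s $ k $ l)"
  have "(\<Sum>s\<in>reflections. (1/2 * pairing (x - act_h s x) y) *s (gal s *v e)) $ k
      = 1/2 * (\<Sum>l\<in>UNIV. e $ l * ?T k l)" for k
  proof -
    have "(\<Sum>s\<in>reflections. (1/2 * pairing (x - act_h s x) y) *s (gal s *v e)) $ k
      = (\<Sum>s\<in>reflections. \<Sum>l\<in>UNIV. 1/2 * (e $ l * (pairing (x - act_h s x) y * complex_of_real (conj_mat s $ k $ l))))"
      by (simp add: gal_def refl_rep_def matrix_vector_mult_def sum_distrib_left mult_ac)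
    then show ?thesis by (subst (asm) sum.swap) (simp add: sum_distrib_left)
  qed
  moreover have "((-1/2) *s Nm (Bm x e) y) $ k = pairing x y * e $ k - 1/2 * (\<Sum>l\<in>UNIV. e $ l * ?T k l)" for k
    using exhaust_3[of k]
    by (elim disjE) (simp_all only: moment_pairing moment_3 moment_table_3 sum_3,
      simp_all add: pair_index_def zval_simps Nm_entries Bm_entries pairing_def,
      simp_all add: field_simps G_eqs sum_3)
  ultimately show ?thesis by (simp add: vec_eq_iff)
qed

text \<open>The commutator relation in degree \<open>0\<close>, where both products contribute.\<close>

lemma relation_d:
  "(1/2) *s (Bm y (Nm d x) + Bm x (Nm d y)) = pairing x y *s d
     - (\<Sum>s\<in>reflections. (1/2 * pairing (x - act_h s x) y) *s (drep s *v d))"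
proof -
  let ?T = "\<lambda>k l. \<Sum>s\<in>reflections. pairing (x - act_h s x) y * complex_of_real (dmat s $ k $ l)"
  have "(\<Sum>s\<in>reflections. (1/2 * pairing (x - act_h s x) y) *s (drep s *v d)) $ k
      = 1/2 * (\<Sum>l\<in>UNIV. d $ l * ?T k l)" for k
  proof -
    have "(\<Sum>s\<in>reflections. (1/2 * pairing (x - act_h s x) y) *s (drep s *v d)) $ k
      = (\<Sum>s\<in>reflections. \<Sum>l\<in>UNIV. 1/2 * (d $ l * (pairing (x - act_h s x) y * complex_of_real (dmat s $ k $ l))))"
      by (simp add: drep_def matrix_vector_mult_def sum_distrib_left mult_ac)
    then show ?thesis by (subst (asm) sum.swap) (simp add: sum_distrib_left)
  qed
  moreover have "((1/2) *s (Bm y (Nm d x) + Bm x (Nm d y))) $ k = pairing x y * d $ k - 1/2 * (\<Sum>l\<in>UNIV. d $ l * ?T k l)" for k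
    using exhaust_4[of k]
    by (elim disjE) (simp_all only: moment_pairing moment_4 moment_table_4 sum_3 sum_4,
      simp_all add: pair_index_def zval_simps Nm_entries Bm_entries pairing_def,
      simp_all add: field_simps G_eqs sum_3)
  ultimately show ?thesis by (simp add: vec_eq_iff)
qed

subsection \<open>Equivariance\<close>

lemma gal_mult: "w \<in> H3 \<Longrightarrow> w' \<in> H3 \<Longrightarrow> gal (w ** w') = gal w ** gal w'"
  by (simp add: gal_def conj_mat_mult refl_rep_mult)

lemma gal_one: "gal (mat 1) = mat 1"
  by (simp add: gal_def conj_mat_one)

lemma refl_rep_transpose: "refl_rep (transpose w) = transpose (refl_rep w)"
  by (simp add: refl_rep_def transpose_def vec_eq_iff)

lemma refl_rep_inverse:
  assumes "w \<in> H3"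
  shows "transpose (refl_rep w) ** refl_rep w = mat 1" "refl_rep w ** transpose (refl_rep w) = mat 1"
  using H3_inverse[OF assms] by (simp_all flip: refl_rep_transpose refl_rep_mult)

lemma pairing_act_h:
  assumes "w \<in> H3" shows "pairing (act_h w x) (act_h w y) = pairing x y"
proof -
  have "pairing (A *v x) y = pairing x (transpose A *v y)" for A :: "complex^3^3" and x y
    by (simp add: pairing_def matrix_vector_mult_def transpose_def sum_3 algebra_simps)
  then have "pairing (act_h w x) (act_h w y) = pairing x ((transpose (refl_rep w) ** refl_rep w) *v y)"
    unfolding act_h_def by (simp only: matrix_vector_mul_assoc)
  then show ?thesis by (simp add: refl_rep_inverse[OF assms])
qed

lemma act_h_diff: "act_h w (x - y) = act_h w x - act_h w y"
  by (simp add: act_h_def matrix_vector_mult_diff_distrib)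

lemma matrix_vector_mult_sum: "A *v (sum f I) = (\<Sum>i\<in>I. A *v f i)" for A :: "complex^'n^'m"
  by (induction I rule: infinite_finite_induct) (simp_all add: matrix_vector_right_distrib)

lemma matrix_vector_mult_minus: "A *v (- v) = - (A *v v)" for A :: "complex^'n^'m"
  using matrix_vector_mult_diff_distrib[of A 0 v] by simp

lemma matrix_mult_add_left: "(A + B) ** C = A ** C + B ** C" for A B :: "complex^'n^'m"
  by (simp add: vec_eq_iff matrix_matrix_mult_def distrib_right sum.distrib)

text \<open>Equivariance is read off from \<open>relation_e\<close>, whose right-hand side is visibly equivariant; no further
  computation with the sixty rotations is needed.\<close>

lemma Nm_Bm_equivariant:
  assumes w: "w \<in> H3"
  shows "Nm (Bm (act_h w x) (gal w *v e)) (act_h w y) = gal w *v Nm (Bm x e) y"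
proof -
  let ?x = "act_h w x" and ?y = "act_h w y" and ?e = "gal w *v e"
  have "(\<Sum>s\<in>reflections. (1/2 * pairing (?x - act_h s ?x) ?y) *s (gal s *v ?e))
      = (\<Sum>s\<in>reflections. (1/2 * pairing (?x - act_h (w ** s ** transpose w) ?x) ?y) *s (gal (w ** s ** transpose w) *v ?e))"
    by (rule sum_reflections_conj[OF w, symmetric])
  also have "\<dots> = (\<Sum>s\<in>reflections. gal w *v ((1/2 * pairing (x - act_h s x) y) *s (gal s *v e)))"
  proof (rule sum.cong)
    fix s assume "s \<in> reflections"
    then have s: "s \<in> H3" using reflections_H3 by auto
    have c: "(w ** s ** transpose w) ** w = w ** s"
      using H3_inverse(5)[OF w] by (simp add: matrix_mul_assoc[symmetric])
    have "act_h (w ** s ** transpose w) ?x = act_h w (act_h s x)"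
      using c by (simp add: act_h_mult[symmetric])
    moreover have "gal (w ** s ** transpose w) *v ?e = gal w *v (gal s *v e)"
    proof -
      have "gal (w ** s ** transpose w) ** gal w = gal w ** gal s"
        using c w s by (simp add: gal_mult[symmetric] H3_mult H3_transpose)
      then show ?thesis by (simp add: matrix_vector_mul_assoc)
    qed
    ultimately show "(1/2 * pairing (?x - act_h (w ** s ** transpose w) ?x) ?y) *s (gal (w ** s ** transpose w) *v ?e)
        = gal w *v ((1/2 * pairing (x - act_h s x) y) *s (gal s *v e))"
      using pairing_act_h[OF w, of "x - act_h s x" y] by (simp add: act_h_diff vector_scalar_commute)
  qed simp
  also have "\<dots> = gal w *v (\<Sum>s\<in>reflections. (1/2 * pairing (x - act_h s x) y) *s (gal s *v e))"
    by (rule matrix_vector_mult_sum[symmetric])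
  finally have "(-1/2) *s Nm (Bm ?x ?e) ?y = pairing x y *s ?e
      - gal w *v (\<Sum>s\<in>reflections. (1/2 * pairing (x - act_h s x) y) *s (gal s *v e))"
    unfolding relation_e by (simp add: pairing_act_h w)
  also have "\<dots> = gal w *v ((-1/2) *s Nm (Bm x e) y)"
    unfolding relation_e by (simp add: matrix_vector_mult_diff_distrib vector_scalar_commute)
  finally have "(-1/2) *s Nm (Bm ?x ?e) ?y = (-1/2) *s (gal w *v Nm (Bm x e) y)"
    by (simp only: vector_scalar_commute)
  then show ?thesis by (simp only: vec.scale_cancel_left) simp
qed

lemma Emat_add: "Emat (d + d') = Emat d + Emat d'"
  by (simp add: vec_eq_iff forall_3 Emat_entries algebra_simps)

lemma Bm_add: "Bm (x + x') e = Bm x e + Bm x' e" "Bm x (e + e') = Bm x e + Bm x e'"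
  by (simp_all add: vec_eq_iff forall_4 Bm_entries algebra_simps)

lemma Bm_scale: "Bm (z *s x) e = z *s Bm x e" "Bm x (z *s e) = z *s Bm x e"
  by (simp_all add: vec_eq_iff forall_4 Bm_entries algebra_simps)

lemma Nm_add: "Nm (d + d') x = Nm d x + Nm d' x" "Nm d (x + x') = Nm d x + Nm d x'"
  by (simp_all add: vec_eq_iff forall_3 Nm_entries algebra_simps)

lemma Nm_scale: "Nm (z *s d) x = z *s Nm d x" "Nm d (z *s x) = z *s Nm d x"
  by (simp_all add: vec_eq_iff forall_3 Nm_entries algebra_simps)

lemma Bm_Nm_0 [simp]: "Bm 0 e = 0" "Bm x 0 = 0" "Nm 0 x = 0" "Nm d 0 = 0"
  using Bm_scale(1)[of 0 0 e] Bm_scale(2)[of x 0 0] Nm_scale(1)[of 0 0 x] Nm_scale(2)[of d 0 0] by simp_all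

lemma Bm_minus [simp]: "Bm x (- e) = - Bm x e"
  using Bm_scale(2)[of x "-1" e] by simp

lemma Bm_span:
  "d = Bm (axis 1 1) (d$1 *s axis 1 1) + Bm (axis 2 1) (((G-1) * d$2) *s axis 3 1)
     + Bm (axis 3 1) (((G-1) * d$3) *s axis 1 1) + Bm (axis 1 1) (((G-1) * d$4) *s axis 2 1)"
proof -
  have "G * ((G - 1) * z) = z" for z using G_eqs by (simp add: algebra_simps)
  then show ?thesis by (simp add: vec_eq_iff forall_4 Bm_entries axis_def)
qed

lemma drep_apply: "drep w *v d = co (refl_rep w ** Emat d ** transpose (gal w))"
proof -
  have "(drep w *v d) $ k = co (refl_rep w ** Emat d ** transpose (gal w)) $ k" for k
    using exhaust_4[of k]
    by (elim disjE)
      (simp_all add: drep_def dmat_def Let_def co_def vector_4_nth drow_def matrix_vector_mult_def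
        matrix_matrix_mult_def transpose_def sum_3 sum_4 Emat_entries gal_def refl_rep_def,
       simp_all add: algebra_simps)
  then show ?thesis by (simp add: vec_eq_iff)
qed

lemma Emat_Bm_equivariant:
  assumes w: "w \<in> H3"
  shows "Emat (Bm (act_h w x) (gal w *v e)) = refl_rep w ** Emat (Bm x e) ** transpose (gal w)"
proof -
  let ?B = "Bm (act_h w x) (gal w *v e)"
  have "(transpose (Emat ?B) ** refl_rep w) *v y = (gal w ** transpose (Emat (Bm x e))) *v y" for y
    using Nm_Bm_equivariant[OF w, of x e y]
    by (simp only: Nm_def act_h_def matrix_vector_mul_assoc)
  then have "transpose (Emat ?B) ** refl_rep w = gal w ** transpose (Emat (Bm x e))"
    by (simp add: matrix_eq)
  then have "transpose (transpose (Emat ?B) ** refl_rep w) = transpose (gal w ** transpose (Emat (Bm x e)))"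
    by simp
  then have "transpose (refl_rep w) ** Emat ?B = Emat (Bm x e) ** transpose (gal w)"
    by (simp only: matrix_transpose_mul transpose_transpose)
  then have "refl_rep w ** (transpose (refl_rep w) ** Emat ?B) = refl_rep w ** (Emat (Bm x e) ** transpose (gal w))"
    by simp
  then show ?thesis by (simp add: matrix_mul_assoc refl_rep_inverse[OF w])
qed

text \<open>The matrices \<open>Emat d\<close> form the image of the equivariant map \<open>\<hh> \<otimes> gal \<rightarrow> \<hh> \<otimes> gal\<close> in the relation on the
  lowest weight space, so they are stable under the group.\<close>

lemma Emat_drep:
  assumes w: "w \<in> H3"
  shows "Emat (drep w *v d) = refl_rep w ** Emat d ** transpose (gal w)"
proof -
  have "\<exists>d'. Emat d' = refl_rep w ** Emat (Bm x e + Bm x' e' + Bm x'' e'' + Bm x''' e''') ** transpose (gal w)"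
    for x e x' e' x'' e'' x''' e'''
    by (simp only: Emat_add matrix_add_ldistrib matrix_mult_add_left Emat_Bm_equivariant[OF w, symmetric])
      (metis Emat_add)
  from this[of "axis 1 1" "d$1 *s axis 1 1" "axis 2 1" "((G-1) * d$2) *s axis 3 1"
      "axis 3 1" "((G-1) * d$3) *s axis 1 1" "axis 1 1" "((G-1) * d$4) *s axis 2 1"]
  obtain d' where "Emat d' = refl_rep w ** Emat d ** transpose (gal w)"
    using Bm_span[of d] by metis
  then show ?thesis by (simp add: drep_apply co_Emat flip: \<open>Emat d' = _\<close>)
qed

lemma Emat_inject: "Emat d = Emat d' \<Longrightarrow> d = d'"
  using co_Emat by metis

lemma Bm_equivariant: "w \<in> H3 \<Longrightarrow> Bm (act_h w x) (gal w *v e) = drep w *v Bm x e"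
  by (rule Emat_inject) (simp add: Emat_drep Emat_Bm_equivariant)

lemma Nm_equivariant:
  assumes w: "w \<in> H3" shows "Nm (drep w *v d) (act_h w x) = gal w *v Nm d x"
proof -
  have "transpose (Emat (drep w *v d)) ** refl_rep w = gal w ** transpose (Emat d)"
    unfolding Emat_drep[OF w]
    by (simp add: matrix_transpose_mul matrix_mul_assoc[symmetric] refl_rep_inverse[OF w])
  then show ?thesis by (simp only: Nm_def act_h_def matrix_vector_mul_assoc)
qed

lemma drep_mult: "w \<in> H3 \<Longrightarrow> w' \<in> H3 \<Longrightarrow> drep (w ** w') = drep w ** drep w'"
proof -
  assume w: "w \<in> H3" "w' \<in> H3"
  have "drep (w ** w') *v d = (drep w ** drep w') *v d" for d
  proof (rule Emat_inject)
    show "Emat (drep (w ** w') *v d) = Emat ((drep w ** drep w') *v d)"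
      using w by (simp add: matrix_vector_mul_assoc[symmetric] Emat_drep H3_mult refl_rep_mult gal_mult
          matrix_transpose_mul matrix_mul_assoc)
  qed
  then show ?thesis by (simp add: matrix_eq)
qed

lemma drep_one: "drep (mat 1) = mat 1"
proof -
  have "drep (mat 1) *v d = mat 1 *v d" for d
    by (rule Emat_inject) (simp add: Emat_drep H3_one gal_one transpose_mat)
  then show ?thesis by (simp add: matrix_eq)
qed

subsection \<open>The module\<close>

text \<open>The components are the parts of degrees \<open>-1\<close>, \<open>0\<close> and \<open>1\<close>.\<close>

type_synonym V10 = "(complex^3) \<times> (complex^4) \<times> (complex^3)"

definition sc10 :: "complex \<Rightarrow> V10 \<Rightarrow> V10" where
  "sc10 z v = (case v of (e, d, f) \<Rightarrow> (z *s e, z *s d, z *s f))"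

definition X10 :: "complex^3 \<Rightarrow> V10 \<Rightarrow> V10" where
  "X10 x v = (case v of (e, d, f) \<Rightarrow> (0, Bm x e, Nm d x))"

definition Y10 :: "complex^3 \<Rightarrow> V10 \<Rightarrow> V10" where
  "Y10 y v = (case v of (e, d, f) \<Rightarrow> ((-1/2) *s Nm d y, (1/2) *s Bm y f, 0))"

definition R10 :: "mat3 \<Rightarrow> V10 \<Rightarrow> V10" where
  "R10 w v = (case v of (e, d, f) \<Rightarrow> (gal w *v e, drep w *v d, gal w *v f))"

lemma op10_simps [simp]:
  "sc10 z (e, d, f) = (z *s e, z *s d, z *s f)" "X10 x (e, d, f) = (0, Bm x e, Nm d x)"
  "Y10 y (e, d, f) = ((-1/2) *s Nm d y, (1/2) *s Bm y f, 0)"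
  "R10 w (e, d, f) = (gal w *v e, drep w *v d, gal w *v f)"
  by (simp_all add: sc10_def X10_def Y10_def R10_def)

lemma sum_triple: "(\<Sum>i\<in>I. (p i, q i, r i)) = (sum p I, sum q I, sum r I)"
  by (induction I rule: infinite_finite_induct) (simp_all add: zero_prod_def)

interpretation V10: cherednik_action sc10 "1/2" X10 Y10 R10
proof unfold_locales
  fix x y v and z :: complex
  show "Y10 y (X10 x v) - X10 x (Y10 y v) =
      sc10 (pairing x y) v - (\<Sum>s\<in>reflections. sc10 (1/2 * pairing (x - act_h s x) y) (R10 s v))"
  proof (cases v)
    case (fields e d f)
    have c1: "Y10 y (X10 x v) - X10 x (Y10 y v)
        = ((-1/2) *s Nm (Bm x e) y, (1/2) *s (Bm y (Nm d x) + Bm x (Nm d y)), (-1/2) *s Nm (Bm x f) y)"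
      by (simp add: fields Bm_scale Nm_scale Nm_Bm_sym[of y f x] vec.scale_right_distrib)
    show ?thesis
      unfolding c1 by (simp only: fields op10_simps sum_triple diff_Pair relation_e relation_d)
  qed
qed (auto simp: Bm_add Bm_scale Nm_add Nm_scale Nm_Bm_sym matrix_vector_right_distrib vector_scalar_commute
    matrix_vector_mult_minus gal_one drep_one gal_mult drep_mult matrix_vector_mul_assoc Bm_equivariant Nm_equivariant
    vec.scale_right_distrib vec.scale_left_distrib mult.commute split: prod.splits)

lemma gal_table: "m \<in> set refl_table \<Longrightarrow> gal (zmat m) $ k $ l = complex_of_real (zval (zstar m ! ix3 k ! ix3 l) / 4)"
  by (simp add: gal_def conj_zmat refl_table_square3 refl_rep_def) (simp add: zmat_def)

lemma drep_table: "m \<in> set refl_table \<Longrightarrow> drep (zmat m) $ k $ l = complex_of_real (zval (zdmat m (zstar m) ! ix4 k ! ix4 l) / 16)"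
  by (simp add: drep_def dmat_zmat refl_table_square3)

definition mirror :: "nat \<Rightarrow> zg list list" where "mirror n = zrefl (root_table ! n)"

lemma mirror_mem: "n < 15 \<Longrightarrow> mirror n \<in> set refl_table"
proof -
  assume "n < 15"
  moreover have "length root_table = 15" by (simp add: root_table_def)
  ultimately have "root_table ! n \<in> set root_table" by simp
  then show ?thesis by (simp add: mirror_def refl_table_def)
qed

lemma mirror_H3: "n < 15 \<Longrightarrow> zmat (mirror n) \<in> H3"
  using mirror_mem reflections_table reflections_H3 by blast

lemmas mirror_eval = mirror_def root_table_def zstar_def zval_simps

text \<open>The coordinate reflections project onto the coordinate axes, and a reflection without
  vanishing entries connects the axes.\<close>

lemma gal_irreducible:
  assumes v0: "v0 \<in> U" "v0 \<noteq> 0" and add: "\<And>u v. u \<in> U \<Longrightarrow> v \<in> U \<Longrightarrow> u + v \<in> U"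
    and sc: "\<And>z v. v \<in> U \<Longrightarrow> z *s v \<in> U" and act: "\<And>w v. w \<in> H3 \<Longrightarrow> v \<in> U \<Longrightarrow> gal w *v v \<in> U"
  shows "U = UNIV"
proof -
  have proj: "axis i 1 \<in> U" if v: "v \<in> U" "v $ i \<noteq> 0" for v i
  proof -
    have n: "ix3 i < 15" by (simp add: ix3_def)
    let ?g = "gal (zmat (mirror (ix3 i)))"
    have "v + (-1) *s (?g *v v) \<in> U" using v(1) act[OF mirror_H3[OF n]] add sc by blast
    moreover have "v + (-1) *s (?g *v v) = (2 * v $ i) *s axis i 1"
      using exhaust_3[of i]
      by (elim disjE)
        (simp_all add: vec_eq_iff forall_3 matrix_vector_mult_def sum_3 gal_table mirror_mem axis_def,
         simp_all add: mirror_eval)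
    ultimately have "(2 * v $ i) *s axis i 1 \<in> U" by (simp only:)
    from sc[OF this, of "inverse (2 * v $ i)"] show ?thesis using v(2) by simp
  qed
  obtain i where "v0 $ i \<noteq> 0" using v0(2) by (auto simp: vec_eq_iff)
  then have i: "axis i 1 \<in> U" using proj v0(1) by blast
  have all: "axis j 1 \<in> U" for j
  proof -
    have "gal (zmat (mirror 3)) *v axis i 1 \<in> U" using act[OF mirror_H3[of 3]] i by simp
    moreover have "(gal (zmat (mirror 3)) *v axis i 1) $ j \<noteq> 0"
    proof -
      have e: "(gal (zmat (mirror 3)) *v axis i 1) $ j = complex_of_real (zval (zstar (mirror 3) ! ix3 j ! ix3 i) / 4)"
        by (simp add: matrix_vector_mult_def axis_def if_distrib gal_table mirror_mem cong: if_cong)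
      have "zstar (mirror 3) ! ix3 j ! ix3 i \<noteq> (0, 0)"
        using exhaust_3[of i] exhaust_3[of j] by (elim disjE) (simp_all add: mirror_def root_table_def zstar_def)
      then have "zval (zstar (mirror 3) ! ix3 j ! ix3 i) \<noteq> zval (0, 0)" by (simp only: zval_inject not_False_eq_True)
      then show ?thesis unfolding e by (simp add: zval_simps)
    qed
    ultimately show ?thesis by (rule proj)
  qed
  have "v \<in> U" for v
  proof -
    have "v = v$1 *s axis 1 1 + v$2 *s axis 2 1 + v$3 *s axis 3 1"
      by (simp add: vec_eq_iff forall_3 axis_def)
    moreover have "v$1 *s axis 1 1 + v$2 *s axis 2 1 + v$3 *s axis 3 1 \<in> U"
      by (intro add sc all)
    ultimately show ?thesis by simp
  qed
  then show ?thesis by blast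
qed

abbreviation L10 :: "(hc_elem, V10) module" where "L10 \<equiv> V10.hc_action"

interpretation L10: hc_module "1/2" L10
  using V10.left_module_action by (simp add: hc_module_def)

lemma lowest_generates:
  assumes add: "\<And>u v. u \<in> N \<Longrightarrow> v \<in> N \<Longrightarrow> u + v \<in> N" and X: "\<And>x v. v \<in> N \<Longrightarrow> X10 x v \<in> N"
    and low: "\<And>e. (e, 0, 0) \<in> N"
  shows "N = UNIV"
proof -
  have b: "(0, Bm x e, 0) \<in> N" for x e using X[OF low[of e], of x] by simp
  have d: "(0, d, 0) \<in> N" for d
  proof -
    have "(0, Bm x1 e1 + Bm x2 e2 + Bm x3 e3 + Bm x4 e4, 0) \<in> N" for x1 e1 x2 e2 x3 e3 x4 e4
      using add[OF add[OF add[OF b[of x1 e1] b[of x2 e2]] b[of x3 e3]] b[of x4 e4]] by simp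
    from this[of "axis 1 1" "d$1 *s axis 1 1" "axis 2 1" "((G-1) * d$2) *s axis 3 1"
        "axis 3 1" "((G-1) * d$3) *s axis 1 1" "axis 1 1" "((G-1) * d$4) *s axis 2 1"]
    show ?thesis by (simp only: Bm_span[symmetric])
  qed
  have f: "(0, 0, f) \<in> N" for f
  proof -
    have "Nm (axis 1 1) f = f" by (simp add: vec_eq_iff forall_3 Nm_entries axis_def)
    then show ?thesis using X[OF d[of "axis 1 1"], of f] by simp
  qed
  have "(e, d, f) \<in> N" for e d f using add[OF add[OF low[of e] d[of d]] f[of f]] by simp
  then show ?thesis by auto
qed

lemma L10_submodule:
  assumes "submodule N (Hc (1/2)) L10"
  shows "0 \<in> N" "\<And>u v. u \<in> N \<Longrightarrow> v \<in> N \<Longrightarrow> u + v \<in> N" "\<And>z v. v \<in> N \<Longrightarrow> sc10 z v \<in> N"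
    "\<And>x v. v \<in> N \<Longrightarrow> X10 x v \<in> N" "\<And>y v. v \<in> N \<Longrightarrow> Y10 y v \<in> N"
    "\<And>w v. w \<in> H3 \<Longrightarrow> v \<in> N \<Longrightarrow> R10 w v \<in> N"
proof -
  note D = L10.submoduleD[OF assms]
  show "0 \<in> N" using D(2) by simp
  show "\<And>u v. u \<in> N \<Longrightarrow> v \<in> N \<Longrightarrow> u + v \<in> N" using D(3) by simp
  show "\<And>z v. v \<in> N \<Longrightarrow> sc10 z v \<in> N" using D(4)[OF hc_gen_closed(1)] by simp
  show "\<And>x v. v \<in> N \<Longrightarrow> X10 x v \<in> N" using D(4)[OF hc_gen_closed(2)] by simp
  show "\<And>y v. v \<in> N \<Longrightarrow> Y10 y v \<in> N" using D(4)[OF hc_gen_closed(3)] by simp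
  show "R10 w v \<in> N" if "w \<in> H3" "v \<in> N" for w v
    using D(4)[OF hc_gen_closed(4)[OF that(1)] that(2)] that by simp
qed

lemma G_neq: "G \<noteq> 0" "G - 1 \<noteq> 0" "G \<noteq> 1"
  using golden_eqs(2,3) by auto

text \<open>A vector with a nonzero component in degree \<open>1\<close> or \<open>0\<close> is moved to a nonzero vector of degree \<open>-1\<close> by
  two or one elements of \<open>\<hh>\<close>; the irreducible lowest weight space then generates everything.\<close>

lemma L10_irreducible: "irreducible_module (Hc (1/2)) L10"
  unfolding irreducible_module_def
proof (intro conjI allI impI)
  show "left_module (Hc (1/2)) L10" by (rule L10.left_module_axioms)
  have "(axis 1 1, 0, 0) \<noteq> (0 :: V10)" by (simp add: zero_prod_def axis_eq_0_iff)
  then show "carrier L10 \<noteq> {\<zero>\<^bsub>L10\<^esub>}" by auto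
  fix N assume N: "submodule N (Hc (1/2)) L10"
  note D = L10_submodule[OF N]
  show "N = {\<zero>\<^bsub>L10\<^esub>} \<or> N = carrier L10"
  proof (cases "N = {0}")
    case False
    then obtain n0 where n0: "n0 \<in> N" "n0 \<noteq> 0" using D(1) by blast
    obtain e d f where "n0 = (e, d, f)" by (cases n0)
    then have n: "(e, d, f) \<in> N" "(e, d, f) \<noteq> 0" using n0 by auto
    have "\<exists>e0. e0 \<noteq> 0 \<and> (e0, 0, 0) \<in> N"
    proof (cases "f = 0")
      case False
      let ?a = "axis 1 1 :: complex^3"
      have "Y10 ?a (Y10 ?a (e, d, f)) \<in> N" using D(5) n by blast
      moreover have "Nm (Bm ?a f) ?a \<noteq> 0"
        using False G_neq by (auto simp: vec_eq_iff forall_3 Nm_entries Bm_entries axis_def)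
      ultimately show ?thesis
        by (intro exI[of _ "(-1/4) *s Nm (Bm ?a f) ?a"]) (simp add: Nm_scale)
    next
      case f: True
      show ?thesis
      proof (cases "d = 0")
        case False
        have "\<exists>y. Nm d y \<noteq> 0"
        proof (rule ccontr)
          assume "\<not> ?thesis"
          then have "Nm d (axis 1 1) = 0" "Nm d (axis 2 1) = 0" by auto
          then have "d = 0" using G_neq by (auto simp: vec_eq_iff forall_3 forall_4 Nm_entries axis_def)
          then show False using False by simp
        qed
        then obtain y where "Nm d y \<noteq> 0" by blast
        moreover have "Y10 y (e, d, f) \<in> N" using D(5) n by blast
        ultimately show ?thesis using f by (intro exI[of _ "(-1/2) *s Nm d y"]) simp
      qed (use n f in \<open>auto simp: zero_prod_def\<close>)
    qed
    then obtain e0 where e0: "e0 \<noteq> 0" "(e0, 0, 0) \<in> N" by blast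
    have "{e. (e, 0, 0) \<in> N} = UNIV"
    proof (rule gal_irreducible[of e0])
      show "u + v \<in> {e. (e, 0, 0) \<in> N}" if "u \<in> {e. (e, 0, 0) \<in> N}" "v \<in> {e. (e, 0, 0) \<in> N}" for u v
        using that D(2)[of "(u, 0, 0)" "(v, 0, 0)"] by simp
      show "z *s v \<in> {e. (e, 0, 0) \<in> N}" if "v \<in> {e. (e, 0, 0) \<in> N}" for z v
        using that D(3)[of "(v, 0, 0)" z] by simp
      show "gal w *v v \<in> {e. (e, 0, 0) \<in> N}" if "w \<in> H3" "v \<in> {e. (e, 0, 0) \<in> N}" for w v
        using that D(6)[of w "(v, 0, 0)"] by simp
    qed (use e0 in auto)
    then have "N = UNIV" by (intro lowest_generates D(2,4)) auto
    then show ?thesis by simp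
  qed simp
qed

lemma sum_gal_reflections: "(\<Sum>s\<in>reflections. gal s *v e) = 5 *s e"
proof -
  have "(\<Sum>s\<in>reflections. gal s *v e) $ k = (\<Sum>l\<in>UNIV. complex_of_real (\<Sum>s\<in>reflections. conj_mat s $ k $ l) * e $ l)" for k
    by (simp add: gal_def refl_rep_def matrix_vector_mult_def sum_distrib_right del: sum_conj_reflections)
      (rule sum.swap)
  then show ?thesis
    by (simp add: vec_eq_iff sum_conj_reflections if_distrib if_distribR cong: if_cong)
qed

text \<open>The equivalence \<open>P\<close> is absorbed into the embedding of the lowest weight space.\<close>

lemma L10_lowest_weight:
  fixes \<tau> :: "mat3 \<Rightarrow> complex^3^3"
  assumes P: "P ** P' = mat 1" "P' ** P = mat 1" and \<tau>: "\<And>w. w \<in> H3 \<Longrightarrow> \<tau> w ** P = P ** gal w"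
  shows "lowest_weight_module (1/2) L10 \<tau> (\<lambda>v. (P' *v v, 0, 0)) (-1)"
proof -
  have \<tau>': "P' *v (\<tau> w *v v) = gal w *v (P' *v v)" if w: "w \<in> H3" for w v
  proof -
    have "P' ** \<tau> w = P' ** (\<tau> w ** P) ** P'" by (simp add: matrix_mul_assoc[symmetric] P)
    also have "\<dots> = gal w ** P'" by (simp add: \<tau>[OF w] matrix_mul_assoc P)
    finally show ?thesis by (simp add: matrix_vector_mul_assoc)
  qed
  have PP: "P' *v (P *v v) = v" "P *v (P' *v v) = v" for v by (simp_all add: matrix_vector_mul_assoc P)
  show ?thesis
  proof (intro lowest_weight_module.intro lowest_weight_module_axioms.intro L10.hc_module_axioms)
    fix v
    have "(\<Sum>s\<in>reflections. \<tau> s *v v) = P *v (P' *v (\<Sum>s\<in>reflections. \<tau> s *v v))" by (simp add: PP)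
    also have "P' *v (\<Sum>s\<in>reflections. \<tau> s *v v) = (\<Sum>s\<in>reflections. gal s *v (P' *v v))"
      using reflections_H3 by (auto simp: matrix_vector_mult_sum \<tau>' intro!: sum.cong)
    also have "P *v \<dots> = 5 *s v" by (simp add: sum_gal_reflections vector_scalar_commute PP)
    finally show "(3/2) *s v - (1/2) *s (\<Sum>s\<in>reflections. \<tau> s *v v) = (-1) *s v"
      by (simp add: vec_eq_iff)
    have "\<tau> (mat 1) = \<tau> (mat 1) ** P ** P'" by (simp add: matrix_mul_assoc[symmetric] P)
    then show "\<tau> (mat 1) = mat 1" by (simp add: \<tau>[OF H3_one] gal_one P)
  next
    fix N assume N: "submodule N (Hc (1/2)) L10" "range (\<lambda>v. (P' *v v, 0, 0)) \<subseteq> N"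
    have "(e, 0, 0) \<in> N" for e
    proof -
      have "(P' *v (P *v e), 0, 0) \<in> N" using N(2) by blast
      then show ?thesis by (simp only: PP)
    qed
    then show "N = carrier L10" using lowest_generates[OF L10_submodule(2,4)[OF N(1)]] by simp
  next
    fix v0 U assume v0: "v0 \<in> U" "v0 \<noteq> 0" and add: "\<And>u v. u \<in> U \<Longrightarrow> v \<in> U \<Longrightarrow> u + v \<in> U"
      and sc: "\<And>z v. v \<in> U \<Longrightarrow> z *s v \<in> U" and act: "\<And>w v. w \<in> H3 \<Longrightarrow> v \<in> U \<Longrightarrow> \<tau> w *v v \<in> U"
    have U': "{e. P *v e \<in> U} = UNIV"
    proof (rule gal_irreducible[of "P' *v v0"])
      show "P' *v v0 \<in> {e. P *v e \<in> U}" using v0 by (simp add: PP)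
      show "P' *v v0 \<noteq> 0" using v0(2) PP(2)[of v0] by auto
    next
      fix u v assume "u \<in> {e. P *v e \<in> U}" "v \<in> {e. P *v e \<in> U}"
      then show "u + v \<in> {e. P *v e \<in> U}" using add by (simp add: matrix_vector_right_distrib)
    next
      fix z v assume "v \<in> {e. P *v e \<in> U}"
      then show "z *s v \<in> {e. P *v e \<in> U}" using sc by (simp add: vector_scalar_commute)
    next
      fix w v assume "w \<in> H3" "v \<in> {e. P *v e \<in> U}"
      then show "gal w *v v \<in> {e. P *v e \<in> U}"
        using act[of w "P *v v"] \<tau>[of w] by (simp add: matrix_vector_mul_assoc)
    qed
    have "v \<in> U" for v
    proof -
      have "P' *v v \<in> {e. P *v e \<in> U}" using U' by blast
      then show ?thesis by (simp add: PP)
    qed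
    then show "U = UNIV" by blast
  qed (simp_all add: \<tau>' matrix_vector_right_distrib vector_scalar_commute zero_prod_def)
qed

lemma sym_dual_subset: "sym_dual c \<subseteq> carrier (Hc c)"
  unfolding sym_dual_def by (rule ring.generate_ring_incl[OF ring_Hc]) auto

lemma L10_category_O: "category_O (1/2) L10"
  unfolding category_O_def
proof (intro conjI L10.left_module_axioms ballI)
  let ?F = "(\<lambda>i. (axis i 1, 0, 0)) ` (UNIV :: 3 set) :: V10 set"
  show "\<exists>F. finite F \<and> F \<subseteq> carrier L10 \<and>
    (\<forall>N. submodule N (Hc (1/2)\<lparr>carrier := sym_dual (1/2)\<rparr>) L10 \<and> F \<subseteq> N \<longrightarrow> N = carrier L10)"
  proof (intro exI[of _ ?F] conjI allI impI)
    fix N assume "submodule N (Hc (1/2)\<lparr>carrier := sym_dual (1/2)\<rparr>) L10 \<and> ?F \<subseteq> N"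
    then have N: "submodule N (Hc (1/2)\<lparr>carrier := sym_dual (1/2)\<rparr>) L10" and F: "?F \<subseteq> N" by auto
    interpret N: submodule N "Hc (1/2)\<lparr>carrier := sym_dual (1/2)\<rparr>" L10 by (rule N)
    have add: "u + v \<in> N" if "u \<in> N" "v \<in> N" for u v
      using N.m_closed[OF that] by simp
    have "hc_scalar (1/2) z \<in> sym_dual (1/2)" "hc_dual (1/2) x \<in> sym_dual (1/2)" for z x
      unfolding sym_dual_def by (rule generate_ring.incl, simp)+
    then have sc: "sc10 z v \<in> N" and X: "X10 x v \<in> N" if "v \<in> N" for z x v
      using N.smult_closed[of "hc_scalar (1/2) z" v] N.smult_closed[of "hc_dual (1/2) x" v] that by auto
    have "(e, 0, 0) \<in> N" for e
    proof -
      have "(axis i 1, 0, 0) \<in> N" for i using F by auto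
      then have "sc10 (e$1) (axis 1 1, 0, 0) + sc10 (e$2) (axis 2 1, 0, 0) + sc10 (e$3) (axis 3 1, 0, 0) \<in> N"
        by (intro add sc)
      moreover have "e = e$1 *s axis 1 1 + e$2 *s axis 2 1 + e$3 *s axis 3 1"
        by (simp add: vec_eq_iff forall_3 axis_def)
      ultimately show ?thesis by simp
    qed
    then show "N = carrier L10" using lowest_generates[OF add X] by simp
  qed auto
  fix v :: V10
  show "\<exists>n. \<forall>ys. length ys = n \<longrightarrow> foldr (\<lambda>y u. hc_vec (1/2) y \<odot>\<^bsub>L10\<^esub> u) ys v = \<zero>\<^bsub>L10\<^esub>"
  proof (intro exI[of _ 3] allI impI)
    fix ys :: "(complex^3) list" assume "length ys = 3"
    then obtain a b c where "ys = [a, b, c]" by (auto simp: length_Suc_conv numeral_3_eq_3)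
    then show "foldr (\<lambda>y u. hc_vec (1/2) y \<odot>\<^bsub>L10\<^esub> u) ys v = \<zero>\<^bsub>L10\<^esub>"
      by (cases v) (simp add: zero_prod_def)
  qed
qed

text \<open>The element \<open>-Id\<close> excludes degrees \<open>-1\<close> and \<open>1\<close>. In degree \<open>0\<close> the coordinate reflections leave only the
  first coordinate, and one further reflection multiplies it by \<open>-1/4\<close>.\<close>

lemma L10_invariants: "invariants (1/2) L10 = {\<zero>\<^bsub>L10\<^esub>}"
proof
  show "invariants (1/2) L10 \<subseteq> {\<zero>\<^bsub>L10\<^esub>}"
  proof
    fix v assume "v \<in> invariants (1/2) L10"
    then have inv: "R10 w v = v" if "w \<in> H3" for w using that by (auto simp: invariants_def)
    obtain e d f where v: "v = (e, d, f)" by (cases v)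
    have m: "- mat 1 \<in> H3" using H3_minus[OF H3_one] .
    have "gal (- mat 1) = - mat 1"
      by (simp add: gal_def conj_mat_minus H3_one conj_mat_one) (simp add: refl_rep_def vec_eq_iff mat_def)
    moreover have "(- mat 1) *v u = - u" for u :: "complex^3"
      by (simp add: vec_eq_iff matrix_vector_mult_def mat_def if_distrib if_distribR sum_negf cong: if_cong)
    ultimately have "gal (- mat 1) *v u = - u" for u by simp
    then have ef: "e = 0" "f = 0" using inv[OF m] by (simp_all add: v vec_eq_iff)
    have dm: "drep (zmat (mirror n)) *v d = d" if "n < 15" for n
      using inv[OF mirror_H3[OF that]] by (simp add: v)
    have c: "(\<Sum>l\<in>UNIV. complex_of_real (zval (zdmat (mirror n) (zstar (mirror n)) ! ix4 k ! ix4 l) / 16) * d $ l) = d $ k"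
      if "n < 15" for n k
      using arg_cong[OF dm[OF that], of "\<lambda>u. u $ k"] that
      by (simp add: matrix_vector_mult_def drep_table mirror_mem)
    have "d $ 3 = 0" "d $ 4 = 0" using c[of 0 3] c[of 0 4]
      by (simp_all add: sum_4 mirror_eval)
    moreover have "d $ 2 = 0" using c[of 1 2] by (simp add: sum_4 mirror_eval)
    moreover have "d $ 1 = 0"
    proof -
      have e: "- (d $ 1 / 4) = d $ 1" using c[of 3 1] calculation by (simp add: sum_4 mirror_eval)
      have "5 * d $ 1 = 4 * d $ 1 + d $ 1" by simp
      also have "4 * d $ 1 = 4 * (- (d $ 1 / 4))" by (simp only: e)
      finally show ?thesis by simp
    qed
    ultimately have "d = 0" by (simp add: vec_eq_iff forall_4)
    then show "v \<in> {\<zero>\<^bsub>L10\<^esub>}" using ef v by (simp add: zero_prod_def)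
  qed
  show "{\<zero>\<^bsub>L10\<^esub>} \<subseteq> invariants (1/2) L10"
    by (auto simp: invariants_def zero_prod_def)
qed

section \<open>Transport along isomorphisms\<close>

lemma category_O_transport:
  assumes iso: "lmod_iso (Hc c) M V f" and V: "category_O c V"
  shows "category_O c M"
proof -
  interpret lmod_iso "Hc c" M V f by (rule iso)
  let ?g = "inv_into (carrier M) f"
  interpret inv: lmod_iso "Hc c" V M ?g by (rule inverse)
  have gf: "?g (f u) = u" if "u \<in> carrier M" for u
    using that bij by (simp add: bij_betw_def)
  have V': "\<exists>F. finite F \<and> F \<subseteq> carrier V \<and>
      (\<forall>N. submodule N (Hc c \<lparr>carrier := sym_dual c\<rparr>) V \<and> F \<subseteq> N \<longrightarrow> N = carrier V)"
    using V unfolding category_O_def by (elim conjE)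
  have nil: "\<forall>v\<in>carrier V. \<exists>n. \<forall>ys. length ys = n \<longrightarrow>
      foldr (\<lambda>y u. hc_vec c y \<odot>\<^bsub>V\<^esub> u) ys v = \<zero>\<^bsub>V\<^esub>"
    using V unfolding category_O_def by (elim conjE)
  from V' obtain F where FF: "finite F \<and> F \<subseteq> carrier V \<and>
      (\<forall>N. submodule N (Hc c \<lparr>carrier := sym_dual c\<rparr>) V \<and> F \<subseteq> N \<longrightarrow> N = carrier V)" by (elim exE)
  then have F: "finite F" "F \<subseteq> carrier V"
    "\<And>N. submodule N (Hc c \<lparr>carrier := sym_dual c\<rparr>) V \<Longrightarrow> F \<subseteq> N \<Longrightarrow> N = carrier V" by simp_all
  show ?thesis
    unfolding category_O_def
  proof (intro conjI M.left_module_axioms exI[of _ "?g ` F"] allI impI ballI)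
    show "finite (?g ` F)" using F by simp
    show "?g ` F \<subseteq> carrier M" using F(2) inv.f_closed by blast
    fix N assume "submodule N (Hc c \<lparr>carrier := sym_dual c\<rparr>) M \<and> ?g ` F \<subseteq> N"
    then have N: "submodule N (Hc c \<lparr>carrier := sym_dual c\<rparr>) M" and sub: "?g ` F \<subseteq> N" by auto
    have "{v \<in> carrier V. ?g v \<in> N} = carrier V"
      using inv.image_submodule[OF sym_dual_subset N] F(2) sub by (intro F(3)) auto
    then have "u \<in> N" if "u \<in> carrier M" for u using gf[OF that] f_closed[OF that] by force
    moreover have "N \<subseteq> carrier M" using subgroup.subset[OF submodule.axioms(1)[OF N]] by simp
    ultimately show "N = carrier M" by blast
  next
    fix u assume u: "u \<in> carrier M"
    from bspec[OF nil f_closed[OF u]]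
    obtain n where n: "\<forall>ys. length ys = n \<longrightarrow> foldr (\<lambda>y u. hc_vec c y \<odot>\<^bsub>V\<^esub> u) ys (f u) = \<zero>\<^bsub>V\<^esub>"
      by (elim exE)
    have fold: "foldr (\<lambda>y u. hc_vec c y \<odot>\<^bsub>M\<^esub> u) ys u \<in> carrier M \<and>
        f (foldr (\<lambda>y u. hc_vec c y \<odot>\<^bsub>M\<^esub> u) ys u) = foldr (\<lambda>y u. hc_vec c y \<odot>\<^bsub>V\<^esub> u) ys (f u)" for ys
      by (induction ys) (auto simp: u M.smult_closed f_smult)
    show "\<exists>n. \<forall>ys. length ys = n \<longrightarrow> foldr (\<lambda>y u. hc_vec c y \<odot>\<^bsub>M\<^esub> u) ys u = \<zero>\<^bsub>M\<^esub>"
    proof (intro exI[of _ n] allI impI)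
      fix ys :: "(complex^3) list" assume "length ys = n"
      then have "f (foldr (\<lambda>y u. hc_vec c y \<odot>\<^bsub>M\<^esub> u) ys u) = \<zero>\<^bsub>V\<^esub>" using fold[of ys] n by simp
      then show "foldr (\<lambda>y u. hc_vec c y \<odot>\<^bsub>M\<^esub> u) ys u = \<zero>\<^bsub>M\<^esub>"
        using f_zero_iff[OF conjunct1[OF fold[of ys]]] by (rule iffD1[rotated])
    qed
  qed
qed

lemma invariants_transport:
  assumes iso: "lmod_iso (Hc c) M V f" and V: "invariants c V = {\<zero>\<^bsub>V\<^esub>}"
  shows "invariants c M = {\<zero>\<^bsub>M\<^esub>}"
proof -
  interpret lmod_iso "Hc c" M V f by (rule iso)
  have "u = \<zero>\<^bsub>M\<^esub>" if u: "u \<in> invariants c M" for u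
  proof -
    have uM: "u \<in> carrier M" and w: "\<And>w. w \<in> H3 \<Longrightarrow> hc_group c w \<odot>\<^bsub>M\<^esub> u = u"
      using u by (auto simp: invariants_def)
    have "f u \<in> invariants c V"
      using uM w by (auto simp: invariants_def simp flip: f_smult)
    then show ?thesis using V f_zero_iff[OF uM] by simp
  qed
  moreover have "\<zero>\<^bsub>M\<^esub> \<in> invariants c M"
    by (auto simp: invariants_def M.smult_r_null)
  ultimately show ?thesis by blast
qed

lemma iso_of_injection:
  fixes V :: "(hc_elem, 'v) module" and j :: "'v \<Rightarrow> 'w"
  assumes V: "left_module (Hc c) V" and j: "inj_on j (carrier V)"
  shows "\<exists>M :: (hc_elem, 'w) module. \<exists>f. lmod_iso (Hc c) M V f"
proof -
  interpret V: left_module "Hc c" V by (rule V)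
  let ?g = "inv_into (carrier V) j"
  define M :: "(hc_elem, 'w) module" where
    "M = \<lparr>carrier = j ` carrier V, monoid.mult = undefined, monoid.one = undefined, ring.zero = j \<zero>\<^bsub>V\<^esub>,
      ring.add = (\<lambda>u v. j (?g u \<oplus>\<^bsub>V\<^esub> ?g v)), smult = (\<lambda>a u. j (a \<odot>\<^bsub>V\<^esub> ?g u))\<rparr>"
  have g: "?g (j v) = v" if "v \<in> carrier V" for v using j that by simp
  have hom: "lmod_hom (Hc c) M V ?g" by (auto simp: lmod_hom_def M_def g V.smult_closed)
  have bij: "bij_betw ?g (carrier M) (carrier V)"
    using j by (simp add: M_def bij_betw_inv_into inj_on_imp_bij_betw)
  have "left_module (Hc c) M"
    by (rule left_module_transport[OF V hom bij]) (auto simp: M_def g V.smult_closed)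
  then show ?thesis using V hom bij lmod_iso.intro lmod_iso_axioms.intro by blast
qed

text \<open>The ten coordinates of a vector serve as the first ten entries of a finitely supported sequence.\<close>

theorem aspherical_half: "aspherical (1/2)"
proof -
  define j :: "V10 \<Rightarrow> (nat \<Rightarrow>\<^sub>0 complex)" where "j = (\<lambda>(e, d, f).
    Poly_Mapping.single 0 (e$1) + Poly_Mapping.single 1 (e$2) + Poly_Mapping.single 2 (e$3)
    + Poly_Mapping.single 3 (d$1) + Poly_Mapping.single 4 (d$2) + Poly_Mapping.single 5 (d$3) + Poly_Mapping.single 6 (d$4)
    + Poly_Mapping.single 7 (f$1) + Poly_Mapping.single 8 (f$2) + Poly_Mapping.single 9 (f$3))"
  have l: "Poly_Mapping.lookup (j (e, d, f)) 0 = e$1" "Poly_Mapping.lookup (j (e, d, f)) 1 = e$2"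
    "Poly_Mapping.lookup (j (e, d, f)) 2 = e$3" "Poly_Mapping.lookup (j (e, d, f)) 3 = d$1"
    "Poly_Mapping.lookup (j (e, d, f)) 4 = d$2" "Poly_Mapping.lookup (j (e, d, f)) 5 = d$3"
    "Poly_Mapping.lookup (j (e, d, f)) 6 = d$4" "Poly_Mapping.lookup (j (e, d, f)) 7 = f$1"
    "Poly_Mapping.lookup (j (e, d, f)) 8 = f$2" "Poly_Mapping.lookup (j (e, d, f)) 9 = f$3" for e d f
    by (simp_all add: j_def lookup_add lookup_single)
  have "inj j"
  proof (rule injI)
    fix u v assume uv: "j u = j v"
    obtain e d f e' d' f' where "u = (e, d, f)" "v = (e', d', f')" by (cases u; cases v)
    then show "u = v" using uv l[of e d f] l[of e' d' f'] by (simp add: vec_eq_iff forall_3 forall_4)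
  qed
  then have "inj_on j (carrier L10)" by simp
  from iso_of_injection[OF L10.left_module_axioms this]
  obtain M :: "(hc_elem, nat \<Rightarrow>\<^sub>0 complex) module" and f where iso: "lmod_iso (Hc (1/2)) M L10 f"
    by (elim exE)
  have "carrier M \<noteq> {\<zero>\<^bsub>M\<^esub>}"
    using irreducible_transport[OF iso L10_irreducible] by (simp add: irreducible_module_def)
  then show ?thesis
    unfolding aspherical_def
    using category_O_transport[OF iso L10_category_O] invariants_transport[OF iso L10_invariants] by blast
qed

section \<open>Characters\<close>

text \<open>The relation whose unique solution is \<open>operator_trace\<close>. An isomorphism transports the relation, and
  hence the trace, without knowing that the solution is unique.\<close>

definition trace_witness ::
    "complex \<Rightarrow> (hc_elem, 'v) module \<Rightarrow> 'v set \<Rightarrow> ('v \<Rightarrow> 'v) \<Rightarrow> complex \<Rightarrow> bool" where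
  "trace_witness c V U T t \<longleftrightarrow> (\<exists>n b (a :: nat \<Rightarrow> nat \<Rightarrow> complex).
        is_basis c V U n b \<and>
        (\<forall>k<n. T (b k) = (\<Oplus>\<^bsub>V\<^esub>i\<in>{..<n}. hc_scalar c (a i k) \<odot>\<^bsub>V\<^esub> b i)) \<and>
        t = (\<Sum>i<n. a i i))"

lemma operator_trace_witness: "operator_trace c V U T = (THE t. trace_witness c V U T t)"
  unfolding operator_trace_def trace_witness_def ..

lemma trace_witness_transport:
  assumes iso: "lmod_iso (Hc c) M V f" and U: "U \<subseteq> carrier M"
    and T: "\<And>u. u \<in> U \<Longrightarrow> f (T u) = T' (f u)" and w: "trace_witness c M U T t"
  shows "trace_witness c V (f ` U) T' t"
proof -
  interpret lmod_iso "Hc c" M V f by (rule iso)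
  from w obtain n b a where "is_basis c M U n b \<and>
    (\<forall>k<n. T (b k) = (\<Oplus>\<^bsub>M\<^esub>i\<in>{..<n}. hc_scalar c (a i k) \<odot>\<^bsub>M\<^esub> b i)) \<and> t = (\<Sum>i<n. a i i)"
    unfolding trace_witness_def by (elim exE)
  then have b: "is_basis c M U n b"
    "\<And>k. k < n \<Longrightarrow> T (b k) = (\<Oplus>\<^bsub>M\<^esub>i\<in>{..<n}. hc_scalar c (a i k) \<odot>\<^bsub>M\<^esub> b i)" "t = (\<Sum>i<n. a i i)"
    by simp_all
  have bU: "b i \<in> U" if "i < n" for i using b(1) that by (auto simp: is_basis_def)
  then have bM: "b i \<in> carrier M" if "i < n" for i using U that by blast
  have fs: "f (\<Oplus>\<^bsub>M\<^esub>i\<in>{..<n}. hc_scalar c (p i) \<odot>\<^bsub>M\<^esub> b i)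
      = (\<Oplus>\<^bsub>V\<^esub>i\<in>{..<n}. hc_scalar c (p i) \<odot>\<^bsub>V\<^esub> f (b i))" for p
  proof -
    have "f (\<Oplus>\<^bsub>M\<^esub>i\<in>{..<n}. hc_scalar c (p i) \<odot>\<^bsub>M\<^esub> b i) = (\<Oplus>\<^bsub>V\<^esub>i\<in>{..<n}. f (hc_scalar c (p i) \<odot>\<^bsub>M\<^esub> b i))"
      using bM by (intro f_finsum) (auto simp: M.smult_closed)
    also have "\<dots> = (\<Oplus>\<^bsub>V\<^esub>i\<in>{..<n}. hc_scalar c (p i) \<odot>\<^bsub>V\<^esub> f (b i))"
      using bM by (intro V.M.finsum_cong') (auto simp: f_smult V.smult_closed)
    finally show ?thesis .
  qed
  have cl: "(\<Oplus>\<^bsub>M\<^esub>i\<in>{..<n}. hc_scalar c (p i) \<odot>\<^bsub>M\<^esub> b i) \<in> carrier M" for p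
    using bM by (intro M.M.finsum_closed) (auto simp: M.smult_closed)
  have "is_basis c V (f ` U) n (f \<circ> b)"
    unfolding is_basis_def
  proof (intro conjI allI impI ballI)
    show "(f \<circ> b) i \<in> f ` U" if "i < n" for i using bU[OF that] by simp
    fix v assume "v \<in> f ` U"
    then obtain u where u: "u \<in> U" "v = f u" by blast
    have eq: "f u = (\<Oplus>\<^bsub>V\<^esub>i\<in>{..<n}. hc_scalar c (p i) \<odot>\<^bsub>V\<^esub> (f \<circ> b) i) \<longleftrightarrow>
        u = (\<Oplus>\<^bsub>M\<^esub>i\<in>{..<n}. hc_scalar c (p i) \<odot>\<^bsub>M\<^esub> b i)" for p
      using f_inj[OF _ cl[of p], of u] u U fs[of p] by (auto simp: o_def)
    show "\<exists>!p. (\<forall>i\<ge>n. p i = 0) \<and> v = (\<Oplus>\<^bsub>V\<^esub>i\<in>{..<n}. hc_scalar c (p i) \<odot>\<^bsub>V\<^esub> (f \<circ> b) i)"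
      unfolding u(2) eq using b(1) u(1) by (simp add: is_basis_def)
  qed
  moreover have "T' ((f \<circ> b) k) = (\<Oplus>\<^bsub>V\<^esub>i\<in>{..<n}. hc_scalar c (a i k) \<odot>\<^bsub>V\<^esub> (f \<circ> b) i)" if "k < n" for k
    using T[OF bU[OF that]] b(2)[OF that] fs[of "\<lambda>i. a i k"] by (simp add: o_def)
  ultimately have "is_basis c V (f ` U) n (f \<circ> b) \<and>
      (\<forall>k<n. T' ((f \<circ> b) k) = (\<Oplus>\<^bsub>V\<^esub>i\<in>{..<n}. hc_scalar c (a i k) \<odot>\<^bsub>V\<^esub> (f \<circ> b) i)) \<and> t = (\<Sum>i<n. a i i)"
    using b(3) by simp
  then show ?thesis unfolding trace_witness_def by (intro exI)
qed

lemma gen_eigenspace_transport: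
  assumes iso: "lmod_iso (Hc c) M V f"
  shows "f ` gen_eigenspace c M j = gen_eigenspace c V j"
proof -
  interpret lmod_iso "Hc c" M V f by (rule iso)
  let ?S = "\<lambda>u. (euler c \<odot>\<^bsub>M\<^esub> u) \<ominus>\<^bsub>M\<^esub> (hc_scalar c j \<odot>\<^bsub>M\<^esub> u)"
  let ?T = "\<lambda>u. (euler c \<odot>\<^bsub>V\<^esub> u) \<ominus>\<^bsub>V\<^esub> (hc_scalar c j \<odot>\<^bsub>V\<^esub> u)"
  have it: "(?S ^^ n) u \<in> carrier M \<and> f ((?S ^^ n) u) = (?T ^^ n) (f u)" if "u \<in> carrier M" for u n
    by (induction n) (auto simp: that a_minus_def f_add f_minus f_smult M.smult_closed)
  have "f u \<in> gen_eigenspace c V j \<longleftrightarrow> u \<in> gen_eigenspace c M j" if "u \<in> carrier M" for u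
  proof -
    have "(?T ^^ n) (f u) = \<zero>\<^bsub>V\<^esub> \<longleftrightarrow> (?S ^^ n) u = \<zero>\<^bsub>M\<^esub>" for n
      using it[OF that, of n] f_zero_iff[of "(?S ^^ n) u"] by argo
    then show ?thesis unfolding gen_eigenspace_def using that f_closed[OF that] by simp
  qed
  moreover have "gen_eigenspace c M j \<subseteq> carrier M" "gen_eigenspace c V j \<subseteq> carrier V"
    by (auto simp: gen_eigenspace_def)
  ultimately show ?thesis using f_surj by blast
qed

lemma character_transport:
  assumes iso: "lmod_iso (Hc c) M V f" and w: "w \<in> H3"
  shows "character c M w j = character c V w j"
proof -
  interpret lmod_iso "Hc c" M V f by (rule iso)
  let ?g = "inv_into (carrier M) f"
  interpret inv: lmod_iso "Hc c" V M ?g by (rule inverse)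
  let ?U = "gen_eigenspace c M j" and ?W = "gen_eigenspace c V j"
  have sub: "?U \<subseteq> carrier M" "?W \<subseteq> carrier V" by (auto simp: gen_eigenspace_def)
  have "trace_witness c M ?U (\<lambda>v. hc_group c w \<odot>\<^bsub>M\<^esub> v) t \<longleftrightarrow> trace_witness c V ?W (\<lambda>v. hc_group c w \<odot>\<^bsub>V\<^esub> v) t" for t
    using trace_witness_transport[OF iso sub(1), of "\<lambda>v. hc_group c w \<odot>\<^bsub>M\<^esub> v" "\<lambda>v. hc_group c w \<odot>\<^bsub>V\<^esub> v" t]
      trace_witness_transport[OF inverse sub(2), of "\<lambda>v. hc_group c w \<odot>\<^bsub>V\<^esub> v" "\<lambda>v. hc_group c w \<odot>\<^bsub>M\<^esub> v" t]
      gen_eigenspace_transport[OF iso, of j] gen_eigenspace_transport[OF inverse, of j] w sub f_smult inv.f_smult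
    by (auto simp: subset_iff)
  then show ?thesis by (simp add: character_def operator_trace_witness)
qed

lemma (in vector_space) trace_independent_of_basis:
  fixes n n' :: nat and a a' :: "nat \<Rightarrow> nat \<Rightarrow> 'a"
  assumes b: "\<And>i. i < n \<Longrightarrow> b i \<in> U" and b': "\<And>i. i < n' \<Longrightarrow> b' i \<in> U"
    and rep: "\<And>u. u \<in> U \<Longrightarrow> \<exists>p. u = (\<Sum>i<n. scale (p i) (b i))"
    and rep': "\<And>u. u \<in> U \<Longrightarrow> \<exists>p. u = (\<Sum>i<n'. scale (p i) (b' i))"
    and uniq: "\<And>p q i. (\<Sum>i<n. scale (p i) (b i)) = (\<Sum>i<n. scale (q i) (b i)) \<Longrightarrow> i < n \<Longrightarrow> p i = q i"
    and uniq': "\<And>p q i. (\<Sum>i<n'. scale (p i) (b' i)) = (\<Sum>i<n'. scale (q i) (b' i)) \<Longrightarrow> i < n' \<Longrightarrow> p i = q i"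
    and T: "\<And>u v. T (u + v) = T u + T v" "\<And>z v. T (scale z v) = scale z (T v)"
    and a: "\<And>k. k < n \<Longrightarrow> T (b k) = (\<Sum>i<n. scale (a i k) (b i))"
    and a': "\<And>k. k < n' \<Longrightarrow> T (b' k) = (\<Sum>i<n'. scale (a' i k) (b' i))"
  shows "(\<Sum>i<n. a i i) = (\<Sum>i<n'. a' i i)"
proof -
  have T0: "T 0 = 0" using T(2)[of 0 0] by simp
  have Tsum: "T (sum g I) = (\<Sum>i\<in>I. T (g i))" for g :: "nat \<Rightarrow> 'b" and I
    by (induction I rule: infinite_finite_induct) (simp_all add: T0 T)
  obtain C where C: "\<And>k. k < n' \<Longrightarrow> b' k = (\<Sum>i<n. scale (C i k) (b i))"
  proof -
    have "\<forall>k. \<exists>p. k < n' \<longrightarrow> b' k = (\<Sum>i<n. scale (p i) (b i))" using rep[OF b'] by blast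
    then obtain p where "\<And>k. k < n' \<Longrightarrow> b' k = (\<Sum>i<n. scale (p k i) (b i))" by metis
    then show thesis using that[of "\<lambda>i k. p k i"] by simp
  qed
  obtain D where D: "\<And>k. k < n \<Longrightarrow> b k = (\<Sum>i<n'. scale (D i k) (b' i))"
  proof -
    have "\<forall>k. \<exists>p. k < n \<longrightarrow> b k = (\<Sum>i<n'. scale (p i) (b' i))" using rep'[OF b] by blast
    then obtain p where "\<And>k. k < n \<Longrightarrow> b k = (\<Sum>i<n'. scale (p k i) (b' i))" by metis
    then show thesis using that[of "\<lambda>i k. p k i"] by simp
  qed
  have CD: "(\<Sum>l<n'. C i l * D l j) = (if i = j then 1 else 0)" if ij: "i < n" "j < n" for i j
  proof -
    have "b j = (\<Sum>l<n'. \<Sum>i<n. scale (D l j * C i l) (b i))"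
      using D[OF ij(2)] by (simp add: C scale_sum_right)
    also have "\<dots> = (\<Sum>i<n. scale (\<Sum>l<n'. C i l * D l j) (b i))"
      by (subst sum.swap) (simp add: scale_sum_left mult.commute)
    finally have e: "b j = (\<Sum>i<n. scale (\<Sum>l<n'. C i l * D l j) (b i))" .
    have "b j = (\<Sum>i<n. scale (if i = j then 1 else 0) (b i))"
      using ij by (simp add: if_distrib if_distribR cong: if_cong)
    then show ?thesis using uniq[of "\<lambda>i. \<Sum>l<n'. C i l * D l j" "\<lambda>i. if i = j then 1 else 0" i] e ij by simp
  qed
  have "a' l k = (\<Sum>i<n. \<Sum>j<n. D l j * a j i * C i k)" if lk: "l < n'" "k < n'" for l k
  proof -
    have "T (b' k) = (\<Sum>i<n. scale (C i k) (\<Sum>j<n. scale (a j i) (b j)))"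
      by (simp add: C[OF lk(2)] Tsum T a)
    also have "\<dots> = (\<Sum>i<n. scale (C i k) (\<Sum>j<n. scale (a j i) (\<Sum>l<n'. scale (D l j) (b' l))))"
      by (intro sum.cong refl arg_cong2[where f = scale] D) simp
    also have "\<dots> = (\<Sum>i<n. \<Sum>j<n. \<Sum>l<n'. scale (D l j * a j i * C i k) (b' l))"
      by (simp add: scale_sum_right mult_ac)
    also have "\<dots> = (\<Sum>i<n. \<Sum>l<n'. \<Sum>j<n. scale (D l j * a j i * C i k) (b' l))"
      by (intro sum.cong refl sum.swap)
    also have "\<dots> = (\<Sum>l<n'. \<Sum>i<n. \<Sum>j<n. scale (D l j * a j i * C i k) (b' l))"
      by (rule sum.swap)
    also have "\<dots> = (\<Sum>l<n'. scale (\<Sum>i<n. \<Sum>j<n. D l j * a j i * C i k) (b' l))"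
      by (simp add: scale_sum_left)
    finally show ?thesis
      using uniq'[of "\<lambda>l. a' l k" "\<lambda>l. \<Sum>i<n. \<Sum>j<n. D l j * a j i * C i k" l] a'[OF lk(2)] lk by simp
  qed
  then have "(\<Sum>l<n'. a' l l) = (\<Sum>l<n'. \<Sum>i<n. \<Sum>j<n. D l j * a j i * C i l)" by simp
  also have "\<dots> = (\<Sum>i<n. \<Sum>l<n'. \<Sum>j<n. D l j * a j i * C i l)" by (rule sum.swap)
  also have "\<dots> = (\<Sum>i<n. \<Sum>j<n. \<Sum>l<n'. D l j * a j i * C i l)"
    by (intro sum.cong refl sum.swap)
  also have "\<dots> = (\<Sum>i<n. \<Sum>j<n. a j i * (\<Sum>l<n'. C i l * D l j))"
    by (simp add: sum_distrib_left mult_ac)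
  also have "\<dots> = (\<Sum>i<n. \<Sum>j<n. a j i * (if i = j then 1 else 0))"
    by (intro sum.cong refl) (simp add: CD)
  also have "\<dots> = (\<Sum>i<n. a i i)" by (simp add: if_distrib cong: if_cong)
  finally show ?thesis ..
qed

lemma finsum_L10: "finite I \<Longrightarrow> finsum L10 g I = sum g I"
proof (induction I rule: finite_induct)
  case (insert i I)
  then show ?case by (simp add: L10.M.finsum_insert)
qed simp

lemma truncate_sum: "(\<Sum>i<n. sc10 (if i < n then p i else 0) (b i)) = (\<Sum>i<(n::nat). sc10 (p i) (b i))"
  by (rule sum.cong) auto

text \<open>Coefficients of a basis are normalised to vanish outside the index range, which turns unique
  existence into generation and independence.\<close>

lemma is_basis_L10:
  "is_basis (1/2) L10 U n b \<longleftrightarrow> (\<forall>i<n. b i \<in> U) \<and> (\<forall>u\<in>U. \<exists>p. u = (\<Sum>i<n. sc10 (p i) (b i))) \<and>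
     (\<forall>p q. (\<Sum>i<n. sc10 (p i) (b i)) \<in> U \<longrightarrow> (\<Sum>i<n. sc10 (p i) (b i)) = (\<Sum>i<n. sc10 (q i) (b i)) \<longrightarrow> (\<forall>i<n. p i = q i))"
  (is "_ \<longleftrightarrow> ?B \<and> ?R \<and> ?Q")
proof -
  have e: "(\<Oplus>\<^bsub>L10\<^esub>i\<in>{..<n}. hc_scalar (1/2) (p i) \<odot>\<^bsub>L10\<^esub> b i) = (\<Sum>i<n. sc10 (p i) (b i))" for p
    by (simp add: finsum_L10)
  let ?E = "\<forall>u\<in>U. \<exists>!p. (\<forall>i\<ge>n. p i = 0) \<and> u = (\<Sum>i<n. sc10 (p i) (b i))"
  have "?E \<longleftrightarrow> ?R \<and> ?Q"
  proof (intro iffI conjI allI impI ballI)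
    fix u assume "?E" "u \<in> U"
    then show "\<exists>p. u = (\<Sum>i<n. sc10 (p i) (b i))" by blast
  next
    fix p q i assume E: ?E and U: "(\<Sum>i<n. sc10 (p i) (b i)) \<in> U"
      and eq: "(\<Sum>i<n. sc10 (p i) (b i)) = (\<Sum>i<n. sc10 (q i) (b i))" and i: "i < n"
    let ?p = "\<lambda>i. if i < n then p i else 0" and ?q = "\<lambda>i. if i < n then q i else 0"
    have "?p = ?q"
    proof -
      have ex1: "\<exists>!r. (\<forall>i\<ge>n. r i = 0) \<and> (\<Sum>i<n. sc10 (p i) (b i)) = (\<Sum>i<n. sc10 (r i) (b i))"
        using E U by (rule bspec)
      show ?thesis
        using the1_equality[OF ex1, of ?p] the1_equality[OF ex1, of ?q] truncate_sum[of n p b] truncate_sum[of n q b] eq by simp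
    qed
    from fun_cong[OF this, of i] show "p i = q i" using i by simp
  next
    fix u assume RQ: "?R \<and> ?Q" and u: "u \<in> U"
    then obtain p where p: "u = (\<Sum>i<n. sc10 (p i) (b i))" by blast
    show "\<exists>!p. (\<forall>i\<ge>n. p i = 0) \<and> u = (\<Sum>i<n. sc10 (p i) (b i))"
    proof (intro ex1I conjI)
      let ?p = "\<lambda>i. if i < n then p i else 0"
      show "\<forall>i\<ge>n. ?p i = 0" by simp
      show up: "u = (\<Sum>i<n. sc10 (?p i) (b i))" using p truncate_sum by simp
      fix q assume q: "(\<forall>i\<ge>n. q i = 0) \<and> u = (\<Sum>i<n. sc10 (q i) (b i))"
      have "\<forall>i<n. q i = ?p i"
      proof (rule conjunct2[OF RQ, THEN spec, THEN spec, THEN mp, THEN mp])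
        show "(\<Sum>i<n. sc10 (q i) (b i)) \<in> U" using q u by (simp only:)
        show "(\<Sum>i<n. sc10 (q i) (b i)) = (\<Sum>i<n. sc10 (?p i) (b i))" using q up by (simp only:)
      qed
      then show "q = ?p" using q by (auto simp: fun_eq_iff)
    qed
  qed
  from arg_cong[OF this, where f = "\<lambda>C. ?B \<and> C"] show ?thesis unfolding is_basis_def e .
qed

lemma operator_trace_L10:
  assumes U: "\<And>u v. u \<in> U \<Longrightarrow> v \<in> U \<Longrightarrow> u + v \<in> U" "\<And>z v. v \<in> U \<Longrightarrow> sc10 z v \<in> U" "0 \<in> U"
    and T: "\<And>u v. T (u + v) = T u + T v" "\<And>z v. T (sc10 z v) = sc10 z (T v)"
    and b: "is_basis (1/2) L10 U n b" and a: "\<And>k. k < n \<Longrightarrow> T (b k) = (\<Sum>i<n. sc10 (a i k) (b i))"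
  shows "operator_trace (1/2) L10 U T = (\<Sum>i<n. a i i)"
proof -
  have e: "(\<Oplus>\<^bsub>L10\<^esub>i\<in>{..<n}. hc_scalar (1/2) (p i) \<odot>\<^bsub>L10\<^esub> b i) = (\<Sum>i<n. sc10 (p i) (b i))" for p b and n :: nat
    by (simp add: finsum_L10)
  have mem: "(\<Sum>i<n. sc10 (p i) (b i)) \<in> U" if "\<forall>i<n. b i \<in> U" for n :: nat and p b
    using that by (induction n) (auto intro: U)
  show ?thesis
    unfolding operator_trace_witness
  proof (rule the_equality)
    show "trace_witness (1/2) L10 U T (\<Sum>i<n. a i i)"
      unfolding trace_witness_def e using b a by blast
    fix t assume "trace_witness (1/2) L10 U T t"
    then obtain n' b' a' where b': "is_basis (1/2) L10 U n' b'"
      and a': "\<And>k. k < n' \<Longrightarrow> T (b' k) = (\<Sum>i<n'. sc10 (a' i k) (b' i))" and t: "t = (\<Sum>i<n'. a' i i)"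
      unfolding trace_witness_def e by blast
    note B = b[unfolded is_basis_L10] and B' = b'[unfolded is_basis_L10]
    have "(\<Sum>i<n'. a' i i) = (\<Sum>i<n. a i i)"
    proof (rule V10.trace_independent_of_basis[where U = U and T = T and n = n' and n' = n and a = a' and a' = a and b = b' and b' = b])
      show "p i = q i" if "(\<Sum>i<n. sc10 (p i) (b i)) = (\<Sum>i<n. sc10 (q i) (b i))" "i < n" for p q i
        using B mem[of n b p] that by blast
      show "p i = q i" if "(\<Sum>i<n'. sc10 (p i) (b' i)) = (\<Sum>i<n'. sc10 (q i) (b' i))" "i < n'" for p q i
        using B' mem[of n' b' p] that by blast
      show "T (u + v) = T u + T v" "T (sc10 z v) = sc10 z (T v)" for u v z by (rule T)+
      show "T (b k) = (\<Sum>i<n. sc10 (a i k) (b i))" if "k < n" for k using that by (rule a)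
      show "T (b' k) = (\<Sum>i<n'. sc10 (a' i k) (b' i))" if "k < n'" for k using that by (rule a')
      show "b i \<in> U" if "i < n" for i using B that by blast
      show "b' i \<in> U" if "i < n'" for i using B' that by blast
      show "\<exists>p. u = (\<Sum>i<n. sc10 (p i) (b i))" if "u \<in> U" for u using B that by blast
      show "\<exists>p. u = (\<Sum>i<n'. sc10 (p i) (b' i))" if "u \<in> U" for u using B' that by blast
    qed
    then show "t = (\<Sum>i<n. a i i)" by (simp add: t)
  qed
qed

text \<open>The grading comes from the action of \<open>\<hh>\<^sup>*\<close>, which raises the eigenvalue by one, starting from \<open>-1\<close> on the
  lowest weight space.\<close>

lemma euler_L10: "euler (1/2) \<odot>\<^bsub>L10\<^esub> (e, d, f) = (- e, 0, f)"
proof -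
  interpret W: lowest_weight_module "1/2" L10 gal "\<lambda>v. (mat 1 *v v, 0, 0)" "-1"
    by (rule L10_lowest_weight[where P = "mat 1"]; simp only: matrix_mul_lid matrix_mul_rid)
  let ?h = "\<lambda>v. euler (1/2) \<odot>\<^bsub>L10\<^esub> v"
  have add: "?h (u + v) = ?h u + ?h v" for u v
    using L10.smult_r_distr[of "euler (1/2)" u v] by simp
  have X: "?h (X10 x v) = X10 x (?h v) + X10 x v" for x v
    using L10.euler_dual[of v x] by simp
  have e: "?h (e, 0, 0) = (- e, 0, 0)" for e using W.euler_\<iota>[of e] by simp
  have b: "?h (0, Bm x e, 0) = 0" for x e using X[of x "(e, 0, 0)"] e by (simp add: zero_prod_def)
  have d: "?h (0, d, 0) = 0" for d
  proof -
    have "?h (0, Bm x1 e1 + Bm x2 e2 + Bm x3 e3 + Bm x4 e4, 0) = 0" for x1 e1 x2 e2 x3 e3 x4 e4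
      using add[of "(0, Bm x1 e1 + Bm x2 e2 + Bm x3 e3, 0)" "(0, Bm x4 e4, 0)"]
        add[of "(0, Bm x1 e1 + Bm x2 e2, 0)" "(0, Bm x3 e3, 0)"] add[of "(0, Bm x1 e1, 0)" "(0, Bm x2 e2, 0)"] b
      by simp
    from this[of "axis 1 1" "d$1 *s axis 1 1" "axis 2 1" "((G-1) * d$2) *s axis 3 1"
        "axis 3 1" "((G-1) * d$3) *s axis 1 1" "axis 1 1" "((G-1) * d$4) *s axis 2 1"]
    show ?thesis by (simp only: Bm_span[symmetric])
  qed
  have f: "?h (0, 0, f) = (0, 0, f)" for f
  proof -
    have "Nm (axis 1 1) f = f" by (simp add: vec_eq_iff forall_3 Nm_entries axis_def)
    then show ?thesis using X[of f "(0, axis 1 1, 0)"] d by (simp add: zero_prod_def X10_def)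
  qed
  show ?thesis using add[of "(e, 0, 0)" "(0, d, f)"] add[of "(0, d, 0)" "(0, 0, f)"] e[of e] d[of d] f[of f] by simp
qed

lemma eigenspace_L10:
  "gen_eigenspace (1/2) L10 j = {(e, d, f). (j = -1 \<or> e = 0) \<and> (j = 0 \<or> d = 0) \<and> (j = 1 \<or> f = 0)}"
proof -
  let ?S = "\<lambda>u. (euler (1/2) \<odot>\<^bsub>L10\<^esub> u) \<ominus>\<^bsub>L10\<^esub> (hc_scalar (1/2) j \<odot>\<^bsub>L10\<^esub> u)"
  have inv: "\<ominus>\<^bsub>L10\<^esub> v = - v" for v by (rule L10.M.minus_equality) simp_all
  have s: "?S (e, d, f) = ((-1 - j) *s e, (- j) *s d, (1 - j) *s f)" for e d f
    by (simp add: a_minus_def inv euler_L10 vec.scale_left_diff_distrib)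
  have it: "(?S ^^ n) (e, d, f) = ((-1 - j)^n *s e, (- j)^n *s d, (1 - j)^n *s f)" for n e d f
  proof (induction n)
    case (Suc n)
    then show ?case by (simp only: funpow.simps o_apply s vec.scale_scale power_Suc)
  qed simp
  have z: "(\<exists>n. (?S ^^ n) (e, d, f) = 0) \<longleftrightarrow> (j = -1 \<or> e = 0) \<and> (j = 0 \<or> d = 0) \<and> (j = 1 \<or> f = 0)" for e d f
  proof
    assume "\<exists>n. (?S ^^ n) (e, d, f) = 0"
    then show "(j = -1 \<or> e = 0) \<and> (j = 0 \<or> d = 0) \<and> (j = 1 \<or> f = 0)"
      unfolding it by (auto simp: zero_prod_def)
  next
    assume "(j = -1 \<or> e = 0) \<and> (j = 0 \<or> d = 0) \<and> (j = 1 \<or> f = 0)"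
    then have "(?S ^^ 1) (e, d, f) = 0" unfolding it by (auto simp: zero_prod_def)
    then show "\<exists>n. (?S ^^ n) (e, d, f) = 0" by blast
  qed
  show ?thesis unfolding gen_eigenspace_def using z by auto
qed

definition nat3 :: "nat \<Rightarrow> 3" where "nat3 n = (if n = 0 then 1 else if n = 1 then 2 else 3)"
definition nat4 :: "nat \<Rightarrow> 4" where "nat4 n = (if n = 0 then 1 else if n = 1 then 2 else if n = 2 then 3 else 4)"

lemma sum_lessThan_3: "(\<Sum>i<3. g i) = g 0 + g 1 + g (2::nat)"
  by (simp add: numeral_3_eq_3 numeral_2_eq_2)

lemma sum_lessThan_4: "(\<Sum>i<4. g i) = g 0 + g 1 + g 2 + g (3::nat)"
  by (simp add: eval_nat_numeral)

lemma less_3_cases: "i < (3::nat) \<Longrightarrow> i = 0 \<or> i = 1 \<or> i = 2" by auto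
lemma less_4_cases: "i < (4::nat) \<Longrightarrow> i = 0 \<or> i = 1 \<or> i = 2 \<or> i = 3" by auto

theorem character_L10:
  assumes w: "w \<in> H3"
  shows "character (1/2) L10 w j
    = trace (gal w) * t_power (-1) j + trace (drep w) * t_power 0 j + trace (gal w) * t_power 1 j"
proof -
  let ?U = "gen_eigenspace (1/2) L10 j"
  have U: "\<And>u v. u \<in> ?U \<Longrightarrow> v \<in> ?U \<Longrightarrow> u + v \<in> ?U" "\<And>z v. v \<in> ?U \<Longrightarrow> sc10 z v \<in> ?U" "0 \<in> ?U"
    unfolding eigenspace_L10 by (auto simp: zero_prod_def)
  have "operator_trace (1/2) L10 ?U (\<lambda>v. hc_group (1/2) w \<odot>\<^bsub>L10\<^esub> v) = operator_trace (1/2) L10 ?U (R10 w)"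
    using w by simp
  moreover have tr: "operator_trace (1/2) L10 ?U (R10 w) = (\<Sum>i<n. a i i)"
    if "is_basis (1/2) L10 ?U n b" "\<And>k. k < n \<Longrightarrow> R10 w (b k) = (\<Sum>i<n. sc10 (a i k) (b i))" for n b a
    using U V10.R_linear that by (rule operator_trace_L10)
  consider "j = -1" | "j = 0" | "j = 1" | "j \<noteq> -1" "j \<noteq> 0" "j \<noteq> 1" by blast
  then have "operator_trace (1/2) L10 ?U (R10 w)
      = trace (gal w) * t_power (-1) j + trace (drep w) * t_power 0 j + trace (gal w) * t_power 1 j"
  proof cases
    case 1
    have "is_basis (1/2) L10 ?U 3 (\<lambda>i. (axis (nat3 i) 1, 0, 0))"
      unfolding is_basis_L10 unfolding eigenspace_L10
    proof (intro conjI ballI allI impI)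
      fix u :: V10 assume "u \<in> {(e, d, f). (j = -1 \<or> e = 0) \<and> (j = 0 \<or> d = 0) \<and> (j = 1 \<or> f = 0)}"
      then obtain e where "u = (e, 0, 0)" using 1 by auto
      then show "\<exists>p. u = (\<Sum>i<3. sc10 (p i) (axis (nat3 i) 1, 0, 0))"
        by (intro exI[of _ "\<lambda>i. e $ nat3 i"]) (simp add: sum_lessThan_3 nat3_def vec_eq_iff forall_3 axis_def)
    next
      fix p q i assume "(\<Sum>i<3. sc10 (p i) (axis (nat3 i) 1, 0, 0)) = (\<Sum>i<3. sc10 (q i) (axis (nat3 i) 1, 0, 0))"
        and i: "i < (3::nat)"
      then show "p i = q i" using less_3_cases[OF i]
        by (auto simp: sum_lessThan_3 nat3_def vec_eq_iff forall_3 axis_def)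
    qed (use 1 in auto)
    from tr[OF this, of "\<lambda>i k. gal w $ nat3 i $ nat3 k"] show ?thesis
      using 1 by (auto dest!: less_3_cases simp: sum_lessThan_3 nat3_def vec_eq_iff forall_3 axis_def matrix_vector_mult_def sum_3
          trace_def t_power_def)
  next
    case 2
    have "is_basis (1/2) L10 ?U 4 (\<lambda>i. (0, axis (nat4 i) 1, 0))"
      unfolding is_basis_L10 unfolding eigenspace_L10
    proof (intro conjI ballI allI impI)
      fix u :: V10 assume "u \<in> {(e, d, f). (j = -1 \<or> e = 0) \<and> (j = 0 \<or> d = 0) \<and> (j = 1 \<or> f = 0)}"
      then obtain d where "u = (0, d, 0)" using 2 by auto
      then show "\<exists>p. u = (\<Sum>i<4. sc10 (p i) (0, axis (nat4 i) 1, 0))"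
        by (intro exI[of _ "\<lambda>i. d $ nat4 i"]) (simp add: sum_lessThan_4 nat4_def vec_eq_iff forall_4 axis_def)
    next
      fix p q i assume "(\<Sum>i<4. sc10 (p i) (0, axis (nat4 i) 1, 0)) = (\<Sum>i<4. sc10 (q i) (0, axis (nat4 i) 1, 0))"
        and i: "i < (4::nat)"
      then show "p i = q i" using less_4_cases[OF i]
        by (auto simp: sum_lessThan_4 nat4_def vec_eq_iff forall_4 axis_def)
    qed (use 2 in auto)
    from tr[OF this, of "\<lambda>i k. drep w $ nat4 i $ nat4 k"] show ?thesis
      using 2 by (auto dest!: less_4_cases simp: sum_lessThan_4 nat4_def vec_eq_iff forall_4 axis_def matrix_vector_mult_def sum_4
          trace_def t_power_def)
  next
    case 3
    have "is_basis (1/2) L10 ?U 3 (\<lambda>i. (0, 0, axis (nat3 i) 1))"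
      unfolding is_basis_L10 unfolding eigenspace_L10
    proof (intro conjI ballI allI impI)
      fix u :: V10 assume "u \<in> {(e, d, f). (j = -1 \<or> e = 0) \<and> (j = 0 \<or> d = 0) \<and> (j = 1 \<or> f = 0)}"
      then obtain f where "u = (0, 0, f)" using 3 by auto
      then show "\<exists>p. u = (\<Sum>i<3. sc10 (p i) (0, 0, axis (nat3 i) 1))"
        by (intro exI[of _ "\<lambda>i. f $ nat3 i"]) (simp add: sum_lessThan_3 nat3_def vec_eq_iff forall_3 axis_def)
    next
      fix p q i assume "(\<Sum>i<3. sc10 (p i) (0, 0, axis (nat3 i) 1)) = (\<Sum>i<3. sc10 (q i) (0, 0, axis (nat3 i) 1))"
        and i: "i < (3::nat)"
      then show "p i = q i" using less_3_cases[OF i]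
        by (auto simp: sum_lessThan_3 nat3_def vec_eq_iff forall_3 axis_def)
    qed (use 3 in auto)
    from tr[OF this, of "\<lambda>i k. gal w $ nat3 i $ nat3 k"] show ?thesis
      using 3 by (auto dest!: less_3_cases simp: sum_lessThan_3 nat3_def vec_eq_iff forall_3 axis_def matrix_vector_mult_def sum_3
          trace_def t_power_def)
  next
    case 4
    have "is_basis (1/2) L10 ?U 0 (\<lambda>i. 0)"
      unfolding is_basis_L10 eigenspace_L10 using 4 by (auto simp: zero_prod_def)
    from tr[OF this] show ?thesis using 4 by (simp add: t_power_def)
  qed
  ultimately show ?thesis by (simp add: character_def)
qed

section \<open>Rotations and their traces\<close>

lemma rotation_carrier: "g \<in> carrier rotation_group \<longleftrightarrow> g \<in> H3 \<and> det g = 1"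
  by (auto simp: rotation_group_def)

lemma rotation_group_simps [simp]: "a \<otimes>\<^bsub>rotation_group\<^esub> b = a ** b" "\<one>\<^bsub>rotation_group\<^esub> = mat 1"
  by (simp_all add: rotation_group_def)

lemma rotation_closed:
  shows "mat 1 \<in> carrier rotation_group"
    "g \<in> carrier rotation_group \<Longrightarrow> h \<in> carrier rotation_group \<Longrightarrow> g ** h \<in> carrier rotation_group"
    "g \<in> carrier rotation_group \<Longrightarrow> transpose g \<in> carrier rotation_group"
  by (auto simp: rotation_carrier H3_one H3_mult H3_transpose det_mul)

lemma finite_rotations: "finite (carrier rotation_group)"
  by (rule finite_subset[OF _ finite_H3]) (auto simp: rotation_carrier)

lemma rotation_inverse:
  assumes "g \<in> carrier rotation_group"
  shows "transpose g ** g = mat 1" "g ** transpose g = mat 1"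
  using assms H3_inverse by (auto simp: rotation_carrier)

lemma H3_cases:
  assumes "w \<in> H3"
  shows "w \<in> carrier rotation_group \<or> (w \<notin> carrier rotation_group \<and> - w \<in> carrier rotation_group)"
  using assms H3_det[OF assms] by (auto simp: rotation_carrier det_minus3 H3_minus)

text \<open>The principal \<open>2 \<times> 2\<close> minors of a rotation sum to its trace, because a rotation preserves cross
  products and so coincides with its cofactor matrix.\<close>

lemma rotation_minors:
  assumes "g \<in> carrier rotation_group"
  shows "g$1$1*g$2$2 - g$1$2*g$2$1 = g$3$3" "g$2$2*g$3$3 - g$2$3*g$3$2 = g$1$1" "g$3$3*g$1$1 - g$3$1*g$1$3 = g$2$2"
proof -
  have "rotation_matrix g" using assms H3_orthogonal by (simp add: rotation_matrix_def rotation_carrier)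
  note c = cross_rotation_matrix[OF this]
  from c[of "axis 1 1" "axis 2 1"] show "g$1$1*g$2$2 - g$1$2*g$2$1 = g$3$3"
    by (simp add: cross3_simps axis_def vec_eq_iff forall_3 matrix_vector_mult_def sum_3)
  from c[of "axis 2 1" "axis 3 1"] show "g$2$2*g$3$3 - g$2$3*g$3$2 = g$1$1"
    by (simp add: cross3_simps axis_def vec_eq_iff forall_3 matrix_vector_mult_def sum_3)
  from c[of "axis 3 1" "axis 1 1"] show "g$3$3*g$1$1 - g$3$1*g$1$3 = g$2$2"
    by (simp add: cross3_simps axis_def vec_eq_iff forall_3 matrix_vector_mult_def sum_3)
qed

lemma trace_square:
  assumes "g \<in> carrier rotation_group"
  shows "trace (g ** g) = trace g * trace g - 2 * trace g"
proof -
  have "trace (g ** g) = trace g * trace g - 2 * ((g$1$1*g$2$2 - g$1$2*g$2$1) + (g$2$2*g$3$3 - g$2$3*g$3$2)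
      + (g$3$3*g$1$1 - g$3$1*g$1$3))"
    by (simp add: trace_def sum_3 matrix_matrix_mult_def algebra_simps)
  also have "\<dots> = trace g * trace g - 2 * trace g"
    unfolding rotation_minors[OF assms] by (simp add: trace_def sum_3)
  finally show ?thesis .
qed

lemma rotation_cube:
  assumes g: "g \<in> carrier rotation_group"
  shows "g ** g ** g = trace g *\<^sub>R (g ** g) - trace g *\<^sub>R g + mat 1"
proof -
  let ?e = "(g$1$1*g$2$2 - g$1$2*g$2$1) + (g$2$2*g$3$3 - g$2$3*g$3$2) + (g$3$3*g$1$1 - g$3$1*g$1$3)"
  have "g ** g ** g = trace g *\<^sub>R (g ** g) - ?e *\<^sub>R g + det g *\<^sub>R mat 1"
    by (simp add: vec_eq_iff forall_3 trace_def sum_3 matrix_matrix_mult_def det_3 mat_def algebra_simps)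
  moreover have "?e = trace g" unfolding rotation_minors[OF g] by (simp add: trace_def sum_3)
  moreover have "det g = 1" using g by (simp add: rotation_carrier)
  ultimately show ?thesis by simp
qed

lemma trace_add_scale: "trace (A + B) = trace A + trace B" "trace (A - B) = trace A - trace (B :: real^'n^'n)"
  "trace (r *\<^sub>R A) = r * trace (A :: real^'n^'n)"
  by (simp_all add: trace_def sum.distrib sum_subtractf sum_distrib_left)

lemma trace_one3: "trace (mat 1 :: real^3^3) = 3"
  by (simp add: trace_def sum_3 mat_def)

lemma trace_cube:
  assumes g: "g \<in> carrier rotation_group"
  shows "trace (g ** g ** g) = trace g * (trace g * trace g - 2 * trace g) - trace g * trace g + 3"
  unfolding rotation_cube[OF g] trace_add_scale trace_square[OF g] trace_one3 by simp

lemma trace_fifth: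
  assumes g: "g \<in> carrier rotation_group"
  shows "trace (g ** g ** (g ** g ** g)) = trace g * trace ((g ** g) ** (g ** g))
    - trace g * trace (g ** g ** g) + trace (g ** g)"
proof -
  have "g ** g ** (g ** g ** g) = trace g *\<^sub>R ((g ** g) ** (g ** g)) - trace g *\<^sub>R (g ** g ** g) + g ** g"
  proof -
    have "A ** (r *\<^sub>R B - r *\<^sub>R C + mat 1) = r *\<^sub>R (A ** B) - r *\<^sub>R (A ** C) + A" for A B C :: mat3 and r
      by (simp add: vec_eq_iff forall_3 sum_3 matrix_matrix_mult_def mat_def algebra_simps)
    from this[of "g ** g" "trace g" "g ** g" g] show ?thesis
      by (simp only: rotation_cube[OF g, symmetric])
  qed
  then show ?thesis by (simp add: trace_add_scale)
qed

text \<open>The diagonal entries of an orthogonal matrix are at most \<open>1\<close>.\<close>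

lemma trace_three_iff:
  assumes g: "g \<in> carrier rotation_group" shows "trace g = 3 \<longleftrightarrow> g = mat 1"
proof
  assume t: "trace g = 3"
  have "(\<Sum>i\<in>UNIV. g$i$j * g$i$j) = 1" for j
    using rotation_inverse(1)[OF g] by (simp add: vec_eq_iff matrix_matrix_mult_def transpose_def mat_def)
  then have n: "g$1$j * g$1$j + g$2$j * g$2$j + g$3$j * g$3$j = 1" for j by (simp add: sum_3)
  have le: "g$j$j \<le> 1" for j
  proof -
    have "g$j$j * g$j$j \<le> 1" 
      using exhaust_3[of j] n[of j] zero_le_square[of "g$1$j"] zero_le_square[of "g$2$j"] zero_le_square[of "g$3$j"]
      by (elim disjE; hypsubst; linarith)
    then show ?thesis using abs_square_le_1[of "g$j$j"] by (simp add: power2_eq_square)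
  qed
  have "g$1$1 + g$2$2 + g$3$3 = 3" using t by (simp add: trace_def sum_3)
  then have d: "g$1$1 = 1" "g$2$2 = 1" "g$3$3 = 1" using le[of 1] le[of 2] le[of 3] by linarith+
  have z: "x = 0 \<and> y = 0" if "x * x + y * y = 0" for x y :: real using that by (simp add: sum_squares_eq_zero_iff)
  have "g$2$1 = 0 \<and> g$3$1 = 0" "g$1$2 = 0 \<and> g$3$2 = 0" "g$1$3 = 0 \<and> g$2$3 = 0"
    by (rule z, use n[of 1] n[of 2] n[of 3] d in simp)+
  then show "g = mat 1" using d by (simp add: vec_eq_iff forall_3 mat_def)
qed (simp add: trace_one3)

lemma golden_neq: "golden \<noteq> 0" "golden \<noteq> 1" "golden \<noteq> -1" "golden \<noteq> 2" "golden \<noteq> 3" "- golden \<noteq> 2"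
proof -
  have "sqrt 5 < sqrt 9" by (rule real_sqrt_less_mono) simp
  moreover have "sqrt 9 = (3::real)" by (rule real_sqrt_unique) auto
  ultimately show "golden \<noteq> 2" "golden \<noteq> 3" by (auto simp: golden_def)
qed (use golden_eqs(2) in auto)

text \<open>The trace determines the order of a rotation, because the traces of its powers are polynomials in the
  trace, and a rotation of trace \<open>3\<close> is the identity.\<close>

lemma rotation_trace_cases:
  assumes g: "g \<in> carrier rotation_group"
  obtains "g = mat 1" "trace g = 3" "trace (conj_mat g) = 3" "dtrace g (conj_mat g) = 4"
  | "g ** g = mat 1" "g \<noteq> mat 1" "trace g = -1" "trace (conj_mat g) = -1" "dtrace g (conj_mat g) = 0"
  | "g ** g ** g = mat 1" "g \<noteq> mat 1" "g ** g \<noteq> mat 1" "trace g = 0" "trace (conj_mat g) = 0" "dtrace g (conj_mat g) = 1"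
  | "g ** g ** (g ** g ** g) = mat 1" "g \<noteq> mat 1" "g ** g \<noteq> mat 1" "g ** g ** g \<noteq> mat 1"
    "trace g = golden \<or> trace g = 1 - golden" "trace (conj_mat g) = 1 - trace g" "trace (g ** g) = 1 - trace g"
    "dtrace g (conj_mat g) = -1"
proof -
  have g2: "g ** g \<in> carrier rotation_group" "g ** g ** g \<in> carrier rotation_group"
    "g ** g ** (g ** g ** g) \<in> carrier rotation_group" using g by (simp_all add: rotation_closed)
  note one = trace_three_iff[OF g, symmetric] trace_three_iff[OF g2(1), symmetric]
    trace_three_iff[OF g2(2), symmetric] trace_three_iff[OF g2(3), symmetric]
  note tr = trace_square[OF g] trace_cube[OF g] trace_fifth[OF g] trace_square[OF g2(1)]
  have "w \<in> H3" "det w = 1" if "w \<in> carrier rotation_group" for w using that by (auto simp: rotation_carrier)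
  from rotation_traces[OF this[OF g]]
  consider (1) "trace g = 3" "trace (conj_mat g) = 3" "dtrace g (conj_mat g) = 4"
    | (2) "trace g = -1" "trace (conj_mat g) = -1" "dtrace g (conj_mat g) = 0"
    | (3) "trace g = 0" "trace (conj_mat g) = 0" "dtrace g (conj_mat g) = 1"
    | (5) "trace g = golden \<or> trace g = 1 - golden" "trace (conj_mat g) = 1 - trace g" "dtrace g (conj_mat g) = -1"
    by auto
  then show thesis
  proof cases
    case 1 then show thesis using that(1) one by blast
  next
    case 2
    show thesis by (rule that(2)) (simp_all add: one tr 2)
  next
    case 3
    show thesis by (rule that(3)) (simp_all add: one tr 3)
  next
    case 5
    have q: "trace g * trace g = trace g + 1" 
      using 5(1) by (elim disjE; simp only:; simp add: algebra_simps golden_eqs)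
    have irr: "trace g \<noteq> 3" "1 - trace g \<noteq> 3"
      using 5(1) golden_neq by auto
    have t2: "trace (g ** g) = 1 - trace g" by (simp add: tr q)
    have t3: "trace (g ** g ** g) = 1 - trace g" by (simp add: tr q) (simp add: algebra_simps q)
    have t4: "trace ((g ** g) ** (g ** g)) = trace g" by (simp add: tr(4) t2) (simp add: algebra_simps q)
    have t5: "trace (g ** g ** (g ** g ** g)) = 3" by (simp add: tr(3) t2 t3 t4) (simp add: algebra_simps q)
    show thesis
      by (rule that(4)) (use 5 irr in \<open>auto simp: one t2 t3 t5\<close>)
  qed
qed

lemma trace_conj:
  assumes "p ** q = mat 1" shows "trace (q ** a ** p) = trace (a :: real^'n^'n)"
  using assms by (simp add: trace_mul_sym[of _ p] matrix_mul_assoc)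

section \<open>The outer automorphism of the alternating group\<close>

definition \<sigma> :: "nat \<Rightarrow> nat" where "\<sigma> = Transposition.transpose 1 2"

lemma \<sigma>_simps [simp]: "\<sigma> (\<sigma> x) = x" "permutation \<sigma>" "\<not> evenperm \<sigma>" "\<sigma> permutes {1..5}"
  by (simp_all add: \<sigma>_def permutation_swap_id evenperm_swap permutes_swap_id)

text \<open>The square of a 5-cycle \<open>p\<close> is conjugate to \<open>p\<close> in the symmetric group by a 4-cycle, which is odd; so
  conjugating \<open>p\<close> by a transposition gives an element conjugate to \<open>p\<^sup>2\<close> by an even permutation.\<close>

lemma five_cycle_twist:
  fixes p :: "nat \<Rightarrow> nat"
  assumes p: "p permutes {1..5}" and p5: "p \<circ> p \<circ> (p \<circ> p \<circ> p) = id" and p1: "p \<noteq> id"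
  shows "\<exists>q. q permutes {1..5} \<and> evenperm q \<and> \<sigma> \<circ> p \<circ> \<sigma> \<circ> q = q \<circ> (p \<circ> p)"
proof -
  obtain a where a: "p a \<noteq> a" using p1 by (auto simp: fun_eq_iff)
  have a5: "a \<in> {1..5}" using p a unfolding permutes_def by blast
  have c: "p (p (p (p (p x)))) = x" for x using fun_cong[OF p5, of x] by simp
  have inj: "p x = p y \<longleftrightarrow> x = y" for x y using permutes_inj[OF p] by (auto dest: injD)
  define b1 where "b1 = p a"
  define b2 where "b2 = p b1"
  define b3 where "b3 = p b2"
  define b4 where "b4 = p b3"
  have pb: "p a = b1" "p b1 = b2" "p b2 = b3" "p b3 = b4" "p b4 = a"
    by (simp_all add: b1_def b2_def b3_def b4_def c)
  have d0: "a \<noteq> b1" "a \<noteq> b2" "a \<noteq> b3" "a \<noteq> b4"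
    using a pb by metis+
  have dist: "a \<noteq> b1" "a \<noteq> b2" "a \<noteq> b3" "a \<noteq> b4" "b1 \<noteq> b2" "b1 \<noteq> b3" "b1 \<noteq> b4" "b2 \<noteq> b3" "b2 \<noteq> b4" "b3 \<noteq> b4"
    using d0 pb inj by metis+
  have mem: "b1 \<in> {1..5}" "b2 \<in> {1..5}" "b3 \<in> {1..5}" "b4 \<in> {1..5}"
    unfolding b4_def b3_def b2_def b1_def using a5 by (simp_all only: permutes_in_image[OF p])
  have "{a, b1, b2, b3, b4} = {1..5}"
    by (rule card_subset_eq) (use a5 mem dist in auto)
  then have cases: "x = a \<or> x = b1 \<or> x = b2 \<or> x = b3 \<or> x = b4 \<or> x \<notin> {1..5}" for x by blast
  let ?t = "Transposition.transpose :: nat \<Rightarrow> nat \<Rightarrow> nat \<Rightarrow> nat"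
  \<comment> \<open>The 4-cycle that takes the \<open>2i\<close>-th iterate of \<open>a\<close> to the \<open>i\<close>-th one.\<close>
  define r where "r = ?t b4 b3 \<circ> ?t b2 b4 \<circ> ?t b1 b2"
  have tp: "?t x y permutes {1..5}" if "x \<in> {1..5}" "y \<in> {1..5}" for x y
    using permutes_swap_id[OF that] .
  have r: "r permutes {1..5}" unfolding r_def using mem by (intro permutes_compose tp)
  have "r x = x \<and> p (p x) = x" if "x \<notin> {1..5}" for x
    using that r p by (simp add: permutes_not_in)
  moreover have "r a = a" "r b1 = b3" "r b2 = b1" "r b3 = b4" "r b4 = b2"
    using dist by (auto simp: r_def Transposition.transpose_def)
  ultimately have "p (r x) = r (p (p x))" for x
    using cases[of x] pb by (auto simp: permutes_not_in[OF p])
  then have pr: "p \<circ> r = r \<circ> (p \<circ> p)" by (simp add: fun_eq_iff)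
  show ?thesis
  proof (intro exI[of _ "\<sigma> \<circ> r"] conjI)
    show "\<sigma> \<circ> r permutes {1..5}" by (rule permutes_compose[OF r \<sigma>_simps(4)])
    have "evenperm (\<sigma> \<circ> r)"
      using dist by (simp add: r_def evenperm_comp evenperm_swap permutation_compose permutation_swap_id)
    then show "evenperm (\<sigma> \<circ> r)" .
    show "\<sigma> \<circ> p \<circ> \<sigma> \<circ> (\<sigma> \<circ> r) = \<sigma> \<circ> r \<circ> (p \<circ> p)"
      using pr by (simp add: fun_eq_iff)
  qed
qed

locale rotation_iso =
  fixes \<phi> :: "(nat \<Rightarrow> nat) \<Rightarrow> mat3"
  assumes iso: "\<phi> \<in> iso (alt_group 5) rotation_group"
begin

definition twist :: "mat3 \<Rightarrow> mat3" where
  "twist g = \<phi> (\<sigma> \<circ> inv_into (carrier (alt_group 5)) \<phi> g \<circ> \<sigma>)"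

lemma rep3_tilde_twist: "rep3_tilde \<phi> g = refl_rep (twist g)"
  by (simp add: rep3_tilde_def twist_def Let_def \<sigma>_def)

lemma \<phi>_mult: "p \<in> carrier (alt_group 5) \<Longrightarrow> q \<in> carrier (alt_group 5) \<Longrightarrow> \<phi> (p \<circ> q) = \<phi> p ** \<phi> q"
  using iso by (auto simp: iso_def hom_def alt_group_mult)

lemma \<phi>_bij: "bij_betw \<phi> (carrier (alt_group 5)) (carrier rotation_group)"
  using iso by (simp add: iso_def)

lemma \<phi>_closed: "p \<in> carrier (alt_group 5) \<Longrightarrow> \<phi> p \<in> carrier rotation_group"
  using \<phi>_bij by (rule bij_betwE[rule_format])

lemma alt_closed: "p \<in> carrier (alt_group 5) \<Longrightarrow> q \<in> carrier (alt_group 5) \<Longrightarrow> p \<circ> q \<in> carrier (alt_group 5)"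
  "id \<in> carrier (alt_group 5)"
  using group.is_monoid[OF alt_group_is_group, of 5] monoid.m_closed monoid.one_closed
  by (fastforce simp: alt_group_mult alt_group_one)+

lemma \<sigma>_conj_closed: "p \<in> carrier (alt_group 5) \<Longrightarrow> \<sigma> \<circ> p \<circ> \<sigma> \<in> carrier (alt_group 5)"
  unfolding alt_group_carrier
proof (elim conjE, intro conjI)
  assume p: "p permutes {1..5}" "evenperm p"
  then have "permutation p" using permutation_permutes by blast
  then show "evenperm (\<sigma> \<circ> p \<circ> \<sigma>)" using p by (simp add: evenperm_comp permutation_compose)
  show "\<sigma> \<circ> p \<circ> \<sigma> permutes {1..5}" by (intro permutes_compose p \<sigma>_simps)
qed

lemma \<phi>_id: "\<phi> id = mat 1"
proof -
  have "\<phi> id = \<phi> id ** \<phi> id" using \<phi>_mult[OF alt_closed(2) alt_closed(2)] by simp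
  then have "transpose (\<phi> id) ** \<phi> id = transpose (\<phi> id) ** \<phi> id ** \<phi> id"
    by (simp add: matrix_mul_assoc[symmetric])
  then show ?thesis using rotation_inverse(1)[OF \<phi>_closed[OF alt_closed(2)]] by simp
qed

lemma preimage:
  assumes "g \<in> carrier rotation_group"
  obtains p where "p \<in> carrier (alt_group 5)" "g = \<phi> p" "twist g = \<phi> (\<sigma> \<circ> p \<circ> \<sigma>)"
proof
  let ?p = "inv_into (carrier (alt_group 5)) \<phi> g"
  have "g \<in> \<phi> ` carrier (alt_group 5)" using assms \<phi>_bij by (simp add: bij_betw_def)
  then show "?p \<in> carrier (alt_group 5)" "g = \<phi> ?p" by (simp_all add: inv_into_into f_inv_into_f)
  show "twist g = \<phi> (\<sigma> \<circ> ?p \<circ> \<sigma>)" by (simp add: twist_def)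
qed

lemma twist_\<phi>:
  assumes "p \<in> carrier (alt_group 5)" shows "twist (\<phi> p) = \<phi> (\<sigma> \<circ> p \<circ> \<sigma>)"
  using assms \<phi>_bij by (simp add: twist_def bij_betw_def)

lemma twist_closed: "g \<in> carrier rotation_group \<Longrightarrow> twist g \<in> carrier rotation_group"
  by (erule preimage) (simp add: \<phi>_closed \<sigma>_conj_closed)

lemma twist_mult:
  assumes g: "g \<in> carrier rotation_group" and h: "h \<in> carrier rotation_group"
  shows "twist (g ** h) = twist g ** twist h"
proof -
  obtain p where p: "p \<in> carrier (alt_group 5)" "g = \<phi> p" "twist g = \<phi> (\<sigma> \<circ> p \<circ> \<sigma>)" using g by (rule preimage)
  obtain q where q: "q \<in> carrier (alt_group 5)" "h = \<phi> q" "twist h = \<phi> (\<sigma> \<circ> q \<circ> \<sigma>)" using h by (rule preimage)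
  have "\<sigma> \<circ> (p \<circ> q) \<circ> \<sigma> = (\<sigma> \<circ> p \<circ> \<sigma>) \<circ> (\<sigma> \<circ> q \<circ> \<sigma>)" by (simp add: fun_eq_iff)
  moreover have "twist (g ** h) = \<phi> (\<sigma> \<circ> (p \<circ> q) \<circ> \<sigma>)"
    using p q \<phi>_mult[OF p(1) q(1)] twist_\<phi>[OF alt_closed(1)[OF p(1) q(1)]] by simp
  ultimately show ?thesis using p(3) q(3) \<phi>_mult[OF \<sigma>_conj_closed[OF p(1)] \<sigma>_conj_closed[OF q(1)]] by simp
qed

lemma twist_one: "twist (mat 1) = mat 1"
proof -
  have "\<sigma> \<circ> id \<circ> \<sigma> = id" by (simp add: fun_eq_iff)
  then show ?thesis using twist_\<phi>[OF alt_closed(2)] by (simp add: \<phi>_id)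
qed

lemma twist_one_iff:
  assumes g: "g \<in> carrier rotation_group" shows "twist g = mat 1 \<longleftrightarrow> g = mat 1"
proof
  assume t: "twist g = mat 1"
  obtain p where p: "p \<in> carrier (alt_group 5)" "g = \<phi> p" "twist g = \<phi> (\<sigma> \<circ> p \<circ> \<sigma>)" using g by (rule preimage)
  have "\<phi> (\<sigma> \<circ> p \<circ> \<sigma>) = \<phi> id" using t p(3) \<phi>_id by simp
  then have "\<sigma> \<circ> p \<circ> \<sigma> = id"
    using \<phi>_bij \<sigma>_conj_closed[OF p(1)] alt_closed(2) by (auto simp: bij_betw_def dest: inj_onD)
  then have "\<sigma> (p (\<sigma> x)) = x" for x by (simp add: fun_eq_iff)
  then have "p x = x" for x by (metis \<sigma>_simps(1))
  then have "p = id" by (simp add: fun_eq_iff)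
  then show "g = mat 1" using p(2) \<phi>_id by simp
qed (simp add: twist_one)

text \<open>The twist preserves the order of an element, hence the trace except in order five, where it
  replaces the conjugacy class of an element by that of its square.\<close>

lemma trace_twist:
  assumes g: "g \<in> carrier rotation_group" shows "trace (twist g) = trace (conj_mat g)"
proof -
  have t: "twist g \<in> carrier rotation_group" using g by (rule twist_closed)
  have tg: "twist g ** twist g = twist (g ** g)" "twist (g ** g) ** twist g = twist (g ** g ** g)"
    using g by (simp_all add: twist_mult rotation_closed)
  note iff = twist_one_iff[OF g] twist_one_iff[of "g ** g"] twist_one_iff[of "g ** g ** g"]
  show ?thesis
  proof (cases rule: rotation_trace_cases[OF g])
    case 1
    then show ?thesis by (simp add: twist_one trace_one3)
  next
    case 2
    then show ?thesis
      using iff g by (cases rule: rotation_trace_cases[OF t]) (auto simp: tg twist_one rotation_closed golden_neq)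
  next
    case 3
    then show ?thesis
      using iff g by (cases rule: rotation_trace_cases[OF t]) (auto simp: tg twist_one rotation_closed golden_neq)
  next
    case 4
    obtain p where p: "p \<in> carrier (alt_group 5)" "g = \<phi> p" "twist g = \<phi> (\<sigma> \<circ> p \<circ> \<sigma>)" using g by (rule preimage)
    have pp: "p \<circ> p \<in> carrier (alt_group 5)" "p \<circ> p \<circ> p \<in> carrier (alt_group 5)"
      "p \<circ> p \<circ> (p \<circ> p \<circ> p) \<in> carrier (alt_group 5)" using p(1) alt_closed(1) by blast+
    have "\<phi> (p \<circ> p \<circ> (p \<circ> p \<circ> p)) = mat 1"
      using 4(1) p(1,2) pp by (simp add: \<phi>_mult)
    then have p5: "p \<circ> p \<circ> (p \<circ> p \<circ> p) = id"
      using pp(3) alt_closed(2) by (intro inj_onD[OF bij_betw_imp_inj_on[OF \<phi>_bij]]) (simp only: \<phi>_id)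
    have "p \<noteq> id" using 4(2) p(2) \<phi>_id by auto
    moreover have "p permutes {1..5}" using p(1) by (simp add: alt_group_carrier)
    ultimately obtain q where q: "q permutes {1..5}" "evenperm q" "\<sigma> \<circ> p \<circ> \<sigma> \<circ> q = q \<circ> (p \<circ> p)"
      using five_cycle_twist p5 by blast
    then have qA: "q \<in> carrier (alt_group 5)" by (simp add: alt_group_carrier)
    have e: "twist g ** \<phi> q = \<phi> q ** (g ** g)"
      using arg_cong[OF q(3), of \<phi>] \<phi>_mult[OF \<sigma>_conj_closed[OF p(1)] qA] \<phi>_mult[OF qA pp(1)] \<phi>_mult[OF p(1) p(1)] p
      by simp
    let ?q' = "transpose (\<phi> q)"
    have "twist g = twist g ** (\<phi> q ** ?q')" using rotation_inverse(2)[OF \<phi>_closed[OF qA]] by simp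
    also have "\<dots> = \<phi> q ** (g ** g) ** ?q'" using e by (simp add: matrix_mul_assoc)
    finally have "trace (twist g) = trace (g ** g)"
      using trace_conj[OF rotation_inverse(1)[OF \<phi>_closed[OF qA]], of "g ** g"] by simp
    then show ?thesis using 4 by simp
  qed
qed

end

section \<open>Orthogonality of matrix coefficients\<close>

abbreviation Rot :: "mat3 set" where "Rot \<equiv> carrier rotation_group"

definition rotation_rep :: "(mat3 \<Rightarrow> complex^'n^'n) \<Rightarrow> bool" where
  "rotation_rep \<rho> \<longleftrightarrow> \<rho> (mat 1) = mat 1 \<and> (\<forall>g\<in>Rot. \<forall>h\<in>Rot. \<rho> (g ** h) = \<rho> g ** \<rho> h)"

definition intertwines :: "(mat3 \<Rightarrow> complex^'m^'m) \<Rightarrow> (mat3 \<Rightarrow> complex^'n^'n) \<Rightarrow> complex^'m^'n \<Rightarrow> bool" where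
  "intertwines \<kappa> \<rho> S \<longleftrightarrow> (\<forall>g\<in>Rot. \<rho> g ** S = S ** \<kappa> g)"

lemma matrix_zero_mult: "(0 :: complex^'m^'k) ** A = 0" for A :: "complex^'n^'m"
  by (simp_all add: vec_eq_iff matrix_matrix_mult_def)

lemma matrix_zeroI: "(\<And>v. A *v v = 0) \<Longrightarrow> A = (0 :: complex^'n^'m)"
  by (simp add: matrix_eq)

lemma matrix_mult_sum_right: "A ** sum f I = (\<Sum>i\<in>I. A ** f i)" for A :: "complex^'n^'m"
  by (induction I rule: infinite_finite_induct) (simp_all add: matrix_add_ldistrib matrix_zero_mult)

lemma matrix_mult_sum_left: "sum f I ** A = (\<Sum>i\<in>I. f i ** A)" for A :: "complex^'n^'m"
  by (induction I rule: infinite_finite_induct) (simp_all add: matrix_mult_add_left matrix_zero_mult)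

lemma average_intertwines:
  fixes \<kappa> :: "mat3 \<Rightarrow> complex^'m^'m" and \<rho> :: "mat3 \<Rightarrow> complex^'n^'n"
  assumes \<kappa>: "rotation_rep \<kappa>" and \<rho>: "rotation_rep \<rho>"
  shows "intertwines \<kappa> \<rho> (\<Sum>g\<in>Rot. \<rho> g ** E ** \<kappa> (transpose g))"
  unfolding intertwines_def
proof
  fix h assume h: "h \<in> Rot"
  have "\<rho> h ** (\<Sum>g\<in>Rot. \<rho> g ** E ** \<kappa> (transpose g)) = (\<Sum>g\<in>Rot. \<rho> (h ** g) ** E ** \<kappa> (transpose g))"
    using \<rho> h by (simp add: rotation_rep_def matrix_mult_sum_right matrix_mul_assoc)
  also have "\<dots> = (\<Sum>g\<in>Rot. \<rho> g ** E ** \<kappa> (transpose g ** h))"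
  proof (rule sum.reindex_bij_witness[where i = "\<lambda>g. transpose h ** g" and j = "\<lambda>g. h ** g"])
    fix g assume g: "g \<in> Rot"
    show "transpose h ** (h ** g) = g" "h ** (transpose h ** g) = g"
      by (simp_all add: matrix_mul_assoc rotation_inverse[OF h])
    show "transpose h ** g \<in> Rot" "h ** g \<in> Rot" using g h by (simp_all add: rotation_closed)
    have "transpose (h ** g) ** h = transpose g"
      by (simp add: matrix_transpose_mul matrix_mul_assoc[symmetric] rotation_inverse[OF h])
    then show "\<rho> (h ** g) ** E ** \<kappa> (transpose (h ** g) ** h) = \<rho> (h ** g) ** E ** \<kappa> (transpose g)" by simp
  qed
  also have "\<dots> = (\<Sum>g\<in>Rot. \<rho> g ** E ** \<kappa> (transpose g)) ** \<kappa> h"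
    using \<kappa> h by (simp add: rotation_rep_def matrix_mult_sum_left matrix_mul_assoc[symmetric] rotation_closed)
  finally show "\<rho> h ** (\<Sum>g\<in>Rot. \<rho> g ** E ** \<kappa> (transpose g)) = (\<Sum>g\<in>Rot. \<rho> g ** E ** \<kappa> (transpose g)) ** \<kappa> h" .
qed

text \<open>Averaging the matrix units gives intertwiners whose entries are the sums of products of matrix
  coefficients.\<close>

lemma coefficient_orthogonality:
  fixes \<kappa> :: "mat3 \<Rightarrow> complex^'m^'m" and \<rho> :: "mat3 \<Rightarrow> complex^'n^'n"
  assumes \<kappa>: "rotation_rep \<kappa>" and \<rho>: "rotation_rep \<rho>" and none: "\<And>S. intertwines \<kappa> \<rho> S \<Longrightarrow> S = 0"
  shows "(\<Sum>g\<in>Rot. trace (\<kappa> (transpose g)) * \<rho> g $ k $ i) = 0"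
proof -
  have e: "(A ** (\<chi> a b. if a = i then (if b = j then 1 else 0) else 0) ** B) $ k $ j = A $ k $ i * B $ j $ j"
    for A :: "complex^'n^'n" and B :: "complex^'m^'m" and j
  proof -
    let ?E = "(\<chi> a b. if a = i then (if b = j then 1 else 0) else 0) :: complex^'m^'n"
    have "(A ** ?E) $ k $ b = (if b = j then A $ k $ i else 0)" for b
      by (cases "b = j") (simp_all add: matrix_matrix_mult_def if_distrib cong: if_cong)
    moreover have "(A ** ?E ** B) $ k $ j = (\<Sum>b\<in>UNIV. (A ** ?E) $ k $ b * B $ b $ j)"
      unfolding matrix_matrix_mult_def[of "A ** ?E"] by simp
    ultimately show ?thesis by (simp add: if_distribR if_distrib[of "\<lambda>x. x * _"] cong: if_cong)
  qed
  have "(\<Sum>g\<in>Rot. \<rho> g $ k $ i * \<kappa> (transpose g) $ j $ j) = 0" for j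
  proof -
    let ?E = "(\<chi> a b. if a = i then (if b = j then 1 else 0) else 0) :: complex^'m^'n"
    have "(\<Sum>g\<in>Rot. \<rho> g ** ?E ** \<kappa> (transpose g)) $ k $ j = 0"
      by (simp only: none[OF average_intertwines[OF \<kappa> \<rho>]] zero_index)
    then show ?thesis by (simp add: e)
  qed
  then have "(\<Sum>j\<in>UNIV. \<Sum>g\<in>Rot. \<rho> g $ k $ i * \<kappa> (transpose g) $ j $ j) = 0" by simp
  then show ?thesis
    by (subst (asm) sum.swap) (simp add: trace_def sum_distrib_left mult.commute)
qed

lemma trace_gal: "trace (gal g) = complex_of_real (trace (conj_mat g))"
  and trace_refl_rep: "trace (refl_rep g) = complex_of_real (trace g)"
  and trace_drep: "trace (drep g) = complex_of_real (dtrace g (conj_mat g))"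
  by (simp_all add: gal_def refl_rep_def drep_def trace_def flip: trace_dmat)

lemma conj_mat_transpose: "conj_mat (transpose g) = transpose (conj_mat g)"
  by (simp add: conj_mat_def transpose_def vec_eq_iff)

lemma trace_transpose: "trace (transpose A) = trace (A :: real^'n^'n)"
  by (simp add: trace_def transpose_def)

lemma rotation_rep_gal: "rotation_rep gal"
  by (simp add: rotation_rep_def gal_one gal_mult rotation_carrier)

lemma rotation_rep_refl: "rotation_rep refl_rep"
  by (simp add: rotation_rep_def refl_rep_mult)

lemma rotation_rep_drep: "rotation_rep drep"
  by (simp add: rotation_rep_def drep_one drep_mult rotation_carrier)

lemma matrix_mult_minus: "(- A) ** B = - (A ** B)" "A ** (- B) = - (A ** B)" for A :: "complex^'n^'m"
  by (simp_all add: vec_eq_iff matrix_matrix_mult_def sum_negf)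

lemma mat_minus_one_mult: "mat (-1) ** A = - (A :: complex^'n^'m)"
  by (simp add: vec_eq_iff matrix_matrix_mult_def mat_def if_distrib if_distribR cong: if_cong)

lemma gal_minus: "w \<in> H3 \<Longrightarrow> gal (- w) = - gal w"
  by (simp add: gal_def conj_mat_minus refl_rep_def vec_eq_iff)

lemma injective_invertible:
  fixes A :: "complex^'n^'n"
  assumes "\<And>x. A *v x = 0 \<Longrightarrow> x = 0" shows "\<exists>B. A ** B = mat 1 \<and> B ** A = mat 1"
  using assms matrix_left_invertible_ker[of A] matrix_left_right_inverse by blast

text \<open>The twisted reflection representation and the Galois conjugate one have the same character, so
  there is a nonzero intertwiner.\<close>

lemma (in rotation_iso) gal_equivalent:
  obtains P P' :: "complex^3^3" where "P ** P' = mat 1" "P' ** P = mat 1"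
    "\<And>w. w \<in> H3 \<Longrightarrow> extend_rep (-1) (rep3_tilde \<phi>) w ** P = P ** gal w"
proof -
  let ?\<tau> = "rep3_tilde \<phi>"
  have \<tau>: "rotation_rep ?\<tau>"
    by (simp add: rotation_rep_def rep3_tilde_twist twist_one twist_mult refl_rep_mult)
  have tr: "trace (?\<tau> g) = complex_of_real (trace (conj_mat g))" if "g \<in> Rot" for g
    by (simp add: rep3_tilde_twist trace_refl_rep trace_twist[OF that])
  have "\<exists>P. intertwines gal ?\<tau> P \<and> P \<noteq> 0"
  proof (rule ccontr)
    assume "\<not> ?thesis"
    then have none: "\<And>S. intertwines gal ?\<tau> S \<Longrightarrow> S = 0" by blast
    have "(\<Sum>g\<in>Rot. trace (gal (transpose g)) * ?\<tau> g $ k $ k) = 0" for k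
      by (rule coefficient_orthogonality[OF rotation_rep_gal \<tau> none])
    then have "(\<Sum>k\<in>UNIV. \<Sum>g\<in>Rot. trace (gal (transpose g)) * ?\<tau> g $ k $ k) = 0" by simp
    then have "(\<Sum>g\<in>Rot. trace (gal (transpose g)) * trace (?\<tau> g)) = 0"
      by (subst (asm) sum.swap) (simp add: trace_def sum_distrib_left)
    then have "complex_of_real (\<Sum>g\<in>Rot. trace (conj_mat g) * trace (conj_mat g)) = 0"
      by (simp add: tr trace_gal conj_mat_transpose trace_transpose)
    then have "(\<Sum>g\<in>Rot. trace (conj_mat g) * trace (conj_mat g)) = 0" by (simp only: of_real_eq_0_iff)
    then have "\<forall>g\<in>Rot. trace (conj_mat g) * trace (conj_mat g) = 0"
      by (subst (asm) sum_nonneg_eq_0_iff) (simp_all add: finite_rotations)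
    then have "trace (conj_mat (mat 1)) = 0" using rotation_closed(1) by auto
    then show False by (simp add: conj_mat_one trace_one3)
  qed
  then obtain P where P: "intertwines gal ?\<tau> P" "P \<noteq> 0" by blast
  have ext: "extend_rep (-1) ?\<tau> w ** P = P ** gal w" if w: "w \<in> H3" for w
    using H3_cases[OF w]
  proof
    assume w': "w \<notin> Rot \<and> - w \<in> Rot"
    then have "?\<tau> (- w) ** P = P ** gal (- w)" using P(1) by (simp add: intertwines_def)
    then show ?thesis
      using w w' by (simp add: extend_rep_def mat_minus_one_mult matrix_mult_minus gal_minus)
  qed (use P(1) in \<open>simp add: extend_rep_def intertwines_def\<close>)
  have "\<exists>P'. P ** P' = mat 1 \<and> P' ** P = mat 1"
  proof (rule injective_invertible, rule ccontr)
    fix v0 assume v0: "P *v v0 = 0" "v0 \<noteq> 0"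
    have "{v. P *v v = 0} = UNIV"
    proof (rule gal_irreducible[of v0])
      fix w v assume w: "w \<in> H3" and v: "v \<in> {v. P *v v = 0}"
      have "P *v (gal w *v v) = extend_rep (-1) ?\<tau> w *v (P *v v)"
        by (simp only: matrix_vector_mul_assoc ext[OF w])
      then show "gal w *v v \<in> {v. P *v v = 0}" using v by simp
    qed (use v0 in \<open>auto simp: matrix_vector_right_distrib vector_scalar_commute\<close>)
    then have "P *v v = 0" for v by auto
    then have "P = 0" by (rule matrix_zeroI)
    then show False using P(2) by simp
  qed
  then show thesis using that ext by blast
qed

section \<open>The four-dimensional representation\<close>

lemma scaled_relation:
  assumes "x + p + q + r = 0" "x - p + q - r = 0" "x - p - q + r = 0" "x + p - q - r = (0 :: complex^'n)"
  shows "x = 0" "p = 0" "q = 0" "r = 0"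
proof -
  have z: "y = 0" if "y + y + y + y = 0" for y :: "complex^'n"
    using that by (simp add: vec_eq_iff)
  have "x + x + x + x = (x + p + q + r) + (x - p + q - r) + (x - p - q + r) + (x + p - q - r)" by simp
  then show "x = 0" using z assms by simp
  have "p + p + p + p = (x + p + q + r) - (x - p + q - r) - (x - p - q + r) + (x + p - q - r)" by simp
  then show "p = 0" using z assms by simp
  have "q + q + q + q = (x + p + q + r) + (x - p + q - r) - (x - p - q + r) - (x + p - q - r)" by simp
  then show "q = 0" using z assms by simp
  have "r + r + r + r = (x + p + q + r) - (x - p + q - r) + (x - p - q + r) - (x + p - q - r)" by simp
  then show "r = 0" using z assms by simp
qed

text \<open>The images of the five basis vectors of the five-dimensional constituent of \<open>\<hh> \<otimes> gal\<close> satisfy a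
  linear relation in dimension four. Sign changes split the relation into homogeneous parts, and the
  reflection \<open>A3\<close> mixes these parts until all five vectors vanish.\<close>

lemma five_vectors_vanish:
  fixes A0 A1 A3 :: "complex^4^4" and u v p q r :: "complex^4"
  assumes A0: "A0 *v u = u" "A0 *v v = v" "A0 *v p = - p" "A0 *v q = q" "A0 *v r = - r"
    and A1: "A1 *v u = u" "A1 *v v = v" "A1 *v p = - p" "A1 *v q = - q" "A1 *v r = r"
    and A3: "A3 *v u = (1/2) *s u + (G/2) *s p + G *s q + (- G/2) *s r"
      "A3 *v v = (-1/2) *s u + (-1/2) *s v + (- G) *s p + (- G/2) *s q + (- G/2) *s r"
      "A3 *v p = ((1 - G)/2) *s v + (1/2) *s p + (-1/2) *s q"
      "A3 *v q = ((G - 1)/2) *s u + (-1/2) *s p + (1/2) *s r"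
      "A3 *v r = ((1 - G)/2) *s u + ((1 - G)/2) *s v + (1/2) *s q + (1/2) *s r"
  shows "u = 0" "v = 0" "p = 0" "q = 0" "r = 0"
proof -
  have split: "a *s u + b *s v = 0" "c *s p = 0" "d *s q = 0" "e *s r = 0"
    if rel: "a *s u + b *s v + c *s p + d *s q + e *s r = 0" for a b c d e
  proof -
    have 0: "(a *s u + b *s v) + c *s p + d *s q + e *s r = 0" using rel .
    have 1: "(a *s u + b *s v) - c *s p + d *s q - e *s r = 0"
      using arg_cong[OF rel, of "(*v) A0"] A0 by (simp add: matrix_vector_right_distrib vector_scalar_commute)
    have 2: "(a *s u + b *s v) - c *s p - d *s q + e *s r = 0"
      using arg_cong[OF rel, of "(*v) A1"] A1 by (simp add: matrix_vector_right_distrib vector_scalar_commute)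
    have 3: "(a *s u + b *s v) + c *s p - d *s q - e *s r = 0"
      using arg_cong[OF 1, of "(*v) A1"] A1
      by (simp add: matrix_vector_right_distrib matrix_vector_mult_diff_distrib vector_scalar_commute)
    show "a *s u + b *s v = 0" "c *s p = 0" "d *s q = 0" "e *s r = 0"
      by (rule scaled_relation[OF 0 1 2 3])+
  qed
  have G0: "G \<noteq> 0" "G - 1 \<noteq> 0" "1 - G \<noteq> 0" using G_neq by auto
  have q: "u = 0 \<and> p = 0 \<and> r = 0" if "q = 0"
  proof -
    have "((G - 1)/2) *s u + 0 *s v + (-1/2) *s p + 0 *s q + (1/2) *s r = 0" using A3(4) that by simp
    from split[OF this] show ?thesis using G0 by simp
  qed
  have p: "v = 0 \<and> q = 0" if "p = 0"
  proof -
    have "0 *s u + ((1 - G)/2) *s v + (1/2) *s p + (-1/2) *s q + 0 *s r = 0" using A3(3) that by simp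
    from split[OF this] show ?thesis using G0 by simp
  qed
  have r: "q = 0" if "r = 0"
  proof -
    have "((1 - G)/2) *s u + ((1 - G)/2) *s v + 0 *s p + (1/2) *s q + (1/2) *s r = 0" using A3(5) that by simp
    from split[OF this] show ?thesis by simp
  qed
  \<comment> \<open>A relation between \<open>u\<close> and \<open>v\<close> is mapped by \<open>A3\<close> to one involving \<open>p\<close>, \<open>q\<close> and \<open>r\<close>.\<close>
  have uv: "p = 0 \<or> q = 0 \<or> r = 0" if ab: "a *s u + b *s v = 0" "a \<noteq> 0 \<or> b \<noteq> 0" for a b
  proof (rule ccontr)
    assume n: "\<not> ?thesis"
    have "a *s (A3 *v u) + b *s (A3 *v v) = 0"
      using arg_cong[OF ab(1), of "(*v) A3"] by (simp add: matrix_vector_right_distrib vector_scalar_commute)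
    moreover have "a *s (A3 *v u) + b *s (A3 *v v) = (a/2 - b/2) *s u + (- b/2) *s v + (G * (a/2 - b)) *s p
        + (G * (a - b/2)) *s q + (- G/2 * (a + b)) *s r"
      unfolding A3 by (simp add: vec_eq_iff forall_4 field_simps)
    ultimately have "(a/2 - b/2) *s u + (- b/2) *s v + (G * (a/2 - b)) *s p
        + (G * (a - b/2)) *s q + (- G/2 * (a + b)) *s r = 0" by simp
    from split[OF this] have "a/2 - b = 0" "a - b/2 = 0" using n G0 by auto
    then have "a = 0" "b = 0" by (auto simp: field_simps)
    then show False using ab(2) by simp
  qed
  have "p = 0 \<or> q = 0 \<or> r = 0"
  proof -
    \<comment> \<open>Either \<open>u, p, q, r\<close> are dependent or \<open>v\<close> is a combination of them.\<close>
    define N :: "complex^4^4" where "N = (\<chi> k i. if i = 1 then u$k else if i = 2 then p$k else if i = 3 then q$k else r$k)"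
    have N: "N *v z = z$1 *s u + z$2 *s p + z$3 *s q + z$4 *s r" for z
      by (simp add: N_def vec_eq_iff forall_4 matrix_vector_mult_def sum_4 algebra_simps)
    show ?thesis
    proof (cases "\<forall>z. N *v z = 0 \<longrightarrow> z = 0")
      case False
      then obtain z where z: "N *v z = 0" "z \<noteq> 0" by blast
      then have "z$1 *s u + 0 *s v + z$2 *s p + z$3 *s q + z$4 *s r = 0" by (simp add: N)
      from split[OF this] have "z$1 *s u = 0" "z$2 *s p = 0" "z$3 *s q = 0" "z$4 *s r = 0" by simp_all
      moreover have "z$1 \<noteq> 0 \<or> z$2 \<noteq> 0 \<or> z$3 \<noteq> 0 \<or> z$4 \<noteq> 0" using z(2) by (auto simp: vec_eq_iff forall_4)
      ultimately show ?thesis using uv[of 1 0] by auto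
    next
      case True
      then obtain N' where "N ** N' = mat 1" using injective_invertible[of N] by blast
      then have "v = N *v (N' *v v)" by (simp only: matrix_vector_mul_assoc matrix_vector_mul_lid)
      then have "(N' *v v)$1 *s u + (-1) *s v + (N' *v v)$2 *s p + (N' *v v)$3 *s q + (N' *v v)$4 *s r = 0"
        unfolding N by (simp add: algebra_simps)
      from split(1)[OF this] show ?thesis by (rule uv) simp
    qed
  qed
  then have "q = 0" using p r by blast
  with p q show "u = 0" "v = 0" "p = 0" "q = 0" "r = 0" by blast+
qed

text \<open>The Kronecker product realises \<open>\<hh> \<otimes> gal\<close> on column vectors, so that the orthogonality of matrix
  coefficients applies to it.\<close>

definition kron :: "mat3 \<Rightarrow> complex^(3 \<times> 3)^(3 \<times> 3)" where
  "kron w = (\<chi> a b. refl_rep w $ fst a $ fst b * gal w $ snd a $ snd b)"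

definition tens :: "complex^3 \<Rightarrow> complex^3 \<Rightarrow> complex^(3 \<times> 3)" where
  "tens x e = (\<chi> a. x $ fst a * e $ snd a)"

definition flat :: "complex^3^3 \<Rightarrow> complex^(3 \<times> 3)" where
  "flat M = (\<chi> a. M $ fst a $ snd a)"

lemma sum_pairs: "sum f (UNIV :: (3 \<times> 3) set) = (\<Sum>i\<in>UNIV. \<Sum>j\<in>UNIV. f (i, j))"
  by (simp add: sum.cartesian_product)

lemma forall_pairs: "(\<forall>a :: 3 \<times> 3. P a) \<longleftrightarrow> (\<forall>i j. P (i, j))"
  by auto

lemma trace_kron: "trace (kron w) = trace (refl_rep w) * trace (gal w)"
  by (simp add: trace_def kron_def sum_pairs sum_product)

lemma kron_tens: "kron w *v tens x e = tens (refl_rep w *v x) (gal w *v e)"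
  by (simp add: vec_eq_iff forall_pairs matrix_vector_mult_def kron_def tens_def sum_pairs sum_3 algebra_simps)

lemma kron_flat: "kron w *v flat M = flat (refl_rep w ** M ** transpose (gal w))"
  by (simp add: vec_eq_iff forall_pairs matrix_vector_mult_def kron_def flat_def sum_pairs matrix_matrix_mult_def
      transpose_def sum_3 algebra_simps)

lemma rotation_rep_kron: "rotation_rep kron"
  unfolding rotation_rep_def
proof (intro conjI ballI)
  show "kron (mat 1) = mat 1"
    unfolding kron_def gal_one refl_rep_one by (simp add: vec_eq_iff forall_pairs mat_def)
  fix g h assume "g \<in> Rot" "h \<in> Rot"
  then have "gal (g ** h) = gal g ** gal h" by (simp add: gal_mult rotation_carrier)
  then show "kron (g ** h) = kron g ** kron h"
    unfolding kron_def refl_rep_mult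
    by (simp only:) (simp add: vec_eq_iff forall_pairs matrix_matrix_mult_def sum_pairs sum_3 algebra_simps)
qed

lemma kron_minus: "w \<in> H3 \<Longrightarrow> kron (- w) = kron w"
  by (simp add: kron_def gal_minus vec_eq_iff) (simp add: refl_rep_def)

text \<open>Modulo the image of \<open>Emat\<close> the nine basis tensors are multiples of five of them, or sums of two such
  multiples; note that \<open>\<gamma> / (\<gamma> - 1) = \<gamma>\<^sup>2 = \<gamma> + 1\<close>.\<close>

lemma tens_decomposition:
  "tens x e = (x$1*e$1 - x$3*e$3) *s tens (axis 1 1) (axis 1 1) + (x$2*e$2 - x$3*e$3) *s tens (axis 2 1) (axis 2 1)
    + (x$1*e$2 - (G+1)*(x$2*e$1)) *s tens (axis 1 1) (axis 2 1) + (x$2*e$3 - (G+1)*(x$3*e$2)) *s tens (axis 2 1) (axis 3 1)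
    + (x$3*e$1 - (G+1)*(x$1*e$3)) *s tens (axis 3 1) (axis 1 1)
    + flat (Emat (vector [x$3*e$3, G*(x$3*e$2), G*(x$1*e$3), G*(x$2*e$1)]))"
proof -
  have "(G - 1) * (G * z) = z" "G * (G * z) = (G + 1) * z" for z using G_eqs by (simp_all add: algebra_simps)
  then show ?thesis
    by (simp add: vec_eq_iff forall_pairs forall_3 tens_def flat_def Emat_entries vector_4_nth axis_def)
qed

lemma mirror_columns:
  "refl_rep (zmat (mirror 0)) *v x = vector [- x$1, x$2, x$3]" "gal (zmat (mirror 0)) *v x = vector [- x$1, x$2, x$3]"
  "refl_rep (zmat (mirror 1)) *v x = vector [x$1, - x$2, x$3]" "gal (zmat (mirror 1)) *v x = vector [x$1, - x$2, x$3]"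
  "refl_rep (zmat (mirror 3)) *v x = vector [x$1/2 + (1-G)/2*x$2 - G/2*x$3, (1-G)/2*x$1 + G/2*x$2 - x$3/2, - G/2*x$1 - x$2/2 + (1-G)/2*x$3]"
  "gal (zmat (mirror 3)) *v x = vector [x$1/2 + G/2*x$2 + (G-1)/2*x$3, G/2*x$1 + (1-G)/2*x$2 - x$3/2, (G-1)/2*x$1 - x$2/2 + G/2*x$3]"
  by (simp_all add: vec_eq_iff forall_3 matrix_vector_mult_def sum_3 gal_table mirror_mem,
      simp_all add: refl_rep_def zmat_def mirror_eval field_simps)

lemma mirror_det: "n \<in> {0, 1, 3} \<Longrightarrow> det (zmat (mirror n)) = -1"
proof -
  have g: "golden * (golden * x) = golden * x + x" for x
    by (simp add: mult.assoc[symmetric] golden_eqs) (simp add: algebra_simps)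
  show "n \<in> {0, 1, 3} \<Longrightarrow> det (zmat (mirror n)) = -1"
    by (elim insertE emptyE; hypsubst; simp add: det_3 zmat_def; simp add: mirror_eval; simp add: field_simps golden_eqs g)
qed

text \<open>Restricted to the complement of \<open>drep\<close> the intertwiner is determined by five vectors. The negatives of
  the three mirrors used here are rotations, and the sign is lost in the tensor product, so the
  mirrors themselves may be used to compute the action.\<close>

lemma kron_intertwiner_vanishes:
  fixes \<rho> :: "mat3 \<Rightarrow> complex^4^4" and S :: "complex^(3 \<times> 3)^4"
  assumes S: "intertwines kron \<rho> S" and D: "\<And>d. S *v flat (Emat d) = 0"
  shows "S = 0"
proof -
  define B where "B i j = S *v tens (axis i 1) (axis j 1)" for i j
  have form: "S *v tens x e = (x$1*e$1 - x$3*e$3) *s B 1 1 + (x$2*e$2 - x$3*e$3) *s B 2 2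
      + (x$1*e$2 - (G+1)*(x$2*e$1)) *s B 1 2 + (x$2*e$3 - (G+1)*(x$3*e$2)) *s B 2 3
      + (x$3*e$1 - (G+1)*(x$1*e$3)) *s B 3 1" for x e
    by (subst tens_decomposition) (simp only: matrix_vector_right_distrib vector_scalar_commute D B_def add_0_right)
  have act: "\<rho> (- zmat (mirror n)) *v (S *v tens x e)
      = S *v tens (refl_rep (zmat (mirror n)) *v x) (gal (zmat (mirror n)) *v e)" if "n < 15" "n \<in> {0, 1, 3}" for n x e
  proof -
    have H: "zmat (mirror n) \<in> H3" using that(1) by (rule mirror_H3)
    have "det (zmat (mirror n)) = -1" using that(2) by (rule mirror_det)
    then have "- zmat (mirror n) \<in> Rot" using H by (simp add: rotation_carrier H3_minus det_minus3)
    then have "\<rho> (- zmat (mirror n)) ** S = S ** kron (zmat (mirror n))"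
      using S H by (simp add: intertwines_def kron_minus)
    then show ?thesis by (simp only: matrix_vector_mul_assoc flip: kron_tens)
  qed
  let ?A = "\<lambda>n. \<rho> (- zmat (mirror n))"
  have act_form: "?A n *v B i j = (let x = refl_rep (zmat (mirror n)) *v axis i 1; e = gal (zmat (mirror n)) *v axis j 1 in
      (x$1*e$1 - x$3*e$3) *s B 1 1 + (x$2*e$2 - x$3*e$3) *s B 2 2
      + (x$1*e$2 - (G+1)*(x$2*e$1)) *s B 1 2 + (x$2*e$3 - (G+1)*(x$3*e$2)) *s B 2 3
      + (x$3*e$1 - (G+1)*(x$1*e$3)) *s B 3 1)"
    if "n = 0 \<or> n = 1 \<or> n = 3" for n i j
    using that act[of n "axis i 1" "axis j 1"]
      form[of "refl_rep (zmat (mirror n)) *v axis i 1" "gal (zmat (mirror n)) *v axis j 1"]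
    unfolding Let_def B_def by auto
  have A0: "?A 0 *v B 1 1 = B 1 1" "?A 0 *v B 2 2 = B 2 2" "?A 0 *v B 1 2 = - B 1 2" "?A 0 *v B 2 3 = B 2 3"
    "?A 0 *v B 3 1 = - B 3 1"
    by (simp_all add: act_form Let_def mirror_columns axis_def)
  have A1: "?A 1 *v B 1 1 = B 1 1" "?A 1 *v B 2 2 = B 2 2" "?A 1 *v B 1 2 = - B 1 2" "?A 1 *v B 2 3 = - B 2 3"
    "?A 1 *v B 3 1 = B 3 1"
    by (simp_all only: act_form simp_thms Let_def mirror_columns, simp_all add: axis_def)
  have A3: "?A 3 *v B 1 1 = (1/2) *s B 1 1 + (G/2) *s B 1 2 + G *s B 2 3 + (- G/2) *s B 3 1"
    "?A 3 *v B 2 2 = (-1/2) *s B 1 1 + (-1/2) *s B 2 2 + (- G) *s B 1 2 + (- G/2) *s B 2 3 + (- G/2) *s B 3 1"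
    "?A 3 *v B 1 2 = ((1 - G)/2) *s B 2 2 + (1/2) *s B 1 2 + (-1/2) *s B 2 3"
    "?A 3 *v B 2 3 = ((G - 1)/2) *s B 1 1 + (-1/2) *s B 1 2 + (1/2) *s B 3 1"
    "?A 3 *v B 3 1 = ((1 - G)/2) *s B 1 1 + ((1 - G)/2) *s B 2 2 + (1/2) *s B 2 3 + (1/2) *s B 3 1"
    by (simp_all add: act_form Let_def mirror_columns axis_def, simp_all add: vec_eq_iff field_simps G_eqs)
  note five_vectors_vanish[OF A0 A1 A3]
  then have t: "S *v tens x e = 0" for x e by (simp add: form)
  have "S *v z = 0" for z
  proof -
    have "z = (\<Sum>i\<in>UNIV. \<Sum>j\<in>UNIV. z $ (i, j) *s tens (axis i 1) (axis j 1))"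
      by (simp add: vec_eq_iff forall_pairs forall_3 sum_3 tens_def axis_def)
    then have "S *v z = S *v (\<Sum>i\<in>UNIV. \<Sum>j\<in>UNIV. z $ (i, j) *s tens (axis i 1) (axis j 1))" by (rule arg_cong)
    then show ?thesis by (simp only: matrix_vector_mult_sum vector_scalar_commute t) simp
  qed
  then show "S = 0" by (rule matrix_zeroI)
qed

lemma intertwiner_surjective:
  fixes \<rho> :: "mat3 \<Rightarrow> complex^'n^'n" and S :: "complex^'m^'n"
  assumes irr: "irreducible_rep rotation_group \<rho>" and S: "intertwines \<kappa> \<rho> S" and S0: "S \<noteq> 0"
  shows "surj ((*v) S)"
proof -
  let ?U = "range ((*v) S)"
  have sub: "vec.subspace ?U"
    by (rule vec.subspaceI) (auto simp: matrix_vector_right_distrib[symmetric] vector_scalar_commute[symmetric]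
        intro: range_eqI[of _ _ 0])
  have "\<rho> g *v u \<in> ?U" if g: "g \<in> Rot" and u: "u \<in> ?U" for g u
  proof -
    obtain z where "u = S *v z" using u by blast
    then have "\<rho> g *v u = S *v (\<kappa> g *v z)" using S g by (simp add: matrix_vector_mul_assoc intertwines_def)
    then show ?thesis by blast
  qed
  then have "?U = {0} \<or> ?U = UNIV" using irr sub unfolding irreducible_rep_def by blast
  moreover have "?U \<noteq> {0}"
  proof
    assume "?U = {0}"
    then have "S *v z = 0" for z by auto
    then have "S = 0" by (rule matrix_zeroI)
    then show False using S0 by contradiction
  qed
  ultimately show ?thesis by blast
qed

lemma surj_card:
  assumes "surj ((*v) (S :: complex^'m^'n))" shows "CARD('n) \<le> CARD('m)"
  using vec.dim_image_le[OF matrix_vector_mul_linear_gen[of S], of UNIV] unfolding assms vec_dim_card .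

text \<open>The class function \<open>1 + 3 \<chi>\<^sub>3 + 3 \<chi>\<^sub>3\<^sub>' + 5 \<chi>\<^sub>3 \<chi>\<^sub>3\<^sub>' - \<chi>\<^sub>4\<close> is the regular character, since \<open>\<chi>\<^sub>3 \<chi>\<^sub>3\<^sub>'\<close> is
  the sum of \<open>\<chi>\<^sub>4\<close> and the character of degree five.\<close>

lemma regular_character:
  assumes g: "g \<in> Rot"
  shows "1 + 3 * trace (refl_rep g) + 3 * trace (gal g) + 5 * trace (kron g) - trace (drep g)
    = (if g = mat 1 then 60 else 0)"
proof (cases rule: rotation_trace_cases[OF g])
  case 4
  have "golden * (1 - golden) = -1" by (simp add: algebra_simps golden_eqs)
  then have "trace g * (1 - trace g) = -1" using 4(5) by (auto simp: mult.commute)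
  then have "complex_of_real (trace g) * (1 - complex_of_real (trace g)) = -1"
    by (metis of_real_1 of_real_diff of_real_minus of_real_mult)
  then show ?thesis
    using 4 by (simp add: trace_gal trace_refl_rep trace_drep trace_kron)
next
  case 1
  have "trace (mat 1 :: complex^3^3) = 3" by (simp add: trace_def sum_3 mat_def)
  with 1 show ?thesis by (simp add: trace_gal trace_drep trace_kron)
qed (simp_all add: trace_gal trace_refl_rep trace_drep trace_kron)

text \<open>If no constituent of the regular representation listed in \<open>regular_character\<close> had an intertwiner to
  \<open>\<rho>\<close>, the orthogonality relations would sum to \<open>60 \<rho>(1) = 0\<close>.\<close>

theorem four_dimensional_equivalent:
  fixes \<rho> :: "mat3 \<Rightarrow> complex^4^4"
  assumes irr: "irreducible_rep rotation_group \<rho>"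
  obtains P P' where "P ** P' = mat 1" "P' ** P = mat 1" "\<And>g. g \<in> Rot \<Longrightarrow> \<rho> g ** P = P ** drep g"
proof -
  have \<rho>: "rotation_rep \<rho>" using irr by (simp add: irreducible_rep_def rotation_rep_def)
  have "\<exists>S. intertwines drep \<rho> S \<and> S \<noteq> 0"
  proof (rule ccontr)
    assume "\<not> ?thesis"
    then have D: "S = 0" if "intertwines drep \<rho> S" for S using that by blast
    have triv: "rotation_rep (\<lambda>g. mat 1 :: complex^1^1)" by (simp add: rotation_rep_def)
    have T: "S = 0" if "intertwines (\<lambda>g. mat 1 :: complex^1^1) \<rho> S" for S
      using surj_card[OF intertwiner_surjective[OF irr that]] by fastforce
    have R: "S = 0" if "intertwines refl_rep \<rho> S" for S
      using surj_card[OF intertwiner_surjective[OF irr that]] by fastforce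
    have C: "S = 0" if "intertwines gal \<rho> S" for S
      using surj_card[OF intertwiner_surjective[OF irr that]] by fastforce
    have K: "S = 0" if S: "intertwines kron \<rho> S" for S
    proof (rule kron_intertwiner_vanishes[OF S])
      define J :: "complex^4^(3 \<times> 3)" where "J = (\<chi> a k. Emat (axis k 1) $ fst a $ snd a)"
      have J: "J *v d = flat (Emat d)" for d
        by (simp add: vec_eq_iff forall_pairs forall_3 J_def flat_def matrix_vector_mult_def sum_4 Emat_entries axis_def)
      have "kron g ** J = J ** drep g" if "g \<in> Rot" for g
      proof -
        have "(kron g ** J) *v d = (J ** drep g) *v d" for d
          using that by (simp add: J kron_flat Emat_drep rotation_carrier flip: matrix_vector_mul_assoc)
        then show ?thesis by (simp add: matrix_eq)
      qed
      then have "intertwines drep \<rho> (S ** J)"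
        using S by (simp add: intertwines_def matrix_mul_assoc) (simp add: matrix_mul_assoc[symmetric])
      then have "S ** J = 0" by (rule D)
      then have "(S ** J) *v d = 0" for d by simp
      then show "S *v flat (Emat d) = 0" for d by (simp only: J[symmetric] matrix_vector_mul_assoc)
    qed
    have t1: "trace (mat 1 :: complex^1^1) = 1" by (simp add: trace_def mat_def)
    note orth = coefficient_orthogonality[OF _ \<rho>]
    have "(\<Sum>g\<in>Rot. (if transpose g = mat 1 then 60 else 0) * \<rho> g $ k $ i) = 0" for k i
    proof -
      have "(\<Sum>g\<in>Rot. (if transpose g = mat 1 then 60 else 0) * \<rho> g $ k $ i)
        = (\<Sum>g\<in>Rot. (1 + 3 * trace (refl_rep (transpose g)) + 3 * trace (gal (transpose g))
            + 5 * trace (kron (transpose g)) - trace (drep (transpose g))) * \<rho> g $ k $ i)"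
        by (intro sum.cong refl) (simp add: regular_character rotation_closed)
      also have "\<dots> = (\<Sum>g\<in>Rot. trace (mat 1 :: complex^1^1) * \<rho> g $ k $ i)
          + 3 * (\<Sum>g\<in>Rot. trace (refl_rep (transpose g)) * \<rho> g $ k $ i)
          + 3 * (\<Sum>g\<in>Rot. trace (gal (transpose g)) * \<rho> g $ k $ i)
          + 5 * (\<Sum>g\<in>Rot. trace (kron (transpose g)) * \<rho> g $ k $ i)
          - (\<Sum>g\<in>Rot. trace (drep (transpose g)) * \<rho> g $ k $ i)"
        by (simp add: t1 sum.distrib sum_subtractf sum_distrib_left algebra_simps)
      also have "\<dots> = 0"
        using orth[OF triv T] orth[OF rotation_rep_refl R] orth[OF rotation_rep_gal C] orth[OF rotation_rep_kron K]
          orth[OF rotation_rep_drep D] by simp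
      finally show ?thesis .
    qed
    moreover have "(\<Sum>g\<in>Rot. (if transpose g = mat 1 then 60 else 0) * \<rho> g $ k $ i) = 60 * \<rho> (mat 1) $ k $ i" for k i
    proof -
      have "transpose g = mat 1 \<longleftrightarrow> g = mat 1" for g :: mat3
        by (metis transpose_mat transpose_transpose)
      then show ?thesis
        using finite_rotations rotation_closed(1) by (simp add: if_distrib if_distribR sum.delta cong: if_cong)
    qed
    ultimately have "\<rho> (mat 1) $ k $ i = 0" for k i by simp
    then have "\<rho> (mat 1) $ 1 $ 1 = 0" .
    then show False using \<rho> by (simp add: rotation_rep_def) (simp add: mat_def)
  qed
  then obtain S where S: "intertwines drep \<rho> S" "S \<noteq> 0" by blast
  from intertwiner_surjective[OF irr S] obtain S' where "S ** S' = mat 1"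
    using matrix_right_invertible_surjective[of S] by blast
  then show thesis using that[of S S'] S(1) matrix_left_right_inverse[of S S'] by (simp add: intertwines_def)
qed

lemma drep_minus: "w \<in> H3 \<Longrightarrow> drep (- w) = drep w"
  by (simp add: vec_eq_iff drep_def dmat_def Let_def conj_mat_minus forall_4 vector_4_nth drow_def)

lemma trace_similar:
  assumes "P ** P' = mat 1" "P' ** P = mat 1" "A ** P = P ** B"
  shows "trace A = trace (B :: complex^'n^'n)"
proof -
  have "A = P ** B ** P'" using assms by (metis matrix_mul_assoc matrix_mul_rid)
  then show ?thesis using assms(2) by (simp add: trace_mul_sym[of _ P'] matrix_mul_assoc)
qed

lemma trace_four:
  fixes \<rho> :: "mat3 \<Rightarrow> complex^4^4"
  assumes "irreducible_rep rotation_group \<rho>" and w: "w \<in> H3"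
  shows "trace (extend_rep 1 \<rho> w) = trace (drep w)"
proof -
  obtain P P' where P: "P ** P' = mat 1" "P' ** P = mat 1" "\<And>g. g \<in> Rot \<Longrightarrow> \<rho> g ** P = P ** drep g"
    using four_dimensional_equivalent[OF assms(1)] by blast
  from H3_cases[OF w] show ?thesis
    using trace_similar[OF P(1,2) P(3)] w by (auto simp: extend_rep_def drep_minus)
qed

section \<open>The irreducible module\<close>

theorem mainTheorem2:
  shows "(\<forall>\<phi> \<in> iso (alt_group 5) rotation_group.
          \<forall>\<rho>\<^sub>4 :: mat3 \<Rightarrow> complex^4^4. irreducible_rep rotation_group \<rho>\<^sub>4 \<longrightarrow>
            (let \<tau> = extend_rep (-1) (rep3_tilde \<phi>);
                 four = extend_rep 1 \<rho>\<^sub>4;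
                 L = simple_L (1/2) \<tau>
             in irreducible_module (Hc (1/2)) L \<and>
                category_O (1/2) L \<and>
                (\<forall>w\<in>H3. \<forall>j. character (1/2) L w j =
                   trace (\<tau> w) * t_power (-1) j + trace (four w) * t_power 0 j
                     + trace (\<tau> w) * t_power 1 j) \<and>
                invariants (1/2) L = {\<zero>\<^bsub>L\<^esub>})) \<and>
         aspherical (1/2)"
proof (intro conjI ballI allI impI aspherical_half)
  fix \<phi> and \<rho>\<^sub>4 :: "mat3 \<Rightarrow> complex^4^4"
  assume \<phi>: "\<phi> \<in> iso (alt_group 5) rotation_group" and \<rho>: "irreducible_rep rotation_group \<rho>\<^sub>4"
  interpret rotation_iso \<phi> by unfold_locales (rule \<phi>)
  let ?\<tau> = "extend_rep (-1) (rep3_tilde \<phi>)"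
  let ?L = "simple_L (1/2) ?\<tau>"
  obtain P P' :: "complex^3^3" where P: "P ** P' = mat 1" "P' ** P = mat 1"
    "\<And>w. w \<in> H3 \<Longrightarrow> ?\<tau> w ** P = P ** gal w" using gal_equivalent by blast
  have "P' *v (P *v axis 1 1) = axis 1 1" by (simp only: matrix_vector_mul_assoc P(2) matrix_vector_mul_lid)
  then have "(P' *v (P *v axis 1 1), 0, 0) \<noteq> \<zero>\<^bsub>L10\<^esub>" by (simp add: zero_prod_def axis_eq_0_iff)
  moreover have "lowest_weight_module (1/2) L10 ?\<tau> (\<lambda>v. (P' *v v, 0, 0)) (-1)"
    by (rule L10_lowest_weight) (fact P)+
  ultimately have "\<exists>f. lmod_iso (Hc (1/2)) ?L L10 f" using L10_irreducible by (intro simple_L_iso)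
  then obtain f where iso: "lmod_iso (Hc (1/2)) ?L L10 f" by (elim exE)
  have char: "character (1/2) ?L w j = trace (?\<tau> w) * t_power (-1) j + trace (extend_rep 1 \<rho>\<^sub>4 w) * t_power 0 j
      + trace (?\<tau> w) * t_power 1 j" if w: "w \<in> H3" for w j
    unfolding character_transport[OF iso w] character_L10[OF w] trace_similar[OF P(1,2) P(3)[OF w]] trace_four[OF \<rho> w] ..
  show "let \<tau> = ?\<tau>; four = extend_rep 1 \<rho>\<^sub>4; L = simple_L (1/2) \<tau>
      in irreducible_module (Hc (1/2)) L \<and> category_O (1/2) L \<and>
        (\<forall>w\<in>H3. \<forall>j. character (1/2) L w j = trace (\<tau> w) * t_power (-1) j + trace (four w) * t_power 0 j
          + trace (\<tau> w) * t_power 1 j) \<and> invariants (1/2) L = {\<zero>\<^bsub>L\<^esub>}"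
    unfolding Let_def
    using irreducible_transport[OF iso L10_irreducible] category_O_transport[OF iso L10_category_O]
      invariants_transport[OF iso L10_invariants] char
    by (intro conjI ballI allI)
qed

end
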